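(* Let $\gamma,\delta$ be strict partitions of total size $n=|\gamma|+|\delta|$. Then the maps $\psi_i$ for $i=0,2,\dots,n-1$ on $\mathrm{SST}(\gamma\otimes\delta)$ (defined in the context) are well defined and give a queer dual equivalence for $(\mathrm{SST}(\gamma\otimes\delta),\mathrm{Des})$.
   Context: Notation: $[m]=\{1,\dots,m\}$. For $D\subseteq[m-1]$, $F_D(X)=\sum x_{i_1}\cdots x_{i_m}$, the sum over $i_1\le\cdots\le i_m$ with $i_j<i_{j+1}$ whenever $j\in D$. $s_\lambda$ denotes the Schur function. Signed standard tableaux. A strict partition of $n$ is $\gamma=(\gamma_1>\cdots>\gamma_\ell>0)$ with $\sum\gamma_r=n$. Its shifted diagram consists of the cells $(r,c)$ (row $r$, column $c$; rows numbered bottom to top, columns left to right) with $1\le r\le\ell$, $r\le c\le r+\gamma_r-1$; the main diagonal consists of the cells $(r,r)$. A signed standard tableau of shape $\gamma$ is a filling of the shifted diagram in which the absolute values of the entries are $1,\dots,n$, each used once, each entry is marked (written $i'$, absolute value $i$) or unmarked, absolute values increase left to right along rows and bottom to top along columns, and no entry on the main diagonal is marked. $\mathrm{SST}(\gamma)$ is the set of these. The hook reading word $\mathrm{hook}(S)$ is obtained, for $i$ from largest to smallest, by reading (absolute values of) the marked entries of column $i$ bottom to top and then the unmarked entries of row $i$ left to right. For a permutation $w$, $\mathrm{Des}(w)=\{i:i\text{ appears to the right of }i+1\text{ in }w\}$; $\mathrm{Des}(S)=\mathrm{Des}(\mathrm{hook}(S))$; $P_\gamma=\sum_{S\in\mathrm{SST}(\gamma)}F_{\mathrm{Des}(S)}$.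 Concatenated tableaux. A signed standard tableau of shape $\gamma\otimes\delta$ is a pair $S\otimes T$ of fillings of the shifted diagrams of $\gamma$ (by $S$) and of $\delta$ (by $T$) such that the absolute values used in $S$ and $T$ together are $1,\dots,n$, each once, where $n=|\gamma|+|\delta|$, each entry is marked or unmarked, absolute values increase along rows (left to right) and columns (bottom to top) within each of $S$ and $T$, and no entry on either main diagonal is marked. $\mathrm{SST}(\gamma\otimes\delta)$ is the set of these. The hook reading word $\mathrm{hook}(S\otimes T)$ is the concatenation $\mathrm{hook}(S)\mathrm{hook}(T)$ (with $\mathrm{hook}$ of each filling defined by the same rule), and $\mathrm{Des}(S\otimes T)=\mathrm{Des}(\mathrm{hook}(S)\mathrm{hook}(T))$. The maps $d_i$. If $S$ is a filling containing entries of absolute values $i-1,i,i+1$, assign to each entry its diagonal: row minus column if unmarked, column minus row if marked. Let $a\le b\le c$ be the diagonals of the entries of absolute values $i-1,i,i+1$. Then $d_i(S)$ is defined by: (1) if $i$ lies on diagonal $b$, then $d_i(S)=S$; (2) else if $a=b$ (respectively $b=c$), toggle the mark on the letter on diagonal $c$ (respectively $a$); (3) else if $\big||a|-|c|\big|=1$, toggle the marks on the letters on diagonals $a$ and $c$; (4) else swap the absolute values of the letters on diagonals $a$ and $c$, keeping the marking status of each cell. If $S$ contains entries of absolute values $1,2$, $d_0(S)$ toggles the mark on the entry of absolute value $2$. The maps $\psi_i$ on $\mathrm{SST}(\gamma\otimes\delta)$. For $1<i<n$: (1) if $i$ lies between $i-1$ and $i+1$ in $\mathrm{hook}(S\otimes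 T)$, then $\psi_i(S\otimes T)=S\otimes T$; (2) else if $i-1,i,i+1$ all lie in $S$ (as absolute values), $\psi_i(S\otimes T)=d_i(S)\otimes T$; (3) else if $i-1,i,i+1$ all lie in $T$, $\psi_i(S\otimes T)=S\otimes d_i(T)$; (4) else swap the absolute values of the two letters among $i-1,i,i+1$ that are furthest apart in the hook reading word, keeping the marking status of each cell. For $i=0$: (1) if $1,2$ both lie in $S$ (as absolute values), $\psi_0(S\otimes T)=d_0(S)\otimes T$; (2) else if both lie in $T$, $\psi_0(S\otimes T)=S\otimes d_0(T)$; (3) else swap $1$ and $2$. Dual equivalence. For a finite set $\mathcal{A}$ and a map $\mathrm{Des}$ from $\mathcal{A}$ to subsets of $[N-1]$, a dual equivalence for $(\mathcal{A},\mathrm{Des})$ is a family of involutions $\{\varphi_i\}_{1<i<N}$ on $\mathcal{A}$ such that: (i) for all $1<h\le i<N$ with $i-h\le 3$ and all $T\in\mathcal{A}$ there is a partition $\lambda$ of $i-h+3$ with $\sum_{U\in[T]_{(h,i)}}F_{\mathrm{Des}_{(h-1,i+1)}(U)}=s_\lambda$, where $[T]_{(h,i)}$ is the equivalence class of $T$ generated by $\varphi_h,\dots,\varphi_i$, and $\mathrm{Des}_{(p,q)}(U)\subseteq[q-p]$ is obtained from $\mathrm{Des}(U)$ by deleting all letters less than $p$ or at least $q$ and subtracting $p-1$ from the remaining letters; (ii) $\varphi_j\varphi_i(T)=\varphi_i\varphi_j(T)$ for all $T$ whenever $|i-j|\ge3$. Queer dual equivalence. A queer dual equivalence for $(\mathcal{A},\mathrm{Des})$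 is a dual equivalence $\{\psi_i\}_{1<i<N}$ together with an involution $\psi_0$ on $\mathcal{A}$ such that, writing $[S]_{\le k}$ for the equivalence class of $S$ generated by the $\psi_h$ with $h\le k$ ($h\in\{0,2,3,\dots,N-1\}$): (i) for each $i\in\{1,2,3\}$ with $i<N$ and each $S\in\mathcal{A}$ there is a strict partition $\gamma$ of $i+1$ with $\sum_{U\in[S]_{\le i}}F_{\mathrm{Des}(U)\cap[i]}=P_\gamma$; (ii) $\psi_0\psi_i(S)=\psi_i\psi_0(S)$ for all $3<i<N$ and $S\in\mathcal{A}$; (iii) for all $1\le k<N$ and $S,T\in\mathcal{A}$ with $T\in[S]_{\le k}$, there is a sequence of indices $i_1,\dots,i_j\in\{0,2,3,\dots,k\}$ (only $0$ if $k=1$), at most two of which equal $k$, such that $T=\psi_{i_j}\cdots\psi_{i_1}(S)$. *)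

theory Defs
  imports
    "HOL-Library.Multiset"
    "HOL-Library.FuncSet"
    "HOL-Library.Function_Algebras"
    "HOL-Combinatorics.Transposition"
begin

section \<open>Partitions\<close>

definition is_partition :: "nat \<Rightarrow> nat list \<Rightarrow> bool" where
  "is_partition m la \<longleftrightarrow> sorted_wrt (\<ge>) la \<and> 0 \<notin> set la \<and> sum_list la = m"

definition strict_partition :: "nat \<Rightarrow> nat list \<Rightarrow> bool" where
  "strict_partition m ga \<longleftrightarrow> sorted_wrt (>) ga \<and> 0 \<notin> set ga \<and> sum_list ga = m"

text \<open>
  A cell is a pair (row, column). Rows and columns are numbered from 1, rows from bottom to top.
\<close>

type_synonym cell = "nat \<times> nat"

definition diagram :: "nat list \<Rightarrow> cell set" where
  "diagram la = {(r, c). 1 \<le> r \<and> r \<le> length la \<and> 1 \<le> c \<and> c \<le> la ! (r - 1)}"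

definition shifted_diagram :: "nat list \<Rightarrow> cell set" where
  "shifted_diagram ga = {(r, c). 1 \<le> r \<and> r \<le> length ga \<and> r \<le> c \<and> c \<le> r + ga ! (r - 1) - 1}"


section \<open>Quasisymmetric and symmetric functions\<close>

text \<open>
  A formal power series in the variables \<open>x\<^sub>1, x\<^sub>2, \<dots>\<close> is given by its coefficients: the monomial
  \<open>x\<^sub>i x\<^sub>j \<dots>\<close> is the multiset \<open>{#i, j, \<dots>#}\<close> of its (positive) indices. Addition, and with it
  finite sums, is the pointwise one.
\<close>

type_synonym series = "nat multiset \<Rightarrow> int"

definition fundamental :: "nat \<Rightarrow> nat set \<Rightarrow> series" where
  "fundamental m D = (\<lambda>M. int (card {is :: nat list.
      length is = m \<and> (\<forall>i \<in> set is. 1 \<le> i) \<and> sorted is \<and>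
      (\<forall>j \<in> D. is ! (j - 1) < is ! j) \<and> mset is = M}))"

text \<open>
  Schur functions are the generating functions of semistandard Young tableaux
  (French convention, as rows are numbered from bottom to top).
\<close>

definition semistandard :: "nat list \<Rightarrow> (cell \<Rightarrow> nat) set" where
  "semistandard la = {T \<in> diagram la \<rightarrow>\<^sub>E {1..}.
     (\<forall>r c c'. (r, c) \<in> diagram la \<and> (r, c') \<in> diagram la \<and> c < c' \<longrightarrow> T (r, c) \<le> T (r, c')) \<and>
     (\<forall>r r' c. (r, c) \<in> diagram la \<and> (r', c) \<in> diagram la \<and> r < r' \<longrightarrow> T (r, c) < T (r', c))}"

definition schur :: "nat list \<Rightarrow> series" where
  "schur la = (\<lambda>M. int (card {T \<in> semistandard la. image_mset T (mset_set (diagram la)) = M}))"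


section \<open>Signed fillings and their reading words\<close>

text \<open>
  An entry is a pair of its absolute value and a Boolean telling whether it is marked.
  A filling of a shape is a partial map on cells whose domain is the shape.
\<close>

type_synonym filling = "cell \<rightharpoonup> nat \<times> bool"

definition absval :: "filling \<Rightarrow> cell \<Rightarrow> nat" where
  "absval S x = fst (the (S x))"

definition marked :: "filling \<Rightarrow> cell \<Rightarrow> bool" where
  "marked S x \<longleftrightarrow> snd (the (S x))"

definition letters :: "filling \<Rightarrow> nat set" where
  "letters S = absval S ` dom S"

definition signed_filling :: "nat list \<Rightarrow> filling \<Rightarrow> bool" where
  "signed_filling ga S \<longleftrightarrow>
     dom S = shifted_diagram ga \<and>
     (\<forall>r c c'. (r, c) \<in> dom S \<and> (r, c') \<in> dom S \<and> c < c' \<longrightarrow> absval S (r, c) < absval S (r, c')) \<and>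
     (\<forall>r r' c. (r, c) \<in> dom S \<and> (r', c) \<in> dom S \<and> r < r' \<longrightarrow> absval S (r, c) < absval S (r', c)) \<and>
     (\<forall>r. (r, r) \<in> dom S \<longrightarrow> \<not> marked S (r, r))"

definition SST :: "nat list \<Rightarrow> filling set" where
  "SST ga = {S. signed_filling ga S \<and> bij_betw (absval S) (dom S) {1..sum_list ga}}"

definition SST_tensor :: "nat list \<Rightarrow> nat list \<Rightarrow> (filling \<times> filling) set" where
  "SST_tensor ga de = {(S, T). signed_filling ga S \<and> signed_filling de T \<and>
     bij_betw (case_sum (absval S) (absval T)) (dom S <+> dom T) {1..sum_list ga + sum_list de}}"

definition marked_in_column :: "filling \<Rightarrow> nat \<Rightarrow> nat list" where
  "marked_in_column S i =
     map (\<lambda>r. absval S (r, i)) (sorted_list_of_set {r. (r, i) \<in> dom S \<and> marked S (r, i)})"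

definition unmarked_in_row :: "filling \<Rightarrow> nat \<Rightarrow> nat list" where
  "unmarked_in_row S i =
     map (\<lambda>c. absval S (i, c)) (sorted_list_of_set {c. (i, c) \<in> dom S \<and> \<not> marked S (i, c)})"

definition hook :: "filling \<Rightarrow> nat list" where
  "hook S = concat (map (\<lambda>i. marked_in_column S i @ unmarked_in_row S i)
     (rev (sorted_list_of_set (fst ` dom S \<union> snd ` dom S))))"

definition hook_tensor :: "filling \<times> filling \<Rightarrow> nat list" where
  "hook_tensor X = hook (fst X) @ hook (snd X)"

definition Des_word :: "nat list \<Rightarrow> nat set" where
  "Des_word w = {i. \<exists>p q. p < q \<and> q < length w \<and> w ! p = i + 1 \<and> w ! q = i}"

definition Des_tensor :: "filling \<times> filling \<Rightarrow> nat set" where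
  "Des_tensor X = Des_word (hook_tensor X)"

definition schurP :: "nat list \<Rightarrow> series" where
  "schurP ga = (\<Sum>S \<in> SST ga. fundamental (sum_list ga) (Des_word (hook S)))"


section \<open>The maps \<open>d\<^sub>i\<close> and \<open>\<psi>\<^sub>i\<close>\<close>

definition toggle :: "nat \<Rightarrow> filling \<Rightarrow> filling" where
  "toggle k S = (\<lambda>x. map_option (\<lambda>(v, m). (v, if v = k then \<not> m else m)) (S x))"

definition swap_abs :: "nat \<Rightarrow> nat \<Rightarrow> filling \<Rightarrow> filling" where
  "swap_abs j k S = (\<lambda>x. map_option (\<lambda>(v, m). (transpose j k v, m)) (S x))"

definition cell_of :: "filling \<Rightarrow> nat \<Rightarrow> cell" where
  "cell_of S k = (THE x. x \<in> dom S \<and> absval S x = k)"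

definition diagonal :: "filling \<Rightarrow> nat \<Rightarrow> int" where
  "diagonal S k = (let (r, c) = cell_of S k in
     if marked S (r, c) then int c - int r else int r - int c)"

text \<open>
  In the definition of \<open>dmap\<close>, \<open>a \<le> b \<le> c\<close> are the diagonals of \<open>i - 1, i, i + 1\<close> with repetition.
  Whenever \<open>letter e\<close> is used, exactly one of the three letters lies on diagonal \<open>e\<close>.
\<close>

definition dmap :: "nat \<Rightarrow> filling \<Rightarrow> filling" where
  "dmap i S = (if i = 0 then toggle 2 S else
     let ds = sort (map (diagonal S) [i - 1, i, i + 1]);
         a = ds ! 0; b = ds ! 1; c = ds ! 2;
         letter = (\<lambda>e. THE k. k \<in> {i - 1, i, i + 1} \<and> diagonal S k = e)
     in if diagonal S i = b then S
        else if a = b then toggle (letter c) S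
        else if b = c then toggle (letter a) S
        else if \<bar>\<bar>a\<bar> - \<bar>c\<bar>\<bar> = 1 then toggle (letter a) (toggle (letter c) S)
        else swap_abs (letter a) (letter c) S)"

text \<open>
  The subword \<open>u\<close> of \<open>hook(S \<otimes> T)\<close> on the letters \<open>i - 1, i, i + 1\<close> has length three; its outer
  letters are the ones furthest apart. The map is used for \<open>i = 0\<close> and \<open>1 < i < n\<close> only. For
  \<open>i = 0\<close> the final alternative arises only if \<open>n \<le> 1\<close>, when there are no letters 1 and 2 to be
  swapped.
\<close>

definition psi :: "nat \<Rightarrow> filling \<times> filling \<Rightarrow> filling \<times> filling" where
  "psi i X = (let S = fst X; T = snd X in
     if i = 0 then
       (if {1, 2} \<subseteq> letters S then (dmap 0 S, T)
        else if {1, 2} \<subseteq> letters T then (S, dmap 0 T)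
        else if {1, 2} \<subseteq> letters S \<union> letters T then (swap_abs 1 2 S, swap_abs 1 2 T)
        else (S, T))
     else
       let u = filter (\<lambda>k. k \<in> {i - 1, i, i + 1}) (hook_tensor X)
       in if u ! 1 = i then (S, T)
          else if {i - 1, i, i + 1} \<subseteq> letters S then (dmap i S, T)
          else if {i - 1, i, i + 1} \<subseteq> letters T then (S, dmap i T)
          else (swap_abs (u ! 0) (u ! 2) S, swap_abs (u ! 0) (u ! 2) T))"


section \<open>Dual equivalence and queer dual equivalence\<close>

definition involution_on :: "'a set \<Rightarrow> ('a \<Rightarrow> 'a) \<Rightarrow> bool" where
  "involution_on A f \<longleftrightarrow> (\<forall>x \<in> A. f x \<in> A \<and> f (f x) = x)"

text \<open>
  The class of \<open>S\<close> under the equivalence relation on \<open>A\<close> generated by the maps \<open>\<phi>\<^sub>j\<close>, \<open>j \<in> J\<close>.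
\<close>

definition gen_class :: "'a set \<Rightarrow> (nat \<Rightarrow> 'a \<Rightarrow> 'a) \<Rightarrow> nat set \<Rightarrow> 'a \<Rightarrow> 'a set" where
  "gen_class A \<phi> J S =
     (let R = {(X, \<phi> j X) |X j. X \<in> A \<and> j \<in> J} in (R \<union> R\<inverse>)\<^sup>* `` {S})"

text \<open>\<open>Des\<^bsub>(p,q)\<^esub>(U)\<close>, as a function of \<open>D = Des(U)\<close>.\<close>

definition restrict_Des :: "nat \<Rightarrow> nat \<Rightarrow> nat set \<Rightarrow> nat set" where
  "restrict_Des p q D = (\<lambda>x. x - (p - 1)) ` {x \<in> D. p \<le> x \<and> x < q}"

definition dual_equivalence ::
  "nat \<Rightarrow> 'a set \<Rightarrow> ('a \<Rightarrow> nat set) \<Rightarrow> (nat \<Rightarrow> 'a \<Rightarrow> 'a) \<Rightarrow> bool" where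
  "dual_equivalence N A Des \<phi> \<longleftrightarrow>
     finite A \<and> (\<forall>T \<in> A. Des T \<subseteq> {1..<N}) \<and>
     (\<forall>i. 1 < i \<and> i < N \<longrightarrow> involution_on A (\<phi> i)) \<and>
     (\<forall>h i. 1 < h \<and> h \<le> i \<and> i < N \<and> i - h \<le> 3 \<longrightarrow> (\<forall>T \<in> A. \<exists>la. is_partition (i - h + 3) la \<and>
        (\<Sum>U \<in> gen_class A \<phi> {h..i} T.
           fundamental (i - h + 3) (restrict_Des (h - 1) (i + 1) (Des U))) = schur la)) \<and>
     (\<forall>i j. 1 < i \<and> i < N \<and> 1 < j \<and> j < N \<and> \<bar>int i - int j\<bar> \<ge> 3 \<longrightarrow>
        (\<forall>T \<in> A. \<phi> j (\<phi> i T) = \<phi> i (\<phi> j T)))"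

definition queer_indices :: "nat \<Rightarrow> nat set" where
  "queer_indices N = {0} \<union> {2..<N}"

text \<open>
  The family \<open>\<psi>\<close> comprises both the dual equivalence and the additional involution \<open>\<psi>\<^sub>0\<close>;
  \<open>\<psi>\<^sub>1\<close> is irrelevant.
\<close>

definition queer_dual_equivalence ::
  "nat \<Rightarrow> 'a set \<Rightarrow> ('a \<Rightarrow> nat set) \<Rightarrow> (nat \<Rightarrow> 'a \<Rightarrow> 'a) \<Rightarrow> bool" where
  "queer_dual_equivalence N A Des \<psi> \<longleftrightarrow>
     dual_equivalence N A Des \<psi> \<and>
     involution_on A (\<psi> 0) \<and>
     (\<forall>i \<in> {1, 2, 3}. i < N \<longrightarrow> (\<forall>S \<in> A. \<exists>ga. strict_partition (i + 1) ga \<and>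
        (\<Sum>U \<in> gen_class A \<psi> {h \<in> queer_indices N. h \<le> i} S.
           fundamental (i + 1) (Des U \<inter> {1..i})) = schurP ga)) \<and>
     (\<forall>i. 3 < i \<and> i < N \<longrightarrow> (\<forall>S \<in> A. \<psi> 0 (\<psi> i S) = \<psi> i (\<psi> 0 S))) \<and>
     (\<forall>k. 1 \<le> k \<and> k < N \<longrightarrow> (\<forall>S \<in> A. \<forall>T \<in> A.
        T \<in> gen_class A \<psi> {h \<in> queer_indices N. h \<le> k} S \<longrightarrow>
        (\<exists>is. set is \<subseteq> {0} \<union> {2..k} \<and> count_list is k \<le> 2 \<and> T = fold \<psi> is S)))"

end

theory Submission
  imports Defs "HOL-Library.Product_Lexorder"
begin

text \<open>
  Every filling is encoded by the sequence of its contents: the content of a letter is the column minus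
  the row of its cell, negated if the letter is marked. Writing the symmetric double of a shifted
  diagram as a set of particles on the integers, the content of a letter says which particle hops (together
  with its mirror image) when the cell of the letter is added, so that fillings of a shape become
  legal sequences of hops that end in a given configuration (\<open>valid_signed_growing\<close>, \<open>fill_normal_form\<close>).
  In these terms \<open>d\<^sub>i\<close> changes three consecutive contents only (\<open>fill_dmap\<close>), and two consecutive
  letters of a filling appear in the hook reading word in the order of their contents (\<open>hook_consecutive\<close>).

  An insertion procedure, given by local growth rules, assigns to a word without repetitions a pair of such sequences.
  The pair determines the word (\<open>rsk_inj\<close>), every legal sequence occurs as the first member of a pair
  (\<open>rsk_surj\<close>), and the first member has the descents of the word (\<open>descents_rsk\<close>). Elementary Knuth moves of the word leave the second sequence
  alone and act as \<open>d\<^sub>i\<close> on the first one; exchanging the first two letters acts as \<open>d\<^sub>0\<close> (\<open>rsk_word_move\<close>). The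
  growth rules exist in two forms, for ordinary and for symmetric shapes, and both are instances of one locale.
  Moreover the moves act transitively on the sequences of a given shape, and in the symmetric form the last move
  is needed at most twice; a second use occurs only if the last letter keeps its cell and changes its mark (\<open>shifted_connected\<close>).

  Consequently the classes of words under Knuth moves have the generating function of standard Young
  tableaux of a shape, which is a Schur function (\<open>knuth_class_schur\<close>), and the classes under Knuth moves
  together with the exchange of the first two letters have the generating function of signed standard
  tableaux of a shape, which is a Schur P-function (\<open>queer_class_schurP\<close>). Both statements hold for every word without repetitions.

  It remains to turn pairs \<open>S \<otimes> T\<close> into words. Inverting the insertion for the two shapes separately gives
  a word for \<open>S\<close> and one for \<open>T\<close>; they are merged into one word of length \<open>n\<close> with the entries of \<open>S\<close> below those
  of \<open>T\<close>, placed at the positions given by the letters. Then the order of consecutive letters in \<open>hook(S) hook(T)\<close> is the order of the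
  corresponding entries, all cases in the definition of \<open>\<psi>\<^sub>i\<close> become the same Knuth move (\<open>psi_word\<close>), and every condition on
  \<open>\<psi>\<close> is one on words. Conditions that concern only the indices \<open>h, \<dots>, i\<close> are those of a factor of the word,
  because Knuth moves act on positions.
\<close>


section \<open>Particle hopping and insertion\<close>

text \<open>A configuration is the set of sites of particles on the integers, with all sites far to the left
  occupied and all sites far to the right empty: the Maya diagram of a Young diagram, in which row \<open>r\<close>
  of length \<open>l\<close> is a particle at site \<open>l - r\<close>. Adding a cell of content \<open>e\<close> is a hop from \<open>e - 1\<close> to \<open>e\<close>.\<close>

definition addable :: "int set => int => bool" where
  "addable M e \<longleftrightarrow> e - 1 \<in> M & e ~: M"

definition bounded_config :: "int set => bool" where
  "bounded_config M \<longleftrightarrow> (\<exists>N. {..<- N} \<subseteq> M & M \<subseteq> {..<N})"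

text \<open>If the hop \<open>d\<close> has extended a row, then this is the content of a cell appended to the next row: the
  hop of the nearest particle to the left of \<open>d - 1\<close>.\<close>

definition bump :: "int set => int => int" where
  "bump B d = (THE e. e - 1 \<in> B & e < d & (\<forall>z. e <= z & z < d - 1 --> z ~: B))"

text \<open>The hop of the rightmost particle, which extends the first row.\<close>

definition front :: "int set => int" where
  "front M = (THE e. e - 1 \<in> M & (\<forall>z. e <= z --> z ~: M))"

lemma bump_eqI:
  assumes "e - 1 \<in> B" "e < d" "\<And>z. e <= z ==> z < d - 1 ==> z ~: B"
  shows "bump B d = e"
  unfolding bump_def
proof (rule the_equality)
  show "e - 1 \<in> B & e < d & (\<forall>z. e <= z & z < d - 1 --> z ~: B)" using assms by blast
next
  fix f assume f: "f - 1 \<in> B & f < d & (\<forall>z. f <= z & z < d - 1 --> z ~: B)"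
  show "f = e"
  proof (rule ccontr)
    assume "f ~= e"
    then consider "f <= e - 1" | "e <= f - 1" by linarith
    then show False
    proof cases
      case 1 then show False using f assms(1,2) by auto
    next
      case 2 then show False using f assms(3)[of "f - 1"] by auto
    qed
  qed
qed

lemma front_eqI:
  assumes "e - 1 \<in> M" "\<And>z. e <= z ==> z ~: M"
  shows "front M = e"
  unfolding front_def
proof (rule the_equality)
  show "e - 1 \<in> M & (\<forall>z. e <= z --> z ~: M)" using assms by blast
next
  fix f assume f: "f - 1 \<in> M & (\<forall>z. f <= z --> z ~: M)"
  have "\<not> f <= e - 1" using f assms(1) by blast
  moreover have "\<not> e <= f - 1" using f assms(2) by blast
  ultimately show "f = e" by linarith
qed

lemma greatest_below:
  fixes B :: "int set"
  assumes "x \<in> B" "x < y"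
  obtains m where "m \<in> B" "m < y" "\<And>z. m < z ==> z < y ==> z ~: B"
proof -
  let ?F = "{z \<in> B. x <= z & z < y}"
  have fin: "finite ?F" by (rule finite_subset[of _ "{x..y}"]) auto
  have ne: "?F ~= {}" using assms by auto
  have m: "Max ?F \<in> ?F" using Max_in[OF fin ne] .
  show thesis
  proof (rule that[of "Max ?F"])
    fix z assume z: "Max ?F < z" "z < y"
    show "z ~: B"
    proof
      assume "z \<in> B"
      then have "z \<in> ?F" using z m by auto
      then have "z <= Max ?F" by (rule Max_ge[OF fin])
      then show False using z by linarith
    qed
  qed (use m in auto)
qed

lemma bump_props:
  assumes "bounded_config B"
  shows "bump B d - 1 \<in> B" "bump B d < d" "\<And>z. bump B d <= z ==> z < d - 1 ==> z ~: B"
proof -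
  obtain N where N: "{..<- N} \<subseteq> B" using assms unfolding bounded_config_def by blast
  have x: "min (d - 2) (- N - 1) \<in> B" using N by auto
  obtain m where m: "m \<in> B" "m < d - 1" "\<And>z. m < z ==> z < d - 1 ==> z ~: B"
    using greatest_below[OF x, of "d - 1"] by (smt (verit))
  have e: "bump B d = m + 1" by (rule bump_eqI) (use m in auto)
  show "bump B d - 1 \<in> B" "bump B d < d" "\<And>z. bump B d <= z ==> z < d - 1 ==> z ~: B"
    using m e by auto
qed

lemma front_props:
  assumes "bounded_config M"
  shows "front M - 1 \<in> M" "\<And>z. front M <= z ==> z ~: M"
proof -
  obtain N where N: "{..<- N} \<subseteq> M" "M \<subseteq> {..<N}" using assms unfolding bounded_config_def by blast
  have x: "min (N - 1) (- N - 1) \<in> M" using N by auto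
  obtain m where m: "m \<in> M" "m < N" "\<And>z. m < z ==> z < N ==> z ~: M"
    using greatest_below[OF x, of N] by (smt (verit))
  have m3: "z ~: M" if "m < z" for z using m(3)[of z] that N(2) by (cases "z < N") auto
  have e: "front M = m + 1" by (rule front_eqI) (use m m3 in auto)
  show "front M - 1 \<in> M" "\<And>z. front M <= z ==> z ~: M"
    using m m3 e by auto
qed

definition descents :: "'a::linorder list => nat set" where
  "descents w = {i. 1 <= i & i < length w & w ! i < w ! (i - 1)}"

text \<open>An elementary Knuth relation, oriented so that the left-hand side has its largest letter in the middle.\<close>

definition word_rel :: "nat \<times> nat \<times> nat => nat \<times> nat \<times> nat => bool" where
  "word_rel w w' \<longleftrightarrow> (case w of (x, y, z) =>
     w' = (y, x, z) & x < z & z < y \<or> w' = (x, z, y) & z < x & x < y)"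

definition list3 :: "'a \<times> 'a \<times> 'a => 'a list" where
  "list3 w = (case w of (x, y, z) => [x, y, z])"

lemma length_list3 [simp]: "length (list3 w) = 3"
  by (auto simp: list3_def split: prod.splits)

text \<open>The data of the insertion: \<open>st\<close> performs a hop, \<open>v\<close> picks a representative among the hops with the same
  effect (the absolute value in the symmetric form), \<open>conf\<close> tells the admissible configurations, and \<open>rel3\<close>
  relates the triples of contents that arise from two words in an elementary Knuth relation.\<close>

locale insertion =
  fixes st :: "int => int set => int set"
    and v :: "int => int"
    and conf :: "int set => bool"
    and rel3 :: "int \<times> int \<times> int => int \<times> int \<times> int => bool"
begin

text \<open>The local rule of growth diagrams. If the hop \<open>p\<close> is made in advance, then the hop \<open>d\<close> becomes \<open>out M p d\<close>, and \<open>lab M p d\<close>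
  is what remains of \<open>p\<close> after \<open>d\<close>. Different hops do not interfere; equal hops are both diverted to the bump.\<close>

definition out :: "int set => int => int => int" where
  "out M p d = (if v d = p then bump (st d M) d else d)"

definition lab :: "int set => int => int => int" where
  "lab M p d = (if v d = p then v (bump (st d M) d) else p)"

fun push :: "int set => int => int list => int list \<times> int" where
  "push M p [] = ([], p)"
| "push M p (d # ds) = (case push (st d M) (lab M p d) ds of (r, q) => (out M p d # r, q))"

fun valid :: "int set => int list => bool" where
  "valid M [] = True"
| "valid M (d # ds) = (addable M d & valid (st d M) ds)"

abbreviation sh :: "int set => int list => int set" where
  "sh M q \<equiv> fold st q M"

abbreviation start :: "int set" where "start \<equiv> {..<0}"

abbreviation legal :: "int list => bool" where "legal \<equiv> valid start"

abbreviation shape :: "int list => int set" where "shape q \<equiv> sh start q"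

text \<open>A new largest letter at position \<open>k\<close> makes the rightmost particle hop, and this additional hop is pushed
  through the remaining ones. The label that comes out is where the final configuration has grown.\<close>

definition ins :: "nat => int list => int list \<times> int" where
  "ins k q = (let A = shape (take k q); (r, p) = push A (v (front A)) (drop k q)
     in (take k q @ front A # r, p))"

text \<open>The first component plays the role of the recording tableau and the second one that of the insertion tableau,
  both given by contents. Removing the largest letter, instead of the last one, has the advantage that the three
  positions of a Knuth relation stay together.\<close>

function rsk :: "nat list => int list \<times> int list" where
  "rsk u = (if u = [] then ([], []) else
     let m = Max (set u); zs = takeWhile (\<lambda>x. x ~= m) u; ys = tl (dropWhile (\<lambda>x. x ~= m) u);
       (q, P) = rsk (zs @ ys); (r, p) = ins (length zs) q
     in (r, P @ [p]))"
  by pat_completeness auto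
termination
proof (relation "measure length")
  fix u :: "nat list" and m zs ys
  assume u: "u ~= []" "m = Max (set u)" "zs = takeWhile (\<lambda>x. x ~= m) u" "ys = tl (dropWhile (\<lambda>x. x ~= m) u)"
  have "m \<in> set u" using u by simp
  then have "dropWhile (\<lambda>x. x ~= m) u ~= []" by (simp add: dropWhile_eq_Nil_conv)
  then have "length ys < length (dropWhile (\<lambda>x. x ~= m) u)" using u(4) by (cases "dropWhile (\<lambda>x. x ~= m) u") auto
  moreover have "length zs + length (dropWhile (\<lambda>x. x ~= m) u) = length u"
    unfolding u(3) by (metis length_append takeWhile_dropWhile_id)
  ultimately show "(zs @ ys, u) \<in> measure length" by simp
qed simp

declare rsk.simps [simp del]

lemma rsk_Nil [simp]: "rsk [] = ([], [])" by (simp add: rsk.simps)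

lemma rsk_max:
  assumes "\<And>x. x \<in> set zs \<union> set ys ==> x < m" and "rsk (zs @ ys) = (q, P)" and "ins (length zs) q = (r, p)"
  shows "rsk (zs @ m # ys) = (r, P @ [p])"
proof -
  have mx: "Max (set (zs @ m # ys)) = m"
    using assms(1) by (intro Max_eqI) (auto simp: less_imp_le)
  have ne: "\<forall>x\<in>set zs. x ~= m" using assms(1) by blast
  have a: "takeWhile (\<lambda>x. x ~= m) (zs @ m # ys) = zs" using ne by (simp add: takeWhile_append)
  have b: "dropWhile (\<lambda>x. x ~= m) (zs @ m # ys) = m # ys" using ne by (simp add: dropWhile_append)
  show ?thesis
    by (subst rsk.simps) (simp only: mx a b list.sel assms(2,3) Let_def prod.case append_is_Nil_conv list.distinct, simp)
qed

lemma push_append: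
  "push M p (xs @ ys) = (case push M p xs of (r, q) => case push (sh M xs) q ys of (r', q') => (r @ r', q'))"
  by (induction xs arbitrary: M p) (auto split: prod.splits)

lemma valid_append: "valid M (xs @ ys) \<longleftrightarrow> valid M xs & valid (sh M xs) ys"
  by (induction xs arbitrary: M) auto

lemma push_length: "push M p ds = (r, q) ==> length r = length ds"
  by (induction ds arbitrary: M p r q) (auto split: prod.splits)

end

lemma split_at_max:
  fixes u :: "nat list"
  assumes "u ~= []" "distinct u"
  obtains zs m ys where "u = zs @ m # ys" "\<And>x. x \<in> set zs \<union> set ys ==> x < m"
proof -
  have "Max (set u) \<in> set u" using assms by simp
  then obtain zs ys where s: "u = zs @ Max (set u) # ys" by (meson split_list)
  show thesis
  proof (rule that[OF s])
    fix x assume x: "x \<in> set zs \<union> set ys"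
    then have "x \<in> set u" by (subst s) auto
    then have "x <= Max (set u)" by simp
    moreover have "x ~= Max (set u)" using x assms(2) by (subst (asm) s) auto
    ultimately show "x < Max (set u)" by simp
  qed
qed

text \<open>The properties that make the local rule work: different hops commute and squares of hops can be completed
  backwards (\<open>square\<close>, \<open>unsquare\<close>, \<open>unbump\<close>), ascents survive (\<open>asc\<close>, \<open>asc_front\<close>), and \<open>rel3\<close> arises when a largest
  letter in the middle of three moves to an end (\<open>rel3_bac\<close>, \<open>rel3_acb\<close>) and survives an additional hop (\<open>rel3_push\<close>).\<close>

locale local_rules = insertion +
  assumes conf_start: "conf {..<0}"
    and conf_bounded: "conf M ==> bounded_config M"
    and conf_st: "conf M ==> addable M d ==> conf (st d M)"
    and v_v: "v (v d) = v d"
    and st_v: "st (v d) M = st d M"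
    and addable_v: "conf M ==> addable M (v d) \<longleftrightarrow> addable M d"
    and st_mem: "d \<in> st d M" "d - 1 ~: st d M"
    and square: "conf M ==> addable M d ==> addable M p ==> v d ~= v p ==>
        addable (st p M) d & st d (st p M) = st p (st d M)"
    and unsquare: "conf A ==> conf A' ==> addable A d ==> addable A' p ==> st d A = st p A' ==> v d ~= v p ==>
        \<exists>B. conf B & addable B p & addable B d & st p B = A & st d B = A'"
    and st_inj: "conf A ==> conf A' ==> addable A d ==> addable A' d' ==> st d A = st d' A' ==> v d = v d' ==> A = A'"
    and unbump: "conf B ==> addable B e ==>
        e = front B \<or> (\<exists>A d. conf A & addable A d & st d A = B & bump B d = e)"
    and asc: "conf M ==> addable M p ==> v p = p ==> addable M x ==> addable (st x M) y ==>
        out M p x < out (st x M) (lab M p x) y \<longleftrightarrow> x < y"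
    and asc_front: "conf M ==> addable M y ==> out M (v (front M)) y < front M"
    and rel3_shape: "conf M ==> valid M [x, y, z] ==> valid M [x', y', z'] ==> rel3 (x, y, z) (x', y', z') ==>
        sh M [x, y, z] = sh M [x', y', z']"
    and rel3_push: "conf M ==> addable M p ==> v p = p ==> valid M [x, y, z] ==> valid M [x', y', z'] ==>
        rel3 (x, y, z) (x', y', z') ==>
        \<exists>w w' q. push M p [x, y, z] = (list3 w, q) & push M p [x', y', z'] = (list3 w', q) & rel3 w w'"
    and rel3_bac: "conf M ==> valid M [x, y] ==> y < x ==>
        rel3 (x, front (st x M), out (st x M) (v (front (st x M))) y) (x, y, front (sh M [x, y])) &
        lab (st x M) (v (front (st x M))) y = v (front (sh M [x, y]))"
    and rel3_acb: "conf M ==> valid M [x, y] ==> x < y ==>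
        rel3 (x, front (st x M), out (st x M) (v (front (st x M))) y)
             (front M, out M (v (front M)) x, out (st x M) (lab M (v (front M)) x) y) &
        lab (st x M) (v (front (st x M))) y = lab (st x M) (lab M (v (front M)) x) y"
begin

lemma addable_bump:
  assumes "conf M" "addable M d"
  shows "addable (st d M) (bump (st d M) d)"
proof -
  note b = bump_props[OF conf_bounded[OF conf_st[OF assms]], of d]
  have "bump (st d M) d ~: st d M"
  proof (cases "bump (st d M) d = d - 1")
    case True
    then show ?thesis using st_mem(2)[of d M] by simp
  next
    case False
    then show ?thesis using b(2) b(3)[of "bump (st d M) d"] by linarith
  qed
  then show ?thesis using b(1) unfolding addable_def by blast
qed

lemma addable_front: "conf M ==> addable M (front M)"
  using front_props[OF conf_bounded] unfolding addable_def by auto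

lemma addable_neq: "addable (st x M) y ==> x ~= y"
  using st_mem(1)[of x M] unfolding addable_def by auto

lemma lab_props:
  assumes "conf M" "addable M p" "v p = p" "addable M d"
  shows "addable (st p M) (out M p d)" "addable (st d M) (lab M p d)" "v (lab M p d) = lab M p d"
    "st (out M p d) (st p M) = st (lab M p d) (st d M)"
proof -
  have "addable (st p M) (out M p d) & addable (st d M) (lab M p d) & v (lab M p d) = lab M p d &
    st (out M p d) (st p M) = st (lab M p d) (st d M)"
  proof (cases "v d = p")
    case True
    have e: "st p M = st d M" using st_v[of d M] True by simp
    show ?thesis using True addable_bump[OF assms(1,4)] addable_v[OF conf_st[OF assms(1,4)]] v_v st_v
      unfolding out_def lab_def e by auto
  next
    case False
    then show ?thesis using square[OF assms(1,4,2)] square[OF assms(1,2,4)] assms(3) unfolding out_def lab_def by auto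
  qed
  then show "addable (st p M) (out M p d)" "addable (st d M) (lab M p d)" "v (lab M p d) = lab M p d"
    "st (out M p d) (st p M) = st (lab M p d) (st d M)" by auto
qed

lemma conf_sh: "conf M ==> valid M q ==> conf (sh M q)"
  by (induction q arbitrary: M) (auto simp: conf_st)

text \<open>One commuting square of hops per entry, side by side.\<close>

lemma push_valid:
  assumes "conf M" "addable M p" "v p = p" "valid M ds" "push M p ds = (r, q)"
  shows "valid (st p M) r & sh (st p M) r = st q (sh M ds) & addable (sh M ds) q & v q = q"
  using assms
proof (induction ds arbitrary: M p r q)
  case Nil
  then show ?case by simp
next
  case (Cons d ds)
  obtain r' where r: "push (st d M) (lab M p d) ds = (r', q)" "r = out M p d # r'"
    using Cons.prems(5) by (auto split: prod.splits)
  have d: "addable M d" "valid (st d M) ds" using Cons.prems by auto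
  note l = lab_props[OF Cons.prems(1-3) d(1)]
  have "valid (st (lab M p d) (st d M)) r' & sh (st (lab M p d) (st d M)) r' = st q (sh (st d M) ds) &
      addable (sh (st d M) ds) q & v q = q"
    by (rule Cons.IH[OF conf_st[OF Cons.prems(1) d(1)] l(2,3) d(2) r(1)])
  then show ?case using l(1,4) r(2) by simp
qed

lemma push_asc:
  assumes "conf M" "addable M p" "v p = p" "valid M ds" "push M p ds = (r, q)" "Suc i < length ds"
  shows "r ! i < r ! Suc i \<longleftrightarrow> ds ! i < ds ! Suc i"
  using assms
proof (induction ds arbitrary: M p r q i)
  case Nil
  then show ?case by simp
next
  case (Cons d ds)
  obtain r' where r: "push (st d M) (lab M p d) ds = (r', q)" "r = out M p d # r'"
    using Cons.prems(5) by (auto split: prod.splits)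
  have d: "addable M d" "valid (st d M) ds" using Cons.prems by auto
  note l = lab_props[OF Cons.prems(1-3) d(1)]
  show ?case
  proof (cases i)
    case 0
    then obtain y ds' where ds: "ds = y # ds'" using Cons.prems(6) by (cases ds) auto
    then obtain r'' where "r' = out (st d M) (lab M p d) y # r''" using r(1) by (auto split: prod.splits)
    then show ?thesis using asc[OF Cons.prems(1-3) d(1), of y] d(2) ds r(2) 0 by simp
  next
    case (Suc j)
    then show ?thesis using Cons.IH[OF conf_st[OF Cons.prems(1) d(1)] l(2,3) d(2) r(1), of j] r(2) Cons.prems(6) by simp
  qed
qed

lemma v_front: "conf M ==> addable M (v (front M)) & v (v (front M)) = v (front M) & st (v (front M)) M = st (front M) M"
  using addable_front addable_v v_v st_v by auto

lemma ins_valid: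
  assumes "legal q" "k <= length q" "ins k q = (r, p)"
  shows "legal r" "length r = Suc (length q)" "shape r = st p (shape q)" "addable (shape q) p" "v p = p"
proof -
  define A where "A = shape (take k q)"
  have va: "legal (take k q)" "valid A (drop k q)"
    using assms(1) valid_append[of start "take k q" "drop k q"] A_def by auto
  have cA: "conf A" unfolding A_def by (rule conf_sh[OF conf_start va(1)])
  obtain r' where r': "push A (v (front A)) (drop k q) = (r', p)" "r = take k q @ front A # r'"
    using assms(3) unfolding ins_def A_def[symmetric] by (auto simp: Let_def split: prod.splits)
  note f = v_front[OF cA]
  have pv: "valid (st (v (front A)) A) r' & sh (st (v (front A)) A) r' = st p (sh A (drop k q)) & addable (sh A (drop k q)) p & v p = p"
    by (rule push_valid[OF cA _ _ va(2) r'(1)]) (use f in auto)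
  have s: "sh A (drop k q) = shape q"
    unfolding A_def by (metis append_take_drop_id comp_apply fold_append)
  show "legal r" using va(1) pv f addable_front[OF cA] unfolding r'(2) valid_append by (simp add: A_def)
  show "length r = Suc (length q)" using push_length[OF r'(1)] assms(2) r'(2) by simp
  show "shape r = st p (shape q)" using pv f s unfolding r'(2) by (simp add: A_def)
  show "addable (shape q) p" "v p = p" using pv s by auto
qed

lemma ins_asc:
  assumes "legal q" "k <= length q" "ins k q = (r, p)"
  shows "Suc i < k ==> r ! i < r ! Suc i \<longleftrightarrow> q ! i < q ! Suc i"
    and "Suc i = k ==> r ! i < r ! Suc i"
    and "k < length q ==> r ! Suc k < r ! k"
    and "k <= i ==> Suc i < length q ==> r ! Suc i < r ! Suc (Suc i) \<longleftrightarrow> q ! i < q ! Suc i"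
proof -
  define A where "A = shape (take k q)"
  have va: "legal (take k q)" "valid A (drop k q)"
    using assms(1) valid_append[of start "take k q" "drop k q"] A_def by auto
  have cA: "conf A" unfolding A_def by (rule conf_sh[OF conf_start va(1)])
  obtain r' where r': "push A (v (front A)) (drop k q) = (r', p)" "r = take k q @ front A # r'"
    using assms(3) unfolding ins_def A_def[symmetric] by (auto simp: Let_def split: prod.splits)
  note f = v_front[OF cA]
  have len: "length r' = length q - k" using push_length[OF r'(1)] by simp
  have rk: "r ! k = front A" "\<And>j. r ! (Suc (k + j)) = r' ! j" "\<And>j. j < k ==> r ! j = q ! j"
    using r'(2) assms(2) by (auto simp: nth_append)
  show "Suc i < k ==> r ! i < r ! Suc i \<longleftrightarrow> q ! i < q ! Suc i" using rk(3) by simp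
  show "r ! i < r ! Suc i" if "Suc i = k"
  proof -
    have t: "take k q = take i q @ [q ! i]" using that assms(2) by (metis Suc_le_lessD take_Suc_conv_app_nth)
    have "q ! i \<in> A" unfolding A_def t using st_mem(1) by simp
    then have "q ! i < front A" using front_props(2)[OF conf_bounded[OF cA], of "q ! i"] by (meson not_less)
    then show ?thesis using rk(1) rk(3)[of i] that by simp
  qed
  show "r ! Suc k < r ! k" if kl: "k < length q"
  proof -
    obtain y ds where ds: "drop k q = y # ds" using kl by (metis Cons_nth_drop_Suc)
    then obtain r'' where "r' = out A (v (front A)) y # r''" using r'(1) by (auto split: prod.splits)
    moreover have "out A (v (front A)) y < front A" using asc_front[OF cA] va(2) ds by simp
    ultimately show ?thesis using rk(1) rk(2)[of 0] by simp
  qed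
  show "r ! Suc i < r ! Suc (Suc i) \<longleftrightarrow> q ! i < q ! Suc i" if "k <= i" "Suc i < length q"
  proof -
    have "r' ! (i - k) < r' ! Suc (i - k) \<longleftrightarrow> drop k q ! (i - k) < drop k q ! Suc (i - k)"
      by (rule push_asc[OF cA _ _ va(2) r'(1)]) (use f that in auto)
    then show ?thesis using rk(2)[of "i - k"] rk(2)[of "Suc (i - k)"] that by simp
  qed
qed

text \<open>Ascents are compared across every new largest letter: entries on one side keep their order, and the new
  letter is an ascent from the left and a descent to the right.\<close>

lemma rsk_valid:
  assumes "distinct u" "rsk u = (q, P)"
  shows "legal q & length q = length u & length P = length u &
    (\<forall>i. Suc i < length u --> (q ! i < q ! Suc i \<longleftrightarrow> u ! i < u ! Suc i))"
  using assms
proof (induction "length u" arbitrary: u q P rule: less_induct)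
  case less
  show ?case
  proof (cases "u = []")
    case True
    then show ?thesis using less.prems by simp
  next
    case False
    obtain zs m ys where u: "u = zs @ m # ys" "\<And>x. x \<in> set zs \<union> set ys ==> x < m"
      using split_at_max[OF False less.prems(1)] by blast
    obtain q0 P0 where q0: "rsk (zs @ ys) = (q0, P0)" by fastforce
    obtain r p where r: "ins (length zs) q0 = (r, p)" by fastforce
    have e: "q = r" "P = P0 @ [p]" using rsk_max[OF u(2) q0 r] less.prems(2) u(1) by auto
    have IH: "legal q0 & length q0 = length (zs @ ys) & length P0 = length (zs @ ys) &
      (\<forall>i. Suc i < length (zs @ ys) --> (q0 ! i < q0 ! Suc i \<longleftrightarrow> (zs @ ys) ! i < (zs @ ys) ! Suc i))"
      by (rule less.hyps[OF _ _ q0]) (use u less.prems(1) in auto)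
    have k: "length zs <= length q0" using IH by simp
    note iv = ins_valid[OF _ k r] ins_asc[OF _ k r]
    have "q ! i < q ! Suc i \<longleftrightarrow> u ! i < u ! Suc i" if i: "Suc i < length u" for i
    proof -
      consider "Suc i < length zs" | "Suc i = length zs" | "i = length zs" | "length zs < i" by linarith
      then show ?thesis
      proof cases
        case 1
        then show ?thesis using iv(6) IH e u(1) by (auto simp: nth_append)
      next
        case 2
        have "u ! i \<in> set zs" using 2 u(1) by (auto simp: nth_append)
        moreover have "u ! Suc i = m" using 2 u(1) by (auto simp: nth_append)
        ultimately show ?thesis using iv(7)[OF _ 2] IH e u(2) by auto
      next
        case 3
        have "u ! Suc i \<in> set ys" using 3 i u(1) by (auto simp: nth_append)
        moreover have "u ! i = m" using 3 u(1) by (auto simp: nth_append)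
        moreover have "q ! Suc i < q ! i" using iv(8) 3 IH e i u(1) by auto
        ultimately show ?thesis using u(2)[of "u ! Suc i"] by auto
      next
        case 4
        then obtain j where j: "i = Suc j" "length zs <= j" by (cases i) auto
        have "r ! Suc j < r ! Suc (Suc j) \<longleftrightarrow> q0 ! j < q0 ! Suc j"
          by (rule iv(9)) (use IH j i u(1) in auto)
        moreover have "(zs @ ys) ! j = u ! Suc j" "(zs @ ys) ! Suc j = u ! Suc (Suc j)"
          using j u(1) by (auto simp: nth_append Suc_diff_le)
        moreover have "Suc j < length (zs @ ys)" using i j u(1) by simp
        ultimately show ?thesis using IH e j(1) by metis
      qed
    qed
    then show ?thesis using iv(1,2) IH e u(1) by auto
  qed
qed

lemma descents_rsk:
  assumes "distinct u"
  shows "descents (fst (rsk u)) = descents u"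
proof -
  obtain q P where q: "rsk u = (q, P)" by fastforce
  note v = rsk_valid[OF assms q]
  have ne: "q ! i ~= q ! Suc i" if "Suc i < length q" for i
  proof -
    have "q = take i q @ q ! i # q ! Suc i # drop (Suc (Suc i)) q"
      using that by (simp add: Cons_nth_drop_Suc)
    then have "legal (take i q @ q ! i # q ! Suc i # drop (Suc (Suc i)) q)" using v by simp
    then have "addable (st (q ! i) (shape (take i q))) (q ! Suc i)" by (simp add: valid_append)
    then show ?thesis using addable_neq by blast
  qed
  have "q ! i < q ! (i - 1) \<longleftrightarrow> u ! i < u ! (i - 1)" if "1 <= i" "i < length u" for i
  proof -
    have "u ! (i - 1) ~= u ! i" using assms that nth_eq_iff_index_eq[of u "i - 1" i] by simp
    moreover have "q ! (i - 1) ~= q ! i" using ne[of "i - 1"] that v by simp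
    moreover have "q ! (i - 1) < q ! i \<longleftrightarrow> u ! (i - 1) < u ! i"
      using v[THEN conjunct2, THEN conjunct2, THEN conjunct2, rule_format, of "i - 1"] that by simp
    ultimately show ?thesis by auto
  qed
  then show ?thesis unfolding descents_def q using v by auto
qed

end


section \<open>Knuth relations and invertibility of insertion\<close>

context local_rules
begin

lemma rsk_max_cases:
  assumes "distinct (zs @ m # ys)" "\<And>x. x \<in> set zs \<union> set ys ==> x < m"
    and "rsk (zs @ ys) = (q, P)" "q = q1 @ q2" "length q1 = length zs"
    and "push (shape q1) (v (front (shape q1))) q2 = (r, p)"
  shows "rsk (zs @ m # ys) = (q1 @ front (shape q1) # r, P @ [p])"
proof -
  have "ins (length zs) q = (q1 @ front (shape q1) # r, p)"
    using assms(4-6) unfolding ins_def by simp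
  then show ?thesis using rsk_max[OF assms(2,3)] by blast
qed

text \<open>By removal of the largest letter. If it is not among the three letters, then its hop passes
  through both triples or comes after them, and \<open>rel3\<close> survives. If it is, then it is the middle one, and the relation is
  the comparison of its insertion in the middle and at an end of the same pair.\<close>

lemma rsk_word_rel:
  assumes "distinct (zs @ list3 w @ ys)" "word_rel w w'"
  shows "\<exists>q1 t t' q2 P. rsk (zs @ list3 w @ ys) = (q1 @ list3 t @ q2, P) &
    rsk (zs @ list3 w' @ ys) = (q1 @ list3 t' @ q2, P) & length q1 = length zs & rel3 t t'"
  using assms
proof (induction "length zs + length ys" arbitrary: zs ys rule: less_induct)
  case less
  obtain a b c where w: "w = (a, b, c)" by (cases w)
  obtain a' b' c' where w': "w' = (a', b', c')" by (cases w')
  have rng: "set (list3 w') = set (list3 w)" "distinct (list3 w')" "distinct (list3 w)"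
    using less.prems unfolding w w' word_rel_def list3_def by auto
  have d': "distinct (zs @ list3 w' @ ys)"
    using less.prems(1) rng by auto
  obtain us m vs where u: "zs @ list3 w @ ys = us @ m # vs" "\<And>x. x \<in> set us \<union> set vs ==> x < m"
    using split_at_max[OF _ less.prems(1)] by (auto simp: list3_def w)
  have big: "x < m" if "x \<in> set (zs @ list3 w @ ys)" "x ~= m" for x
    using that u by auto
  have "m \<in> set (zs @ list3 w @ ys)" using u(1) by simp
  \<comment> \<open>where the largest letter is, relative to the three letters\<close>
  then consider "m \<in> set zs" | "m \<in> set ys" | "m \<in> set (list3 w)" by auto
  then show ?case
  proof cases
    case 1
    then obtain z1 z2 where z: "zs = z1 @ m # z2" by (meson split_list)
    have lt: "x \<in> set z1 \<union> set (z2 @ list3 w @ ys) ==> x < m" for x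
      using big[of x] less.prems(1) z by auto
    have lt': "x \<in> set z1 \<union> set (z2 @ list3 w' @ ys) ==> x < m" for x
      using lt[of x] rng(1) by auto
    have "\<exists>q1 t t' q2 P. rsk ((z1 @ z2) @ list3 w @ ys) = (q1 @ list3 t @ q2, P) &
      rsk ((z1 @ z2) @ list3 w' @ ys) = (q1 @ list3 t' @ q2, P) & length q1 = length (z1 @ z2) & rel3 t t'"
      by (rule less.hyps) (use z less.prems in auto)
    then obtain q1 t t' q2 P where IH: "rsk ((z1 @ z2) @ list3 w @ ys) = (q1 @ list3 t @ q2, P)"
      "rsk ((z1 @ z2) @ list3 w' @ ys) = (q1 @ list3 t' @ q2, P)" "length q1 = length (z1 @ z2)" "rel3 t t'" by blast
    have va: "legal (q1 @ list3 t @ q2)" using rsk_valid[OF _ IH(1)] z less.prems(1) by auto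
    have va': "legal (q1 @ list3 t' @ q2)" using rsk_valid[OF _ IH(2)] z d' by auto
    define r1 where "r1 = take (length z1) q1"
    define r2 where "r2 = drop (length z1) q1"
    have q1: "q1 = r1 @ r2" "length r1 = length z1" "length r2 = length z2"
      using IH(3) unfolding r1_def r2_def by auto
    define A where "A = shape r1"
    define B where "B = sh A r2"
    have vA: "legal r1" "valid A r2" "valid B (list3 t)" "valid (sh B (list3 t)) q2"
      "valid B (list3 t')"
      using va va' unfolding q1 A_def B_def by (auto simp: valid_append)
    have cA: "conf A" unfolding A_def by (rule conf_sh[OF conf_start vA(1)])
    have cB: "conf B" unfolding B_def by (rule conf_sh[OF cA vA(2)])
    obtain s2 p2 where s2: "push A (v (front A)) r2 = (s2, p2)" by fastforce
    note f = v_front[OF cA]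
    have pv: "addable B p2 & v p2 = p2"
      unfolding B_def using push_valid[OF cA _ _ vA(2) s2] f by blast
    obtain x y z x' y' z' where t: "t = (x, y, z)" "t' = (x', y', z')" by (cases t, cases t')
    obtain l w1 w1' where y: "push B p2 (list3 t) = (list3 w1, l)" "push B p2 (list3 t') = (list3 w1', l)" "rel3 w1 w1'"
      using rel3_push[OF cB, of p2 x y z x' y' z'] pv vA(3,5) IH(4) unfolding t list3_def by auto
    have eqs: "sh B (list3 t) = sh B (list3 t')"
      using rel3_shape[OF cB, of x y z x' y' z'] vA(3,5) IH(4) unfolding t list3_def by simp
    obtain s3 p where s3: "push (sh B (list3 t)) l q2 = (s3, p)" by fastforce
    have g: "push A (v (front A)) (r2 @ list3 t @ q2) = (s2 @ list3 w1 @ s3, p)"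
      "push A (v (front A)) (r2 @ list3 t' @ q2) = (s2 @ list3 w1' @ s3, p)"
      using s2 s3 y eqs by (simp_all add: push_append B_def)
    have R: "rsk (z1 @ m # z2 @ list3 (a, b, c) @ ys) = (r1 @ front A # s2 @ list3 w1 @ s3, P @ [p])"
      unfolding A_def
      by (rule rsk_max_cases[where q = "q1 @ list3 t @ q2" and ?q2.0 = "r2 @ list3 t @ q2"])
        (use lt z less.prems(1) IH(1) q1 g(1) w in \<open>auto simp: A_def\<close>)
    have R': "rsk (z1 @ m # z2 @ list3 (a', b', c') @ ys) = (r1 @ front A # s2 @ list3 w1' @ s3, P @ [p])"
      unfolding A_def
      by (rule rsk_max_cases[where q = "q1 @ list3 t' @ q2" and ?q2.0 = "r2 @ list3 t' @ q2"])
        (use lt' z d' IH(2) q1 g(2) w' in \<open>auto simp: A_def\<close>)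
    have "length (r1 @ front A # s2) = length zs" using push_length[OF s2] q1 z by simp
    then show ?thesis
      using R R' y(3) unfolding z w w'
      by (intro exI[of _ "r1 @ front A # s2"] exI[of _ w1] exI[of _ w1'] exI[of _ s3] exI[of _ "P @ [p]"]) auto
  next
    case 2
    then obtain y1 y2 where z: "ys = y1 @ m # y2" by (meson split_list)
    have lt: "x \<in> set (zs @ list3 w @ y1) \<union> set y2 ==> x < m" for x
      using big[of x] less.prems(1) z by auto
    have lt': "x \<in> set (zs @ list3 w' @ y1) \<union> set y2 ==> x < m" for x
      using lt[of x] rng(1) by auto
    have "\<exists>q1 t t' q2 P. rsk (zs @ list3 w @ (y1 @ y2)) = (q1 @ list3 t @ q2, P) &
      rsk (zs @ list3 w' @ (y1 @ y2)) = (q1 @ list3 t' @ q2, P) & length q1 = length zs & rel3 t t'"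
      by (rule less.hyps) (use z less.prems in auto)
    then obtain q1 t t' q2 P where IH: "rsk (zs @ list3 w @ (y1 @ y2)) = (q1 @ list3 t @ q2, P)"
      "rsk (zs @ list3 w' @ (y1 @ y2)) = (q1 @ list3 t' @ q2, P)" "length q1 = length zs" "rel3 t t'" by blast
    have va: "legal (q1 @ list3 t @ q2)" "length q2 = length (y1 @ y2)"
      using rsk_valid[OF _ IH(1)] z less.prems(1) IH(3) by auto
    have va': "legal (q1 @ list3 t' @ q2)" using rsk_valid[OF _ IH(2)] z d' by auto
    define r1 where "r1 = take (length y1) q2"
    define r2 where "r2 = drop (length y1) q2"
    have q2: "q2 = r1 @ r2" "length r1 = length y1"
      using va(2) unfolding r1_def r2_def by auto
    obtain x y z x' y' z' where t: "t = (x, y, z)" "t' = (x', y', z')" by (cases t, cases t')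
    have cB: "conf (shape q1)" using conf_sh[OF conf_start] va by (simp add: valid_append)
    have eqs: "sh (shape q1) (list3 t') = sh (shape q1) (list3 t)"
      using rel3_shape[OF cB, of x y z x' y' z'] va va' IH(4) unfolding t list3_def by (simp add: valid_append)
    define A where "A = shape (q1 @ list3 t @ r1)"
    have A': "A = shape (q1 @ list3 t' @ r1)" using eqs unfolding A_def by simp
    obtain s p where s: "push A (v (front A)) r2 = (s, p)" by fastforce
    have R: "rsk ((zs @ list3 w @ y1) @ m # y2) = ((q1 @ list3 t @ r1) @ front A # s, P @ [p])"
      unfolding A_def
      by (rule rsk_max_cases[where q = "q1 @ list3 t @ q2" and ?q2.0 = r2])
        (use lt z less.prems(1) IH(1,3) q2 s in \<open>auto simp: A_def\<close>)
    have R': "rsk ((zs @ list3 w' @ y1) @ m # y2) = ((q1 @ list3 t' @ r1) @ front A # s, P @ [p])"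
      unfolding A'
      by (rule rsk_max_cases[where q = "q1 @ list3 t' @ q2" and ?q2.0 = r2])
        (use lt' z d' IH(2,3) q2 s in \<open>auto simp: A'\<close>)
    show ?thesis
      using R R' IH(3,4) unfolding z
      by (intro exI[of _ q1] exI[of _ t] exI[of _ t'] exI[of _ "r1 @ front A # s"] exI[of _ "P @ [p]"]) auto
  next
    case 3
    have "b = m" using 3 big[of b] less.prems big[of a] big[of c] unfolding w list3_def word_rel_def by auto
    note w = w[unfolded this]
    define W where "W = zs @ [a, c] @ ys"
    have dW: "distinct W" using less.prems(1) unfolding W_def w list3_def by auto
    have lt: "x < m" if "x \<in> set W" for x using that big[of x] less.prems(1) unfolding W_def w list3_def by auto
    obtain q P where q: "rsk W = (q, P)" by fastforce
    note vq = rsk_valid[OF dW q]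
    define q1 where "q1 = take (length zs) q"
    define q2 where "q2 = drop (length zs + 2) q"
    define e where "e = q ! length zs"
    define f where "f = q ! Suc (length zs)"
    have qq: "q = q1 @ [e, f] @ q2"
    proof -
      have "length zs < length q" "Suc (length zs) < length q" using vq unfolding W_def by auto
      then show ?thesis unfolding q1_def q2_def e_def f_def
        by (metis Cons_eq_appendI Cons_nth_drop_Suc add_2_eq_Suc' append_self_conv2 append_take_drop_id)
    qed
    have len: "length q1 = length zs" using vq unfolding q1_def W_def by auto
    have ef: "e < f \<longleftrightarrow> a < c"
    proof -
      have "Suc (length zs) < length W" unfolding W_def by simp
      then have "e < f \<longleftrightarrow> W ! length zs < W ! Suc (length zs)" using vq unfolding e_def f_def by blast
      then show ?thesis unfolding W_def by (simp add: nth_append)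
    qed
    define A where "A = shape q1"
    have va: "legal q1" "valid A [e, f]" "valid (sh A [e, f]) q2" using vq unfolding qq A_def valid_append by auto
    have cA: "conf A" unfolding A_def by (rule conf_sh[OF conf_start va(1)])
    have fe: "e ~= f" using addable_neq va(2) by auto
    show ?thesis
    proof (cases "a < c")
      case True
      then have w': "w' = (m, a, c)" using less.prems(2) unfolding w word_rel_def by auto
      \<comment> \<open>the middle letter moves to the left end\<close>
      note R = rel3_acb[OF cA va(2), unfolded ef[symmetric], OF True[folded ef]]
      define l where "l = lab (st e A) (v (front (st e A))) f"
      obtain s p where s: "push (sh A [e, f]) l q2 = (s, p)" by fastforce
      have r1: "rsk ((zs @ [a]) @ m # (c # ys)) = ((q1 @ [e]) @ front (shape (q1 @ [e])) #
          (out (st e A) (v (front (st e A))) f # s), P @ [p])"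
        by (rule rsk_max_cases[where q = q and ?q2.0 = "f # q2"])
          (use dW lt q qq len s less.prems(1) in \<open>auto simp: W_def w A_def l_def list3_def\<close>)
      have r2: "rsk (zs @ m # (a # c # ys)) = (q1 @ front (shape q1) #
          (out A (v (front A)) e # out (st e A) (lab A (v (front A)) e) f # s), P @ [p])"
        by (rule rsk_max_cases[where q = q and ?q2.0 = "e # f # q2"])
          (use dW lt q qq len s R less.prems(1) in \<open>auto simp: W_def w A_def l_def list3_def\<close>)
      show ?thesis unfolding w w'
        by (intro exI[of _ q1] exI[of _ "(e, front (st e A), out (st e A) (v (front (st e A))) f)"]
          exI[of _ "(front A, out A (v (front A)) e, out (st e A) (lab A (v (front A)) e) f)"] exI[of _ s] exI[of _ "P @ [p]"])
          (use r1 r2 R len in \<open>auto simp: list3_def A_def\<close>)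
    next
      case False
      then have w': "w' = (a, c, m)" using less.prems(2) unfolding w word_rel_def by auto
      have "f < e" using False fe ef by simp
      \<comment> \<open>the middle letter moves to the right end\<close>
      note R = rel3_bac[OF cA va(2) this]
      define l where "l = lab (st e A) (v (front (st e A))) f"
      obtain s p where s: "push (sh A [e, f]) l q2 = (s, p)" by fastforce
      have r1: "rsk ((zs @ [a]) @ m # (c # ys)) = ((q1 @ [e]) @ front (shape (q1 @ [e])) #
          (out (st e A) (v (front (st e A))) f # s), P @ [p])"
        by (rule rsk_max_cases[where q = q and ?q2.0 = "f # q2"])
          (use dW lt q qq len s less.prems(1) in \<open>auto simp: W_def w A_def l_def list3_def\<close>)
      have r2: "rsk ((zs @ [a, c]) @ m # ys) = ((q1 @ [e, f]) @ front (shape (q1 @ [e, f])) # s, P @ [p])"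
        by (rule rsk_max_cases[where q = q and ?q2.0 = "q2"])
          (use dW lt q qq len s R less.prems(1) in \<open>auto simp: W_def w A_def l_def list3_def\<close>)
      show ?thesis unfolding w w'
        by (intro exI[of _ q1] exI[of _ "(e, front (st e A), out (st e A) (v (front (st e A))) f)"]
          exI[of _ "(e, f, front (sh A [e, f]))"] exI[of _ s] exI[of _ "P @ [p]"])
          (use r1 r2 R len in \<open>auto simp: list3_def A_def\<close>)
    qed
  qed
qed

lemma bump_unique:
  assumes "conf A" "addable A d" "conf A'" "addable A' d'" "st d A = st d' A'" "bump (st d A) d = bump (st d A) d'"
  shows "d = d'"
proof -
  let ?B = "st d A"
  have bB: "bounded_config ?B" by (rule conf_bounded[OF conf_st[OF assms(1,2)]])
  have m: "d \<in> ?B" "d - 1 ~: ?B" "d' \<in> ?B" "d' - 1 ~: ?B"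
    using st_mem[of d A] st_mem[of d' A'] assms(5) by auto
  note b = bump_props[OF bB, of d] and b' = bump_props[OF bB, of d', folded assms(6)]
  have "\<not> d < d'" using b(2) b'(3)[of d] m by (cases "d = d' - 1") auto
  moreover have "\<not> d' < d" using b'(2) b(3)[of d'] m by (cases "d' = d - 1") auto
  ultimately show ?thesis by simp
qed

lemma bump_neq_front:
  assumes "conf A" "addable A d"
  shows "bump (st d A) d ~= front (st d A)"
proof -
  have bB: "bounded_config (st d A)" by (rule conf_bounded[OF conf_st[OF assms]])
  show ?thesis using bump_props(2)[OF bB, of d] front_props(2)[OF bB, of d] st_mem(1)[of d A] by force
qed

lemma ins_snoc:
  assumes "k <= length q" "ins k q = (r, p)"
  shows "ins k (q @ [d]) = (r @ [out (shape q) p d], lab (shape q) p d)"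
proof -
  have s: "sh (shape (take k q)) (drop k q) = shape q"
    by (metis append_take_drop_id comp_apply fold_append)
  show ?thesis using assms s unfolding ins_def by (auto simp: Let_def push_append split: prod.splits)
qed

lemma ins_last: "ins (length q) q = (q @ [front (shape q)], v (front (shape q)))"
  unfolding ins_def by (simp add: Let_def)

text \<open>The last entry and the label can be pulled back through the local rule: either they come from a completed
  square, or from a common bump, or the new letter was the last one, and the configuration tells which.\<close>

lemma ins_inj:
  assumes "legal q" "legal q'" "k <= length q" "k' <= length q'" "length q = length q'"
    and "ins k q = (r, p)" "ins k' q' = (r, p)"
  shows "q = q' & k = k'"
  using assms
proof (induction q arbitrary: q' r p rule: rev_induct)
  case Nil
  then show ?case by simp
next
  case (snoc d q)
  obtain s d' where q': "q' = s @ [d']" "length s = length q" using snoc.prems(5) by (cases q' rule: rev_cases) auto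
  have v0: "legal q" "legal s" "addable (shape q) d" "addable (shape s) d'"
    using snoc.prems(1,2) unfolding q' valid_append by auto
  note cs = conf_sh[OF conf_start v0(1)] conf_sh[OF conf_start v0(2)]
  have full: False if "k1 <= length q1" "length q1 = length q2" "legal q1" "legal q2" "addable (shape q1) d1"
      "ins k1 (q1 @ [d1]) = (q2 @ [d2] @ [front (shape (q2 @ [d2]))], v (front (shape (q2 @ [d2]))))"
    for k1 q1 d1 q2 d2
  proof -
    obtain r1 p1 where r1: "ins k1 q1 = (r1, p1)" by fastforce
    note i1 = ins_valid[OF that(3,1) r1]
    have e: "r1 = q2 @ [d2]" "out (shape q1) p1 d1 = front (shape (q2 @ [d2]))"
      "lab (shape q1) p1 d1 = v (front (shape (q2 @ [d2])))"
      using ins_snoc[OF that(1) r1, of d1] that(6) i1(2) that(2) by auto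
    have sB: "shape (q2 @ [d2]) = st p1 (shape q1)" using i1(3) e(1) by simp
    show False
    proof (cases "v d1 = p1")
      case True
      then have "shape (q2 @ [d2]) = st d1 (shape q1)" using sB st_v by metis
      then show False using bump_neq_front[OF conf_sh[OF conf_start that(3)] that(5)] e(2) True unfolding out_def by simp
    next
      case False
      then show False using e(2,3) unfolding out_def lab_def by auto
    qed
  qed
  show ?case
  proof (cases "k = length (q @ [d])"; cases "k' = length q'")
    assume k: "k = length (q @ [d])" "k' = length q'"
    then show ?thesis using snoc.prems(6,7) unfolding ins_last k by auto
  next
    assume k: "k = length (q @ [d])" "k' ~= length q'"
    have "ins k' (s @ [d']) = (q @ [d] @ [front (shape (q @ [d]))], v (front (shape (q @ [d]))))"
      using snoc.prems(6,7) ins_last[of "q @ [d]"] k(1) q'(1) by simp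
    moreover have "k' <= length s" using k(2) snoc.prems(4) q'(1) by simp
    ultimately show ?thesis using full[OF _ q'(2) v0(2,1,4)] by blast
  next
    assume k: "k ~= length (q @ [d])" "k' = length q'"
    have l: "ins k' q' = (s @ [d'] @ [front (shape (s @ [d']))], v (front (shape (s @ [d']))))"
      unfolding k(2) ins_last by (simp only: q'(1) append_assoc)
    have "ins k (q @ [d]) = (s @ [d'] @ [front (shape (s @ [d']))], v (front (shape (s @ [d']))))"
      by (rule trans[OF snoc.prems(6) trans[OF snoc.prems(7)[symmetric] l]])
    moreover have "k <= length q" using k(1) snoc.prems(3) by simp
    ultimately show ?thesis using full[OF _ q'(2)[symmetric] v0(1,2,3)] by blast
  next
    assume k: "k ~= length (q @ [d])" "k' ~= length q'"
    have kk: "k <= length q" "k' <= length s" using k snoc.prems(3,4) q' by auto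
    obtain r1 p1 where r1: "ins k q = (r1, p1)" by fastforce
    obtain r2 p2 where r2: "ins k' s = (r2, p2)" by fastforce
    note i1 = ins_valid[OF v0(1) kk(1) r1] and i2 = ins_valid[OF v0(2) kk(2) r2]
    have e: "r2 = r1" "out (shape q) p1 d = out (shape s) p2 d'" "lab (shape q) p1 d = lab (shape s) p2 d'"
      using ins_snoc[OF kk(1) r1, of d] ins_snoc[OF kk(2) r2, of d'] snoc.prems(6,7) i1(2) i2(2) q' by auto
    have sB: "st p1 (shape q) = st p2 (shape s)" using i1(3) i2(3) e(1) by simp
    have "p1 = p2 & d = d'"
    proof (cases "v d = p1"; cases "v d' = p2")
      assume h: "v d = p1" "v d' = p2"
      have "st d (shape q) = st d' (shape s)" "st d (shape q) = st p1 (shape q)"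
        using sB h st_v by metis+
      then show ?thesis using bump_unique[OF cs(1) v0(3) cs(2) v0(4)] e(2) h unfolding out_def by auto
    next
      assume h: "v d = p1" "v d' ~= p2"
      then show ?thesis using e(2,3) unfolding out_def lab_def by auto
    next
      assume h: "v d ~= p1" "v d' = p2"
      then show ?thesis using e(2,3) unfolding out_def lab_def by auto
    next
      assume h: "v d ~= p1" "v d' ~= p2"
      then show ?thesis using e(2,3) unfolding out_def lab_def by auto
    qed
    then show ?thesis using snoc.IH[OF v0(1,2) kk _ r1] r2 e(1) q' by auto
  qed
qed

lemma rsk_inj:
  assumes "distinct u" "distinct u'" "set u = set u'" "rsk u = rsk u'"
  shows "u = u'"
  using assms
proof (induction "length u" arbitrary: u u' rule: less_induct)
  case less
  show ?case
  proof (cases "u = []")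
    case True
    then show ?thesis using less.prems by simp
  next
    case False
    obtain zs m ys where u: "u = zs @ m # ys" "\<And>x. x \<in> set zs \<union> set ys ==> x < m"
      using split_at_max[OF False less.prems(1)] by blast
    have "u' ~= []" using False less.prems(3) by auto
    then obtain zs' m' ys' where u': "u' = zs' @ m' # ys'" "\<And>x. x \<in> set zs' \<union> set ys' ==> x < m'"
      using split_at_max[OF _ less.prems(2)] by blast
    have mm: "m' = m"
    proof -
      have "m \<in> set u'" "m' \<in> set u" using less.prems(3) u(1) u'(1) by auto
      then show ?thesis using u(1) u'(1) u(2)[of m'] u'(2)[of m] by fastforce
    qed
    obtain q P where q: "rsk (zs @ ys) = (q, P)" by fastforce
    obtain q' P' where q': "rsk (zs' @ ys') = (q', P')" by fastforce
    obtain r p where r: "ins (length zs) q = (r, p)" by fastforce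
    obtain r' p' where r': "ins (length zs') q' = (r', p')" by fastforce
    have e: "r = r'" "P = P'" "p = p'" using rsk_max[OF u(2) q r] rsk_max[OF u'(2) q' r'] less.prems(4) u u' mm by auto
    have d: "distinct (zs @ ys)" "distinct (zs' @ ys')" "set (zs @ ys) = set (zs' @ ys')"
      using less.prems(1-3) unfolding u(1) u'(1) mm by auto
    note vq = rsk_valid[OF d(1) q] rsk_valid[OF d(2) q']
    have "length (zs @ ys) = length (zs' @ ys')" using d by (metis distinct_card)
    then have i: "q = q' & length zs = length zs'"
      using ins_inj[of q q' "length zs" "length zs'" r p] vq r r' e by auto
    have "zs @ ys = zs' @ ys'" by (rule less.hyps[OF _ d]) (use u i q q' e in auto)
    then have "zs = zs' & ys = ys'" using i by simp
    then show ?thesis using u u' mm by simp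
  qed
qed

text \<open>Reverse insertion: the label is pulled back from the right until it becomes the hop of the rightmost particle.\<close>

lemma ins_surj:
  assumes "legal q'" "length q' = Suc n" "conf A" "addable A p" "v p = p" "st p A = shape q'"
  shows "\<exists>q k. legal q & length q = n & k <= n & ins k q = (q', p) & shape q = A"
  using assms
proof (induction n arbitrary: q' A p)
  case 0
  then obtain d where d: "q' = [d]" by (cases q') auto
  have dv: "addable start d" "st p A = st d start" using 0 d by auto
  have fs: "front start = 0" by (rule front_eqI) auto
  have d0: "d = 0" using dv(1) unfolding addable_def by auto
  have "0 = p \<or> 0 ~= p" by simp
  show ?case
  proof (cases "v d = p")
    case True
    have "A = start" by (rule st_inj[OF 0(3) conf_start 0(4) dv(1,2)]) (use True 0(5) v_v in auto)
    then show ?thesis using ins_last[of "[]"] d d0 fs True by (intro exI[of _ "[]"] exI[of _ 0]) auto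
  next
    case False
    then obtain B where B: "conf B" "addable B d" "st d B = A" "addable B p" "st p B = start"
      using unsquare[OF conf_start 0(3) dv(1) 0(4)] dv(2) 0(5) by metis
    have "p \<in> start" "p - 1 ~: start" using st_mem[of p B] B(5) by auto
    then show ?thesis by auto
  qed
next
  case (Suc n)
  then obtain r d where r: "q' = r @ [d]" "length r = Suc n" by (cases q' rule: rev_cases) auto
  have rv: "legal r" "addable (shape r) d" "st p A = st d (shape r)"
    using Suc.prems r by (auto simp: valid_append)
  have cr: "conf (shape r)" by (rule conf_sh[OF conf_start rv(1)])
  show ?case
  proof (cases "v d = p")
    case False
    then obtain B where B: "conf B" "addable B p" "addable B d" "st p B = shape r" "st d B = A"
      using unsquare[OF cr Suc.prems(3) rv(2) Suc.prems(4)] rv(3) Suc.prems(5) by metis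
    obtain q k where q: "legal q" "length q = n" "k <= n" "ins k q = (r, p)" "shape q = B"
      using Suc.IH[OF rv(1) r(2) B(1,2) Suc.prems(5) B(4)] by blast
    have "ins k (q @ [d]) = (q', p)" using ins_snoc[of k q r p d] q False r(1) unfolding out_def lab_def by auto
    then show ?thesis using q B by (intro exI[of _ "q @ [d]"] exI[of _ k]) (auto simp: valid_append)
  next
    case True
    have Ar: "A = shape r" by (rule st_inj[OF Suc.prems(3) cr Suc.prems(4) rv(2,3)]) (use True Suc.prems(5) v_v in auto)
    show ?thesis
    proof (cases "d = front (shape r)")
      case True
      then show ?thesis using ins_last[of r] r rv Ar \<open>v d = p\<close> by (intro exI[of _ r] exI[of _ "Suc n"]) auto
    next
      case False
      then obtain B e where B: "conf B" "addable B e" "st e B = shape r" "bump (shape r) e = d"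
        using unbump[OF cr rv(2)] by blast
      have "addable B (v e)" "st (v e) B = shape r" using B addable_v st_v by auto
      then obtain q k where q: "legal q" "length q = n" "k <= n" "ins k q = (r, v e)" "shape q = B"
        using Suc.IH[OF rv(1) r(2) B(1) _ v_v] by blast
      have "ins k (q @ [e]) = (q', p)" using ins_snoc[of k q r "v e" e] q r(1) B True unfolding out_def lab_def by auto
      then show ?thesis using q B Ar by (intro exI[of _ "q @ [e]"] exI[of _ k]) (auto simp: valid_append)
    qed
  qed
qed

lemma rsk_surj:
  assumes "legal q"
  shows "\<exists>u. distinct u & set u = {1..length q} & fst (rsk u) = q"
  using assms
proof (induction "length q" arbitrary: q)
  case 0
  then show ?case by (intro exI[of _ "[]"]) auto
next
  case (Suc n)
  obtain r d where r: "q = r @ [d]" "length r = n" using Suc.hyps(2) by (cases q rule: rev_cases) auto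
  have rv: "legal r" "addable (shape r) d" using Suc.prems r by (auto simp: valid_append)
  have cr: "conf (shape r)" by (rule conf_sh[OF conf_start rv(1)])
  obtain q0 k where q0: "legal q0" "length q0 = n" "k <= n" "ins k q0 = (q, v d)"
    using ins_surj[OF Suc.prems Suc.hyps(2)[symmetric] cr _ v_v, of d] rv(2) addable_v[OF cr] st_v r(1) by auto
  obtain u where u: "distinct u" "set u = {1..n}" "fst (rsk u) = q0" using Suc.hyps(1)[of q0] q0 by blast
  have lu: "length u = n" using u distinct_card by fastforce
  let ?u = "take k u @ Suc n # drop k u"
  have s: "set (take k u) \<union> set (drop k u) = {1..n}" using u(2) by (metis append_take_drop_id set_append)
  have dd: "distinct (take k u @ drop k u)" using u(1) by simp
  have "rsk ?u = (q, snd (rsk u) @ [v d])"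
  proof (rule rsk_max)
    show "x < Suc n" if "x \<in> set (take k u) \<union> set (drop k u)" for x using that s by simp
    show "rsk (take k u @ drop k u) = (q0, snd (rsk u))" using u(3) by (simp add: prod_eq_iff)
    have "length (take k u) = k" using lu q0(3) by simp
    then show "ins (length (take k u)) q0 = (q, v d)" using q0(4) by simp
  qed
  moreover have "distinct ?u"
  proof -
    have "Suc n ~: set (take k u) \<union> set (drop k u)" using s by simp
    then show ?thesis using dd by (simp only: distinct_append distinct.simps list.set) blast
  qed
  moreover have "set ?u = {1..length q}"
  proof -
    have "set ?u = insert (Suc n) (set (take k u) \<union> set (drop k u))" by auto
    also have "\<dots> = {1..length q}" unfolding s Suc.hyps(2)[symmetric] by (simp add: atLeastAtMostSuc_conv)
    finally show ?thesis .
  qed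
  ultimately show ?case by (intro exI[of _ ?u]) auto
qed

text \<open>Reverse insertion with the label \<open>v e\<close> shows that every removable hop of a shape leaves a reachable shape.\<close>

lemma valid_removable:
  assumes "legal q" "length q = Suc n" "conf A" "addable A e" "st e A = shape q"
  shows "\<exists>r. legal r & length r = n & shape r = A"
  using ins_surj[OF assms(1-3) _ v_v, of e] assms(4,5) addable_v[OF assms(3)] st_v by auto

end


section \<open>Mirror symmetric configurations\<close>

text \<open>A shifted diagram glued to its mirror image along the main diagonal is symmetric, and a new cell comes with
  its mirror image, so two particles hop at once (a single one if \<open>e = 0\<close>). The hops \<open>e\<close> and \<open>- e\<close> have the same effect and stand for
  an unmarked and a marked letter.\<close>

definition hop2 :: "int => int set => int set" where
  "hop2 e M = (M - {e - 1, - e - 1}) \<union> {e, - e}"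

text \<open>Transposing a shape reflects its Maya diagram at \<open>- 1/2\<close> and exchanges particles with empty sites.\<close>

definition mirrored :: "int set => bool" where
  "mirrored M \<longleftrightarrow> bounded_config M & (\<forall>x. x \<in> M \<longleftrightarrow> - 1 - x ~: M)"

text \<open>Two consecutive letters trade places. If their cells lie on neighbouring diagonals, then this is impossible and
  the marks of both are toggled instead.\<close>

definition exchanged :: "int => int => int => int => bool" where
  "exchanged x y x' y' \<longleftrightarrow> x' = y & y' = x \<or>
     x' = - x & y' = - y & \<bar>\<bar>x\<bar> - \<bar>y\<bar>\<bar> = 1 & (x < 0 & 0 < y \<or> y < 0 & 0 < x)"

text \<open>The action of \<open>d\<^sub>i\<close> on three contents, in the direction prescribed by \<open>word_rel\<close>. The extra pair is the
  case of two letters on the same diagonal, where a single mark is toggled.\<close>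

definition shifted_rel :: "int \<times> int \<times> int => int \<times> int \<times> int => bool" where
  "shifted_rel w w' \<longleftrightarrow> (case (w, w') of ((x, y, z), (x', y', z')) =>
     (x < y & z < y & y' < x' & y' < z' &
       (z' = z & exchanged x y x' y' \<or> x' = x & exchanged y z y' z')) \<or>
     w = (0, 1, 0) & w' = (0, - 1, 0))"

lemma hop2_mem: "x \<in> hop2 e M \<longleftrightarrow> x = e \<or> x = - e \<or> x \<in> M & x ~= e - 1 & x ~= - e - 1"
  unfolding hop2_def by auto

lemma hop2_neg: "hop2 (- e) M = hop2 e M"
  unfolding hop2_def by auto

lemma hop2_abs: "hop2 \<bar>e\<bar> M = hop2 e M"
  by (cases "e \<ge> 0") (auto simp: hop2_neg)

lemma antisymD: "mirrored M ==> x \<in> M \<longleftrightarrow> - 1 - x ~: M"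
  unfolding mirrored_def by blast

lemma addable_sites:
  assumes "mirrored M" "addable M e"
  shows "e - 1 \<in> M" "e ~: M" "- e - 1 \<in> M" "- e ~: M"
  using assms antisymD[OF assms(1), of "- e - 1"] antisymD[OF assms(1), of "e - 1"] unfolding addable_def
  by (auto simp: algebra_simps)

lemma addable_neg: "mirrored M ==> addable M (- e) \<longleftrightarrow> addable M e"
  using addable_sites[of M e] addable_sites[of M "- e", unfolded minus_minus] addable_def[of M e] addable_def[of M "- e"] by blast

lemma addable_abs: "mirrored M ==> addable M \<bar>e\<bar> \<longleftrightarrow> addable M e"
  by (cases "e \<ge> 0") (auto simp: addable_neg)

lemma addable_far:
  assumes "mirrored M" "addable M d" "addable M p" "\<bar>d\<bar> ~= \<bar>p\<bar>"
  shows "\<bar>\<bar>d\<bar> - \<bar>p\<bar>\<bar> ~= 1"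
proof
  assume "\<bar>\<bar>d\<bar> - \<bar>p\<bar>\<bar> = 1"
  then have "d - 1 = p \<or> d - 1 = - p \<or> p - 1 = d \<or> p - 1 = - d \<or> - d - 1 = p \<or> - p - 1 = d \<or> - d - 1 = - p \<or> - p - 1 = - d"
    by linarith
  then show False using addable_sites[OF assms(1,2)] addable_sites[OF assms(1,3)] by metis
qed

lemma far_sites:
  assumes "\<bar>d\<bar> ~= \<bar>p\<bar>" "\<bar>\<bar>d\<bar> - \<bar>p\<bar>\<bar> ~= (1 :: int)"
  shows "d ~= p" "d ~= - p" "d - 1 ~= p" "d - 1 ~= - p" "p - 1 ~= d" "p - 1 ~= - d" "- d - 1 ~= p" "- p - 1 ~= d"
    "- d - 1 ~= - p" "- p - 1 ~= - d" "- d ~= p" "- d ~= - p"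
  using assms by linarith+

lemma bounded_hop:
  assumes "bounded_config M" "finite F" "finite G"
  shows "bounded_config ((M - F) \<union> G)"
proof -
  obtain N where N: "{..<- N} \<subseteq> M" "M \<subseteq> {..<N}" using assms(1) unfolding bounded_config_def by blast
  define K where "K = Max (insert N (abs ` (F \<union> G))) + 1"
  have fin: "finite (insert N (abs ` (F \<union> G)))" using assms by simp
  have le: "x \<in> insert N (abs ` (F \<union> G)) ==> x < K" for x
    using Max_ge[OF fin, of x] unfolding K_def by linarith
  have K: "N < K" "\<And>x. x \<in> F \<union> G ==> \<bar>x\<bar> < K"
    by (rule le, simp) (rule le, blast)
  have "{..<- K} \<subseteq> (M - F) \<union> G" using N(1) K by (fastforce simp: subset_iff)
  moreover have "(M - F) \<union> G \<subseteq> {..<K}" using N(2) K by (fastforce simp: subset_iff)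
  ultimately show ?thesis unfolding bounded_config_def by blast
qed

lemma antisym_hop2:
  assumes "mirrored M" "addable M e"
  shows "mirrored (hop2 e M)"
proof -
  have "bounded_config (hop2 e M)" using assms(1) unfolding mirrored_def hop2_def by (intro bounded_hop) auto
  moreover have "x \<in> hop2 e M \<longleftrightarrow> - 1 - x ~: hop2 e M" for x
    using addable_sites[OF assms] antisymD[OF assms(1), of x] unfolding hop2_mem
    by (smt (verit, ccfv_threshold))
  ultimately show ?thesis unfolding mirrored_def by blast
qed

lemma antisym_unhop2:
  assumes "mirrored M" "e \<in> M" "e - 1 ~: M"
  obtains A where "mirrored A" "addable A e" "hop2 e A = M" "\<And>x. x \<in> A \<longleftrightarrow> x = e - 1 \<or> x = - e - 1 \<or> x \<in> M & x ~= e & x ~= - e"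
proof -
  define A where "A = (M - {e, - e}) \<union> {e - 1, - e - 1}"
  have m: "- e - 1 ~: M" "- e \<in> M" using antisymD[OF assms(1), of "- e - 1"] antisymD[OF assms(1), of "e - 1"] assms by simp_all
  have mem: "x \<in> A \<longleftrightarrow> x = e - 1 \<or> x = - e - 1 \<or> x \<in> M & x ~= e & x ~= - e" for x unfolding A_def by auto
  have "bounded_config A" using assms(1) unfolding mirrored_def A_def by (intro bounded_hop) auto
  moreover have "x \<in> A \<longleftrightarrow> - 1 - x ~: A" for x
    using m antisymD[OF assms(1), of x] assms(2,3) unfolding mem by (smt (verit, ccfv_threshold))
  ultimately have "mirrored A" unfolding mirrored_def by blast
  moreover have "addable A e" unfolding addable_def mem by (simp, presburger)
  moreover have "hop2 e A = M" unfolding set_eq_iff hop2_mem mem using m assms(2,3) by auto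
  ultimately show thesis using that mem by blast
qed

lemma hop2_bump:
  assumes "mirrored M" "addable M d"
  defines "e \<equiv> bump (hop2 d M) d"
  shows "e - 1 \<in> hop2 d M" "e < d" "\<And>z. e <= z ==> z <= d - 1 ==> z ~: hop2 d M" "0 < d ==> 0 <= e"
    "addable (hop2 d M) e"
proof -
  have bB: "bounded_config (hop2 d M)" using antisym_hop2[OF assms(1,2)] unfolding mirrored_def by blast
  note b = bump_props[OF bB, of d, folded e_def]
  have d1: "d - 1 ~: hop2 d M" unfolding hop2_mem by presburger
  show "e - 1 \<in> hop2 d M" "e < d" using b by auto
  show rng: "z ~: hop2 d M" if "e <= z" "z <= d - 1" for z using b(3)[of z] that d1 by (cases "z = d - 1") auto
  show "0 <= e" if "0 < d"
  proof (rule ccontr)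
    assume "\<not> 0 <= e"
    then have "0 ~: hop2 d M" "- 1 ~: hop2 d M" using rng[of 0] rng[of "- 1"] that by auto
    then show False using antisymD[OF antisym_hop2[OF assms(1,2)], of 0] by simp
  qed
  show "addable (hop2 d M) e" unfolding addable_def using b rng[of e] by simp
qed

lemma hop2_commute:
  assumes "mirrored M" "addable M a" "addable M c" "\<bar>a\<bar> ~= \<bar>c\<bar>"
  shows "addable (hop2 c M) a" "hop2 a (hop2 c M) = hop2 c (hop2 a M)"
proof -
  note f = far_sites[OF assms(4) addable_far[OF assms]]
  note s = addable_sites[OF assms(1,2)] addable_sites[OF assms(1,3)]
  show "addable (hop2 c M) a" unfolding addable_def hop2_mem using f s by auto
  show "hop2 a (hop2 c M) = hop2 c (hop2 a M)" unfolding set_eq_iff hop2_mem using f by auto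
qed

text \<open>A second hop \<open>c\<close> matters for the bump of \<open>a\<close> only if it moves the very particle that is bumped.\<close>

lemma bump_undisturbed:
  assumes "mirrored M" "addable M a" "addable M c" "\<bar>a\<bar> ~= \<bar>c\<bar>"
    and "\<bar>bump (hop2 a M) a\<bar> ~= \<bar>c\<bar>"
  shows "bump (hop2 a (hop2 c M)) a = bump (hop2 a M) a"
proof -
  note f = far_sites[OF assms(4) addable_far[OF assms(1-4)]]
  note s = addable_sites[OF assms(1,2)] addable_sites[OF assms(1,3)]
  note b = hop2_bump[OF assms(1,2)]
  let ?e = "bump (hop2 a M) a"
  have cM: "c - 1 \<in> hop2 a M" "- c - 1 \<in> hop2 a M" using f s unfolding hop2_mem by auto
  show ?thesis unfolding hop2_commute(2)[OF assms(1-4)]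
  proof (rule bump_eqI)
    show "?e - 1 \<in> hop2 c (hop2 a M)" using b(1) assms(5) unfolding hop2_mem[of _ c] by auto
    show "?e < a" by (rule b(2))
    fix z assume z: "?e <= z" "z < a - 1"
    have "z ~= c" using b(3)[of "c - 1"] cM z assms(5) by (cases "?e = c") auto
    moreover have "z ~= - c" using b(3)[of "- c - 1"] cM z assms(5) by (cases "?e = - c") auto
    ultimately show "z ~: hop2 c (hop2 a M)" using b(3)[of z] z unfolding hop2_mem[of _ c] by auto
  qed
qed

lemma bump_disturbed:
  assumes "mirrored M" "addable M a" "addable M c" "\<bar>a\<bar> ~= \<bar>c\<bar>" "bump (hop2 a M) a = c"
  shows "bump (hop2 a (hop2 c M)) a = c + 1"
proof -
  note f = far_sites[OF assms(4) addable_far[OF assms(1-4)]]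
  note s = addable_sites[OF assms(1,2)] addable_sites[OF assms(1,3)]
  note b = hop2_bump[OF assms(1,2), unfolded assms(5)]
  have cM: "- c - 1 \<in> hop2 a M" using f s unfolding hop2_mem by auto
  show ?thesis unfolding hop2_commute(2)[OF assms(1-4)]
  proof (rule bump_eqI)
    show "c + 1 - 1 \<in> hop2 c (hop2 a M)" unfolding hop2_mem[of _ c] by auto
    show "c + 1 < a" using b(2) f(3) by linarith
    fix z assume z: "c + 1 <= z" "z < a - 1"
    have "z ~= - c" using b(3)[of "- c - 1"] cM z by auto
    then show "z ~: hop2 c (hop2 a M)" using b(3)[of z] z unfolding hop2_mem[of _ c] by auto
  qed
qed

lemma bump_mirrored:
  assumes "mirrored M" "addable M a" "addable M c" "\<bar>a\<bar> ~= \<bar>c\<bar>" "bump (hop2 a M) a = - c"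
  shows "bump (hop2 a (hop2 c M)) a = 1 - c" "bump (hop2 c (hop2 a M)) c = c - 1"
proof -
  note f = far_sites[OF assms(4) addable_far[OF assms(1-4)]]
  note s = addable_sites[OF assms(1,2)] addable_sites[OF assms(1,3)]
  note b = hop2_bump[OF assms(1,2), unfolded assms(5)]
  show "bump (hop2 a (hop2 c M)) a = 1 - c"
    using bump_disturbed[OF assms(1,2), of "- c"] assms addable_neg hop2_neg by simp
  have "1 - c ~: hop2 a M" using b(2) b(3)[of "1 - c"] f(4) by linarith
  then have "c - 2 \<in> hop2 a M" using antisymD[OF antisym_hop2[OF assms(1,2)], of "c - 2"] by simp
  moreover have "c - 2 ~= - c - 1" by presburger
  ultimately have "c - 1 - 1 \<in> hop2 c (hop2 a M)" unfolding hop2_mem[of _ c] by simp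
  then show "bump (hop2 c (hop2 a M)) c = c - 1" by (intro bump_eqI) auto
qed

interpretation shifted: insertion hop2 abs mirrored shifted_rel .

lemmas out_lab = shifted.out_def shifted.lab_def

text \<open>The last alternative is the only one in which the pair gets out of step: the pushed hop coincides with \<open>y\<close> and is diverted to \<open>x\<close>,
  which it meets in one of the two orders only.\<close>

lemma exchanged_push_swap:
  assumes M: "mirrored M" and p: "addable M p" "0 <= p"
    and xy: "addable M x" "addable M y" "\<bar>x\<bar> ~= \<bar>y\<bar>" "x < y"
  defines "x1 \<equiv> shifted.out M p x" and "y1 \<equiv> shifted.out (hop2 x M) (shifted.lab M p x) y"
    and "l1 \<equiv> shifted.lab (hop2 x M) (shifted.lab M p x) y"
    and "y2 \<equiv> shifted.out M p y" and "x2 \<equiv> shifted.out (hop2 y M) (shifted.lab M p y) x"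
    and "l2 \<equiv> shifted.lab (hop2 y M) (shifted.lab M p y) x"
  shows "exchanged x1 y1 y2 x2 & l1 = l2 \<or>
    p = \<bar>y\<bar> & bump (hop2 y M) y = x & x1 = x & y1 = x + 1 & l1 = \<bar>x + 1\<bar> &
    y2 = x & x2 = bump (hop2 x (hop2 y M)) x & l2 = \<bar>x2\<bar>"
proof -
  note c = hop2_commute(2)[OF M xy(1-3)]
  consider "p ~= \<bar>x\<bar>" "p ~= \<bar>y\<bar>" | "p = \<bar>x\<bar>" | "p = \<bar>y\<bar>" by blast
  then show ?thesis
  proof cases
    case 1
    then show ?thesis unfolding assms(8-13) out_lab by (simp add: exchanged_def)
  next
    case 2
    let ?e = "bump (hop2 x M) x"
    consider "\<bar>?e\<bar> ~= \<bar>y\<bar>" | "?e = y" | "?e = - y" by linarith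
    then show ?thesis
    proof cases
      case 1
      then show ?thesis using 2 xy bump_undisturbed[OF M xy(1-3)] unfolding assms(8-13) out_lab by (simp add: exchanged_def)
    next
      case 2
      then show ?thesis using hop2_bump(2)[OF M xy(1)] xy(4) by simp
    next
      case 3
      have "?e < x" by (rule hop2_bump(2)[OF M xy(1)])
      moreover have "\<bar>\<bar>x\<bar> - \<bar>y\<bar>\<bar> ~= 1" by (rule addable_far[OF M xy(1-3)])
      ultimately have "1 < y" using 3 xy(3,4) by linarith
      then show ?thesis using 2 3 xy bump_mirrored[OF M xy(1-3) 3] unfolding assms(8-13) out_lab by (simp add: exchanged_def)
    qed
  next
    case py: 3
    let ?e = "bump (hop2 y M) y"
    have n: "\<bar>y\<bar> ~= \<bar>x\<bar>" using xy(3) by simp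
    consider "\<bar>?e\<bar> ~= \<bar>x\<bar>" | "?e = x" | "?e = - x" "x ~= 0" by linarith
    then show ?thesis
    proof cases
      case 1
      then show ?thesis using py 1 xy bump_undisturbed[OF M xy(2,1) n] unfolding assms(8-13) out_lab by (simp add: exchanged_def)
    next
      case 2
      then show ?thesis using py 2 xy bump_disturbed[OF M xy(2,1) n] unfolding assms(8-13) out_lab by simp
    next
      case 3
      have "0 < y ==> 0 <= ?e" by (rule hop2_bump(4)[OF M xy(2)])
      then have "x < 0" using 3 xy(4) by linarith
      then show ?thesis using py 3 xy bump_mirrored[OF M xy(2,1) n] unfolding assms(8-13) out_lab by (simp add: exchanged_def)
    qed
  qed
qed

lemma exchanged_push_negate:
  assumes M: "mirrored M" and p: "addable M p" "0 <= p"
    and xy: "addable M x" "addable (hop2 x M) y" "x < 0" "0 < y" "\<bar>\<bar>x\<bar> - \<bar>y\<bar>\<bar> = 1"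
  shows "exchanged (shifted.out M p x) (shifted.out (hop2 x M) (shifted.lab M p x) y)
      (shifted.out M p (- x)) (shifted.out (hop2 x M) (shifted.lab M p (- x)) (- y)) &
    shifted.lab (hop2 x M) (shifted.lab M p x) y = shifted.lab (hop2 x M) (shifted.lab M p (- x)) (- y)"
proof (cases "p = - x")
  case False
  have "p ~= y" using addable_far[OF M p(1) xy(1)] False xy(3-5) p(2) by auto
  then show ?thesis using False xy unfolding out_lab by (simp add: exchanged_def)
next
  case True
  define t where "t = - x"
  have t: "x = - t" "0 < t" "p = t" using xy True unfolding t_def by auto
  have tM: "addable M t" using p t by simp
  let ?B = "hop2 t M"
  have hx: "hop2 x M = ?B" unfolding t(1) hop2_neg by simp
  have sB: "mirrored ?B" by (rule antisym_hop2[OF M tM])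
  note bt = hop2_bump[OF M tM] and bx = hop2_bump[OF M xy(1), unfolded hx]
  have yB: "addable ?B y" using xy(2) hx by simp
  note ys = addable_sites[OF sB yB]
  note by1 = hop2_bump[OF sB yB] and by2 = hop2_bump[OF sB, of "- y", unfolded addable_neg[OF sB] hop2_neg, OF yB]
  consider "y = t + 1" | "y = t - 1" using xy t by linarith
  then show ?thesis
  proof cases
    case 1
    have x1: "bump ?B x = - (t + 1)"
    proof (rule bump_eqI)
      show "- (t + 1) - 1 \<in> ?B" using ys(3) 1 by simp
      fix z assume "- (t + 1) <= z" "z < x - 1"
      then show "z ~: ?B" using t by simp
    qed (use t in simp)
    let ?f = "bump ?B t"
    have f: "0 <= ?f" "?f < t" using bt t(2) by auto
    have y1: "bump (hop2 y ?B) y = ?f"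
    proof (rule bump_eqI)
      show "?f - 1 \<in> hop2 y ?B" using bt(1) f 1 unfolding hop2_mem[of _ y] by auto
      show "?f < y" using f 1 by simp
      fix z assume z: "?f <= z" "z < y - 1"
      then have "z ~: ?B" using bt(3)[of z] 1 by simp
      then show "z ~: hop2 y ?B" using z f 1 unfolding hop2_mem[of _ y] by simp
    qed
    have "shifted.out M p x = - y" "shifted.lab M p x = y"
      using x1 hx t 1 by (simp_all add: out_lab)
    moreover have "shifted.out ?B y y = ?f" "shifted.lab ?B y y = ?f"
      using y1 f 1 t by (simp_all add: out_lab)
    moreover have "shifted.out M p (- x) = ?f" "shifted.lab M p (- x) = ?f"
      using f t by (simp_all add: out_lab)
    moreover have "shifted.out ?B ?f (- y) = - y" "shifted.lab ?B ?f (- y) = ?f"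
      using f 1 t by (simp_all add: out_lab)
    ultimately show ?thesis unfolding hx by (simp add: exchanged_def)
  next
    case 2
    let ?e = "bump ?B x"
    have e: "?e < - t" using bx(2) t by simp
    have t2: "bump ?B t = t - 1"
    proof (rule bump_eqI)
      show "t - 1 - 1 \<in> ?B" using ys(1) 2 by simp
    qed (use t in auto)
    have y2: "bump (hop2 y ?B) (- y) = ?e"
    proof (rule bump_eqI)
      show "?e - 1 \<in> hop2 y ?B" using bx(1) e 2 xy unfolding hop2_mem[of _ y] by auto
      show "?e < - y" using e 2 by simp
      fix z assume z: "?e <= z" "z < - y - 1"
      have "z ~: ?B" using bx(3)[of z] z 2 t by simp
      then show "z ~: hop2 y ?B" using z e 2 xy unfolding hop2_mem[of _ y] by simp
    qed
    have "shifted.out M p x = ?e" "shifted.lab M p x = - ?e"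
      using hx t e by (simp_all add: out_lab)
    moreover have "shifted.out ?B (- ?e) y = y" "shifted.lab ?B (- ?e) y = - ?e"
      using e 2 t by (simp_all add: out_lab)
    moreover have "shifted.out M p (- x) = y" "shifted.lab M p (- x) = y"
      using t2 t 2 xy by (simp_all add: out_lab)
    moreover have "shifted.out ?B y (- y) = ?e" "shifted.lab ?B y (- y) = - ?e"
      using y2 e t xy by (simp_all add: out_lab hop2_neg)
    ultimately show ?thesis unfolding hx by (simp add: exchanged_def)
  qed
qed

lemma hop2_inj:
  assumes "mirrored A" "mirrored A'" "addable A d" "addable A' d'" "hop2 d A = hop2 d' A'" "\<bar>d\<bar> = \<bar>d'\<bar>"
  shows "A = A'"
proof -
  have eq: "hop2 d A = hop2 d A'" using assms(5,6) hop2_abs by metis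
  have ad: "addable A' d" using assms(2,4,6) addable_abs by metis
  have mem: "x \<in> A \<longleftrightarrow> x = d - 1 \<or> x = - d - 1 \<or> (x \<in> hop2 d A & x ~= d & x ~= - d)"
    if "mirrored A" "addable A d" for x A
    using addable_sites[OF that] unfolding hop2_mem by auto
  show ?thesis unfolding set_eq_iff mem[OF assms(1,3)] mem[OF assms(2) ad] eq by blast
qed

lemma hop2_unsquare:
  assumes "mirrored A" "mirrored A'" "addable A d" "addable A' p" "hop2 d A = hop2 p A'" "\<bar>d\<bar> ~= \<bar>p\<bar>"
  shows "\<exists>B. mirrored B & addable B p & addable B d & hop2 p B = A & hop2 d B = A'"
proof -
  define C where "C = hop2 d A"
  have C: "d \<in> C" "- d \<in> C" "d - 1 ~: C" "- d - 1 ~: C" unfolding C_def hop2_mem by presburger+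
  have C': "p \<in> C" "- p \<in> C" "p - 1 ~: C" "- p - 1 ~: C" unfolding C_def assms(5) hop2_mem by presburger+
  have "d \<in> A'" "d - 1 ~: A'" using C(1,3) assms(6) unfolding C_def assms(5) hop2_mem by auto
  then obtain B where B: "mirrored B" "addable B d" "hop2 d B = A'"
    "\<And>x. x \<in> B \<longleftrightarrow> x = d - 1 \<or> x = - d - 1 \<or> x \<in> A' & x ~= d & x ~= - d"
    using antisym_unhop2[OF assms(2)] by metis
  have "p - 1 ~= d" "p - 1 ~= - d" "p ~= d - 1" "p ~= - d - 1" using C C' by metis+
  then have Bp: "addable B p" using assms(4) unfolding addable_def B(4) by auto
  have "hop2 d (hop2 p B) = hop2 d A"
    using hop2_commute(2)[OF B(1) B(2) Bp assms(6)] B(3) assms(5) by simp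
  then have "hop2 p B = A"
    using hop2_inj[OF antisym_hop2[OF B(1) Bp] assms(1) hop2_commute(1)[OF B(1) B(2) Bp assms(6)] assms(3)] by simp
  then show ?thesis using B Bp by blast
qed

lemma least_above:
  fixes B :: "int set"
  assumes "x \<in> B" "e <= x"
  obtains m where "m \<in> B" "e <= m" "\<And>z. e <= z ==> z < m ==> z ~: B"
proof -
  let ?F = "{z \<in> B. e <= z & z <= x}"
  have fin: "finite ?F" by (rule finite_subset[of _ "{e..x}"]) auto
  have ne: "?F ~= {}" using assms by auto
  have m: "Min ?F \<in> ?F" using Min_in[OF fin ne] .
  show thesis
  proof (rule that[of "Min ?F"])
    fix z assume z: "e <= z" "z < Min ?F"
    show "z ~: B"
    proof
      assume "z \<in> B"
      then have "z \<in> ?F" using z m by auto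
      then have "Min ?F <= z" by (rule Min_le[OF fin])
      then show False using z by linarith
    qed
  qed (use m in auto)
qed

lemma bump_source:
  assumes "bounded_config B" "addable B e" "e ~= front B"
  obtains d where "d \<in> B" "d - 1 ~: B" "bump B d = e"
proof -
  note f = front_props[OF assms(1)]
  have e: "e - 1 \<in> B" "e ~: B" using assms(2) unfolding addable_def by auto
  have "e <= front B - 1" using f(2)[of "e - 1"] e(1) assms(3) by linarith
  then obtain d where d: "d \<in> B" "e <= d" "\<And>z. e <= z ==> z < d ==> z ~: B" using least_above[OF f(1)] by blast
  have "e < d" using d(1,2) e(2) by (cases "e = d") auto
  have "bump B d = e" by (rule bump_eqI) (use e d \<open>e < d\<close> in auto)
  moreover have "d - 1 ~: B" using d(3)[of "d - 1"] \<open>e < d\<close> by simp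
  ultimately show thesis using that d(1) by blast
qed

lemma hop2_unbump:
  assumes "mirrored B" "addable B e"
  shows "e = front B \<or> (\<exists>A d. mirrored A & addable A d & hop2 d A = B & bump B d = e)"
proof (cases "e = front B")
  case False
  have "bounded_config B" using assms(1) unfolding mirrored_def by blast
  then obtain d where d: "d \<in> B" "d - 1 ~: B" "bump B d = e" using bump_source assms(2) False by blast
  then show ?thesis using antisym_unhop2[OF assms(1) d(1,2)] by metis
qed simp

lemma shifted_lab:
  assumes M: "mirrored M" and p: "addable M p" "0 <= p" and x: "addable M x"
  shows "addable (hop2 x M) (shifted.lab M p x)" "0 <= shifted.lab M p x"
proof -
  note b = hop2_bump[OF M x]
  show "addable (hop2 x M) (shifted.lab M p x)"
  proof (cases "\<bar>x\<bar> = p")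
    case True
    then show ?thesis using b(5) addable_abs[OF antisym_hop2[OF M x]] unfolding out_lab by simp
  next
    case False
    then show ?thesis using hop2_commute(1)[OF M p(1) x] p(2) unfolding out_lab by auto
  qed
  show "0 <= shifted.lab M p x" using p(2) unfolding out_lab by simp
qed

lemma shifted_asc:
  assumes M: "mirrored M" and p: "addable M p" "0 <= p"
    and xy: "addable M x" "addable (hop2 x M) y"
  shows "x < y ==> shifted.out M p x < shifted.out (hop2 x M) (shifted.lab M p x) y"
    and "y < x ==> shifted.out (hop2 x M) (shifted.lab M p x) y < shifted.out M p x"
proof -
  define N where "N = hop2 x M"
  have sN: "mirrored N" unfolding N_def by (rule antisym_hop2[OF M xy(1)])
  have yN: "addable N y" using xy(2) N_def by simp
  have xN: "x \<in> N" unfolding N_def hop2_mem by simp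
  note bx = hop2_bump[OF M xy(1), folded N_def] and by' = hop2_bump[OF sN yN]
  let ?e = "bump N x" and ?f = "bump (hop2 y N) y"
  have y1: "y - 1 \<in> N" using addable_sites[OF sN yN] by simp
  have le: "y <= ?e" if "y < x" using bx(3)[of "y - 1"] y1 that by linarith
  have goal: "(x < y --> shifted.out M p x < shifted.out N (shifted.lab M p x) y) &
    (y < x --> shifted.out N (shifted.lab M p x) y < shifted.out M p x)"
  proof (cases "\<bar>x\<bar> = p")
    case True
    then have o: "shifted.out M p x = ?e" "shifted.lab M p x = \<bar>?e\<bar>" unfolding out_lab N_def by auto
    show ?thesis
    proof (cases "\<bar>y\<bar> = \<bar>?e\<bar>")
      case h: True
      then have o2: "shifted.out N \<bar>?e\<bar> y = ?f" unfolding out_lab by simp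
      have "?e < ?f" if "x < y"
      proof -
        have "?e = - y" using h bx(2) that by linarith
        then have "?e \<in> hop2 y N" unfolding hop2_mem by simp
        then show ?thesis using by'(3)[of ?e] bx(2) that by linarith
      qed
      moreover have "?f < ?e" if "y < x" using by'(2) le[OF that] by linarith
      ultimately show ?thesis unfolding o o2 by blast
    next
      case False
      then have "shifted.out N \<bar>?e\<bar> y = y" unfolding out_lab by simp
      then show ?thesis using o bx(2) le False by force
    qed
  next
    case False
    then have o: "shifted.out M p x = x" "shifted.lab M p x = p" unfolding out_lab by auto
    show ?thesis
    proof (cases "\<bar>y\<bar> = p")
      case h: True
      then have o2: "shifted.out N p y = ?f" unfolding out_lab by simp
      have n: "\<bar>x\<bar> ~= \<bar>p\<bar>" using False p(2) by simp
      have "\<bar>\<bar>x\<bar> - \<bar>y\<bar>\<bar> ~= 1" using addable_far[OF M xy(1) p(1) n] h by simp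
      then have "x ~= y - 1" "x ~= - y - 1" by linarith+
      then have "x \<in> hop2 y N" using xN unfolding hop2_mem by blast
      then have "x < ?f" if "x < y" using by'(3)[of x] that by linarith
      then show ?thesis using by'(2) o o2 by auto
    next
      case h: False
      then show ?thesis unfolding o unfolding out_lab by simp
    qed
  qed
  show "x < y ==> shifted.out M p x < shifted.out (hop2 x M) (shifted.lab M p x) y"
    "y < x ==> shifted.out (hop2 x M) (shifted.lab M p x) y < shifted.out M p x"
    using goal unfolding N_def by auto
qed

lemma antisym_front:
  assumes "mirrored M"
  shows "front M - 1 \<in> M" "\<And>z. front M <= z ==> z ~: M" "0 <= front M" "\<And>y. addable M y ==> \<bar>y\<bar> <= front M"
proof -
  have b: "bounded_config M" using assms unfolding mirrored_def by blast
  note f = front_props[OF b]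
  show "front M - 1 \<in> M" and g: "\<And>z. front M <= z ==> z ~: M" using f by auto
  show "0 <= front M"
  proof (rule ccontr)
    assume "\<not> 0 <= front M"
    then have "- 1 ~: M" "0 ~: M" using g[of "- 1"] g[of 0] by auto
    then show False using antisymD[OF assms, of 0] by simp
  qed
  fix y assume y: "addable M y"
  show "\<bar>y\<bar> <= front M"
    using addable_sites[OF assms y] g[of "y - 1"] g[of "- y - 1"] by linarith
qed

text \<open>The largest of three letters moves from the middle to the right end. It meets the hop \<open>y\<close> only if this involves the rightmost
  particle; then the marks of a pair on neighbouring diagonals are toggled.\<close>

lemma shifted_rel_bac:
  assumes M: "mirrored M" and xy: "addable M x" "addable (hop2 x M) y" "y < x"
  shows "shifted_rel (x, front (hop2 x M), shifted.out (hop2 x M) \<bar>front (hop2 x M)\<bar> y) (x, y, front (hop2 y (hop2 x M))) &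
    shifted.lab (hop2 x M) \<bar>front (hop2 x M)\<bar> y = \<bar>front (hop2 y (hop2 x M))\<bar>"
proof -
  define N where "N = hop2 x M"
  define K where "K = hop2 y N"
  have sN: "mirrored N" unfolding N_def by (rule antisym_hop2[OF M xy(1)])
  have yN: "addable N y" using xy(2) N_def by simp
  have sK: "mirrored K" unfolding K_def by (rule antisym_hop2[OF sN yN])
  note f = antisym_front[OF sN]
  let ?t = "front N"
  have xt: "x < ?t" using f(2)[of x] unfolding N_def hop2_mem by force
  have yt: "\<bar>y\<bar> <= ?t" by (rule f(4)[OF yN])
  show ?thesis
  proof (cases "\<bar>y\<bar> = ?t")
    case False
    have "front K = ?t"
    proof (rule front_eqI)
      show "?t - 1 \<in> K" using f(1,3) False unfolding K_def hop2_mem by auto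
      show "z ~: K" if "?t <= z" for z using f(2)[OF that] that False yt unfolding K_def hop2_mem by linarith
    qed
    then show ?thesis using False xt xy(3) f(3) unfolding N_def[symmetric] K_def[symmetric]
      by (auto simp: out_lab shifted_rel_def exchanged_def)
  next
    case True
    then have y: "y = - ?t" "0 < ?t" using xt xy(3) by linarith+
    have tK: "z ~: K" if "?t + 1 <= z" for z using f(2)[of z] that y unfolding K_def hop2_mem by linarith
    have "y - 2 \<in> K" using antisymD[OF sK, of "y - 2"] tK[of "?t + 1"] y by (simp add: algebra_simps)
    then have b: "bump K y = y - 1" by (intro bump_eqI) auto
    have "front K = ?t + 1"
    proof (rule front_eqI)
      show "?t + 1 - 1 \<in> K" using y unfolding K_def hop2_mem by simp
    qed (rule tK)
    moreover have "shifted.out N ?t y = y - 1" "shifted.lab N ?t y = ?t + 1"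
      using b y unfolding out_lab K_def[symmetric] by simp_all
    moreover have "exchanged ?t (y - 1) y (?t + 1)" using y unfolding exchanged_def by simp
    ultimately show ?thesis using y xt xy(3) f(3) unfolding N_def[symmetric] K_def[symmetric]
      by (simp add: shifted_rel_def)
  qed
qed

lemma shifted_rel_acb:
  assumes M: "mirrored M" and xy: "addable M x" "addable (hop2 x M) y" "x < y"
  defines "N \<equiv> hop2 x M"
  shows "shifted_rel (x, front N, shifted.out N \<bar>front N\<bar> y)
      (front M, shifted.out M \<bar>front M\<bar> x, shifted.out N (shifted.lab M \<bar>front M\<bar> x) y) &
    shifted.lab N \<bar>front N\<bar> y = shifted.lab N (shifted.lab M \<bar>front M\<bar> x) y"
proof -
  have sN: "mirrored N" unfolding N_def by (rule antisym_hop2[OF M xy(1)])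
  have yN: "addable N y" using xy(2) N_def by simp
  have xN: "x \<in> N" unfolding N_def hop2_mem by simp
  define K where "K = hop2 y N"
  note f = antisym_front[OF M] and g = antisym_front[OF sN]
  let ?t = "front M" and ?s = "front N"
  have at: "addable M ?t" "addable N ?s" using f(1) f(2)[of ?t] g(1) g(2)[of ?s] unfolding addable_def by auto
  have xt: "\<bar>x\<bar> <= ?t" by (rule f(4)[OF xy(1)])
  have xs: "x < ?s" using g(2)[of x] xN by force
  have yt: "\<bar>y\<bar> <= ?s" by (rule g(4)[OF yN])
  have bx: "bump N x < x" "0 < x ==> 0 <= bump N x" using hop2_bump[OF M xy(1)] unfolding N_def by auto
  have byy: "bump K y < y" using hop2_bump[OF sN yN] unfolding K_def by auto
  have o1: "shifted.out N ?s y < ?s"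
    using byy yt unfolding out_lab K_def[symmetric] by (cases "\<bar>y\<bar> = ?s") auto
  have o2: "shifted.out M ?t x < ?t"
    using bx(1) xt unfolding out_lab N_def[symmetric] by (cases "\<bar>x\<bar> = ?t") auto
  have o3: "shifted.out M ?t x < shifted.out N (shifted.lab M ?t x) y"
    using shifted_asc(1)[OF M at(1) f(3) xy] unfolding N_def by simp
  have as: "\<bar>?s\<bar> = ?s" "\<bar>?t\<bar> = ?t" using f(3) g(3) by auto
  have tN: "z ~: N" if "?t + 1 <= z" for z using f(2)[of z] that xt unfolding N_def hop2_mem by linarith
  consider "\<bar>x\<bar> ~= ?t" | "x = - ?t" "?t ~= 0" | "x = ?t" using xt by linarith
  then show ?thesis
  proof cases
    case 1
    have "?s = ?t"
    proof (rule front_eqI)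
      show "?t - 1 \<in> N" using f(1,3) 1 unfolding N_def hop2_mem by auto
      show "z ~: N" if "?t <= z" for z using f(2)[OF that] that 1 xt unfolding N_def hop2_mem by linarith
    qed
    moreover have "shifted.out M ?t x = x" "shifted.lab M ?t x = ?t" using 1 unfolding out_lab by auto
    ultimately show ?thesis using o1 o2 o3 xs xy(3) as by (auto simp: shifted_rel_def exchanged_def)
  next
    case 2
    have t: "0 < ?t" using f(3) 2(2) by simp
    have s: "?s = ?t + 1"
    proof (rule front_eqI)
      show "?t + 1 - 1 \<in> N" using 2 unfolding N_def hop2_mem by simp
    qed (rule tN)
    have "- ?t - 2 \<in> N" using antisymD[OF sN, of "- ?t - 2"] tN[of "?t + 1"] by (simp add: algebra_simps)
    then have "bump N x = - ?t - 1" using 2 by (intro bump_eqI) (auto simp: algebra_simps)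
    then have o: "shifted.out M ?t x = - ?s" "shifted.lab M ?t x = ?s" using 2 s t unfolding out_lab N_def[symmetric] by auto
    have "exchanged x ?s ?t (- ?s)" using 2 s t unfolding exchanged_def by auto
    then show ?thesis using o o1 o2 o3 xs as unfolding as shifted_rel_def by auto
  next
    case 3
    have s: "?s = ?t + 1"
    proof (rule front_eqI)
      show "?t + 1 - 1 \<in> N" using 3 xN by simp
    qed (rule tN)
    have y: "y = ?s" using 3 s yt xy(3) by linarith
    have o: "shifted.out N ?s y = bump K y" "shifted.lab N ?s y = \<bar>bump K y\<bar>" "shifted.out M ?t x = bump N x"
      "shifted.lab M ?t x = \<bar>bump N x\<bar>"
      using y 3 as unfolding out_lab K_def[symmetric] N_def[symmetric] by auto
    show ?thesis
    proof (cases "?t = 0")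
      case True
      have "- 2 \<in> N" using antisymD[OF sN, of "- 2"] tN[of 1] True by simp
      then have b1: "bump N x = - 1" using 3 True by (intro bump_eqI) auto
      have b2: "bump K y = 0" using y s True by (intro bump_eqI) (auto simp: K_def hop2_mem)
      have "shifted.out N 1 y = 0" "shifted.lab N 1 y = 0" using b2 y s True unfolding out_lab K_def by auto
      then show ?thesis using o b1 b2 y s True 3 unfolding as by (simp add: shifted_rel_def)
    next
      case False
      then have t: "0 < ?t" using f(3) by simp
      have e: "0 <= bump N x" "bump N x < ?t" using bx 3 t by auto
      have b: "bump K y = bump N x"
      proof (rule bump_eqI)
        have "bump N x - 1 \<in> N" using hop2_bump(1)[OF M xy(1)] unfolding N_def .
        then show "bump N x - 1 \<in> K" using e y s unfolding K_def hop2_mem by auto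
        show "bump N x < y" using e y s by simp
        fix z assume z: "bump N x <= z" "z < y - 1"
        then have "z ~: N" using hop2_bump(3)[OF M xy(1), of z] 3 y s unfolding N_def by simp
        then show "z ~: K" using z y s e unfolding K_def hop2_mem by auto
      qed
      have "shifted.out N (bump N x) y = y" "shifted.lab N (bump N x) y = bump N x" using e y s unfolding out_lab by auto
      then show ?thesis using o b e y s 3 bx(1) unfolding as by (auto simp: shifted_rel_def exchanged_def)
    qed
  qed
qed

lemma exchanged_sym: "exchanged x y x' y' ==> exchanged x' y' x y"
  unfolding exchanged_def by auto

lemma exchanged_far:
  assumes "mirrored M" "addable M x" "addable (hop2 x M) y" "addable M y"
  shows "\<bar>x\<bar> ~= \<bar>y\<bar>"
proof
  assume "\<bar>x\<bar> = \<bar>y\<bar>"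
  then have "y \<in> hop2 x M" unfolding hop2_mem by linarith
  then show False using assms(3) unfolding addable_def by blast
qed

lemma exchanged_shape:
  assumes "mirrored M" "addable M x" "addable (hop2 x M) y" "addable M x'" "addable (hop2 x' M) y'" "exchanged x y x' y'"
  shows "hop2 y (hop2 x M) = hop2 y' (hop2 x' M)"
  using assms(6) unfolding exchanged_def
proof
  assume e: "x' = y & y' = x"
  then show ?thesis using hop2_commute(2)[OF assms(1,2)] assms exchanged_far[OF assms(1-3)] by auto
next
  assume "x' = - x & y' = - y & \<bar>\<bar>x\<bar> - \<bar>y\<bar>\<bar> = 1 & (x < 0 & 0 < y \<or> y < 0 & 0 < x)"
  then show ?thesis by (simp add: hop2_neg)
qed

text \<open>The first or the last two contents are exchanged, and the local rule transports this by
  \<open>exchanged_push_swap\<close> and \<open>exchanged_push_negate\<close>. In the exceptional alternative of the former the third content is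
  forced, and the relation passes from one pair to the other.\<close>

lemma shifted_rel_push:
  assumes M: "mirrored M" and p: "addable M p" "0 <= p"
    and v: "shifted.valid M [x, y, z]" "shifted.valid M [x', y', z']"
    and r: "shifted_rel (x, y, z) (x', y', z')"
  shows "\<exists>w w' q. shifted.push M p [x, y, z] = (list3 w, q) & shifted.push M p [x', y', z'] = (list3 w', q) & shifted_rel w w'"
proof -
  define N where "N = hop2 x M"
  define K where "K = hop2 y N"
  define N' where "N' = hop2 x' M"
  define K' where "K' = hop2 y' N'"
  define x1 where "x1 = shifted.out M p x"
  define p1 where "p1 = shifted.lab M p x"
  define y1 where "y1 = shifted.out N p1 y"
  define p2 where "p2 = shifted.lab N p1 y"
  define z1 where "z1 = shifted.out K p2 z"
  define p3 where "p3 = shifted.lab K p2 z"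
  define x2 where "x2 = shifted.out M p x'"
  define q1 where "q1 = shifted.lab M p x'"
  define y2 where "y2 = shifted.out N' q1 y'"
  define q2 where "q2 = shifted.lab N' q1 y'"
  define z2 where "z2 = shifted.out K' q2 z'"
  define q3 where "q3 = shifted.lab K' q2 z'"
  note defs = x1_def p1_def y1_def p2_def z1_def p3_def x2_def q1_def y2_def q2_def z2_def q3_def
  have push: "shifted.push M p [x, y, z] = (list3 (x1, y1, z1), p3)"
    "shifted.push M p [x', y', z'] = (list3 (x2, y2, z2), q3)"
    unfolding defs N_def K_def N'_def K'_def list3_def by simp_all
  have a: "addable M x" "addable N y" "addable K z" "addable M x'" "addable N' y'" "addable K' z'"
    using v unfolding N_def K_def N'_def K'_def by auto
  have sN: "mirrored N" "mirrored N'" unfolding N_def N'_def using antisym_hop2 M a by auto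
  have sK: "mirrored K" "mirrored K'" unfolding K_def K'_def using antisym_hop2 sN a by auto
  have l1: "addable N p1" "0 <= p1" "addable N' q1" "0 <= q1"
    using shifted_lab[OF M p] a unfolding p1_def q1_def N_def N'_def by auto
  have l2: "addable K p2" "0 <= p2" "addable K' q2" "0 <= q2"
    using shifted_lab[OF sN(1) l1(1,2) a(2)] shifted_lab[OF sN(2) l1(3,4) a(5)] unfolding p2_def q2_def K_def K'_def by auto
  have s1: "x < y ==> x1 < y1" "y < x ==> y1 < x1"
    using shifted_asc[OF M p a(1), of y] a(2) unfolding x1_def y1_def p1_def N_def by auto
  have s2: "y < z ==> y1 < z1" "z < y ==> z1 < y1"
    using shifted_asc[OF sN(1) l1(1,2) a(2), of z] a(3) unfolding z1_def y1_def p2_def K_def by auto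
  have s3: "x' < y' ==> x2 < y2" "y' < x' ==> y2 < x2"
    using shifted_asc[OF M p a(4), of y'] a(5) unfolding x2_def y2_def q1_def N'_def by auto
  have s4: "y' < z' ==> y2 < z2" "z' < y' ==> z2 < y2"
    using shifted_asc[OF sN(2) l1(3,4) a(5), of z'] a(6) unfolding z2_def y2_def q2_def K'_def by auto
  have bx: "bump N x < x" using hop2_bump[OF M a(1)] unfolding N_def by simp
  have "shifted_rel (x1, y1, z1) (x2, y2, z2) & p3 = q3"
  proof (cases "(x, y, z) = (0, 1, 0) & (x', y', z') = (0, - 1, 0)")
    case True
    then have xyz: "x = 0" "y = 1" "z = 0" "x' = 0" "y' = - 1" "z' = 0" by auto
    have N': "N' = N" unfolding N_def N'_def xyz by simp
    have K': "K' = K" unfolding K_def K'_def N' xyz hop2_neg by simp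
    show ?thesis
    proof (cases "p = 0")
      case False
      then have n: "\<bar>p\<bar> ~= \<bar>x\<bar>" using xyz by simp
      have "\<bar>\<bar>p\<bar> - \<bar>x\<bar>\<bar> ~= 1" by (rule addable_far[OF M p(1) a(1) n])
      then have "p ~= 1" using xyz by simp
      then show ?thesis using False unfolding defs N' K' xyz out_lab by (simp add: shifted_rel_def)
    next
      case True
      have m2: "- 2 \<in> N" using addable_sites(3)[OF sN(1) a(2)] xyz by simp
      have b1: "bump N 0 = - 1" using m2 by (intro bump_eqI) auto
      have b2: "bump K 1 = 0" by (intro bump_eqI) (auto simp: K_def hop2_mem xyz)
      let ?t = "bump K (- 1)"
      note bt = hop2_bump[OF sN(1), of "- 1", unfolded hop2_neg addable_neg[OF sN(1)]]
      have aN: "addable N 1" using a(2) xyz by simp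
      have K1: "hop2 1 N = K" unfolding K_def xyz by simp
      note bt = bt[OF aN, unfolded K1]
      have b3: "bump (hop2 0 K) 0 = ?t"
      proof (rule bump_eqI)
        show "?t - 1 \<in> hop2 0 K" using bt(1,2) unfolding hop2_mem by auto
        show "?t < 0" using bt(2) by simp
        show "w ~: hop2 0 K" if "?t <= w" "w < 0 - 1" for w using bt(3)[of w] that unfolding hop2_mem by auto
      qed
      have N0: "hop2 0 M = N" unfolding N_def xyz by simp
      have "x1 = - 1" "p1 = 1" "x2 = - 1" "q1 = 1" unfolding defs xyz out_lab N0 using True b1 by auto
      moreover from this have "y1 = 0" "p2 = 0" "y2 = ?t" "q2 = \<bar>?t\<bar>"
        unfolding y1_def p2_def y2_def q2_def xyz out_lab N' K1 hop2_neg using b2 by auto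
      moreover from this have "z1 = ?t" "p3 = \<bar>?t\<bar>" "z2 = 0" "q3 = \<bar>?t\<bar>"
        unfolding z1_def p3_def z2_def q3_def xyz out_lab K' using b3 bt(2) by auto
      ultimately show ?thesis using bt(2) by (simp add: shifted_rel_def exchanged_def)
    qed
  next
    case False
    then have o: "x < y" "z < y" "y' < x'" "y' < z'" and
      e: "z' = z & exchanged x y x' y' \<or> x' = x & exchanged y z y' z'"
      using r unfolding shifted_rel_def by auto
    have o1: "x1 < y1" "z1 < y1" "y2 < x2" "y2 < z2" using s1 s2 s3 s4 o by auto
    from e show ?thesis
    proof
      assume e: "z' = z & exchanged x y x' y'"
      have K': "K' = K"
        using exchanged_shape[OF M a(1) _ a(4), of y y'] a(2,5) e unfolding K_def K'_def N_def N'_def by simp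
      have fin: ?thesis if "exchanged x1 y1 x2 y2" "p2 = q2"
        using that o1 e K' unfolding z1_def z2_def p3_def q3_def by (simp add: shifted_rel_def)
      from e[THEN conjunct2] show ?thesis unfolding exchanged_def
      proof
        assume h: "x' = - x & y' = - y & \<bar>\<bar>x\<bar> - \<bar>y\<bar>\<bar> = 1 & (x < 0 & 0 < y \<or> y < 0 & 0 < x)"
        have NN: "N' = N" unfolding N_def N'_def using h hop2_neg by simp
        have "x < 0" "0 < y" using h o(1) by auto
        then show ?thesis
          using fin exchanged_push_negate[OF M p a(1), of y] a(2) h
          unfolding x1_def y1_def x2_def y2_def p1_def q1_def p2_def q2_def NN unfolding N_def by simp
      next
        assume h: "x' = y & y' = x"
        have ay: "addable M y" using a(4) h by simp
        have n: "\<bar>x\<bar> ~= \<bar>y\<bar>" using exchanged_far[OF M a(1) _ ay] a(2) unfolding N_def by simp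
        have NN: "N' = hop2 y M" unfolding N'_def using h by simp
        have KK: "K = hop2 x (hop2 y M)" using K' h unfolding K'_def NN by simp
        have "exchanged x1 y1 x2 y2 & p2 = q2 \<or>
          p = \<bar>y\<bar> & bump (hop2 y M) y = x & x1 = x & y1 = x + 1 & p2 = \<bar>x + 1\<bar> &
          x2 = x & y2 = bump (hop2 x (hop2 y M)) x & q2 = \<bar>y2\<bar>"
          using exchanged_push_swap[OF M p a(1) ay n o(1)] h
          unfolding x1_def y1_def x2_def y2_def p1_def q1_def p2_def q2_def NN unfolding N_def by simp
        then show ?thesis
        proof
          assume "exchanged x1 y1 x2 y2 & p2 = q2"
          then show ?thesis using fin by blast
        next
          define b where "b = bump K x"
          assume "p = \<bar>y\<bar> & bump (hop2 y M) y = x & x1 = x & y1 = x + 1 & p2 = \<bar>x + 1\<bar> &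
            x2 = x & y2 = bump (hop2 x (hop2 y M)) x & q2 = \<bar>y2\<bar>"
          then have c: "bump (hop2 y M) y = x" "x1 = x" "y1 = x + 1" "p2 = \<bar>x + 1\<bar>" "x2 = x" "y2 = b" "q2 = \<bar>b\<bar>"
            unfolding b_def KK by auto
          have sM: "mirrored (hop2 y M)" by (rule antisym_hop2[OF M ay])
          note gap = hop2_bump[OF M ay, unfolded c(1)]
          have xM: "addable (hop2 y M) x" using hop2_commute(1)[OF M a(1) ay n] .
          note bb = hop2_bump[OF sM xM, folded KK, folded b_def]
          have zz: "x < z" "z < y" using o h e by auto
          \<comment> \<open>the hop z lies in the gap that the bump of y has skipped, so only the particle moved by x can make it\<close>
          have z: "z = x + 1"
          proof -
            have "z - 1 \<in> K" using addable_sites[OF sK(1) a(3)] by simp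
            moreover have "z - 1 ~: hop2 y M" using gap(3)[of "z - 1"] zz by simp
            ultimately have "z - 1 = x \<or> z - 1 = - x" unfolding KK hop2_mem[of _ x] by auto
            moreover have "x < 0 ==> z - 1 ~= - x"
              using gap(3)[of "- x - 1"] addable_sites(3)[OF sM xM] zz by force
            ultimately show ?thesis using zz by linarith
          qed
          have Kz: "z1 = bump (hop2 z K) z" "p3 = \<bar>z1\<bar>" unfolding z1_def p3_def c out_lab z by auto
          show ?thesis
          proof (cases "x = 0")
            case True
            have "- 2 \<in> K" using addable_sites(3)[OF sK(1) a(3)] z True by simp
            then have b: "b = - 1" unfolding b_def True by (intro bump_eqI) auto
            have "bump (hop2 z K) z = 0" unfolding z True by (intro bump_eqI) (auto simp: hop2_mem)
            then show ?thesis using Kz b c z True e K' unfolding z2_def q3_def out_lab by (simp add: shifted_rel_def)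
          next
            case False
            then have bz: "\<bar>b\<bar> ~= \<bar>z\<bar>" using bb(2,4) z by linarith
            have "bump (hop2 z K) z = b"
            proof (rule bump_eqI)
              show "b - 1 \<in> hop2 z K" using bb(1,2,4) z False unfolding hop2_mem[of _ z] by auto
              show "b < z" using bb(2) z by simp
              fix w assume w: "b <= w" "w < z - 1"
              then have "w ~: K" using bb(3)[of w] z by simp
              moreover have "w ~= z" "w ~= - z" using w z bb(2,4) False by linarith+
              ultimately show "w ~: hop2 z K" unfolding hop2_mem[of _ z] by blast
            qed
            then have "z1 = b" "p3 = \<bar>b\<bar>" using Kz by auto
            moreover have "z2 = z" "q3 = \<bar>b\<bar>" using bz c e K' unfolding z2_def q3_def out_lab by auto
            ultimately show ?thesis using c z bb(2) by (simp add: shifted_rel_def exchanged_def)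
          qed
        qed
      qed
    next
      assume e: "x' = x & exchanged y z y' z'"
      have NN: "N' = N" unfolding N_def N'_def using e by simp
      have xx: "x2 = x1" "q1 = p1" unfolding x1_def x2_def p1_def q1_def using e by auto
      have fin: ?thesis if "exchanged y1 z1 y2 z2" "p3 = q3"
        using that o1 xx by (simp add: shifted_rel_def)
      from e[THEN conjunct2] show ?thesis unfolding exchanged_def
      proof
        assume h: "y' = - y & z' = - z & \<bar>\<bar>y\<bar> - \<bar>z\<bar>\<bar> = 1 & (y < 0 & 0 < z \<or> z < 0 & 0 < y)"
        then have s: "0 < y" "z < 0" using o by auto
        have KK: "K' = K" unfolding K_def K'_def NN using h hop2_neg by simp
        have hy: "hop2 (- y) N = K" unfolding hop2_neg K_def by simp
        have ay: "addable N (- y)" using a(5) h NN by simp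
        have az: "addable (hop2 (- y) N) (- z)" using a(6) h KK hy by simp
        have "exchanged y2 z2 y1 z1 & q3 = p3"
          using exchanged_push_negate[OF sN(1) l1(1,2) ay az] h s
          unfolding hy unfolding y1_def z1_def y2_def z2_def p2_def q2_def p3_def q3_def NN KK xx by simp
        then show ?thesis using fin exchanged_sym by auto
      next
        assume h: "y' = z & z' = y"
        have az: "addable N z" using a(5) h NN by simp
        have n: "\<bar>z\<bar> ~= \<bar>y\<bar>" using exchanged_far[OF sN(1) a(2) _ az] a(3) unfolding K_def by simp
        have KK: "K' = hop2 z N" unfolding K'_def NN using h by simp
        have "exchanged y2 z2 y1 z1 & q3 = p3 \<or> p1 = \<bar>y\<bar> & bump (hop2 y N) y = z"
          using exchanged_push_swap[OF sN(1) l1(1,2) az a(2) n o(2)] h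
          unfolding y1_def z1_def y2_def z2_def p2_def q2_def p3_def q3_def NN KK xx unfolding K_def by (simp, blast)
        then show ?thesis
        proof
          assume "exchanged y2 z2 y1 z1 & q3 = p3"
          then show ?thesis using fin exchanged_sym by auto
        next
          assume c: "p1 = \<bar>y\<bar> & bump (hop2 y N) y = z"
          note gap = hop2_bump[OF sN(1) a(2), folded K_def]
          have bK: "bump K y = z" using c unfolding K_def by simp
          have zx: "z < x" using o h e by simp
          have "x ~: K" using gap(3)[of x] bK zx o(1) by simp
          moreover have "x \<in> N" unfolding N_def hop2_mem by simp
          ultimately have xy: "x = y - 1 \<or> x = - y - 1" unfolding K_def hop2_mem by blast
          show ?thesis
          proof (cases "p = \<bar>x\<bar>")
            case False
            then have n: "\<bar>x\<bar> ~= \<bar>p\<bar>" using p(2) by simp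
            have "p1 = p" using False unfolding p1_def out_lab by auto
            then have "\<bar>\<bar>x\<bar> - \<bar>p\<bar>\<bar> = 1" using xy c by linarith
            then show ?thesis using addable_far[OF M a(1) p(1) n] by blast
          next
            case True
            then have "\<bar>bump N x\<bar> = \<bar>y\<bar>" using c unfolding p1_def out_lab N_def by simp
            then have "bump N x = - y" using bx o(1) by linarith
            moreover have "0 < x ==> 0 <= bump N x" using hop2_bump[OF M a(1)] unfolding N_def by simp
            ultimately have "x = 0" "y = 1" using xy bx o(1) by linarith+
            moreover have "bump K y = 0" if "y = 1" using that by (intro bump_eqI) (auto simp: K_def hop2_mem)
            ultimately show ?thesis using bK zx by simp
          qed
        qed
      qed
    qed
  qed
  then show ?thesis using push by blast
qed

interpretation shifted: local_rules hop2 abs mirrored shifted_rel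
proof
  show "mirrored {..<0}"
    unfolding mirrored_def bounded_config_def by (auto intro!: exI[of _ 0])
  show "bounded_config M" if "mirrored M" for M using that unfolding mirrored_def by blast
  show "mirrored (hop2 d M)" if "mirrored M" "addable M d" for M d by (rule antisym_hop2[OF that])
  show "hop2 \<bar>d\<bar> M = hop2 d M" for d M by (rule hop2_abs)
  show "addable M \<bar>d\<bar> = addable M d" if "mirrored M" for M d by (rule addable_abs[OF that])
  show "d \<in> hop2 d M" "d - 1 ~: hop2 d M" for d M unfolding hop2_mem by presburger+
  show "addable (hop2 p M) d & hop2 d (hop2 p M) = hop2 p (hop2 d M)"
    if "mirrored M" "addable M d" "addable M p" "\<bar>d\<bar> ~= \<bar>p\<bar>" for M d p
    using hop2_commute[OF that] by blast
  show "\<exists>B. mirrored B & addable B p & addable B d & hop2 p B = A & hop2 d B = A'"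
    if "mirrored A" "mirrored A'" "addable A d" "addable A' p" "hop2 d A = hop2 p A'" "\<bar>d\<bar> ~= \<bar>p\<bar>" for A A' d p
    by (rule hop2_unsquare[OF that])
  show "A = A'" if "mirrored A" "mirrored A'" "addable A d" "addable A' d'" "hop2 d A = hop2 d' A'" "\<bar>d\<bar> = \<bar>d'\<bar>" for A A' d d'
    by (rule hop2_inj[OF that])
  show "e = front B \<or> (\<exists>A d. mirrored A & addable A d & hop2 d A = B & bump B d = e)"
    if "mirrored B" "addable B e" for B e by (rule hop2_unbump[OF that])
  show "(shifted.out M p x < shifted.out (hop2 x M) (shifted.lab M p x) y) = (x < y)"
    if "mirrored M" "addable M p" "\<bar>p\<bar> = p" "addable M x" "addable (hop2 x M) y" for M p x y
  proof -
    have "x ~= y" using that(5) unfolding addable_def hop2_mem by blast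
    moreover have "0 <= p" using that(3) by simp
    ultimately show ?thesis using shifted_asc[OF that(1,2) _ that(4,5)] by force
  qed
  show "shifted.out M \<bar>front M\<bar> y < front M" if "mirrored M" "addable M y" for M y
  proof -
    note f = antisym_front[OF that(1)]
    have "\<bar>y\<bar> <= front M" by (rule f(4)[OF that(2)])
    then show ?thesis using hop2_bump(2)[OF that] f(3) unfolding out_lab by auto
  qed
  show "fold hop2 [x, y, z] M = fold hop2 [x', y', z'] M"
    if "mirrored M" "shifted.valid M [x, y, z]" "shifted.valid M [x', y', z']" "shifted_rel (x, y, z) (x', y', z')"
    for M x y z x' y' z'
  proof -
    note r = that(4)
    have a: "addable M x" "addable (hop2 x M) y" "addable M x'" "addable (hop2 x' M) y'"
      "addable (hop2 y (hop2 x M)) z" "addable (hop2 y' (hop2 x' M)) z'" using that by auto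
    from r consider "z' = z & exchanged x y x' y'" | "x' = x & exchanged y z y' z'" | "x' = x" "y' = - y" "z' = z"
       unfolding shifted_rel_def by auto
    then show ?thesis
    proof cases
      case 1
      then show ?thesis using exchanged_shape[OF that(1) a(1-4)] by simp
    next
      case 2
      then show ?thesis using exchanged_shape[OF antisym_hop2[OF that(1) a(1)], of y z y' z'] a by simp
    next
      case 3
      then show ?thesis by (simp add: hop2_neg)
    qed
  qed
  show "\<exists>w w' q. shifted.push M p [x, y, z] = (list3 w, q) & shifted.push M p [x', y', z'] = (list3 w', q) & shifted_rel w w'"
    if "mirrored M" "addable M p" "\<bar>p\<bar> = p" "shifted.valid M [x, y, z]" "shifted.valid M [x', y', z']"
      "shifted_rel (x, y, z) (x', y', z')" for M p x y z x' y' z'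
    using shifted_rel_push[OF that(1,2) abs_ge_zero[of p, unfolded that(3)] that(4-6)] .
  show "shifted_rel (x, front (hop2 x M), shifted.out (hop2 x M) \<bar>front (hop2 x M)\<bar> y) (x, y, front (fold hop2 [x, y] M)) &
      shifted.lab (hop2 x M) \<bar>front (hop2 x M)\<bar> y = \<bar>front (fold hop2 [x, y] M)\<bar>"
    if "mirrored M" "shifted.valid M [x, y]" "y < x" for M x y
    using shifted_rel_bac[of M x y] that by simp
  show "shifted_rel (x, front (hop2 x M), shifted.out (hop2 x M) \<bar>front (hop2 x M)\<bar> y)
        (front M, shifted.out M \<bar>front M\<bar> x, shifted.out (hop2 x M) (shifted.lab M \<bar>front M\<bar> x) y) &
       shifted.lab (hop2 x M) \<bar>front (hop2 x M)\<bar> y =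
       shifted.lab (hop2 x M) (shifted.lab M \<bar>front M\<bar> x) y"
    if "mirrored M" "shifted.valid M [x, y]" "x < y" for M x y
    using shifted_rel_acb[of M x y] that by simp
qed simp


section \<open>Ordinary configurations\<close>

text \<open>The growth of ordinary Young diagrams, which is needed for Schur functions.\<close>

definition hop1 :: "int => int set => int set" where
  "hop1 e M = (M - {e - 1}) \<union> {e}"

definition unshifted_rel :: "int \<times> int \<times> int => int \<times> int \<times> int => bool" where
  "unshifted_rel w w' \<longleftrightarrow> (case w of (x, y, z) =>
     w' = (y, x, z) & x < z & z < y \<or> w' = (x, z, y) & z < x & x < y)"

lemma hop1_mem: "x \<in> hop1 e M \<longleftrightarrow> x = e \<or> x \<in> M & x ~= e - 1"
  unfolding hop1_def by auto

lemma bounded_hop1: "bounded_config M ==> bounded_config (hop1 e M)"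
  unfolding hop1_def by (intro bounded_hop) auto

lemma unhop1:
  assumes "bounded_config M" "e \<in> M" "e - 1 ~: M"
  obtains A where "bounded_config A" "addable A e" "hop1 e A = M" "\<And>x. x \<in> A \<longleftrightarrow> x = e - 1 \<or> x \<in> M & x ~= e"
proof -
  define A where "A = (M - {e}) \<union> {e - 1}"
  have mem: "x \<in> A \<longleftrightarrow> x = e - 1 \<or> x \<in> M & x ~= e" for x unfolding A_def by auto
  have "bounded_config A" using assms(1) unfolding A_def by (intro bounded_hop) auto
  moreover have "addable A e" unfolding addable_def mem by auto
  moreover have "hop1 e A = M" unfolding set_eq_iff hop1_mem mem using assms(2,3) by auto
  ultimately show thesis using that mem by blast
qed

lemma hop1_bump:
  assumes "bounded_config M" "addable M d"
  defines "e \<equiv> bump (hop1 d M) d"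
  shows "e - 1 \<in> hop1 d M" "e < d" "\<And>z. e <= z ==> z <= d - 1 ==> z ~: hop1 d M" "addable (hop1 d M) e"
proof -
  note b = bump_props[OF bounded_hop1[OF assms(1)], of d d, folded e_def]
  have d1: "d - 1 ~: hop1 d M" unfolding hop1_mem by presburger
  show "e - 1 \<in> hop1 d M" "e < d" using b by auto
  show rng: "z ~: hop1 d M" if "e <= z" "z <= d - 1" for z using b(3)[of z] that d1 by (cases "z = d - 1") auto
  show "addable (hop1 d M) e" unfolding addable_def using b rng[of e] by simp
qed

lemma hop1_commute:
  assumes "addable M a" "addable M c" "a ~= c"
  shows "addable (hop1 c M) a" "hop1 a (hop1 c M) = hop1 c (hop1 a M)"
  using assms unfolding addable_def hop1_mem set_eq_iff by auto

lemma bump1_undisturbed: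
  assumes "bounded_config M" "addable M a" "addable M c" "a ~= c" "bump (hop1 a M) a ~= c"
  shows "bump (hop1 a (hop1 c M)) a = bump (hop1 a M) a"
proof -
  note b = hop1_bump[OF assms(1,2)]
  let ?e = "bump (hop1 a M) a"
  have cM: "c - 1 \<in> hop1 a M" using assms(2-4) unfolding hop1_mem addable_def by auto
  show ?thesis unfolding hop1_commute(2)[OF assms(2-4)]
  proof (rule bump_eqI)
    show "?e - 1 \<in> hop1 c (hop1 a M)" using b(1) assms(5) unfolding hop1_mem[of _ c] by auto
    show "?e < a" by (rule b(2))
    fix z assume z: "?e <= z" "z < a - 1"
    have "z ~= c" using b(3)[of "c - 1"] cM z assms(5) by (cases "?e = c") auto
    then show "z ~: hop1 c (hop1 a M)" using b(3)[of z] z unfolding hop1_mem[of _ c] by auto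
  qed
qed

interpretation unshifted: insertion hop1 id bounded_config unshifted_rel .

lemmas out_lab1 = unshifted.out_def unshifted.lab_def id_apply

lemma hop1_inj:
  assumes "addable A d" "addable A' d" "hop1 d A = hop1 d A'"
  shows "A = A'"
proof -
  have mem: "x \<in> A \<longleftrightarrow> x = d - 1 \<or> (x \<in> hop1 d A & x ~= d)" if "addable A d" for x A
    using that unfolding addable_def hop1_mem by auto
  show ?thesis unfolding set_eq_iff mem[OF assms(1)] mem[OF assms(2)] assms(3) by blast
qed

lemma hop1_unsquare:
  assumes "bounded_config A" "bounded_config A'" "addable A d" "addable A' p" "hop1 d A = hop1 p A'" "d ~= p"
  shows "\<exists>B. bounded_config B & addable B p & addable B d & hop1 p B = A & hop1 d B = A'"
proof -
  define C where "C = hop1 d A"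
  have C: "d \<in> C" "d - 1 ~: C" unfolding C_def hop1_mem by presburger+
  have C': "p \<in> C" "p - 1 ~: C" unfolding C_def assms(5) hop1_mem by presburger+
  have "d \<in> A'" "d - 1 ~: A'" using C assms(6) unfolding C_def assms(5) hop1_mem by auto
  then obtain B where B: "bounded_config B" "addable B d" "hop1 d B = A'"
    "\<And>x. x \<in> B \<longleftrightarrow> x = d - 1 \<or> x \<in> A' & x ~= d"
    using unhop1[OF assms(2)] by metis
  have "p - 1 ~= d" "p ~= d - 1" using C C' by metis+
  then have Bp: "addable B p" using assms(4) unfolding addable_def B(4) by auto
  have "hop1 d (hop1 p B) = hop1 d A"
    using hop1_commute(2)[OF B(2) Bp assms(6)] B(3) assms(5) by simp
  then have "hop1 p B = A"
    using hop1_inj[OF hop1_commute(1)[OF B(2) Bp assms(6)] assms(3)] by simp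
  then show ?thesis using B Bp by blast
qed

lemma hop1_unbump:
  assumes "bounded_config B" "addable B e"
  shows "e = front B \<or> (\<exists>A d. bounded_config A & addable A d & hop1 d A = B & bump B d = e)"
proof (cases "e = front B")
  case False
  obtain d where d: "d \<in> B" "d - 1 ~: B" "bump B d = e" using bump_source[OF assms False] by blast
  then show ?thesis using unhop1[OF assms(1) d(1,2)] by metis
qed simp

lemma unshifted_lab:
  assumes "bounded_config M" "addable M p" "addable M x"
  shows "addable (hop1 x M) (unshifted.lab M p x)"
proof (cases "x = p")
  case True
  then show ?thesis using hop1_bump(4)[OF assms(1,3)] unfolding out_lab1 by simp
next
  case False
  then show ?thesis using hop1_commute(1)[OF assms(2,3)] unfolding out_lab1 by auto
qed

lemma unshifted_asc:
  assumes M: "bounded_config M" and p: "addable M p" and xy: "addable M x" "addable (hop1 x M) y"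
  shows "x < y ==> unshifted.out M p x < unshifted.out (hop1 x M) (unshifted.lab M p x) y"
    and "y < x ==> unshifted.out (hop1 x M) (unshifted.lab M p x) y < unshifted.out M p x"
proof -
  define N where "N = hop1 x M"
  have sN: "bounded_config N" unfolding N_def by (rule bounded_hop1[OF M])
  have yN: "addable N y" using xy(2) N_def by simp
  have xN: "x \<in> N" unfolding N_def hop1_mem by simp
  note bx = hop1_bump[OF M xy(1), folded N_def] and by' = hop1_bump[OF sN yN]
  let ?e = "bump N x" and ?f = "bump (hop1 y N) y"
  have y1: "y - 1 \<in> N" using yN unfolding addable_def by simp
  have le: "y <= ?e" if "y < x" using bx(3)[of "y - 1"] y1 that by linarith
  have goal: "(x < y --> unshifted.out M p x < unshifted.out N (unshifted.lab M p x) y) &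
    (y < x --> unshifted.out N (unshifted.lab M p x) y < unshifted.out M p x)"
  proof (cases "x = p")
    case True
    then have o: "unshifted.out M p x = ?e" "unshifted.lab M p x = ?e" unfolding out_lab1 N_def by auto
    show ?thesis
    proof (cases "y = ?e")
      case True
      then have "unshifted.out N ?e y = ?f" unfolding out_lab1 by simp
      then show ?thesis using o by'(2) bx(2) True by auto
    next
      case False
      then have "unshifted.out N ?e y = y" unfolding out_lab1 by simp
      then show ?thesis using o bx(2) le False by force
    qed
  next
    case False
    then have o: "unshifted.out M p x = x" "unshifted.lab M p x = p" unfolding out_lab1 by auto
    show ?thesis
    proof (cases "y = p")
      case h: True
      then have o2: "unshifted.out N p y = ?f" unfolding out_lab1 by simp
      have "x ~= y - 1" using p xy(1) h unfolding addable_def by auto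
      then have "x \<in> hop1 y N" using xN unfolding hop1_mem by blast
      then have "x < ?f" if "x < y" using by'(3)[of x] that by linarith
      then show ?thesis using by'(2) o o2 by auto
    next
      case h: False
      then show ?thesis unfolding o unfolding out_lab1 by simp
    qed
  qed
  show "x < y ==> unshifted.out M p x < unshifted.out (hop1 x M) (unshifted.lab M p x) y"
    "y < x ==> unshifted.out (hop1 x M) (unshifted.lab M p x) y < unshifted.out M p x"
    using goal unfolding N_def by auto
qed

lemma unshifted_front:
  assumes "bounded_config M" "addable M y"
  shows "y <= front M"
  using front_props(2)[OF assms(1), of "y - 1"] assms(2) unfolding addable_def by linarith

lemma unshifted_swap:
  fixes p x y :: int
  assumes M: "bounded_config M" and xy: "addable M x" "addable M y" "x < y"
  defines "x1 \<equiv> unshifted.out M p x" and "y1 \<equiv> unshifted.out (hop1 x M) (unshifted.lab M p x) y"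
    and "l1 \<equiv> unshifted.lab (hop1 x M) (unshifted.lab M p x) y"
    and "y2 \<equiv> unshifted.out M p y" and "x2 \<equiv> unshifted.out (hop1 y M) (unshifted.lab M p y) x"
    and "l2 \<equiv> unshifted.lab (hop1 y M) (unshifted.lab M p y) x"
  shows "y2 = y1 & x2 = x1 & l1 = l2 \<or>
    p = y & bump (hop1 y M) y = x & x1 = x & y1 = x + 1 & l1 = x + 1 &
    y2 = x & x2 = bump (hop1 x (hop1 y M)) x & l2 = x2"
proof -
  have n: "x ~= y" "y ~= x" using xy(3) by auto
  consider "p ~= x" "p ~= y" | "p = x" | "p = y" by blast
  then show ?thesis
  proof cases
    case 1
    then show ?thesis unfolding assms(5-10) out_lab1 by simp
  next
    case 2
    have "bump (hop1 x M) x ~= y" using hop1_bump(2)[OF M xy(1)] xy(3) by simp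
    then show ?thesis using 2 n bump1_undisturbed[OF M xy(1,2) n(1)] unfolding assms(5-10) out_lab1 by simp
  next
    case py: 3
    show ?thesis
    proof (cases "bump (hop1 y M) y = x")
      case False
      then show ?thesis using py n bump1_undisturbed[OF M xy(2,1) n(2)] unfolding assms(5-10) out_lab1 by simp
    next
      case True
      note b = hop1_bump[OF M xy(2), unfolded True]
      have "bump (hop1 y (hop1 x M)) y = x + 1" unfolding hop1_commute(2)[OF xy(2,1) n(2)]
      proof (rule bump_eqI)
        show "x + 1 - 1 \<in> hop1 x (hop1 y M)" unfolding hop1_mem[of _ x] by simp
        show "x + 1 < y" using xy unfolding addable_def by (cases "x + 1 = y") auto
        show "z ~: hop1 x (hop1 y M)" if "x + 1 <= z" "z < y - 1" for z
          using b(3)[of z] that unfolding hop1_mem[of _ x] by auto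
      qed
      then show ?thesis using True py n unfolding assms(5-10) out_lab1 by simp
    qed
  qed
qed

lemma unshifted_rel_push:
  assumes M: "bounded_config M" and p: "addable M p"
    and v: "unshifted.valid M [x, y, z]" "unshifted.valid M [x', y', z']"
    and r: "unshifted_rel (x, y, z) (x', y', z')"
  shows "\<exists>w w' q. unshifted.push M p [x, y, z] = (list3 w, q) & unshifted.push M p [x', y', z'] = (list3 w', q) & unshifted_rel w w'"
proof -
  define N where "N = hop1 x M"
  define K where "K = hop1 y N"
  define N' where "N' = hop1 x' M"
  define K' where "K' = hop1 y' N'"
  define x1 where "x1 = unshifted.out M p x"
  define p1 where "p1 = unshifted.lab M p x"
  define y1 where "y1 = unshifted.out N p1 y"
  define p2 where "p2 = unshifted.lab N p1 y"
  define z1 where "z1 = unshifted.out K p2 z"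
  define p3 where "p3 = unshifted.lab K p2 z"
  define x2 where "x2 = unshifted.out M p x'"
  define q1 where "q1 = unshifted.lab M p x'"
  define y2 where "y2 = unshifted.out N' q1 y'"
  define q2 where "q2 = unshifted.lab N' q1 y'"
  define z2 where "z2 = unshifted.out K' q2 z'"
  define q3 where "q3 = unshifted.lab K' q2 z'"
  note defs = x1_def p1_def y1_def p2_def z1_def p3_def x2_def q1_def y2_def q2_def z2_def q3_def
  have push: "unshifted.push M p [x, y, z] = (list3 (x1, y1, z1), p3)"
    "unshifted.push M p [x', y', z'] = (list3 (x2, y2, z2), q3)"
    unfolding defs N_def K_def N'_def K'_def list3_def by simp_all
  have a: "addable M x" "addable N y" "addable K z" "addable M x'" "addable N' y'" "addable K' z'"
    using v unfolding N_def K_def N'_def K'_def by auto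
  have sN: "bounded_config N" "bounded_config N'" unfolding N_def N'_def using bounded_hop1 M by auto
  have sK: "bounded_config K" "bounded_config K'" unfolding K_def K'_def using bounded_hop1 sN by auto
  have l1: "addable N p1" "addable N' q1"
    using unshifted_lab[OF M p] a unfolding p1_def q1_def N_def N'_def by auto
  have l2: "addable K p2" "addable K' q2"
    using unshifted_lab[OF sN(1) l1(1) a(2)] unshifted_lab[OF sN(2) l1(2) a(5)] unfolding p2_def q2_def K_def K'_def by auto
  have s1: "x < y ==> x1 < y1"
    using unshifted_asc[OF M p a(1), of y] a(2) unfolding x1_def y1_def p1_def N_def by auto
  have s2: "z < y ==> z1 < y1"
    using unshifted_asc[OF sN(1) l1(1) a(2), of z] a(3) unfolding z1_def y1_def p2_def K_def by auto
  have s3: "y' < x' ==> y2 < x2"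
    using unshifted_asc[OF M p a(4), of y'] a(5) unfolding x2_def y2_def q1_def N'_def by auto
  have s4: "y' < z' ==> y2 < z2"
    using unshifted_asc[OF sN(2) l1(2) a(5), of z'] a(6) unfolding z2_def y2_def q2_def K'_def by auto
  have "unshifted_rel (x1, y1, z1) (x2, y2, z2) & p3 = q3"
  proof (cases "x < z & z < y & (x', y', z') = (y, x, z)")
    case True
    then have h: "x < z" "z < y" "x' = y" "y' = x" "z' = z" by auto
    then have o1: "x1 < y1" "z1 < y1" "y2 < x2" "y2 < z2" using s1 s2 s3 s4 by auto
    have ay: "addable M y" using a(4) h by simp
    have n: "x ~= y" using h by simp
    have NN: "N' = hop1 y M" unfolding N'_def using h by simp
    have K': "K' = K" unfolding K'_def K_def NN N_def h(4) by (rule hop1_commute(2)[OF a(1) ay n])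
    have KK: "K = hop1 x (hop1 y M)" using K' h unfolding K'_def NN by simp
    have "x2 = y1 & y2 = x1 & p2 = q2 \<or>
      p = y & bump (hop1 y M) y = x & x1 = x & y1 = x + 1 & p2 = x + 1 &
      x2 = x & y2 = bump (hop1 x (hop1 y M)) x & q2 = y2"
      using unshifted_swap[OF M a(1) ay, of p] h
      unfolding x1_def y1_def x2_def y2_def p1_def q1_def p2_def q2_def NN unfolding N_def by simp
    then show ?thesis
    proof
      assume "x2 = y1 & y2 = x1 & p2 = q2"
      then show ?thesis using o1 h K' unfolding z1_def z2_def p3_def q3_def by (simp add: unshifted_rel_def)
    next
      define b where "b = bump K x"
      assume "p = y & bump (hop1 y M) y = x & x1 = x & y1 = x + 1 & p2 = x + 1 &
        x2 = x & y2 = bump (hop1 x (hop1 y M)) x & q2 = y2"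
      then have c: "bump (hop1 y M) y = x" "x1 = x" "y1 = x + 1" "p2 = x + 1" "x2 = x" "y2 = b" "q2 = b"
        unfolding b_def KK by auto
      note gap = hop1_bump[OF M ay, unfolded c(1)]
      note bb = hop1_bump[OF bounded_hop1[OF M] hop1_commute(1)[OF a(1) ay n], folded KK, folded b_def]
      have z: "z = x + 1"
      proof -
        have "z - 1 \<in> K" using a(3) unfolding addable_def by simp
        moreover have "z - 1 ~: hop1 y M" using gap(3)[of "z - 1"] h by simp
        ultimately have "z - 1 = x" unfolding KK hop1_mem[of _ x] by auto
        then show ?thesis by simp
      qed
      have "bump (hop1 z K) z = b"
      proof (rule bump_eqI)
        show "b - 1 \<in> hop1 z K" using bb(1,2) z unfolding hop1_mem[of _ z] by auto
        show "b < z" using bb(2) z by simp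
        show "w ~: hop1 z K" if "b <= w" "w < z - 1" for w
          using bb(3)[of w] that z unfolding hop1_mem[of _ z] by auto
      qed
      then have "z1 = b" "p3 = b" unfolding z1_def p3_def c out_lab1 z by auto
      moreover have "z2 = z" "q3 = b" using bb(2) c z h K' unfolding z2_def q3_def out_lab1 by auto
      ultimately show ?thesis using c z bb(2) by (simp add: unshifted_rel_def)
    qed
  next
    case False
    then have h: "z < x" "x < y" "x' = x" "y' = z" "z' = y" using r unfolding unshifted_rel_def by auto
    then have o1: "x1 < y1" "z1 < y1" "y2 < x2" "y2 < z2" using s1 s2 s3 s4 by auto
    have NN: "N' = N" unfolding N_def N'_def using h by simp
    have xx: "x2 = x1" "q1 = p1" unfolding x1_def x2_def p1_def q1_def using h by auto
    have az: "addable N z" using a(5) h NN by simp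
    have KK: "K' = hop1 z N" unfolding K'_def NN using h by simp
    have zy: "z < y" using h by simp
    have "y1 = z2 & z1 = y2 & p3 = q3 \<or> p1 = y & bump (hop1 y N) y = z"
      using unshifted_swap[OF sN(1) az a(2) zy, of p1]
      unfolding y1_def z1_def y2_def z2_def p2_def q2_def p3_def q3_def NN KK xx h(4,5) unfolding K_def by auto
    then show ?thesis
    proof
      assume "y1 = z2 & z1 = y2 & p3 = q3"
      then show ?thesis using o1 xx by (simp add: unshifted_rel_def)
    next
      assume c: "p1 = y & bump (hop1 y N) y = z"
      then have "x ~: K" using hop1_bump(3)[OF sN(1) a(2), of x] h unfolding K_def by simp
      moreover have "x \<in> N" unfolding N_def hop1_mem by simp
      ultimately have xy: "x = y - 1" unfolding K_def hop1_mem by blast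
      show ?thesis
      proof (cases "p = x")
        case False
        then have "p = y" using c unfolding p1_def out_lab1 by auto
        then show ?thesis using xy p a(1) unfolding addable_def by simp
      next
        case True
        then show ?thesis using c hop1_bump(2)[OF M a(1)] h unfolding p1_def out_lab1 by simp
      qed
    qed
  qed
  then show ?thesis using push by blast
qed

lemma unshifted_rel_acb:
  assumes M: "bounded_config M" and xy: "addable M x" "addable (hop1 x M) y" "x < y"
  defines "N \<equiv> hop1 x M"
  shows "unshifted_rel (x, front N, unshifted.out N (front N) y)
      (front M, unshifted.out M (front M) x, unshifted.out N (unshifted.lab M (front M) x) y) &
    unshifted.lab N (front N) y = unshifted.lab N (unshifted.lab M (front M) x) y"
proof -
  have sN: "bounded_config N" unfolding N_def by (rule bounded_hop1[OF M])
  have yN: "addable N y" using xy(2) N_def by simp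
  have xN: "x \<in> N" unfolding N_def hop1_mem by simp
  define K where "K = hop1 y N"
  note f = front_props[OF M] and g = front_props[OF sN]
  let ?t = "front M" and ?s = "front N"
  have at: "addable M ?t" using f(1) f(2)[of ?t] unfolding addable_def by auto
  have xt: "x <= ?t" by (rule unshifted_front[OF M xy(1)])
  have yt: "y <= ?s" by (rule unshifted_front[OF sN yN])
  have bx: "bump N x < x" using hop1_bump[OF M xy(1)] unfolding N_def by auto
  have byy: "bump K y < y" using hop1_bump[OF sN yN] unfolding K_def by auto
  have o1: "unshifted.out N ?s y < ?s"
    using byy yt unfolding out_lab1 K_def[symmetric] by (cases "y = ?s") auto
  have o3: "unshifted.out M ?t x < unshifted.out N (unshifted.lab M ?t x) y"
    using unshifted_asc(1)[OF M at(1) xy] unfolding N_def by simp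
  show ?thesis
  proof (cases "x = ?t")
    case False
    have "?s = ?t"
    proof (rule front_eqI)
      show "?t - 1 \<in> N" using f(1) False unfolding N_def hop1_mem by auto
      show "z ~: N" if "?t <= z" for z using f(2)[OF that] that False xt unfolding N_def hop1_mem by linarith
    qed
    moreover have "unshifted.out M ?t x = x" "unshifted.lab M ?t x = ?t" using False unfolding out_lab1 by auto
    ultimately show ?thesis using o1 o3 by (simp add: unshifted_rel_def)
  next
    case 3: True
    have s: "?s = ?t + 1"
    proof (rule front_eqI)
      show "?t + 1 - 1 \<in> N" using 3 xN by simp
      show "z ~: N" if "?t + 1 <= z" for z using f(2)[of z] that xt unfolding N_def hop1_mem by linarith
    qed
    have y: "y = ?s" using 3 s yt xy(3) by linarith
    have b: "bump K y = bump N x"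
    proof (rule bump_eqI)
      have "bump N x - 1 \<in> N" using hop1_bump(1)[OF M xy(1)] unfolding N_def .
      then show "bump N x - 1 \<in> K" using bx y s 3 unfolding K_def hop1_mem by auto
      show "bump N x < y" using bx y s 3 by simp
      fix z assume z: "bump N x <= z" "z < y - 1"
      then have "z ~: N" using hop1_bump(3)[OF M xy(1), of z] 3 y s unfolding N_def by simp
      then show "z ~: K" using z y s unfolding K_def hop1_mem by auto
    qed
    have o: "unshifted.out N ?s y = bump N x" "unshifted.lab N ?s y = bump N x" "unshifted.out M ?t x = bump N x"
      "unshifted.lab M ?t x = bump N x"
      using y 3 b unfolding out_lab1 K_def[symmetric] N_def[symmetric] by auto
    have "unshifted.out N (bump N x) y = y" "unshifted.lab N (bump N x) y = bump N x" using bx y s 3 unfolding out_lab1 by auto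
    then show ?thesis using o y s 3 bx by (auto simp: unshifted_rel_def)
  qed
qed

interpretation unshifted: local_rules hop1 id bounded_config unshifted_rel
proof
  show "bounded_config {..<0}" unfolding bounded_config_def by (auto intro!: exI[of _ 0])
  show "bounded_config (hop1 d M)" if "bounded_config M" for M d by (rule bounded_hop1[OF that])
  show "d \<in> hop1 d M" "d - 1 ~: hop1 d M" for d M unfolding hop1_mem by presburger+
  show "addable (hop1 p M) d & hop1 d (hop1 p M) = hop1 p (hop1 d M)"
    if "addable M d" "addable M p" "id d ~= id p" for M d p
    using hop1_commute[OF that(1,2)] that(3) by simp
  show "\<exists>B. bounded_config B & addable B p & addable B d & hop1 p B = A & hop1 d B = A'"
    if "bounded_config A" "bounded_config A'" "addable A d" "addable A' p" "hop1 d A = hop1 p A'" "id d ~= id p" for A A' d p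
    using hop1_unsquare[OF that(1-5)] that(6) by simp
  show "A = A'" if "addable A d" "addable A' d'" "hop1 d A = hop1 d' A'" "id d = id d'" for A A' d d'
    using hop1_inj that by simp
  show "e = front B \<or> (\<exists>A d. bounded_config A & addable A d & hop1 d A = B & bump B d = e)"
    if "bounded_config B" "addable B e" for B e by (rule hop1_unbump[OF that])
  show "(unshifted.out M p x < unshifted.out (hop1 x M) (unshifted.lab M p x) y) = (x < y)"
    if "bounded_config M" "addable M p" "addable M x" "addable (hop1 x M) y" for M p x y
  proof -
    have "x ~= y" using that(4) unfolding addable_def hop1_mem by blast
    then show ?thesis using unshifted_asc[OF that] by force
  qed
  show "unshifted.out M (id (front M)) y < front M" if "bounded_config M" "addable M y" for M y
    using hop1_bump(2)[OF that] unshifted_front[OF that] unfolding out_lab1 by auto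
  show "fold hop1 [x, y, z] M = fold hop1 [x', y', z'] M"
    if "unshifted.valid M [x, y, z]" "unshifted.valid M [x', y', z']" "unshifted_rel (x, y, z) (x', y', z')"
    for M x y z x' y' z'
  proof -
    have a: "addable M x" "addable (hop1 x M) y" "addable M x'" "addable (hop1 x' M) y'" using that by auto
    from that(3) consider "x' = y" "y' = x" "z' = z" "x ~= y" | "x' = x" "y' = z" "z' = y" "y ~= z"
      unfolding unshifted_rel_def by auto
    then show ?thesis
    proof cases
      case 1
      then show ?thesis using hop1_commute(2)[OF a(1), of y] a by simp
    next
      case 2
      then show ?thesis using hop1_commute(2)[OF a(2), of z] a by simp
    qed
  qed
  show "\<exists>w w' q. unshifted.push M p [x, y, z] = (list3 w, q) & unshifted.push M p [x', y', z'] = (list3 w', q) & unshifted_rel w w'"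
    if "bounded_config M" "addable M p" "unshifted.valid M [x, y, z]" "unshifted.valid M [x', y', z']"
      "unshifted_rel (x, y, z) (x', y', z')" for M p x y z x' y' z'
    by (rule unshifted_rel_push[OF that])
  show "unshifted_rel (x, front (hop1 x M), unshifted.out (hop1 x M) (id (front (hop1 x M))) y) (x, y, front (fold hop1 [x, y] M)) &
      unshifted.lab (hop1 x M) (id (front (hop1 x M))) y = id (front (fold hop1 [x, y] M))"
    if "bounded_config M" "unshifted.valid M [x, y]" "y < x" for M x y
  proof -
    define N where "N = hop1 x M"
    have sN: "bounded_config N" unfolding N_def by (rule bounded_hop1[OF that(1)])
    note f = front_props[OF sN]
    have xs: "x < front N" using f(2)[of x] unfolding N_def hop1_mem by force
    have "front (hop1 y N) = front N"
    proof (rule front_eqI)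
      show "front N - 1 \<in> hop1 y N" using f(1) xs that(3) unfolding hop1_mem by auto
      show "z ~: hop1 y N" if "front N <= z" for z using f(2)[OF that] that xs \<open>y < x\<close> unfolding hop1_mem by linarith
    qed
    then show ?thesis using xs that(3) unfolding fold.simps comp_apply id_apply N_def[symmetric] out_lab1 by (auto simp: unshifted_rel_def)
  qed
  show "unshifted_rel (x, front (hop1 x M), unshifted.out (hop1 x M) (id (front (hop1 x M))) y)
        (front M, unshifted.out M (id (front M)) x, unshifted.out (hop1 x M) (unshifted.lab M (id (front M)) x) y) &
       unshifted.lab (hop1 x M) (id (front (hop1 x M))) y =
       unshifted.lab (hop1 x M) (unshifted.lab M (id (front M)) x) y"
    if "bounded_config M" "unshifted.valid M [x, y]" "x < y" for M x y
    using unshifted_rel_acb[of M x y] that by simp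
qed simp_all


section \<open>Knuth moves and orbits\<close>

text \<open>The index is the middle one of the three letters \<open>i - 1, i, i + 1\<close>, which are at the list positions \<open>i - 2, i - 1, i\<close>.\<close>

definition at3 :: "('a \<times> 'a \<times> 'a => 'a \<times> 'a \<times> 'a) => nat => 'a list => 'a list" where
  "at3 f i xs = take (i - 2) xs @ list3 (f (xs ! (i - 2), xs ! (i - 1), xs ! i)) @ drop (i + 1) xs"

text \<open>If the median of the three values is at an end, then the two others are exchanged. For words of
  positions this is the exchange of the two letters that are furthest apart.\<close>

fun knuth :: "'a::linorder \<times> 'a \<times> 'a => 'a \<times> 'a \<times> 'a" where
  "knuth (x, y, z) =
    (if x < z & z < y \<or> y < z & z < x then (y, x, z)
     else if z < x & x < y \<or> y < x & x < z then (x, z, y)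
     else (x, y, z))"

lemma list3_simp [simp]: "list3 (x, y, z) = [x, y, z]" by (simp add: list3_def)

lemma at3_append: "length s = i - 2 ==> 2 <= i ==> at3 f i (s @ list3 w @ r) = s @ list3 (f w) @ r"
  by (cases w) (auto simp: at3_def nth_append Suc_diff_Suc numeral_2_eq_2)

lemma at3_split:
  assumes "2 <= i" "i < length xs"
  obtains s x y z r where "xs = s @ [x, y, z] @ r" "length s = i - 2" "x = xs ! (i - 2)" "y = xs ! (i - 1)" "z = xs ! i"
proof -
  obtain n where n: "i = Suc (Suc n)" using assms(1) by (metis add_2_eq_Suc le_Suc_ex)
  have "xs = take n xs @ [xs ! n, xs ! Suc n, xs ! Suc (Suc n)] @ drop (Suc (Suc (Suc n))) xs"
    using assms(2) n by (simp add: Cons_nth_drop_Suc)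
  then show thesis by (rule that) (use assms(2) n in auto)
qed

lemma at3_prefix:
  assumes "2 <= i" "i < length r"
  shows "at3 f i (r @ s) = at3 f i r @ s"
proof -
  obtain t x y z u where t: "r = t @ [x, y, z] @ u" "length t = i - 2" using at3_split[OF assms] by metis
  show ?thesis using at3_append[OF t(2) assms(1), of f "(x, y, z)" u] at3_append[OF t(2) assms(1), of f "(x, y, z)" "u @ s"] t(1) by simp
qed

lemma length_at3: "2 <= i ==> i < length xs ==> length (at3 f i xs) = length xs"
  by (simp add: at3_def)

lemma knuth_knuth [simp]: "knuth (knuth w) = w"
  by (cases w) auto

lemma mset_at3_knuth:
  assumes "2 <= i" "i < length xs"
  shows "mset (at3 knuth i xs) = mset xs"
proof -
  obtain t x y z u where t: "xs = t @ [x, y, z] @ u" "length t = i - 2" using at3_split[OF assms] by metis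
  have "mset (list3 (knuth (x, y, z))) = mset [x, y, z]" by simp
  then show ?thesis using at3_append[OF t(2) assms(1), of knuth "(x, y, z)" u] t(1) by simp
qed

lemma at3_knuth_at3_knuth:
  assumes "2 <= i" "i < length xs"
  shows "at3 knuth i (at3 knuth i xs) = xs"
proof -
  obtain t x y z u where t: "xs = t @ [x, y, z] @ u" "length t = i - 2" using at3_split[OF assms] by metis
  have "at3 knuth i xs = t @ list3 (knuth (x, y, z)) @ u" using at3_append[OF t(2) assms(1), of knuth "(x, y, z)" u] t(1) by simp
  then have "at3 knuth i (at3 knuth i xs) = t @ list3 (knuth (knuth (x, y, z))) @ u"
    by (simp only: at3_append[OF t(2) assms(1)])
  then show ?thesis unfolding knuth_knuth using t(1) by simp
qed

definition orbit :: "('i => 'a => 'a) => 'i set => 'a => 'a set" where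
  "orbit a J x = {fold a is x | is. set is \<subseteq> J}"

lemma orbit_refl: "x \<in> orbit a J x"
  unfolding orbit_def by (auto intro!: exI[of _ "[]"])

lemma orbit_step: "y \<in> orbit a J x ==> j \<in> J ==> a j y \<in> orbit a J x"
proof -
  assume "y \<in> orbit a J x" "j \<in> J"
  then obtain "is" where "set is \<subseteq> J" "y = fold a is x" unfolding orbit_def by blast
  then have "set (is @ [j]) \<subseteq> J & a j y = fold a (is @ [j]) x" using \<open>j \<in> J\<close> by simp
  then show ?thesis unfolding orbit_def by blast
qed

lemma gen_class_eq_orbit:
  assumes inv: "\<And>j. j \<in> J ==> involution_on A (\<phi> j)" and S: "S \<in> A"
  shows "gen_class A \<phi> J S = orbit \<phi> J S"
proof -
  define R where "R = {(X, \<phi> j X) |X j. X \<in> A & j \<in> J}"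
  have sub: "y \<in> A" if "y \<in> orbit \<phi> J x" "x \<in> A" for x y
  proof -
    have "fold \<phi> is x \<in> A" if "set is \<subseteq> J" for "is"
      using that \<open>x \<in> A\<close> inv by (induction "is" arbitrary: x) (auto simp: involution_on_def)
    then show ?thesis using that unfolding orbit_def by auto
  qed
  have "(S, y) \<in> (R \<union> R\<inverse>)\<^sup>* \<longleftrightarrow> y \<in> orbit \<phi> J S" for y
  proof
    assume "(S, y) \<in> (R \<union> R\<inverse>)\<^sup>*"
    then show "y \<in> orbit \<phi> J S"
    proof (induction rule: rtrancl_induct)
      case base
      then show ?case by (rule orbit_refl)
    next
      case (step y z)
      from step.hyps(2) consider j where "j \<in> J" "z = \<phi> j y" | j where "j \<in> J" "z \<in> A" "y = \<phi> j z"
        unfolding R_def by auto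
      then show ?case
      proof cases
        case 1
        then show ?thesis using orbit_step[OF step.IH] by simp
      next
        case 2
        then have "\<phi> j y = z" using inv[of j] unfolding involution_on_def by simp
        then show ?thesis using orbit_step[OF step.IH 2(1)] by simp
      qed
    qed
  next
    assume "y \<in> orbit \<phi> J S"
    then obtain "is" where i: "set is \<subseteq> J" "y = fold \<phi> is S" unfolding orbit_def by auto
    have "(x, fold \<phi> is x) \<in> (R \<union> R\<inverse>)\<^sup>*" if "x \<in> A" for x
      using i(1) that
    proof (induction "is" arbitrary: x)
      case Nil
      then show ?case by simp
    next
      case (Cons j js)
      have "(x, \<phi> j x) \<in> R" using Cons.prems unfolding R_def by auto
      moreover have "\<phi> j x \<in> A" using inv[of j] Cons.prems unfolding involution_on_def by auto
      ultimately show ?case using Cons.IH[of "\<phi> j x"] Cons.prems by (auto intro: converse_rtrancl_into_rtrancl)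
    qed
    then show "(S, y) \<in> (R \<union> R\<inverse>)\<^sup>*" using S i(2) by simp
  qed
  then show ?thesis unfolding gen_class_def R_def[symmetric] Let_def by auto
qed

lemma fold_commuting:
  assumes "\<And>u j. u \<in> W ==> j \<in> J ==> a j u \<in> W & f (a j u) = b j (f u)" "u \<in> W" "set is \<subseteq> J"
  shows "fold a is u \<in> W & f (fold a is u) = fold b is (f u)"
  using assms(2,3)
proof (induction "is" arbitrary: u)
  case (Cons i js)
  then show ?case using assms(1)[of u i] by simp
qed simp

text \<open>The moves \<open>a\<close> on the left correspond to the moves \<open>b\<close> on the right along \<open>f\<close> and preserve the complementary
  invariant \<open>g\<close>. If \<open>b\<close> is transitive on the fibres of \<open>E\<close>, then an orbit on the left is a whole fibre.\<close>

lemma orbit_bij: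
  assumes W: "\<And>u j. u \<in> W ==> j \<in> J ==> a j u \<in> W & f (a j u) = b j (f u) & g (a j u) = g u"
    and inj: "\<And>u u'. u \<in> W ==> u' \<in> W ==> f u = f u' ==> g u = g u' ==> u = u'"
    and V: "\<And>u. u \<in> W ==> f u \<in> V & E (f u) = G (g u)"
    and conn: "\<And>q. q \<in> V ==> E q = E (f u) ==> \<exists>is. set is \<subseteq> J & fold b is (f u) = q"
    and u: "u \<in> W"
  shows "bij_betw f (orbit a J u) {q \<in> V. E q = E (f u)}"
proof (rule bij_betw_imageI)
  have o: "w \<in> W & g w = g u" if w: "w \<in> orbit a J u" for w
  proof -
    obtain "is" where i: "set is \<subseteq> J" "w = fold a is u" using w unfolding orbit_def by auto
    show ?thesis using fold_commuting[of W J a g "\<lambda>j x. x", OF _ u i(1)] W i(2) by (simp add: fold_id[unfolded id_def] fun_eq_iff)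
  qed
  show "inj_on f (orbit a J u)" using o inj by (intro inj_onI) metis
  show "f ` orbit a J u = {q \<in> V. E q = E (f u)}"
  proof
    show "f ` orbit a J u \<subseteq> {q \<in> V. E q = E (f u)}" using o V u by auto
    show "{q \<in> V. E q = E (f u)} \<subseteq> f ` orbit a J u"
    proof
      fix q assume "q \<in> {q \<in> V. E q = E (f u)}"
      then obtain "is" where i: "set is \<subseteq> J" "fold b is (f u) = q" using conn by blast
      have "f (fold a is u) = q" using fold_commuting[of W J a f b, OF _ u i(1)] W i(2) by auto
      then show "q \<in> f ` orbit a J u" using i(1) unfolding orbit_def by blast
    qed
  qed
qed

lemma knuth_cases:
  fixes x y z :: nat
  assumes "x ~= y" "y ~= z" "x ~= z"
  shows "word_rel (x, y, z) (knuth (x, y, z)) \<or> word_rel (knuth (x, y, z)) (x, y, z) \<or>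
    (x < y \<longleftrightarrow> y < z) & knuth (x, y, z) = (x, y, z)"
  using assms linorder_less_linear[of x y] linorder_less_linear[of y z] linorder_less_linear[of x z]
  by (auto simp: word_rel_def)

locale local_moves = local_rules +
  fixes tri :: "int \<times> int \<times> int => int \<times> int \<times> int"
  assumes tri_mono: "(x < y \<longleftrightarrow> y < z) ==> tri (x, y, z) = (x, y, z)"
    and tri_rel3: "conf M ==> valid M [x, y, z] ==> valid M [x', y', z'] ==> rel3 (x, y, z) (x', y', z') ==>
      tri (x, y, z) = (x', y', z') & tri (x', y', z') = (x, y, z)"
begin

text \<open>A Knuth move is a Knuth relation in one of the two directions or trivial, and in the latter case the three
  contents are monotone as well.\<close>

lemma rsk_knuth:
  assumes "distinct u" "2 <= i" "i < length u"
  shows "rsk (at3 knuth i u) = (at3 tri i (fst (rsk u)), snd (rsk u))"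
proof -
  obtain s x y z r where u: "u = s @ [x, y, z] @ r" "length s = i - 2" "x = u ! (i - 2)" "y = u ! (i - 1)" "z = u ! i"
    using at3_split[OF assms(2,3)] .
  have k: "at3 knuth i u = s @ list3 (knuth (x, y, z)) @ r" using at3_append[OF u(2) assms(2), of knuth "(x, y, z)" r] u(1) by simp
  have d: "x ~= y" "y ~= z" "x ~= z" using assms(1) unfolding u(1) by auto
  have u0: "s @ list3 (x, y, z) @ r = u" using u(1) by simp
  have main: "fst (rsk (s @ list3 w' @ r)) = at3 tri i (fst (rsk (s @ list3 w @ r))) &
      fst (rsk (s @ list3 w @ r)) = at3 tri i (fst (rsk (s @ list3 w' @ r))) &
      snd (rsk (s @ list3 w' @ r)) = snd (rsk (s @ list3 w @ r))"
    if w: "word_rel w w'" "distinct (s @ list3 w @ r)" for w w'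
  proof -
    obtain q1 t t' q2 P where q: "rsk (s @ list3 w @ r) = (q1 @ list3 t @ q2, P)"
      "rsk (s @ list3 w' @ r) = (q1 @ list3 t' @ q2, P)" "length q1 = length s" "rel3 t t'"
      using rsk_word_rel[OF w(2,1)] by blast
    have d': "distinct (s @ list3 w' @ r)" using w unfolding word_rel_def by (auto simp: list3_def split: prod.splits)
    note v = rsk_valid[OF w(2) q(1)] rsk_valid[OF d' q(2)]
    obtain a b c a' b' c' where t: "t = (a, b, c)" "t' = (a', b', c')" by (cases t, cases t')
    have "conf (shape q1)" using v conf_sh[OF conf_start] valid_append by metis
    moreover have "valid (shape q1) [a, b, c]" "valid (shape q1) [a', b', c']" using v unfolding t by (auto simp: valid_append)
    ultimately have "tri t = t' & tri t' = t" using tri_rel3 q(4) unfolding t by blast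
    moreover have "length q1 = i - 2" using q(3) u(2) by simp
    ultimately have "at3 tri i (q1 @ list3 t @ q2) = q1 @ list3 t' @ q2" "at3 tri i (q1 @ list3 t' @ q2) = q1 @ list3 t @ q2"
      using at3_append[of q1 i tri t q2] at3_append[of q1 i tri t' q2] assms(2) by presburger+
    then show ?thesis unfolding q(1,2) fst_conv snd_conv by simp
  qed
  consider "word_rel (x, y, z) (knuth (x, y, z))" | "word_rel (knuth (x, y, z)) (x, y, z)" | "x < y \<longleftrightarrow> y < z" "knuth (x, y, z) = (x, y, z)"
    using knuth_cases[OF d] by blast
  then show ?thesis
  proof cases
    case 1
    note m = main[OF 1, unfolded u0 k[symmetric], OF assms(1)]
    show ?thesis
      by (rule prod_eqI) (simp_all only: fst_conv snd_conv m[THEN conjunct1] m[THEN conjunct2, THEN conjunct2])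
  next
    case 2
    have "distinct (at3 knuth i u)"
      using mset_eq_imp_distinct_iff[OF mset_at3_knuth[OF assms(2,3)]] assms(1) by simp
    note m = main[OF 2, unfolded u0 k[symmetric], OF this]
    show ?thesis
      by (rule prod_eqI) (simp_all only: fst_conv snd_conv m[THEN conjunct2, THEN conjunct1, symmetric]
        m[THEN conjunct2, THEN conjunct2])
  next
    case 3
    obtain q P where q: "rsk u = (q, P)" by fastforce
    note v = rsk_valid[OF assms(1) q]
    have "q ! (i - 2) < q ! (i - 1) \<longleftrightarrow> x < y" "q ! (i - 1) < q ! i \<longleftrightarrow> y < z"
      using v[THEN conjunct2, THEN conjunct2, THEN conjunct2, rule_format, of "i - 2"]
        v[THEN conjunct2, THEN conjunct2, THEN conjunct2, rule_format, of "i - 1"] assms(2,3) u(3-5)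
      by (auto simp: Suc_diff_Suc numeral_2_eq_2)
    then have t: "tri (q ! (i - 2), q ! (i - 1), q ! i) = (q ! (i - 2), q ! (i - 1), q ! i)" using tri_mono 3(1) by simp
    have il: "i < length q" using v assms(3) by simp
    obtain s' x' y' z' r' where q': "q = s' @ [x', y', z'] @ r'" "length s' = i - 2" "x' = q ! (i - 2)" "y' = q ! (i - 1)" "z' = q ! i"
      using at3_split[OF assms(2) il] .
    have "at3 tri i q = s' @ list3 (tri (x', y', z')) @ r'" using at3_append[OF q'(2) assms(2), of tri "(x', y', z')" r'] q'(1) by simp
    also have "\<dots> = q" using t q'(1) unfolding q'(3-5)[symmetric] by simp
    finally have "at3 tri i q = q" .
    moreover have "at3 knuth i u = u" unfolding k 3(2) by (rule u0)
    ultimately show ?thesis using q by simp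
  qed
qed

lemma rsk_shape: "distinct u ==> shape (fst (rsk u)) = shape (snd (rsk u))"
proof (induction "length u" arbitrary: u rule: less_induct)
  case less
  show ?case
  proof (cases "u = []")
    case False
    obtain zs m ys where u: "u = zs @ m # ys" "\<And>x. x \<in> set zs \<union> set ys ==> x < m"
      using split_at_max[OF False less.prems(1)] by blast
    obtain q P where q: "rsk (zs @ ys) = (q, P)" by fastforce
    obtain r p where r: "ins (length zs) q = (r, p)" by fastforce
    have d: "distinct (zs @ ys)" using less.prems u(1) by simp
    have "shape q = shape P" using less.hyps[OF _ d] u(1) q by simp
    moreover have "shape r = st p (shape q)"
      by (rule ins_valid(3)[OF _ _ r]) (use rsk_valid[OF d q] in auto)
    ultimately show ?thesis using rsk_max[OF u(2) q r] u(1) by simp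
  qed simp
qed

text \<open>Knuth classes are the fibres of the insertion tableau, hence they are in bijection with all
  recording tableaux of one shape.\<close>

lemma rsk_orbit_bij:
  assumes u: "distinct u"
    and move: "\<And>w j. mset w = mset u ==> j \<in> J ==> mset (a j w) = mset u & rsk (a j w) = (b j (fst (rsk w)), snd (rsk w))"
    and conn: "\<And>q q'. legal q ==> legal q' ==> length q = length u ==> length q' = length u ==>
      shape q = shape q' ==> \<exists>is. set is \<subseteq> J & fold b is q = q'"
  shows "bij_betw (\<lambda>w. fst (rsk w)) (orbit a J u)
    {q \<in> {q. legal q & length q = length u}. shape q = shape (fst (rsk u))}"
proof (rule orbit_bij[where W = "{w. mset w = mset u}" and g = "\<lambda>w. snd (rsk w)" and G = shape and b = b])
  have d: "distinct w" "length w = length u" "set w = set u" if "w \<in> {w. mset w = mset u}" for w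
    using that mset_eq_imp_distinct_iff[of w u] u mset_eq_length[of w u] mset_eq_setD[of w u] by auto
  have val: "legal (fst (rsk w)) & length (fst (rsk w)) = length u" if "w \<in> {w. mset w = mset u}" for w
    using rsk_valid[OF d(1)[OF that], of "fst (rsk w)" "snd (rsk w)"] d(2)[OF that] by simp
  fix w j assume w: "w \<in> {w. mset w = mset u}"
  show "j \<in> J ==> a j w \<in> {w. mset w = mset u} & fst (rsk (a j w)) = b j (fst (rsk w)) & snd (rsk (a j w)) = snd (rsk w)"
    using move[of w j] w by simp
  show "fst (rsk w) \<in> {q. legal q & length q = length u} & shape (fst (rsk w)) = shape (snd (rsk w))"
    using val[OF w] rsk_shape[OF d(1)[OF w]] by simp
  fix w' assume w': "w' \<in> {w. mset w = mset u}" "fst (rsk w) = fst (rsk w')" "snd (rsk w) = snd (rsk w')"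
  show "w = w'"
    using rsk_inj[OF d(1)[OF w] d(1)[OF w'(1)]] d(3)[OF w] d(3)[OF w'(1)] w'(2,3) by (simp add: prod_eq_iff)
next
  have "length (fst (rsk u)) = length u" "legal (fst (rsk u))"
    using rsk_valid[OF u, of "fst (rsk u)" "snd (rsk u)"] by simp_all
  then show "\<exists>is. set is \<subseteq> J & fold b is (fst (rsk u)) = q"
    if "q \<in> {q. legal q & length q = length u}" "shape q = shape (fst (rsk u))" for q
    using conn[of "fst (rsk u)" q] that by simp
qed simp

end

definition adjacent_abs :: "int => int => bool" where
  "adjacent_abs a c \<longleftrightarrow> \<bar>\<bar>a\<bar> - \<bar>c\<bar>\<bar> = 1"

fun shifted_tri :: "int \<times> int \<times> int => int \<times> int \<times> int" where
  "shifted_tri (x, y, z) =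
    (if x < y \<longleftrightarrow> y < z then (x, y, z)
     else if x = z then (x, - y, z)
     else if x < z & z < y \<or> y < z & z < x then
       (if adjacent_abs x y then (- x, - y, z) else (y, x, z))
     else (if adjacent_abs y z then (x, - y, - z) else (x, z, y)))"

text \<open>Before a diagonal is used again, both neighbouring diagonals have to grow. One hop does this only if they
  are mirror images of each other.\<close>

lemma shifted_repeat:
  assumes M: "mirrored M" "shifted.valid M [x, y, x]"
  shows "x = 0 & \<bar>y\<bar> = 1"
proof -
  let ?N = "hop2 x M"
  have a: "x - 1 \<in> hop2 y ?N" "x ~: hop2 y ?N" using M(2) by (auto simp: addable_def)
  have "x \<in> ?N" "x - 1 ~: ?N" unfolding hop2_mem by presburger+
  then have "x = y - 1 \<or> x = - y - 1" "x - 1 = y \<or> x - 1 = - y" using a unfolding hop2_mem[of _ y] by blast+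
  then show ?thesis by linarith
qed

interpretation shifted: local_moves hop2 abs mirrored shifted_rel shifted_tri
proof
  fix x y z :: int assume "(x < y) = (y < z)"
  then show "shifted_tri (x, y, z) = (x, y, z)" by simp
next
  fix M x y z x' y' z'
  assume M: "mirrored M" and v: "shifted.valid M [x, y, z]" "shifted.valid M [x', y', z']"
    and r: "shifted_rel (x, y, z) (x', y', z')"
  have rep: "x = z ==> x = 0" "x' = z' ==> x' = 0"
    using shifted_repeat[OF M] v by auto
  have a: "addable M x" "addable (hop2 x M) y" "addable M x'" "addable (hop2 x' M) y'"
    "addable (hop2 y (hop2 x M)) z" "addable (hop2 y' (hop2 x' M)) z'" using v by auto
  consider "x = 0 & y = 1 & z = 0 & x' = 0 & y' = - 1 & z' = 0" |
    "x < y" "z < y" "y' < x'" "y' < z'" "z' = z" "x' = y" "y' = x" |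
    "x < y" "z < y" "y' < x'" "y' < z'" "z' = z" "x' = - x" "y' = - y" "\<bar>\<bar>x\<bar> - \<bar>y\<bar>\<bar> = 1" "x < 0 & 0 < y \<or> y < 0 & 0 < x" |
    "x < y" "z < y" "y' < x'" "y' < z'" "x' = x" "y' = z" "z' = y" |
    "x < y" "z < y" "y' < x'" "y' < z'" "x' = x" "y' = - y" "z' = - z" "\<bar>\<bar>y\<bar> - \<bar>z\<bar>\<bar> = 1" "y < 0 & 0 < z \<or> z < 0 & 0 < y"
    using r unfolding shifted_rel_def exchanged_def by fastforce
  then show "shifted_tri (x, y, z) = (x', y', z') & shifted_tri (x', y', z') = (x, y, z)"
  proof cases
    case 1
    then show ?thesis by simp
  next
    case 2
    have ay: "addable M y" using a 2 by simp
    have "\<not> adjacent_abs x y" "\<not> adjacent_abs y x"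
      using addable_far[OF M a(1) ay exchanged_far[OF M a(1,2) ay]] unfolding adjacent_abs_def by auto
    then show ?thesis using 2 by auto
  next
    case 3
    have "adjacent_abs x y" "adjacent_abs (- x) (- y)" using 3 unfolding adjacent_abs_def by auto
    moreover have "x < 0" "0 < y" using 3 by auto
    moreover have "x ~= z" "- x ~= z" using rep 3 by auto
    moreover from calculation have "x < z" "z < - x" using 3 by linarith+
    ultimately show ?thesis using 3 by auto
  next
    case 4
    have sN: "mirrored (hop2 x M)" by (rule antisym_hop2[OF M a(1)])
    have az: "addable (hop2 x M) z" using a 4 by simp
    have "\<not> adjacent_abs y z" "\<not> adjacent_abs z y"
      using addable_far[OF sN a(2) az exchanged_far[OF sN a(2,5) az]] unfolding adjacent_abs_def by auto
    then show ?thesis using 4 by auto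
  next
    case 5
    have "adjacent_abs y z" "adjacent_abs (- y) (- z)" using 5 unfolding adjacent_abs_def by auto
    moreover have "z < 0" "0 < y" using 5 by auto
    moreover have "x ~= z" "x ~= - z" using rep 5 by auto
    moreover from calculation have "z < x" "x < - z" using 5 by linarith+
    ultimately show ?thesis using 5 by auto
  qed
qed

interpretation unshifted: local_moves hop1 id bounded_config unshifted_rel knuth
proof
  fix x y z :: int assume "(x < y) = (y < z)"
  then show "knuth (x, y, z) = (x, y, z)" by auto
next
  fix x y z x' y' z' :: int
  assume "unshifted_rel (x, y, z) (x', y', z')"
  then show "knuth (x, y, z) = (x', y', z') & knuth (x', y', z') = (x, y, z)"
    unfolding unshifted_rel_def by auto
qed


section \<open>Moves on content sequences and connectedness\<close>

fun swap_front :: "'a list => 'a list" where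
  "swap_front (x # y # r) = y # x # r"
| "swap_front u = u"

fun negate_second :: "int list => int list" where
  "negate_second (x # y # r) = x # (- y) # r"
| "negate_second u = u"

definition word_move :: "nat => nat list => nat list" where
  "word_move i u = (if i = 0 then swap_front u else at3 knuth i u)"

definition seq_move :: "nat => int list => int list" where
  "seq_move i q = (if i = 0 then negate_second q else at3 shifted_tri i q)"

text \<open>The hops 1 and -1 have the same effect, so both sequences run through the same configurations, and a larger
  letter that is pushed through them comes out with the same label.\<close>

lemma rsk_swap_front_less:
  assumes "distinct (x # y # ys)" "x < y"
  shows "\<exists>q P. shifted.rsk (x # y # ys) = (0 # 1 # q, P) & shifted.rsk (y # x # ys) = (0 # (- 1) # q, P)"
  using assms(1)
proof (induction "length ys" arbitrary: ys rule: less_induct)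
  case less
  let ?N = "hop2 0 shifted.start"
  have f0: "front shifted.start = 0" by (rule front_eqI) auto
  have f1: "front ?N = 1" by (rule front_eqI) (auto simp: hop2_mem)
  have b0: "bump ?N 0 = - 1" by (rule bump_eqI) (auto simp: hop2_mem)
  have first: "\<exists>q0. q = 0 # q0" if "shifted.rsk (x # ys) = (q, P)" "distinct (x # ys)" for q P ys
  proof -
    have "shifted.legal q" "length q = length (x # ys)" using shifted.rsk_valid[OF that(2,1)] by auto
    then show ?thesis by (cases q) (auto simp: addable_def)
  qed
  obtain us m vs where u: "x # y # ys = us @ m # vs" "\<And>z. z \<in> set us \<union> set vs ==> z < m"
    using split_at_max[OF _ less.prems] by blast
  show ?case
  proof (cases "m = y")
    case True
    have e: "us = [x]" "vs = ys"
    proof -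
      have "us ~= []" using u(1) True assms(2) by (cases us) auto
      then obtain us' where us: "us = x # us'" "y # ys = us' @ m # vs" using u(1) by (cases us) auto
      have "us' = []" using us(2) True less.prems by (cases us') auto
      then show "us = [x]" "vs = ys" using us by auto
    qed
    obtain q P where q: "shifted.rsk (x # ys) = (q, P)" by fastforce
    obtain q0 where q0: "q = 0 # q0" using first[OF q] less.prems by auto
    obtain r p where r: "shifted.push ?N 1 q0 = (r, p)" by fastforce
    have lt: "z < y" if "z \<in> set [x] \<union> set ys" for z using u(2) that e True by auto
    have "shifted.rsk ([x] @ y # ys) = ([0] @ front (shifted.shape [0]) # r, P @ [p])"
      by (rule shifted.rsk_max_cases[where q = q and ?q2.0 = q0]) (use q q0 lt less.prems r f1 in auto)
    moreover have "shifted.rsk ([] @ y # x # ys) = ([] @ front (shifted.shape []) # (- 1) # r, P @ [p])"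
    proof (rule shifted.rsk_max_cases[where q = q and ?q2.0 = "0 # q0"])
      show "shifted.push (shifted.shape []) \<bar>front (shifted.shape [])\<bar> (0 # q0) = (- 1 # r, p)"
        using r f0 b0 by (simp add: out_lab)
    qed (use q q0 lt less.prems in auto)
    ultimately show ?thesis using f0 f1 by auto
  next
    case False
    have mx: "m ~= x"
    proof
      assume "m = x"
      moreover have "y \<in> set us \<union> set (m # vs)" using u(1) by (metis list.set_intros(1,2) set_append)
      ultimately have "y < m \<or> y = m" using u(2)[of y] by auto
      then show False using \<open>m = x\<close> assms(2) by simp
    qed
    have "us ~= []" using u(1) mx by (cases us) auto
    then obtain us1 where us1: "us = x # us1" "y # ys = us1 @ m # vs" using u(1) by (cases us) auto
    have "us1 ~= []" using us1(2) False by (cases us1) auto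
    then obtain us' where us: "us = x # y # us'" "ys = us' @ m # vs" using us1 by (cases us1) auto
    have d: "distinct (x # y # us' @ vs)" using less.prems us by auto
    obtain q P where q: "shifted.rsk (x # y # us' @ vs) = (0 # 1 # q, P)" "shifted.rsk (y # x # us' @ vs) = (0 # (- 1) # q, P)"
      using less.hyps[of "us' @ vs"] us d by auto
    have lq: "length q = length (us' @ vs)" using shifted.rsk_valid[OF d q(1)] by simp
    define r1 where "r1 = take (length us') q"
    define r2 where "r2 = drop (length us') q"
    have r: "q = r1 @ r2" "length r1 = length us'" unfolding r1_def r2_def using lq by auto
    define A where "A = shifted.shape (0 # 1 # r1)"
    have A': "A = shifted.shape (0 # (- 1) # r1)" unfolding A_def by (simp add: hop2_neg[of 1, simplified])
    obtain s p where s: "shifted.push A \<bar>front A\<bar> r2 = (s, p)" by fastforce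
    have "shifted.rsk ((x # y # us') @ m # vs) = ((0 # 1 # r1) @ front A # s, P @ [p])" unfolding A_def
      by (rule shifted.rsk_max_cases[where q = "0 # 1 # q" and ?q2.0 = r2]) (use u us less.prems q r s in \<open>auto simp: A_def\<close>)
    moreover have "shifted.rsk ((y # x # us') @ m # vs) = ((0 # (- 1) # r1) @ front A # s, P @ [p])" unfolding A'
      by (rule shifted.rsk_max_cases[where q = "0 # (- 1) # q" and ?q2.0 = r2]) (use u us less.prems q r s in \<open>auto simp: A'\<close>)
    ultimately show ?thesis using us by auto
  qed
qed

lemma rsk_swap_front:
  assumes "distinct u"
  shows "shifted.rsk (swap_front u) = (negate_second (fst (shifted.rsk u)), snd (shifted.rsk u))"
proof (cases "length u <= 1")
  case False
  then obtain x u' where "u = x # u'" "u' ~= []" by (cases u) auto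
  then obtain y ys where u: "u = x # y # ys" by (cases u') auto
  have xy: "x ~= y" using assms u by auto
  then consider "x < y" | "y < x" by linarith
  then show ?thesis
  proof cases
    case 1
    then show ?thesis using rsk_swap_front_less[of x y ys] assms u by auto
  next
    case 2
    have "distinct (y # x # ys)" using assms u by auto
    then show ?thesis using rsk_swap_front_less[of y x ys] 2 u by auto
  qed
next
  case True
  obtain q P where q: "shifted.rsk u = (q, P)" by fastforce
  have "length q <= 1" using shifted.rsk_valid[OF assms q] True by simp
  then have "negate_second q = q" by (cases q rule: negate_second.cases) auto
  moreover have "swap_front u = u" using True by (cases u rule: swap_front.cases) auto
  ultimately show ?thesis using q by simp
qed

lemma rsk_word_move:
  assumes "distinct u" "i = 0 \<or> 2 <= i & i < length u"
  shows "shifted.rsk (word_move i u) = (seq_move i (fst (shifted.rsk u)), snd (shifted.rsk u))"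
proof (cases "i = 0")
  case True
  then show ?thesis unfolding word_move_def seq_move_def using rsk_swap_front[OF assms(1)] by simp
next
  case False
  then show ?thesis unfolding word_move_def seq_move_def using shifted.rsk_knuth[OF assms(1)] assms(2) by simp
qed

lemma mset_swap_front: "mset (swap_front u) = mset u"
  by (cases u rule: swap_front.cases) auto

lemma mset_word_move: "i = 0 \<or> 2 <= i & i < length u ==> mset (word_move i u) = mset u"
  unfolding word_move_def using mset_swap_front mset_at3_knuth by auto

lemma swap_front_swap_front: "swap_front (swap_front u) = u"
  by (cases u rule: swap_front.cases) auto

lemma word_move_word_move: "i = 0 \<or> 2 <= i & i < length u ==> word_move i (word_move i u) = u"
  unfolding word_move_def using at3_knuth_at3_knuth swap_front_swap_front by auto

lemma interior_removable:
  fixes M :: "int set"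
  assumes "y ~: M" "x \<in> M" "y < x"
  obtains b where "y < b" "b <= x" "b \<in> M" "b - 1 ~: M"
proof -
  have "y \<in> - M" using assms(1) by simp
  obtain m where m: "m \<in> - M" "m < x" "\<And>z. m < z ==> z < x ==> z ~: - M"
    using greatest_below[OF \<open>y \<in> - M\<close> assms(3)] by blast
  have "y <= m" using m(3)[of y] assms(1,3) by (cases "m < y") auto
  moreover have "m + 1 \<in> M" using m(2) m(3)[of "m + 1"] assms(2) by (cases "m + 1 = x") auto
  ultimately show thesis using that[of "m + 1"] m(1,2) by auto
qed


lemma fold_prefix:
  assumes "\<And>i xs. i \<in> J ==> length xs = n ==> length (a i xs) = n & a i (xs @ s) = a i xs @ s"
    and "set is \<subseteq> J" "length xs = n"
  shows "fold a is (xs @ s) = fold a is xs @ s"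
  using assms(2,3)
proof (induction "is" arbitrary: xs)
  case (Cons i js)
  then show ?case using assms(1)[of i xs] by simp
qed simp

lemma seq_move_prefix:
  assumes "i = 0 & 2 <= length xs \<or> 2 <= i & i < length xs"
  shows "length (seq_move i xs) = length xs & seq_move i (xs @ s) = seq_move i xs @ s"
proof (cases "i = 0")
  case True
  then show ?thesis using assms unfolding seq_move_def by (cases xs rule: negate_second.cases) auto
next
  case False
  then show ?thesis using assms at3_prefix length_at3 unfolding seq_move_def by auto
qed

text \<open>By induction it suffices to change the last content. If \<open>a\<close> and \<open>c\<close> are two removable hops of the shape, then after both
  of them are undone there is a removable hop \<open>b\<close> strictly in between, and the last move exchanges the endings
  \<open>b, a, c\<close> and \<open>b, c, a\<close>.\<close>

lemma unshifted_connected: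
  assumes "unshifted.legal q" "unshifted.legal q'" "length q = m" "length q' = m"
    "unshifted.shape q = unshifted.shape q'"
  shows "\<exists>is. set is \<subseteq> {2..<m} & fold (at3 knuth) is q = q'"
  using assms
proof (induction m arbitrary: q q')
  case 0
  then show ?case by (intro exI[of _ "[]"]) auto
next
  case (Suc m)
  let ?S = "unshifted.start"
  let ?C = "fold hop1 q ?S"
  have same: "\<exists>is. set is \<subseteq> {2..<Suc m} & fold (at3 knuth) is r = r'"
    if r: "unshifted.valid ?S r" "unshifted.valid ?S r'" "length r = Suc m" "length r' = Suc m"
      "fold hop1 r ?S = fold hop1 r' ?S" "last r = last r'" for r r'
  proof -
    obtain s e where s: "r = s @ [e]" "length s = m" using r(3) by (cases r rule: rev_cases) auto
    obtain s' where s': "r' = s' @ [e]" "length s' = m" using r(4,6) s by (cases r' rule: rev_cases) auto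
    have v: "unshifted.valid ?S s" "unshifted.valid ?S s'" "addable (fold hop1 s ?S) e" "addable (fold hop1 s' ?S) e"
      using r(1,2) unfolding s s' unshifted.valid_append by auto
    have "fold hop1 s ?S = fold hop1 s' ?S" using hop1_inj[OF v(3,4)] r(5) unfolding s s' by simp
    then obtain "is" where i: "set is \<subseteq> {2..<m}" "fold (at3 knuth) is s = s'"
      using Suc.IH[OF v(1,2) s(2) s'(2)] by blast
    have "fold (at3 knuth) is (s @ [e]) = fold (at3 knuth) is s @ [e]"
      by (rule fold_prefix[of "{2..<m}" m]) (use i s at3_prefix length_at3 in auto)
    then show ?thesis using i s s' by (intro exI[of _ "is"]) auto
  qed
  obtain s e where s: "q = s @ [e]" "length s = m" using Suc.prems(3) by (cases q rule: rev_cases) auto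
  obtain s' f where s': "q' = s' @ [f]" "length s' = m" using Suc.prems(4) by (cases q' rule: rev_cases) auto
  show ?case
  proof (cases "e = f")
    case True
    then show ?thesis using same[OF Suc.prems] s s' by simp
  next
    case False
    define a where "a = min e f"
    define c where "c = max e f"
    have ac: "a < c" "{a, c} = {e, f}" using False unfolding a_def c_def by auto
    have C: "?C = hop1 e (fold hop1 s ?S)" "?C = hop1 f (fold hop1 s' ?S)" using Suc.prems(5) unfolding s s' by auto
    have mem: "e \<in> ?C" "e - 1 ~: ?C" unfolding C(1) using unshifted.st_mem by auto
    have mem': "f \<in> ?C" "f - 1 ~: ?C" unfolding C(2) using unshifted.st_mem by auto
    have acC: "a \<in> ?C" "a - 1 ~: ?C" "c \<in> ?C" "c - 1 ~: ?C" using mem mem' unfolding a_def c_def min_def max_def by auto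
    have bC: "bounded_config ?C" by (rule unshifted.conf_sh[OF unshifted.conf_start Suc.prems(1)])
    obtain A1 where A1: "bounded_config A1" "addable A1 c" "hop1 c A1 = ?C" "\<And>x. x \<in> A1 \<longleftrightarrow> x = c - 1 \<or> x \<in> ?C & x ~= c"
      using unhop1[OF bC acC(3,4)] by metis
    have a1: "a \<in> A1" "a - 1 ~: A1" using A1(4) acC ac(1) by auto
    obtain A2 where A2: "bounded_config A2" "addable A2 a" "hop1 a A2 = A1" "\<And>x. x \<in> A2 \<longleftrightarrow> x = a - 1 \<or> x \<in> A1 & x ~= a"
      using unhop1[OF A1(1) a1] by metis
    have "a ~= c - 1" using acC by metis
    then have "a < c - 1" using ac(1) by linarith
    have "a ~: A2" using A2(2) unfolding addable_def by blast
    moreover have "c - 1 \<in> A2" using A2(4)[of "c - 1"] A1(4)[of "c - 1"] \<open>a ~= c - 1\<close> by blast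
    ultimately obtain b where b: "a < b" "b <= c - 1" "b \<in> A2" "b - 1 ~: A2" using interior_removable \<open>a < c - 1\<close> by blast
    obtain A3 where A3: "bounded_config A3" "addable A3 b" "hop1 b A3 = A2" using unhop1[OF A2(1) b(3,4)] by metis
    obtain r1 where r1: "unshifted.valid ?S r1" "length r1 = m" "fold hop1 r1 ?S = A1"
      using unshifted.valid_removable[OF Suc.prems(1,3) A1(1,2,3)] by blast
    have m1: "m ~= 0"
    proof
      assume "m = 0"
      then have "A1 = ?S" using r1 by simp
      then show False using a1 by auto
    qed
    then obtain m' where m': "m = Suc m'" by (cases m) auto
    obtain r2 where r2: "unshifted.valid ?S r2" "length r2 = m'" "fold hop1 r2 ?S = A2"
      using unshifted.valid_removable[OF r1(1) _ A2(1,2), of m'] A2(3) r1 m' by metis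
    have "m' ~= 0"
    proof
      assume "m' = 0"
      then have "A2 = ?S" using r2 by simp
      then show False using b by auto
    qed
    then obtain m'' where m'': "m' = Suc m''" by (cases m') auto
    obtain r3 where r3: "unshifted.valid ?S r3" "length r3 = m''" "fold hop1 r3 ?S = A3"
      using unshifted.valid_removable[OF r2(1) _ A3(1,2), of m''] A3(3) r2 m'' by metis
    have cA2: "addable A2 c"
    proof -
      have "c ~: A1" "c ~= a - 1" using A1(2) ac(1) unfolding addable_def by auto
      then have "c - 1 \<in> A2" "c ~: A2"
        using A2(4)[of "c - 1"] A1(4)[of "c - 1"] A2(4)[of c] \<open>a ~= c - 1\<close> by blast+
      then show ?thesis unfolding addable_def by blast
    qed
    have comm: "hop1 a (hop1 c A2) = ?C" "addable (hop1 c A2) a"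
      using hop1_commute[OF A2(2) cA2] ac(1) A2(3) A1(3) by auto
    define t where "t = r3 @ [b, a, c]"
    define t' where "t' = r3 @ [b, c, a]"
    have t: "unshifted.valid ?S t" "unshifted.valid ?S t'" "length t = Suc m" "length t' = Suc m"
      "fold hop1 t ?S = ?C" "fold hop1 t' ?S = ?C" "last t = c" "last t' = a"
      unfolding t_def t'_def unshifted.valid_append using r3 A3 A2 A1 cA2 comm m' m'' by auto
    have mv: "at3 knuth m t = t'" "at3 knuth m t' = t"
      using at3_append[of r3 m knuth "(b, a, c)" "[]"] at3_append[of r3 m knuth "(b, c, a)" "[]"] b r3(2) m' m''
      unfolding t_def t'_def by auto
    have m2: "m \<in> {2..<Suc m}" using m' m'' by simp
    have join: "\<exists>is. set is \<subseteq> {2..<Suc m} & fold (at3 knuth) is q = q'"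
      if "unshifted.valid ?S w" "unshifted.valid ?S w'" "length w = Suc m" "length w' = Suc m"
        "fold hop1 w ?S = ?C" "fold hop1 w' ?S = ?C" "last w = e" "last w' = f" "at3 knuth m w = w'" for w w'
    proof -
      note w = that
      obtain i1 where i1: "set i1 \<subseteq> {2..<Suc m}" "fold (at3 knuth) i1 q = w"
        using same[OF Suc.prems(1) w(1) Suc.prems(3) w(3)] w(5,7) s by auto
      obtain i2 where i2: "set i2 \<subseteq> {2..<Suc m}" "fold (at3 knuth) i2 w' = q'"
        using same[OF w(2) Suc.prems(2) w(4) Suc.prems(4)] w(6,8) s' Suc.prems(5) by auto
      show ?thesis using i1 i2 m2 w(9) by (intro exI[of _ "i1 @ m # i2"]) auto
    qed
    show ?thesis
    proof (cases "e < f")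
      case True
      then have "a = e" "c = f" unfolding a_def c_def by auto
      then show ?thesis using join[OF t(2,1,4,3,6,5)] t(7,8) mv by simp
    next
      case False
      then have "a = f" "c = e" unfolding a_def c_def by auto
      then show ?thesis using join[OF t(1,2,3,4,5,6)] t(7,8) mv by simp
    qed
  qed
qed

text \<open>A single use of the last move can change the last content from \<open>e\<close> to \<open>f\<close>.\<close>

definition linked :: "nat => int set => int => int => bool" where
  "linked m C e f \<longleftrightarrow> (\<exists>t t'. shifted.legal t & shifted.legal t' & length t = m & length t' = m &
     shifted.shape t = C & shifted.shape t' = C & last t = e & last t' = f & seq_move (m - 1) t = t')"

text \<open>Once the removable hops \<open>a < c\<close> are undone, some removable hop \<open>b\<close> lies strictly between them, and the
  endings \<open>b, a, c\<close> and \<open>b, c, a\<close> are exchanged by the last move.\<close>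

lemma linked_corners:
  assumes q: "shifted.legal q" "length q = m" "shifted.shape q = C" "2 < m"
    and ef: "e \<in> C" "e - 1 ~: C" "f \<in> C" "f - 1 ~: C" "\<bar>e\<bar> ~= \<bar>f\<bar>"
  shows "linked m C e f"
proof -
  let ?S = "shifted.start"
  obtain n where n: "m = Suc (Suc (Suc n))" using q(4) by (metis less_imp_Suc_add numeral_2_eq_2 add_Suc_right add_Suc)
  define a where "a = min e f"
  define c where "c = max e f"
  have ac: "a < c" "\<bar>a\<bar> ~= \<bar>c\<bar>" "a \<in> C" "a - 1 ~: C" "c \<in> C" "c - 1 ~: C"
    using ef unfolding a_def c_def min_def max_def by auto
  have sC: "mirrored C" using shifted.conf_sh[OF shifted.conf_start q(1)] q(3) by simp
  obtain A1 where A1: "mirrored A1" "addable A1 c" "hop2 c A1 = C" "\<And>x. x \<in> A1 \<longleftrightarrow> x = c - 1 \<or> x = - c - 1 \<or> x \<in> C & x ~= c & x ~= - c"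
    by (rule antisym_unhop2[OF sC ac(5,6)]) (rule that)
  have cC: "- c \<in> C" "- c - 1 ~: C" using antisymD[OF sC, of "c - 1"] antisymD[OF sC, of "- c - 1"] ac by auto
  have ne: "a ~= c" "a ~= - c" "a - 1 ~= c - 1" "a - 1 ~= - c - 1" using ac(2) by linarith+
  have a1: "a \<in> A1" "a - 1 ~: A1" using A1(4)[of a] A1(4)[of "a - 1"] ne ac(3,4) by blast+
  obtain A2 where A2: "mirrored A2" "addable A2 a" "hop2 a A2 = A1" "\<And>x. x \<in> A2 \<longleftrightarrow> x = a - 1 \<or> x = - a - 1 \<or> x \<in> A1 & x ~= a & x ~= - a"
    by (rule antisym_unhop2[OF A1(1) a1]) (rule that)
  have aC': "- a \<in> C" "- a - 1 ~: C" using antisymD[OF sC, of "a - 1"] antisymD[OF sC, of "- a - 1"] ac by auto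
  have "c - 1 ~= a" "c - 1 ~= - a" "c ~= a - 1" "c ~= - a - 1" using ac aC' by metis+
  moreover have "c ~: A1" using A1(2) unfolding addable_def by blast
  ultimately have c2: "c - 1 \<in> A2" and cn: "c ~: A2"
    using A2(4)[of c] A2(4)[of "c - 1"] A1(4)[of "c - 1"] by blast+
  have a2: "a ~: A2" using A2(2) unfolding addable_def by blast
  have "a ~= c - 1" using ac by auto
  then obtain b where b: "a < b" "b <= c - 1" "b \<in> A2" "b - 1 ~: A2" using interior_removable[OF a2 c2] ac(1) by auto
  obtain A3 where A3: "mirrored A3" "addable A3 b" "hop2 b A3 = A2" by (rule antisym_unhop2[OF A2(1) b(3,4)]) (rule that)
  obtain r1 where r1: "shifted.valid ?S r1" "length r1 = Suc (Suc n)" "fold hop2 r1 ?S = A1"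
    using shifted.valid_removable[OF q(1) _ A1(1,2), of "Suc (Suc n)"] A1(3) q(2,3) n by auto
  obtain r2 where r2: "shifted.valid ?S r2" "length r2 = Suc n" "fold hop2 r2 ?S = A2"
    using shifted.valid_removable[OF r1(1) _ A2(1,2), of "Suc n"] A2(3) r1(2,3) by auto
  obtain r3 where r3: "shifted.valid ?S r3" "length r3 = n" "fold hop2 r3 ?S = A3"
    using shifted.valid_removable[OF r2(1) _ A3(1,2), of "n"] A3(3) r2(2,3) by auto
  have cA2: "addable A2 c" unfolding addable_def using c2 cn by blast
  have comm: "hop2 a (hop2 c A2) = C" "addable (hop2 c A2) a"
    using hop2_commute[OF A2(1,2) cA2 ac(2)] A2(3) A1(3) by auto
  have nadj: "\<not> adjacent_abs a c" "\<not> adjacent_abs c a"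
    using addable_far[OF A2(1,2) cA2 ac(2)] unfolding adjacent_abs_def by auto
  define t where "t = r3 @ [b, a, c]"
  define t' where "t' = r3 @ [b, c, a]"
  have t: "shifted.valid ?S t" "shifted.valid ?S t'" "length t = m" "length t' = m"
    "fold hop2 t ?S = C" "fold hop2 t' ?S = C" "last t = c" "last t' = a"
    unfolding t_def t'_def shifted.valid_append using r3 A3 A2 A1 cA2 comm n by auto
  have mv: "seq_move (m - 1) t = t'" "seq_move (m - 1) t' = t"
    using at3_append[of r3 "m - 1" shifted_tri "(b, a, c)" "[]"] at3_append[of r3 "m - 1" shifted_tri "(b, c, a)" "[]"] b r3(2) n nadj
    unfolding t_def t'_def seq_move_def by auto
  show ?thesis
  proof (cases "e < f")
    case True
    then have "a = e" "c = f" unfolding a_def c_def by auto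
    then show ?thesis unfolding linked_def using t mv by blast
  next
    case False
    then have "a = f" "c = e" unfolding a_def c_def by auto
    then show ?thesis unfolding linked_def using t mv by blast
  qed
qed


text \<open>With a single corner, the mark of the last letter can be toggled directly: the letter before it can be put on a neighbouring
  diagonal \<open>y\<close>, and with a content \<open>b\<close> of small absolute value before them the last move exchanges the endings
  \<open>b, - y, t\<close> and \<open>b, y, - t\<close>.\<close>

lemma linked_opposite:
  assumes q: "shifted.legal q" "length q = m" "shifted.shape q = C" "2 < m"
    and sole: "\<And>f. f \<in> C ==> f - 1 ~: C ==> \<bar>f\<bar> = t"
    and t: "0 < t" "t \<in> C" "t - 1 ~: C"
  shows "linked m C t (- t) & linked m C (- t) t"
proof -
  let ?S = "shifted.start"
  obtain n where n: "m = Suc (Suc (Suc n))" using q(4) by (metis less_imp_Suc_add numeral_2_eq_2 add_Suc_right add_Suc)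
  have sC: "mirrored C" using shifted.conf_sh[OF shifted.conf_start q(1)] q(3) by simp
  have tC: "- t \<in> C" "- t - 1 ~: C" using antisymD[OF sC, of "t - 1"] antisymD[OF sC, of "- t - 1"] t by auto
  obtain A1 where A1: "mirrored A1" "addable A1 t" "hop2 t A1 = C" "\<And>x. x \<in> A1 \<longleftrightarrow> x = t - 1 \<or> x = - t - 1 \<or> x \<in> C & x ~= t & x ~= - t"
    by (rule antisym_unhop2[OF sC t(2,3)]) (rule that)
  obtain r1 where r1: "shifted.valid ?S r1" "length r1 = Suc (Suc n)" "fold hop2 r1 ?S = A1"
    using shifted.valid_removable[OF q(1) _ A1(1,2), of "Suc (Suc n)"] A1(3) q(2,3) n by auto
  have main: ?thesis if y: "y \<in> A1" "y - 1 ~: A1" "\<bar>y - t\<bar> = 1" "0 < y"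
    and B: "\<And>A2. mirrored A2 ==> addable A2 y ==> hop2 y A2 = A1 ==> \<exists>b. b \<in> A2 & b - 1 ~: A2 & \<bar>b\<bar> < t & \<bar>b\<bar> < y" for y
  proof -
    obtain A2 where A2: "mirrored A2" "addable A2 y" "hop2 y A2 = A1" "\<And>x. x \<in> A2 \<longleftrightarrow> x = y - 1 \<or> x = - y - 1 \<or> x \<in> A1 & x ~= y & x ~= - y"
      by (rule antisym_unhop2[OF A1(1) y(1,2)]) (rule that)
    obtain b where b: "b \<in> A2" "b - 1 ~: A2" "\<bar>b\<bar> < t" "\<bar>b\<bar> < y" using B[OF A2(1-3)] by blast
    obtain A3 where A3: "mirrored A3" "addable A3 b" "hop2 b A3 = A2" by (rule antisym_unhop2[OF A2(1) b(1,2)]) (rule that)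
    obtain r2 where r2: "shifted.valid ?S r2" "length r2 = Suc n" "fold hop2 r2 ?S = A2"
      using shifted.valid_removable[OF r1(1) _ A2(1,2), of "Suc n"] A2(3) r1(2,3) by auto
    obtain r3 where r3: "shifted.valid ?S r3" "length r3 = n" "fold hop2 r3 ?S = A3"
      using shifted.valid_removable[OF r2(1) _ A3(1,2), of "n"] A3(3) r2(2,3) by auto
    have adj: "adjacent_abs (- y) t" "adjacent_abs y (- t)" using y(3,4) t(1) unfolding adjacent_abs_def by auto
    define w where "w = r3 @ [b, - y, t]"
    define w' where "w' = r3 @ [b, y, - t]"
    have w: "shifted.valid ?S w" "shifted.valid ?S w'" "length w = m" "length w' = m"
      "fold hop2 w ?S = C" "fold hop2 w' ?S = C" "last w = t" "last w' = - t"
      unfolding w_def w'_def shifted.valid_append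
      using r3 A3 A2(1-3) A1(1-3) n addable_neg[OF A2(1), of y] addable_neg[OF A1(1), of t] by (auto simp: hop2_neg)
    have tri: "shifted_tri (b, - y, t) = (b, y, - t)" "shifted_tri (b, y, - t) = (b, - y, t)"
      using b(3,4) y(4) t(1) adj by auto
    have "seq_move (m - 1) w = w'" "seq_move (m - 1) w' = w"
      using at3_append[of r3 "m - 1" shifted_tri "(b, - y, t)" "[]"] at3_append[of r3 "m - 1" shifted_tri "(b, y, - t)" "[]"] r3(2) n tri
      unfolding w_def w'_def seq_move_def by (simp_all del: shifted_tri.simps)
    then show ?thesis unfolding linked_def using w by blast
  qed
  \<comment> \<open>once t is undone, t + 1 is removable if its site is occupied, and t - 1 otherwise\<close>
  consider "t + 1 \<in> C" | "t + 1 ~: C" "1 < t" | "t + 1 ~: C" "t = 1" using t(1) by linarith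
  then show ?thesis
  proof cases
    case 1
    show ?thesis
    proof (rule main[of "t + 1"])
      show "t + 1 \<in> A1" "t + 1 - 1 ~: A1" using 1 A1(4)[of "t + 1"] A1(2) t(1) unfolding addable_def by auto
      fix A2 assume A2: "mirrored A2" "addable A2 (t + 1)" "hop2 (t + 1) A2 = A1"
      have "t - 1 \<in> A1" using A1(2) unfolding addable_def by simp
      then have t2: "t - 1 \<in> A2" using t(1) unfolding A2(3)[symmetric] hop2_mem by auto
      then have nt: "- t ~: A2" using antisymD[OF A2(1), of "- t"] by simp
      have "- t < t - 1" using t(1) by linarith
      then obtain b where "- t < b" "b <= t - 1" "b \<in> A2" "b - 1 ~: A2" using interior_removable[OF nt t2] by blast
      then show "\<exists>b. b \<in> A2 & b - 1 ~: A2 & \<bar>b\<bar> < t & \<bar>b\<bar> < t + 1" by (intro exI[of _ b]) auto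
    qed (use t in auto)
  next
    case 2
    have t2C: "t - 2 ~: C"
    proof
      assume i: "t - 2 \<in> C"
      then have nt: "1 - t ~: C" using antisymD[OF sC, of "1 - t"] by simp
      have "1 - t < t - 2" using 2(2) by linarith
      then obtain b where "1 - t < b" "b <= t - 2" "b \<in> C" "b - 1 ~: C" using interior_removable[OF nt i] by blast
      then show False using sole[of b] by auto
    qed
    show ?thesis
    proof (rule main[of "t - 1"])
      show "t - 1 \<in> A1" using A1(2) unfolding addable_def by simp
      have "t - 1 - 1 ~= - t - 1" using t(1) by simp
      then show "t - 1 - 1 ~: A1" using t2C A1(4)[of "t - 1 - 1"] by simp
      fix A2 assume A2: "mirrored A2" "addable A2 (t - 1)" "hop2 (t - 1) A2 = A1"
      have t2: "t - 2 \<in> A2" using A2(2) unfolding addable_def by simp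
      then have nt: "1 - t ~: A2" using antisymD[OF A2(1), of "1 - t"] by simp
      have "1 - t < t - 2" using 2(2) by linarith
      then obtain b where "1 - t < b" "b <= t - 2" "b \<in> A2" "b - 1 ~: A2" using interior_removable[OF nt t2] by blast
      then show "\<exists>b. b \<in> A2 & b - 1 ~: A2 & \<bar>b\<bar> < t & \<bar>b\<bar> < t - 1" by (intro exI[of _ b]) auto
    qed (use 2 in auto)
  next
    case 3
    \<comment> \<open>here the shape has two cells only, contrary to 2 < m\<close>
    obtain s y where s: "r1 = s @ [y]" "length s = Suc n" using r1(2) by (cases r1 rule: rev_cases) auto
    obtain s' w where s': "s = s' @ [w]" using s(2) by (cases s rule: rev_cases) auto
    have v: "shifted.valid ?S s'" "addable (fold hop2 s' ?S) w" "addable (fold hop2 s ?S) y" "shifted.valid ?S s"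
      using r1(1) unfolding s s' shifted.valid_append by auto
    define A2 where "A2 = fold hop2 s ?S"
    have A2: "mirrored A2" "A1 = hop2 y A2" "A2 = hop2 w (fold hop2 s' ?S)"
      using shifted.conf_sh[OF shifted.conf_start v(4)] r1(3) unfolding A2_def s(1) s' by auto
    have far: "\<bar>f\<bar> <= 2" if "f \<in> A1" "f - 1 ~: A1" for f
    proof (rule ccontr)
      assume "\<not> \<bar>f\<bar> <= 2"
      then have "f \<in> C" "f - 1 ~: C" using that unfolding A1(3)[symmetric] hop2_mem 3(2) by auto
      then show False using sole[of f] 3 \<open>\<not> \<bar>f\<bar> <= 2\<close> by simp
    qed
    have a1: "0 \<in> A1" "1 ~: A1" "2 ~: A1"
      using A1(4)[of 0] A1(4)[of 1] A1(4)[of 2] 3 by auto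
    then have a1': "- 1 ~: A1" "- 2 \<in> A1" "- 3 \<in> A1"
      using antisymD[OF A1(1), of "- 1"] antisymD[OF A1(1), of "- 2"] antisymD[OF A1(1), of "- 3"] by auto
    have y: "y \<in> A1" "y - 1 ~: A1" unfolding A2(2) hop2_mem by presburger+
    then have "\<bar>y\<bar> <= 2" by (rule far)
    then have "y \<in> {- 2, - 1, 0, 1, 2}" by auto
    then have y0: "y = 0" using y a1 a1' by auto
    have m2: "x \<in> A2 \<longleftrightarrow> x = - 1 \<or> x \<in> A1 & x ~= 0" for x
      using v(3) unfolding A2(2) y0 hop2_mem A2_def[symmetric] addable_def by auto
    have w: "w \<in> A2" "w - 1 ~: A2" unfolding A2(3) hop2_mem by presburger+
    have "\<bar>w\<bar> <= 2"
    proof (rule ccontr)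
      assume "\<not> \<bar>w\<bar> <= 2"
      then show False using far[of w] w unfolding m2 by auto
    qed
    then have "w \<in> {- 2, - 1, 0, 1, 2}" by auto
    then show ?thesis using w a1 a1' unfolding m2 by auto
  qed
qed

text \<open>Sequences with the same last content are connected by induction without the last move. If the last contents
  lie on different diagonals, then the last move is used once; if they are opposite, then it is used
  once if there is a single corner, and otherwise twice, by way of another corner.\<close>

lemma shifted_connected:
  assumes "shifted.legal q" "shifted.legal q'" "length q = m" "length q' = m"
    "shifted.shape q = shifted.shape q'"
  shows "\<exists>is. set is \<subseteq> {0} \<union> {2..<m} & count_list is (m - 1) <= 2 & fold seq_move is q = q'"
  using assms
proof (induction m arbitrary: q q')
  case 0
  then show ?case by (intro exI[of _ "[]"]) auto
next
  case (Suc m)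
  let ?S = "shifted.start"
  let ?C = "fold hop2 q ?S"
  show ?case
  proof (cases "m <= 1")
    case True
    have "r = [0] \<or> r = [0, 1] \<or> r = [0, - 1]" if "shifted.valid ?S r" "length r = Suc m" for r
    proof -
      obtain a r' where r: "r = a # r'" "length r' = m" using \<open>length r = Suc m\<close> by (cases r) auto
      have a: "a = 0" using that(1) r by (auto simp: addable_def)
      show ?thesis
      proof (cases r')
        case Nil
        then show ?thesis using r a by simp
      next
        case (Cons b r'')
        then have "r'' = []" using r True by (cases r'') auto
        moreover have "addable (hop2 0 ?S) b" using that(1) r a Cons by simp
        then have "b = 1 \<or> b = - 1" unfolding addable_def hop2_mem by auto
        ultimately show ?thesis using r a Cons by auto
      qed
    qed
    note short = this
    have "q = q' \<or> q' = negate_second q"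
      using short[OF Suc.prems(1,3)] short[OF Suc.prems(2,4)] Suc.prems(3,4) by auto
    then show ?thesis
    proof
      assume "q = q'"
      then show ?thesis by (intro exI[of _ "[]"]) auto
    next
      assume "q' = negate_second q"
      then show ?thesis
        using count_le_length[of "[0]" m] by (intro exI[of _ "[0]"]) (auto simp: seq_move_def)
    qed
  next
    case False
    have same: "\<exists>is. set is \<subseteq> {0} \<union> {2..<m} & fold seq_move is r = r'"
      if r: "shifted.valid ?S r" "shifted.valid ?S r'" "length r = Suc m" "length r' = Suc m"
        "fold hop2 r ?S = fold hop2 r' ?S" "last r = last r'" for r r'
    proof -
      obtain s e where s: "r = s @ [e]" "length s = m" using r(3) by (cases r rule: rev_cases) auto
      obtain s' where s': "r' = s' @ [e]" "length s' = m" using r(4,6) s by (cases r' rule: rev_cases) auto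
      have v: "shifted.valid ?S s" "shifted.valid ?S s'" "addable (fold hop2 s ?S) e" "addable (fold hop2 s' ?S) e"
        using r(1,2) unfolding s s' shifted.valid_append by auto
      have "fold hop2 s ?S = fold hop2 s' ?S"
        using hop2_inj[OF shifted.conf_sh[OF shifted.conf_start v(1)] shifted.conf_sh[OF shifted.conf_start v(2)] v(3,4)] r(5)
        unfolding s s' by simp
      then obtain "is" where i: "set is \<subseteq> {0} \<union> {2..<m}" "fold seq_move is s = s'"
        using Suc.IH[OF v(1,2) s(2) s'(2)] by blast
      have "fold seq_move is (s @ [e]) = fold seq_move is s @ [e]"
        by (rule fold_prefix[of "{0} \<union> {2..<m}" m]) (use i s False seq_move_prefix in auto)
      then show ?thesis using i s s' by (intro exI[of _ "is"]) auto
    qed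
    have cnt: "count_list is m = 0" if "set is \<subseteq> {0} \<union> {2..<m}" for "is"
      using that False by (intro count_notin) auto
    have path: "\<exists>is. set is \<subseteq> {0} \<union> {2..<Suc m} & count_list is m <= 1 & fold seq_move is r = r'"
      if r: "shifted.valid ?S r" "shifted.valid ?S r'" "length r = Suc m" "length r' = Suc m"
        "fold hop2 r ?S = ?C" "fold hop2 r' ?S = ?C" "linked (Suc m) ?C (last r) (last r')" for r r'
    proof -
      obtain w w' where w: "shifted.valid ?S w" "shifted.valid ?S w'" "length w = Suc m" "length w' = Suc m"
        "fold hop2 w ?S = ?C" "fold hop2 w' ?S = ?C" "last w = last r" "last w' = last r'" "seq_move m w = w'"
        using r(7) unfolding linked_def by auto
      obtain i1 where i1: "set i1 \<subseteq> {0} \<union> {2..<m}" "fold seq_move i1 r = w" using same[OF r(1) w(1) r(3) w(3)] w(5,7) r(5) by auto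
      obtain i2 where i2: "set i2 \<subseteq> {0} \<union> {2..<m}" "fold seq_move i2 w' = r'" using same[OF w(2) r(2) w(4) r(4)] w(6,8) r(6) by auto
      show ?thesis
        using i1 i2 cnt[OF i1(1)] cnt[OF i2(1)] w(9) False by (intro exI[of _ "i1 @ m # i2"]) auto
    qed
    define e where "e = last q"
    define f where "f = last q'"
    have corner: "last r \<in> ?C & last r - 1 ~: ?C" if "length r = Suc m" "fold hop2 r ?S = ?C" for r
    proof -
      note r = that
      obtain s e where s: "r = s @ [e]" using r(1) by (cases r rule: rev_cases) auto
      show ?thesis unfolding r(2)[symmetric] s using shifted.st_mem[of e "fold hop2 s ?S"] by simp
    qed
    note ce = corner[OF Suc.prems(3) refl, folded e_def] and cf = corner[OF Suc.prems(4) Suc.prems(5)[symmetric], folded f_def]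
    have m2: "2 < Suc m" using False by simp
    note lk = linked_corners[OF Suc.prems(1,3) refl m2]
    \<comment> \<open>a single use of m suffices unless f = - e and there is another corner g\<close>
    have signs: "e = f \<or> \<bar>e\<bar> ~= \<bar>f\<bar> \<or> f = - e & e ~= 0" by linarith
    consider "e = f" | "\<bar>e\<bar> ~= \<bar>f\<bar>" | g where "f = - e" "e ~= 0" "g \<in> ?C" "g - 1 ~: ?C" "\<bar>g\<bar> ~= \<bar>e\<bar>"
      | "f = - e" "e ~= 0" "\<And>g. g \<in> ?C ==> g - 1 ~: ?C ==> \<bar>g\<bar> = \<bar>e\<bar>"
      using signs by blast
    then show ?thesis
    proof cases
      case 1
      then obtain "is" where i: "set is \<subseteq> {0} \<union> {2..<m}" "fold seq_move is q = q'"
        using same[OF Suc.prems] unfolding e_def f_def by blast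
      then show ?thesis using cnt[OF i(1)] by (intro exI[of _ "is"]) auto
    next
      case 2
      have "linked (Suc m) ?C e f" by (rule lk) (use ce cf 2 in auto)
      then show ?thesis using path[OF Suc.prems(1-4) refl Suc.prems(5)[symmetric]] unfolding e_def f_def by fastforce
    next
      case 3
      have l: "linked (Suc m) ?C e g" "linked (Suc m) ?C g f" by (rule lk; use ce cf 3 in auto)+
      obtain w where w: "shifted.valid ?S w" "length w = Suc m" "fold hop2 w ?S = ?C" "last w = g"
        using l(1) unfolding linked_def by blast
      obtain i1 where i1: "set i1 \<subseteq> {0} \<union> {2..<Suc m}" "count_list i1 m <= 1" "fold seq_move i1 q = w"
        using path[OF Suc.prems(1) w(1) Suc.prems(3) w(2) refl w(3)] l(1) w(4) unfolding e_def by auto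
      obtain i2 where i2: "set i2 \<subseteq> {0} \<union> {2..<Suc m}" "count_list i2 m <= 1" "fold seq_move i2 w = q'"
        using path[OF w(1) Suc.prems(2) w(2) Suc.prems(4) w(3) Suc.prems(5)[symmetric]] l(2) w(4) unfolding f_def by auto
      show ?thesis using i1 i2 by (intro exI[of _ "i1 @ i2"]) auto
    next
      case 4
      have "- e \<in> ?C" "- e - 1 ~: ?C" using cf 4(1) by auto
      then have "\<bar>e\<bar> \<in> ?C" "\<bar>e\<bar> - 1 ~: ?C" using ce by (auto simp: abs_if)
      then have l: "linked (Suc m) ?C \<bar>e\<bar> (- \<bar>e\<bar>) & linked (Suc m) ?C (- \<bar>e\<bar>) \<bar>e\<bar>"
        using linked_opposite[OF Suc.prems(1,3) refl m2, of "\<bar>e\<bar>"] 4 by simp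
      then have "linked (Suc m) ?C e f" using 4(1) by (cases "e < 0") auto
      then show ?thesis using path[OF Suc.prems(1-4) refl Suc.prems(5)[symmetric]] unfolding e_def f_def by fastforce
    qed
  qed
qed


section \<open>Shapes as configurations\<close>

definition young :: "cell set => bool" where
  "young I \<longleftrightarrow> finite I & (\<forall>r c. (r, c) \<in> I --> 1 <= r & 1 <= c) &
     (\<forall>r c r' c'. (r', c') \<in> I --> 1 <= r --> r <= r' --> 1 <= c --> c <= c' --> (r, c) \<in> I)"

definition shifted_young :: "cell set => bool" where
  "shifted_young I \<longleftrightarrow> finite I & (\<forall>r c. (r, c) \<in> I --> 1 <= r & r <= c) &
     (\<forall>r c r' c'. (r', c') \<in> I --> 1 <= r --> r <= r' --> r <= c --> c <= c' --> (r, c) \<in> I)"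

definition rowlen :: "cell set => nat => nat" where
  "rowlen I r = card {c. (r, c) \<in> I}"

text \<open>The Maya diagram of a shape; the empty rows above the shape give the sea of particles on the left.\<close>

definition cfg :: "cell set => int set" where
  "cfg I = (\<lambda>r. int (rowlen I r) - int r) ` {1..}"

definition doubled :: "cell set => cell set" where
  "doubled I = I \<union> prod.swap ` I"

lemma initial_segment:
  fixes A :: "nat set"
  assumes "finite A" "\<And>c. c \<in> A ==> 1 <= c" "\<And>c d. c \<in> A ==> 1 <= d ==> d <= c ==> d \<in> A"
  shows "A = {1..card A}"
proof (cases "A = {}")
  case False
  have "A = {1..Max A}"
  proof (intro set_eqI iffI)
    fix x assume "x \<in> A"
    then show "x \<in> {1..Max A}" using assms(2) Max_ge[OF assms(1)] by simp
  next
    fix x assume "x \<in> {1..Max A}"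
    then show "x \<in> A" using assms(3)[OF Max_in[OF assms(1) False]] by simp
  qed
  then show ?thesis by (metis card_atLeastAtMost diff_Suc_1)
qed simp

lemma finite_row: "finite I ==> finite {c. (r, c) \<in> I}"
  by (rule finite_subset[of _ "snd ` I"]) force+

lemma youngD: "young I ==> (r', c') \<in> I ==> 1 <= r ==> r <= r' ==> 1 <= c ==> c <= c' ==> (r, c) \<in> I"
  unfolding young_def by blast

lemma young_pos: "young I ==> (r, c) \<in> I ==> 1 <= r & 1 <= c"
  unfolding young_def by blast

lemma young_finite: "young I ==> finite I"
  unfolding young_def by blast

lemma youngI:
  assumes "finite I" "\<And>r c. (r, c) \<in> I ==> 1 <= r & 1 <= c"
    "\<And>r c r' c'. (r', c') \<in> I ==> 1 <= r ==> r <= r' ==> 1 <= c ==> c <= c' ==> (r, c) \<in> I"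
  shows "young I"
  using assms unfolding young_def by meson

lemma shifted_youngD: "shifted_young I ==> (r', c') \<in> I ==> 1 <= r ==> r <= r' ==> r <= c ==> c <= c' ==> (r, c) \<in> I"
  unfolding shifted_young_def by meson

lemma shifted_young_pos: "shifted_young I ==> (r, c) \<in> I ==> 1 <= r & r <= c"
  unfolding shifted_young_def by meson

lemma shifted_young_finite: "shifted_young I ==> finite I"
  unfolding shifted_young_def by blast

lemma shifted_youngI:
  assumes "finite I" "\<And>r c. (r, c) \<in> I ==> 1 <= r & r <= c"
    "\<And>r c r' c'. (r', c') \<in> I ==> 1 <= r ==> r <= r' ==> r <= c ==> c <= c' ==> (r, c) \<in> I"
  shows "shifted_young I"
  using assms unfolding shifted_young_def by meson

lemma young_row:
  assumes "young I" "1 <= r"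
  shows "(r, c) \<in> I \<longleftrightarrow> 1 <= c & c <= rowlen I r"
proof -
  have "{c. (r, c) \<in> I} = {1..card {c. (r, c) \<in> I}}"
  proof (rule initial_segment)
    show "finite {c. (r, c) \<in> I}" by (rule finite_row[OF young_finite[OF assms(1)]])
    show "1 <= c" if "c \<in> {c. (r, c) \<in> I}" for c using young_pos[OF assms(1)] that by blast
    show "d \<in> {c. (r, c) \<in> I}" if "c \<in> {c. (r, c) \<in> I}" "1 <= d" "d <= c" for c d
      using youngD[OF assms(1) _ assms(2) order.refl that(2,3)] that(1) by blast
  qed
  then show ?thesis unfolding rowlen_def by auto
qed

lemma rowlen_antitone:
  assumes "young I" "1 <= r" "r <= r'"
  shows "rowlen I r' <= rowlen I r"
  unfolding rowlen_def
proof (rule card_mono)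
  show "finite {c. (r, c) \<in> I}" by (rule finite_row[OF young_finite[OF assms(1)]])
  show "{c. (r', c) \<in> I} \<subseteq> {c. (r, c) \<in> I}"
    using youngD[OF assms(1) _ assms(2,3)] young_pos[OF assms(1)] by blast
qed

lemma cfg_less: "young I ==> 1 <= r ==> r < r' ==> int (rowlen I r') - int r' < int (rowlen I r) - int r"
  using rowlen_antitone[of I r r'] by simp

lemma cfg_inj_on: "young I ==> inj_on (\<lambda>r. int (rowlen I r) - int r) {1..}"
proof (rule linorder_inj_onI')
  fix i j :: nat assume "young I" "i \<in> {1..}" "i < j"
  then show "int (rowlen I i) - int i ~= int (rowlen I j) - int j" using cfg_less[of I i j] by simp
qed

lemma young_insert:
  assumes "young I" "young (insert (r, c) I)" "(r, c) ~: I"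
  shows "1 <= r" "c = rowlen I r + 1" "rowlen (insert (r, c) I) = (rowlen I)(r := c)"
proof -
  show r: "1 <= r" using young_pos[OF assms(2)] by blast
  have fin: "finite {c. (r, c) \<in> I}" by (rule finite_row[OF young_finite[OF assms(1)]])
  have "{c'. (r, c') \<in> insert (r, c) I} = insert c {c. (r, c) \<in> I}" by auto
  then have len: "rowlen (insert (r, c) I) r = rowlen I r + 1" using assms(3) fin unfolding rowlen_def by simp
  show c: "c = rowlen I r + 1"
    using young_row[OF assms(2) r, of c] young_row[OF assms(1) r, of c] assms(3) len by auto
  show "rowlen (insert (r, c) I) = (rowlen I)(r := c)"
  proof
    fix r' show "rowlen (insert (r, c) I) r' = ((rowlen I)(r := c)) r'"
    proof (cases "r' = r")
      case True
      then show ?thesis using len c by simp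
    next
      case False
      then show ?thesis unfolding rowlen_def by simp
    qed
  qed
qed

lemma cfg_insert:
  assumes "young I" "young (insert (r, c) I)" "(r, c) ~: I"
  shows "addable (cfg I) (int c - int r)" "cfg (insert (r, c) I) = hop1 (int c - int r) (cfg I)"
proof -
  note y = young_insert[OF assms]
  define f where "f = (\<lambda>r. int (rowlen I r) - int r)"
  have cI: "cfg I = f ` {1..}" unfolding cfg_def f_def ..
  have fr: "f r = int c - int r - 1" unfolding f_def using y(2) by simp
  have f': "(\<lambda>r. int (rowlen (insert (r0, c) I) r) - int r) = f(r0 := int c - int r0)" if "r0 = r" for r0
    unfolding that y(3) f_def by auto
  have cI': "cfg (insert (r, c) I) = (f(r := int c - int r)) ` {1..}" unfolding cfg_def f'[OF refl] ..
  have inj: "inj_on f {1..}" "inj_on (f(r := int c - int r)) {1..}"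
    using cfg_inj_on[OF assms(1)] cfg_inj_on[OF assms(2)] f'[OF refl] unfolding f_def by auto
  have nin: "int c - int r ~: f ` ({1..} - {r})"
  proof
    assume "int c - int r \<in> f ` ({1..} - {r})"
    then obtain s where s: "int c - int r = f s" "s \<in> {1..} - {r}" by (rule imageE)
    then show False using inj_onD[OF inj(2), of s r] y(1) by auto
  qed
  have img: "f ` {1..} = insert (f r) (f ` ({1..} - {r}))" using y(1) by auto
  have frn: "f r ~: f ` ({1..} - {r})"
    using inj(1) y(1) by (auto simp: inj_on_def)
  show "addable (cfg I) (int c - int r)"
    unfolding addable_def cI img using nin fr by auto
  have "(f(r := int c - int r)) ` {1..} = insert (int c - int r) (f ` ({1..} - {r}))"
    using y(1) by (auto simp: image_iff)
  then show "cfg (insert (r, c) I) = hop1 (int c - int r) (cfg I)"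
    unfolding cI' cI img hop1_def using frn fr by auto
qed

text \<open>The row of the hopping particle can be extended because the site \<open>e\<close> is not taken by the row below it.\<close>

lemma cfg_addable:
  assumes "young I" "addable (cfg I) e"
  obtains r c where "int c - int r = e" "(r, c) ~: I" "young (insert (r, c) I)"
proof -
  obtain r where r: "1 <= r" "int (rowlen I r) - int r = e - 1" using assms(2) unfolding addable_def cfg_def by auto
  define c where "c = rowlen I r + 1"
  have e: "int c - int r = e" using r(2) unfolding c_def by simp
  have nin: "(r, c) ~: I" using young_row[OF assms(1) r(1)] unfolding c_def by simp
  have below: "c <= rowlen I r0" if "1 <= r0" "r0 < r" for r0
  proof -
    have r1: "1 <= r - 1" using that by simp
    have "rowlen I (r - 1) ~= rowlen I r"
    proof
      assume "rowlen I (r - 1) = rowlen I r"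
      then have "e = int (rowlen I (r - 1)) - int (r - 1)" using r by simp
      then have "e \<in> cfg I" unfolding cfg_def by (rule image_eqI) (use r1 in simp)
      then show False using assms(2) unfolding addable_def by blast
    qed
    moreover have "rowlen I r <= rowlen I (r - 1)" using rowlen_antitone[OF assms(1) r1] by simp
    ultimately have "c <= rowlen I (r - 1)" unfolding c_def by simp
    also have "\<dots> <= rowlen I r0" using rowlen_antitone[OF assms(1) that(1)] that(2) by simp
    finally show ?thesis .
  qed
  have "young (insert (r, c) I)"
  proof -
    have "(r1, c1) \<in> insert (r, c) I" if "(r', c') \<in> insert (r, c) I" "1 <= r1" "r1 <= r'" "1 <= c1" "c1 <= c'" for r1 c1 r' c'
    proof (cases "(r', c') = (r, c)")
      case True
      show ?thesis
      proof (cases "r1 = r")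
        case True
        then show ?thesis using that \<open>(r', c') = (r, c)\<close> young_row[OF assms(1) r(1), of c1] unfolding c_def by auto
      next
        case False
        then have "c <= rowlen I r1" using below that True by simp
        then show ?thesis using that True young_row[OF assms(1), of r1 c1] by auto
      qed
    next
      case False
      then have "(r', c') \<in> I" using that(1) by blast
      then show ?thesis using youngD[OF assms(1) _ that(2-5)] by blast
    qed
    note closed = this
    show ?thesis
    proof (rule youngI)
      show "finite (insert (r, c) I)" using young_finite[OF assms(1)] by simp
      show "1 <= r' & 1 <= c'" if "(r', c') \<in> insert (r, c) I" for r' c'
        using that young_pos[OF assms(1), of r' c'] r(1) unfolding c_def by auto
    qed (rule closed)
  qed
  then show thesis using that e nin by blast
qed

lemma young_content_unique:
  assumes "young I" "young (insert (r, c) I)" "(r, c) ~: I" "young (insert (r', c') I)" "(r', c') ~: I"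
    "int c - int r = int c' - int r'"
  shows "(r, c) = (r', c')"
proof -
  note y = young_insert[OF assms(1-3)] and y' = young_insert[OF assms(1,4,5)]
  have "r = r'" using inj_onD[OF cfg_inj_on[OF assms(1)], of r r'] y(1,2) y'(1,2) assms(6) by simp
  then show ?thesis using assms(6) by simp
qed

lemma cfg_inj:
  assumes "young I" "young J" "cfg I = cfg J"
  shows "I = J"
proof -
  have key: "rowlen A r <= rowlen B r"
    if "young A" "young B" "cfg A = cfg B" "1 <= r" "\<And>s. 1 <= s ==> s < r ==> rowlen A s = rowlen B s" for A B r
  proof (rule ccontr)
    assume n: "\<not> rowlen A r <= rowlen B r"
    have "int (rowlen A r) - int r \<in> cfg B" using that(3,4) unfolding cfg_def by auto
    then obtain s where s: "1 <= s" "int (rowlen A r) - int r = int (rowlen B s) - int s" unfolding cfg_def by auto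
    consider "s < r" | "s = r" | "r < s" by linarith
    then show False
    proof cases
      case 1
      then show False using cfg_less[OF that(1) s(1) 1] that(5)[OF s(1) 1] s(2) by simp
    next
      case 2
      then show False using s n by simp
    next
      case 3
      then show False using cfg_less[OF that(2,4) 3] s(2) n by simp
    qed
  qed
  have "1 <= r --> rowlen I r = rowlen J r" for r
  proof (induction r rule: less_induct)
    case (less r)
    then show ?case using key[OF assms, of r] key[OF assms(2,1) assms(3)[symmetric], of r] by fastforce
  qed
  then have "(r, c) \<in> I \<longleftrightarrow> (r, c) \<in> J" for r c
    using young_row[OF assms(1), of r c] young_row[OF assms(2), of r c] young_pos[OF assms(1), of r c] young_pos[OF assms(2), of r c]
    by (cases "1 <= r") auto
  then show ?thesis by auto
qed

lemma young_empty: "young {}" "cfg {} = {..<0}"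
proof -
  show "young {}" unfolding young_def by simp
  show "cfg {} = {..<0}"
  proof -
    have "x \<in> cfg {}" if "x < 0" for x
      unfolding cfg_def rowlen_def using that by (intro image_eqI[of _ _ "nat (- x)"]) auto
    then show ?thesis unfolding cfg_def rowlen_def by auto
  qed
qed

text \<open>The cells of a standard tableau, in the order of their letters.\<close>

definition growing :: "(cell set => bool) => cell list => bool" where
  "growing P xs \<longleftrightarrow> distinct xs & (\<forall>k \<le> length xs. P (set (take k xs)))"

lemma growing_Nil: "growing P [] \<longleftrightarrow> P {}"
  unfolding growing_def by simp

lemma growing_set: "growing P xs ==> P (set xs)"
  unfolding growing_def by force

lemma growing_snoc: "growing P (xs @ [x]) \<longleftrightarrow> growing P xs & x ~: set xs & P (insert x (set xs))"
  unfolding growing_def by (auto simp: le_Suc_eq)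

fun cont :: "cell => int" where "cont (r, c) = int c - int r"

lemma growing_young_valid:
  assumes "growing young xs"
  shows "unshifted.legal (map cont xs)" "unshifted.shape (map cont xs) = cfg (set xs)"
proof -
  have "unshifted.legal (map cont xs) & unshifted.shape (map cont xs) = cfg (set xs)"
    using assms
  proof (induction xs rule: rev_induct)
    case Nil
    then show ?case using young_empty by simp
  next
    case (snoc x xs)
    obtain r c where x: "x = (r, c)" by (cases x)
    have g: "growing young xs" "x ~: set xs" "young (insert x (set xs))" using snoc.prems growing_snoc by blast+
    note c = cfg_insert[OF growing_set[OF g(1)] g(3,2)[unfolded x]]
    show ?case using snoc.IH[OF g(1)] c x by (simp add: unshifted.valid_append)
  qed
  then show "unshifted.legal (map cont xs)" "unshifted.shape (map cont xs) = cfg (set xs)" by auto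
qed

lemma valid_growing_young:
  assumes "unshifted.legal q"
  shows "\<exists>xs. growing young xs & map cont xs = q"
  using assms
proof (induction q rule: rev_induct)
  case Nil
  then show ?case using young_empty growing_Nil by auto
next
  case (snoc e q)
  then obtain xs where xs: "growing young xs" "map cont xs = q" by (auto simp: unshifted.valid_append)
  have "addable (cfg (set xs)) e" using snoc.prems growing_young_valid(2)[OF xs(1)] xs(2) by (simp add: unshifted.valid_append)
  then obtain r c where "int c - int r = e" "(r, c) ~: set xs" "young (insert (r, c) (set xs))"
    using cfg_addable[OF growing_set[OF xs(1)]] by blast
  then show ?case using xs by (intro exI[of _ "xs @ [(r, c)]"]) (simp add: growing_snoc)
qed

lemma growing_young_inj:
  assumes "growing young xs" "growing young ys" "map cont xs = map cont ys"
  shows "xs = ys"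
  using assms
proof (induction xs arbitrary: ys rule: rev_induct)
  case Nil
  then show ?case by simp
next
  case (snoc x xs)
  obtain zs y where ys: "ys = zs @ [y]" using snoc.prems(3) by (cases ys rule: rev_cases) auto
  obtain r c where x: "x = (r, c)" by (cases x)
  obtain r' c' where y: "y = (r', c')" by (cases y)
  have e: "xs = zs" by (rule snoc.IH) (use snoc.prems ys growing_snoc in auto)
  have "(r, c) = (r', c')"
    by (rule young_content_unique[of "set xs"]) (use snoc.prems ys e x y growing_snoc growing_set in auto)
  then show ?case using ys e x y by simp
qed

lemma doubled_mem: "(r, c) \<in> doubled I \<longleftrightarrow> (r, c) \<in> I \<or> (c, r) \<in> I"
  unfolding doubled_def by force

lemma young_doubled:
  assumes "shifted_young I"
  shows "young (doubled I)"
proof (rule youngI)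
  show "finite (doubled I)" using shifted_young_finite[OF assms] unfolding doubled_def by simp
  show "1 <= r & 1 <= c" if "(r, c) \<in> doubled I" for r c
    using that shifted_young_pos[OF assms, of r c] shifted_young_pos[OF assms, of c r] unfolding doubled_mem by auto
  fix r c r' c' assume h: "(r', c') \<in> doubled I" "1 <= r" "r <= r'" "1 <= c" "c <= c'"
  have "(min r c, max r c) \<in> I"
  proof (cases "(r', c') \<in> I")
    case True
    then have "r' <= c'" using shifted_young_pos[OF assms] by blast
    then show ?thesis by (intro shifted_youngD[OF assms True]) (use h in auto)
  next
    case False
    then have i: "(c', r') \<in> I" using h(1) unfolding doubled_mem by blast
    then have "c' <= r'" using shifted_young_pos[OF assms] by blast
    then show ?thesis by (intro shifted_youngD[OF assms i]) (use h in auto)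
  qed
  then show "(r, c) \<in> doubled I" unfolding doubled_mem min_def max_def by (auto split: if_splits)
qed

lemma hop1_hop1: "hop1 (- e) (hop1 e M) = hop2 e M"
proof -
  have "e ~= - e - 1" by presburger
  then show ?thesis unfolding set_eq_iff hop1_mem hop2_mem by auto
qed

text \<open>The cell and its mirror image are added one after the other; for a diagonal cell they coincide.\<close>

lemma scfg_insert:
  assumes "shifted_young I" "shifted_young (insert (r, c) I)" "(r, c) ~: I"
  shows "addable (cfg (doubled I)) (int c - int r)" "cfg (doubled (insert (r, c) I)) = hop2 (int c - int r) (cfg (doubled I))"
proof -
  have rc: "1 <= r" "r <= c" using shifted_young_pos[OF assms(2), of r c] by auto
  have yD: "young (doubled I)" by (rule young_doubled[OF assms(1)])
  have d: "doubled (insert (r, c) I) = insert (c, r) (insert (r, c) (doubled I))" unfolding doubled_def by auto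
  have yD': "young (insert (c, r) (insert (r, c) (doubled I)))" using young_doubled[OF assms(2)] d by simp
  have n: "(r, c) ~: doubled I" "(c, r) ~: doubled I"
    using assms(3) rc shifted_young_pos[OF assms(1), of c r] unfolding doubled_mem by auto
  have y1: "young (insert (r, c) (doubled I))"
  proof (cases "r = c")
    case True
    then show ?thesis using yD' by simp
  next
    case False
    show ?thesis
    proof (rule youngI)
      show "finite (insert (r, c) (doubled I))" using young_finite[OF yD] by simp
      show "1 <= r' & 1 <= c'" if "(r', c') \<in> insert (r, c) (doubled I)" for r' c'
        using that young_pos[OF yD, of r' c'] rc by auto
      fix r1 c1 r' c' assume h: "(r', c') \<in> insert (r, c) (doubled I)" "1 <= r1" "r1 <= r'" "1 <= c1" "c1 <= c'"
      show "(r1, c1) \<in> insert (r, c) (doubled I)"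
      proof (cases "(r', c') = (r, c)")
        case True
        then have "(r1, c1) \<in> insert (c, r) (insert (r, c) (doubled I))"
          using youngD[OF yD' _ h(2-5)] by blast
        moreover have "(r1, c1) ~= (c, r)" using True h False rc by auto
        ultimately show ?thesis by blast
      next
        case False
        then have "(r', c') \<in> doubled I" using h(1) by blast
        then show ?thesis using youngD[OF yD _ h(2-5)] by blast
      qed
    qed
  qed
  note c1 = cfg_insert[OF yD y1 n(1)]
  show "addable (cfg (doubled I)) (int c - int r)" by (rule c1(1))
  show "cfg (doubled (insert (r, c) I)) = hop2 (int c - int r) (cfg (doubled I))"
  proof (cases "r = c")
    case True
    have "hop1 0 M = hop2 0 M" for M unfolding hop1_def hop2_def by auto
    then show ?thesis using c1(2) d True by simp
  next
    case False
    have "(c, r) ~: insert (r, c) (doubled I)" using n False by auto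
    then have "cfg (insert (c, r) (insert (r, c) (doubled I))) = hop1 (int r - int c) (cfg (insert (r, c) (doubled I)))"
      using cfg_insert(2)[OF y1 yD'] by blast
    also have "\<dots> = hop2 (int c - int r) (cfg (doubled I))"
      using hop1_hop1[of "int c - int r" "cfg (doubled I)"] c1(2) by simp
    finally show ?thesis using d by simp
  qed
qed

lemma scfg_addable:
  assumes "shifted_young I" "addable (cfg (doubled I)) (int t)"
  obtains r c where "r <= c" "c - r = t" "(r, c) ~: I" "shifted_young (insert (r, c) I)"
proof -
  obtain r c where rc: "int c - int r = int t" "(r, c) ~: doubled I" "young (insert (r, c) (doubled I))"
    using cfg_addable[OF young_doubled[OF assms(1)] assms(2)] by blast
  have le: "r <= c" "1 <= r" using rc(1) young_pos[OF rc(3), of r c] by auto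
  have n: "(r, c) ~: I" using rc(2) unfolding doubled_mem by blast
  have "shifted_young (insert (r, c) I)"
  proof (rule shifted_youngI)
    show "finite (insert (r, c) I)" using shifted_young_finite[OF assms(1)] by simp
    show "1 <= r' & r' <= c'" if "(r', c') \<in> insert (r, c) I" for r' c'
      using that shifted_young_pos[OF assms(1), of r' c'] le by auto
    fix r1 c1 r' c' assume h: "(r', c') \<in> insert (r, c) I" "1 <= r1" "r1 <= r'" "r1 <= c1" "c1 <= c'"
    show "(r1, c1) \<in> insert (r, c) I"
    proof (cases "(r', c') = (r, c)")
      case True
      have "1 <= c1" using h by simp
      then have "(r1, c1) \<in> insert (r, c) (doubled I)" using youngD[OF rc(3), of r c r1 c1] h True by auto
      then consider "(r1, c1) = (r, c)" | "(r1, c1) \<in> I" | "(c1, r1) \<in> I" by (auto simp: doubled_mem)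
      then show ?thesis
      proof cases
        case 3
        then have "c1 <= r1" using shifted_young_pos[OF assms(1)] by blast
        then show ?thesis using 3 h(4) by auto
      qed auto
    next
      case False
      then have "(r', c') \<in> I" using h(1) by blast
      then show ?thesis using shifted_youngD[OF assms(1) _ h(2-5)] by blast
    qed
  qed
  moreover have "c - r = t" using rc(1) by simp
  ultimately show thesis using that le(1) n by blast
qed

lemma scfg_inj:
  assumes "shifted_young I" "shifted_young J" "cfg (doubled I) = cfg (doubled J)"
  shows "I = J"
proof -
  have d: "doubled I = doubled J" by (rule cfg_inj[OF young_doubled[OF assms(1)] young_doubled[OF assms(2)] assms(3)])
  have m: "(r, c) \<in> K \<longleftrightarrow> r <= c & (r, c) \<in> doubled K" if "shifted_young K" for r c K
    using shifted_young_pos[OF that, of r c] shifted_young_pos[OF that, of c r] unfolding doubled_mem by auto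
  show ?thesis using m[OF assms(1)] m[OF assms(2)] d by auto
qed

fun scont :: "cell \<times> bool => int" where
  "scont ((r, c), m) = (if m then int r - int c else int c - int r)"

definition signed_growing :: "(cell \<times> bool) list => bool" where
  "signed_growing es \<longleftrightarrow> growing shifted_young (map fst es) & (\<forall>r c. ((r, c), True) \<in> set es --> r ~= c)"

lemma signed_growing_snoc:
  "signed_growing (es @ [((r, c), m)]) \<longleftrightarrow> signed_growing es & (r, c) ~: fst ` set es &
     shifted_young (insert (r, c) (fst ` set es)) & (m --> r ~= c)"
  unfolding signed_growing_def by (auto simp: growing_snoc)

lemma signed_growing_valid:
  assumes "signed_growing es"
  shows "shifted.legal (map scont es)" "shifted.shape (map scont es) = cfg (doubled (fst ` set es))"
proof -
  have "shifted.legal (map scont es) & shifted.shape (map scont es) = cfg (doubled (fst ` set es))"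
    using assms
  proof (induction es rule: rev_induct)
    case Nil
    then show ?case using young_empty by (simp add: doubled_def)
  next
    case (snoc e es)
    obtain r c m where e: "e = ((r, c), m)" by (metis surj_pair)
    have g: "signed_growing es" "(r, c) ~: fst ` set es" "shifted_young (insert (r, c) (fst ` set es))"
      using snoc.prems signed_growing_snoc unfolding e by blast+
    have y: "shifted_young (fst ` set es)" using growing_set[of shifted_young "map fst es"] g(1) unfolding signed_growing_def by simp
    note c = scfg_insert[OF y g(3,2)]
    have ac: "mirrored (cfg (doubled (fst ` set es)))"
      using snoc.IH[OF g(1)] shifted.conf_sh[OF shifted.conf_start] by metis
    have "addable (cfg (doubled (fst ` set es))) (scont e)" "hop2 (scont e) (cfg (doubled (fst ` set es))) = cfg (doubled (fst ` set (es @ [e])))"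
      using c addable_neg[OF ac, of "int c - int r"] hop2_neg[of "int c - int r"] unfolding e by auto
    then show ?case using snoc.IH[OF g(1)] by (simp add: shifted.valid_append)
  qed
  then show "shifted.legal (map scont es)" "shifted.shape (map scont es) = cfg (doubled (fst ` set es))" by auto
qed

lemma shifted_young_empty: "shifted_young {}"
  unfolding shifted_young_def by simp

lemma valid_signed_growing:
  assumes "shifted.legal q"
  shows "\<exists>es. signed_growing es & map scont es = q"
  using assms
proof (induction q rule: rev_induct)
  case Nil
  then show ?case using shifted_young_empty by (auto simp: signed_growing_def growing_Nil)
next
  case (snoc e q)
  then obtain es where es: "signed_growing es" "map scont es = q" by (auto simp: shifted.valid_append)
  have y: "shifted_young (fst ` set es)" using growing_set[of shifted_young "map fst es"] es(1) unfolding signed_growing_def by simp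
  have ac: "mirrored (cfg (doubled (fst ` set es)))"
    using signed_growing_valid[OF es(1)] shifted.conf_sh[OF shifted.conf_start] by metis
  have "addable (cfg (doubled (fst ` set es))) e" using snoc.prems signed_growing_valid(2)[OF es(1)] es(2) by (simp add: shifted.valid_append)
  then have "addable (cfg (doubled (fst ` set es))) (int (nat \<bar>e\<bar>))" using addable_abs[OF ac] by simp
  then obtain r c where rc: "r <= c" "c - r = nat \<bar>e\<bar>" "(r, c) ~: fst ` set es" "shifted_young (insert (r, c) (fst ` set es))"
    using scfg_addable[OF y] by blast
  have "scont ((r, c), e < 0) = e" using rc(1,2) by auto
  moreover have "e < 0 --> r ~= c" using rc(2) by auto
  ultimately show ?case using es rc by (intro exI[of _ "es @ [((r, c), e < 0)]"]) (simp add: signed_growing_snoc)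
qed

text \<open>The cells of a diagonal are filled from the bottom, so the \<open>k\<close>-th letter on a diagonal is in row \<open>k\<close>.\<close>

definition cell_at :: "int list => nat => cell" where
  "cell_at q j = (let k = card {i. i <= j & \<bar>q ! i\<bar> = \<bar>q ! j\<bar>} in (k, k + nat \<bar>q ! j\<bar>))"

definition entries_of :: "int list => (cell \<times> bool) list" where
  "entries_of q = map (\<lambda>j. (cell_at q j, q ! j < 0)) [0..<length q]"

lemma abs_scont: "r <= c ==> nat \<bar>scont ((r, c), m)\<bar> = c - r"
  by auto

text \<open>A shape that contains a cell contains the part of its diagonal below it, hence contents determine cells.\<close>

lemma signed_growing_cells:
  assumes "signed_growing es"
  shows "es = entries_of (map scont es)"
proof (rule nth_equalityI)
  show "length es = length (entries_of (map scont es))" by (simp add: entries_of_def)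
  fix j assume j: "j < length es"
  let ?q = "map scont es"
  have gr: "growing shifted_young (map fst es)" using assms unfolding signed_growing_def by blast
  have dist: "distinct (map fst es)" using gr unfolding growing_def by blast
  define I where "I = set (take (Suc j) (map fst es))"
  define I' where "I' = set (take j (map fst es))"
  have yI: "shifted_young I" "shifted_young I'" using gr j unfolding growing_def I_def I'_def by auto
  obtain r c m where e: "es ! j = ((r, c), m)" by (metis surj_pair)
  have II: "I = insert (r, c) I'" unfolding I_def I'_def using j e by (simp add: take_Suc_conv_app_nth)
  have nI: "(r, c) ~: I'"
  proof
    assume "(r, c) \<in> I'"
    then obtain i where "i < j" "map fst es ! i = (r, c)" unfolding I'_def by (auto simp: in_set_conv_nth)
    then show False using dist j e nth_eq_iff_index_eq[of "map fst es" i j] by simp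
  qed
  have rc: "1 <= r" "r <= c" using shifted_young_pos[OF yI(1), of r c] II by auto
  have diag: "(a, a + (c - r)) \<in> I \<longleftrightarrow> 1 <= a & a <= r" for a
  proof
    assume h: "(a, a + (c - r)) \<in> I"
    have "a <= r"
    proof (rule ccontr)
      assume a: "\<not> a <= r"
      then have "(a, a + (c - r)) \<in> I'" using h II by auto
      then have "(r, c) \<in> I'" by (rule shifted_youngD[OF yI(2)]) (use rc a in auto)
      then show False using nI by simp
    qed
    moreover have "1 <= a" using shifted_young_pos[OF yI(1) h] by blast
    ultimately show "1 <= a & a <= r" by simp
  next
    assume h: "1 <= a & a <= r"
    have "(r, c) \<in> I" using II by simp
    then show "(a, a + (c - r)) \<in> I" by (rule shifted_youngD[OF yI(1)]) (use h rc in auto)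
  qed
  have contc: "\<bar>?q ! i\<bar> = \<bar>?q ! j\<bar> \<longleftrightarrow> snd (fst (es ! i)) = fst (fst (es ! i)) + (c - r)" if "i <= j" for i
  proof -
    obtain r' c' m' where e': "es ! i = ((r', c'), m')" by (metis surj_pair)
    have "(r', c') \<in> I" unfolding I_def set_conv_nth using that j e' by (auto intro!: exI[of _ i])
    then have "r' <= c'" using shifted_young_pos[OF yI(1)] by blast
    then show ?thesis using that j e e' rc by auto
  qed
  have "bij_betw (\<lambda>i. fst (fst (es ! i))) {i. i <= j & \<bar>?q ! i\<bar> = \<bar>?q ! j\<bar>} {1..r}"
  proof (rule bij_betwI')
    fix i i' assume h: "i \<in> {i. i <= j & \<bar>?q ! i\<bar> = \<bar>?q ! j\<bar>}" "i' \<in> {i. i <= j & \<bar>?q ! i\<bar> = \<bar>?q ! j\<bar>}"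
    show "(fst (fst (es ! i)) = fst (fst (es ! i'))) = (i = i')"
    proof
      assume "fst (fst (es ! i)) = fst (fst (es ! i'))"
      then have "fst (es ! i) = fst (es ! i')" using h contc by (auto simp: prod_eq_iff)
      then show "i = i'" using dist h j nth_eq_iff_index_eq[of "map fst es" i i'] by auto
    qed simp
  next
    fix i assume h: "i \<in> {i. i <= j & \<bar>?q ! i\<bar> = \<bar>?q ! j\<bar>}"
    have "fst (es ! i) \<in> I" unfolding I_def set_conv_nth using h j by (auto intro!: exI[of _ i])
    then have "(fst (fst (es ! i)), fst (fst (es ! i)) + (c - r)) \<in> I" using h contc by (metis (mono_tags, lifting) mem_Collect_eq prod.collapse)
    then show "fst (fst (es ! i)) \<in> {1..r}" using diag by simp
  next
    fix a assume "a \<in> {1..r}"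
    then have "(a, a + (c - r)) \<in> I" using diag by simp
    then obtain i where i: "i <= j" "fst (es ! i) = (a, a + (c - r))"
      unfolding I_def using j by (auto simp: in_set_conv_nth less_Suc_eq_le)
    then show "\<exists>i\<in>{i. i <= j & \<bar>?q ! i\<bar> = \<bar>?q ! j\<bar>}. a = fst (fst (es ! i))"
      using contc[OF i(1)] by (intro bexI[of _ i]) auto
  qed
  then have "card {i. i <= j & \<bar>?q ! i\<bar> = \<bar>?q ! j\<bar>} = r" by (simp add: bij_betw_same_card)
  moreover have "nat \<bar>?q ! j\<bar> = c - r" using j e abs_scont[OF rc(2), of m] by simp
  ultimately have "cell_at ?q j = (r, c)" unfolding cell_at_def Let_def using rc by simp
  moreover have "(?q ! j < 0) = m"
  proof -
    have "((r, c), m) \<in> set es" using e j by (metis nth_mem)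
    then have "m ==> r ~= c" using assms unfolding signed_growing_def by auto
    then show ?thesis using j e rc by auto
  qed
  ultimately show "es ! j = entries_of ?q ! j" using j e unfolding entries_of_def by simp
qed


section \<open>Fillings and their contents\<close>

lemma strict_gap:
  assumes "sorted_wrt (>) (ga :: nat list)" "i <= j" "j < length ga"
  shows "ga ! j + (j - i) <= ga ! i"
  using assms(2,3)
proof (induction j rule: dec_induct)
  case (step k)
  have "ga ! Suc k < ga ! k" using assms(1) step.prems by (simp add: sorted_wrt_iff_nth_less)
  then show ?case using step by simp
qed simp

lemma shifted_diagram_mem:
  assumes "0 ~: set ga"
  shows "(r, c) \<in> shifted_diagram ga \<longleftrightarrow> 1 <= r & r <= length ga & r <= c & c < r + ga ! (r - 1)"
proof -
  have "1 <= r ==> r <= length ga ==> 0 < ga ! (r - 1)"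
    using assms by (metis One_nat_def Suc_le_lessD diff_less gr0I less_le_trans nth_mem zero_less_Suc le_trans less_imp_diff_less Suc_pred order_less_le_trans)
  then show ?thesis unfolding shifted_diagram_def by auto
qed

lemma card_shifted_diagram:
  assumes "0 ~: set ga"
  shows "finite (shifted_diagram ga)" "card (shifted_diagram ga) = sum_list ga"
proof -
  have e: "shifted_diagram ga = Sigma {1..length ga} (\<lambda>r. {r..<r + ga ! (r - 1)})"
    using shifted_diagram_mem[OF assms] by auto
  show "finite (shifted_diagram ga)" unfolding e by auto
  have "card (shifted_diagram ga) = (\<Sum>r\<in>{1..length ga}. ga ! (r - 1))" unfolding e by simp
  also have "\<dots> = (\<Sum>i<length ga. ga ! i)"
    by (rule sum.reindex_bij_witness[of _ Suc "\<lambda>r. r - 1"]) auto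
  finally show "card (shifted_diagram ga) = sum_list ga" by (simp add: sum_list_sum_nth atLeast0LessThan)
qed

lemma shifted_diagram_young:
  assumes "strict_partition m ga"
  shows "shifted_young (shifted_diagram ga)"
proof (rule shifted_youngI)
  have g: "0 ~: set ga" "sorted_wrt (>) ga" using assms unfolding strict_partition_def by auto
  show "finite (shifted_diagram ga)" by (rule card_shifted_diagram[OF g(1)])
  show "1 <= r & r <= c" if "(r, c) \<in> shifted_diagram ga" for r c
    using that shifted_diagram_mem[OF g(1)] by auto
  fix r c r' c' assume h: "(r', c') \<in> shifted_diagram ga" "1 <= r" "r <= r'" "r <= c" "c <= c'"
  then have "ga ! (r' - 1) + (r' - 1 - (r - 1)) <= ga ! (r - 1)"
    using shifted_diagram_mem[OF g(1)] by (intro strict_gap[OF g(2)]) auto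
  then show "(r, c) \<in> shifted_diagram ga" using h shifted_diagram_mem[OF g(1)] by auto
qed

text \<open>The row lengths are strictly decreasing, as each row starts one column later than the row below and ends no later.\<close>

lemma shifted_young_is_diagram:
  assumes "shifted_young I"
  obtains ga where "strict_partition (card I) ga" "shifted_diagram ga = I"
proof -
  define l where "l = card {r. (r, r) \<in> I}"
  have fin: "finite I" by (rule shifted_young_finite[OF assms])
  have l: "{r. (r, r) \<in> I} = {1..l}" unfolding l_def
  proof (rule initial_segment)
    show "finite {r. (r, r) \<in> I}" by (rule finite_subset[of _ "fst ` I"]) (use fin in force)+
    show "1 <= c" if "c \<in> {r. (r, r) \<in> I}" for c using that shifted_young_pos[OF assms] by auto
    show "d \<in> {r. (r, r) \<in> I}" if "c \<in> {r. (r, r) \<in> I}" "1 <= d" "d <= c" for c d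
      using that shifted_youngD[OF assms, of c c d d] by auto
  qed
  define L where "L = rowlen I"
  have row: "(r, c) \<in> I \<longleftrightarrow> r <= c & c < r + L r" if r: "1 <= r" for r c
  proof -
    have inj: "inj_on (\<lambda>c. Suc c - r) {c. (r, c) \<in> I}"
      using shifted_young_pos[OF assms] by (intro inj_onI) (metis (no_types, lifting) Suc_diff_le diff_add_inverse le_add_diff_inverse mem_Collect_eq nat.inject)
    have "(\<lambda>c. Suc c - r) ` {c. (r, c) \<in> I} = {1..card ((\<lambda>c. Suc c - r) ` {c. (r, c) \<in> I})}"
    proof (rule initial_segment)
      show "finite ((\<lambda>c. Suc c - r) ` {c. (r, c) \<in> I})" using finite_row[OF fin] by simp
      show "1 <= d" if "d \<in> (\<lambda>c. Suc c - r) ` {c. (r, c) \<in> I}" for d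
        using that shifted_young_pos[OF assms] by (auto simp: Suc_diff_le)
      fix d e assume d: "d \<in> (\<lambda>c. Suc c - r) ` {c. (r, c) \<in> I}" "1 <= e" "e <= d"
      then obtain c where c: "(r, c) \<in> I" "d = Suc c - r" by auto
      have "(r, r + e - 1) \<in> I" by (rule shifted_youngD[OF assms c(1)]) (use r d(2,3) c in auto)
      then show "e \<in> (\<lambda>c. Suc c - r) ` {c. (r, c) \<in> I}" using d(2) by (intro image_eqI[of _ _ "r + e - 1"]) auto
    qed
    then have i: "(\<lambda>c. Suc c - r) ` {c. (r, c) \<in> I} = {1..L r}" unfolding L_def rowlen_def using card_image[OF inj] by simp
    show ?thesis
    proof
      assume h: "(r, c) \<in> I"
      then have "Suc c - r \<in> {1..L r}" using i by blast
      then show "r <= c & c < r + L r" using shifted_young_pos[OF assms h] by auto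
    next
      assume h: "r <= c & c < r + L r"
      then have "Suc c - r \<in> (\<lambda>c. Suc c - r) ` {c. (r, c) \<in> I}" unfolding i by auto
      then obtain c' where "(r, c') \<in> I" "Suc c - r = Suc c' - r" by auto
      moreover from this have "r <= c'" using shifted_young_pos[OF assms] by blast
      ultimately show "(r, c) \<in> I" using h by (metis Suc_diff_le diff_add_inverse le_add_diff_inverse nat.inject)
    qed
  qed
  define ga where "ga = map L [1..<Suc l]"
  have ga: "length ga = l" "\<And>r. 1 <= r ==> r <= l ==> ga ! (r - 1) = L r" unfolding ga_def by (auto simp: nth_append simp del: upt_Suc)
  have Lpos: "0 < L r" if "1 <= r" "r <= l" for r
  proof -
    have "r \<in> {r. (r, r) \<in> I}" unfolding l using that by simp
    then show ?thesis using row[OF that(1), of r] by simp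
  qed
  have z: "0 ~: set ga"
  proof
    assume "0 \<in> set ga"
    then obtain r where "r \<in> set [1..<Suc l]" "L r = 0" unfolding ga_def by (auto simp del: upt_Suc)
    then show False using Lpos[of r] by (simp del: upt_Suc)
  qed
  have less: "L r' < L r" if "1 <= r" "r < r'" "r' <= l" for r r'
  proof -
    have "(r', r' + L r' - 1) \<in> I" using row[of r' "r' + L r' - 1"] that Lpos[of r'] by auto
    then have "(r, r' + L r' - 1) \<in> I" by (rule shifted_youngD[OF assms]) (use that in auto)
    then show ?thesis using row[OF that(1), of "r' + L r' - 1"] that by linarith
  qed
  have "sorted_wrt (>) ga"
    unfolding sorted_wrt_iff_nth_less using less ga(1) unfolding ga_def by (auto simp: nth_append simp del: upt_Suc)
  moreover have d: "shifted_diagram ga = I"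
  proof -
    have "(r, c) \<in> shifted_diagram ga \<longleftrightarrow> (r, c) \<in> I" for r c
    proof
      assume "(r, c) \<in> shifted_diagram ga"
      then show "(r, c) \<in> I" using shifted_diagram_mem[OF z, of r c] row[of r c] ga by auto
    next
      assume h: "(r, c) \<in> I"
      have r1: "1 <= r" "r <= c" using shifted_young_pos[OF assms h] by auto
      have "(r, r) \<in> I" by (rule shifted_youngD[OF assms h]) (use r1 in auto)
      then have "r <= l" using l by auto
      then show "(r, c) \<in> shifted_diagram ga" using shifted_diagram_mem[OF z, of r c] row[of r c] ga r1 h by auto
    qed
    then show ?thesis by auto
  qed
  ultimately show thesis using that z card_shifted_diagram(2)[OF z] unfolding strict_partition_def by metis
qed

lemma diagram_card:
  shows "finite (diagram la)" "card (diagram la) = sum_list la"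
proof -
  have e: "diagram la = Sigma {1..length la} (\<lambda>r. {1..la ! (r - 1)})"
    unfolding diagram_def by auto
  show "finite (diagram la)" unfolding e by auto
  have "card (diagram la) = (\<Sum>r\<in>{1..length la}. la ! (r - 1))" unfolding e by simp
  also have "\<dots> = (\<Sum>i<length la. la ! i)"
    by (rule sum.reindex_bij_witness[of _ Suc "\<lambda>r. r - 1"]) auto
  finally show "card (diagram la) = sum_list la" by (simp add: sum_list_sum_nth atLeast0LessThan)
qed

lemma young_is_diagram:
  assumes "young I"
  obtains la where "is_partition (card I) la" "diagram la = I"
proof -
  define l where "l = card {r. (r, 1) \<in> I}"
  have fin: "finite I" by (rule young_finite[OF assms])
  have l: "{r. (r, 1) \<in> I} = {1..l}" unfolding l_def
  proof (rule initial_segment)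
    show "finite {r. (r, 1) \<in> I}" by (rule finite_subset[of _ "fst ` I"]) (use fin in force)+
    show "1 <= c" if "c \<in> {r. (r, 1) \<in> I}" for c using that young_pos[OF assms] by auto
    show "d \<in> {r. (r, 1) \<in> I}" if "c \<in> {r. (r, 1) \<in> I}" "1 <= d" "d <= c" for c d
      using that youngD[OF assms, of c 1 d 1] by auto
  qed
  define L where "L = rowlen I"
  have row: "(r, c) \<in> I \<longleftrightarrow> 1 <= c & c <= L r" if r: "1 <= r" for r c
    unfolding L_def by (rule young_row[OF assms r])
  define la where "la = map L [1..<Suc l]"
  have la: "length la = l" "\<And>r. 1 <= r ==> r <= l ==> la ! (r - 1) = L r" unfolding la_def by (auto simp: nth_append simp del: upt_Suc)
  have Lpos: "0 < L r" if "1 <= r" "r <= l" for r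
  proof -
    have "r \<in> {r. (r, 1) \<in> I}" unfolding l using that by simp
    then show ?thesis using row[OF that(1), of 1] by simp
  qed
  have z: "0 ~: set la"
  proof
    assume "0 \<in> set la"
    then obtain r where "r \<in> set [1..<Suc l]" "L r = 0" unfolding la_def by (auto simp del: upt_Suc)
    then show False using Lpos[of r] by (simp del: upt_Suc)
  qed
  have "sorted_wrt (\<ge>) la"
    unfolding sorted_wrt_iff_nth_less using rowlen_antitone[OF assms] la(1) unfolding la_def L_def
    by (auto simp: nth_append simp del: upt_Suc)
  moreover have d: "diagram la = I"
  proof -
    have "(r, c) \<in> diagram la \<longleftrightarrow> (r, c) \<in> I" for r c
    proof
      assume "(r, c) \<in> diagram la"
      then show "(r, c) \<in> I" using row[of r c] la unfolding diagram_def by auto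
    next
      assume h: "(r, c) \<in> I"
      have r1: "1 <= r" "1 <= c" using young_pos[OF assms h] by auto
      have "(r, 1) \<in> I" by (rule youngD[OF assms h]) (use r1 in auto)
      then have "r <= l" using l by auto
      then show "(r, c) \<in> diagram la" using row[of r c] la r1 h unfolding diagram_def by auto
    qed
    then show ?thesis by auto
  qed
  ultimately show thesis using that z diagram_card(2)[of la] unfolding is_partition_def by metis
qed

text \<open>The letters are arbitrary, as the two fillings of a concatenated tableau share the letters \<open>1, \<dots>, n\<close>.\<close>

definition fill :: "nat list => filling => bool" where
  "fill ga S \<longleftrightarrow> signed_filling ga S & inj_on (absval S) (dom S)"

definition content :: "filling => nat => int" where
  "content S k = - diagonal S k"

definition letter_list :: "filling => nat list" where
  "letter_list S = sorted_list_of_set (letters S)"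

definition contents :: "filling => int list" where
  "contents S = map (content S) (letter_list S)"

definition filling_of :: "nat list => int list => filling" where
  "filling_of L q = map_of (zip (map (cell_at q) [0..<length q]) (zip L (map (\<lambda>e. e < 0) q)))"

lemma cell_of_absval: "inj_on (absval S) (dom S) ==> x \<in> dom S ==> cell_of S (absval S x) = x"
  unfolding cell_of_def by (rule the_equality) (auto dest: inj_onD)

lemma cell_of_letter: "inj_on (absval S) (dom S) ==> k \<in> letters S ==> cell_of S k \<in> dom S & absval S (cell_of S k) = k"
  unfolding letters_def using cell_of_absval by fastforce

lemma content_scont: "content S k = scont (cell_of S k, marked S (cell_of S k))"
  unfolding content_def diagonal_def by (cases "cell_of S k") auto

lemma fill_dom:
  assumes "strict_partition m ga" "fill ga S"
  shows "dom S = shifted_diagram ga" "shifted_young (dom S)" "finite (letters S)" "card (letters S) = sum_list ga"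
proof -
  show d: "dom S = shifted_diagram ga" using assms(2) unfolding fill_def signed_filling_def by blast
  then show "shifted_young (dom S)" using shifted_diagram_young[OF assms(1)] by simp
  have "0 ~: set ga" using assms(1) unfolding strict_partition_def by blast
  then show "finite (letters S)" "card (letters S) = sum_list ga"
    using card_shifted_diagram[of ga] assms(2) d card_image[of "absval S" "dom S"] unfolding letters_def fill_def by auto
qed

lemma fill_mono:
  assumes "strict_partition m ga" "fill ga S" "(r, c) \<in> dom S" "(r', c') \<in> dom S" "r <= r'" "c <= c'"
  shows "absval S (r, c) <= absval S (r', c')"
proof -
  note d = fill_dom(2)[OF assms(1,2)]
  have r: "1 <= r" "r <= c" using shifted_young_pos[OF d assms(3)] by auto
  have m: "(r, c') \<in> dom S" by (rule shifted_youngD[OF d assms(4)]) (use assms(5,6) r in auto)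
  have sf: "signed_filling ga S" using assms(2) unfolding fill_def by blast
  have "absval S (r, c) <= absval S (r, c')"
    using sf assms(3,6) m unfolding signed_filling_def by (cases "c = c'") (auto simp: less_imp_le)
  also have "\<dots> <= absval S (r', c')"
    using sf assms(4,5) m unfolding signed_filling_def by (cases "r = r'") (auto simp: less_imp_le)
  finally show ?thesis .
qed

lemma sorted_take_down:
  assumes "sorted L" "distinct L" "a \<in> set L" "b \<in> set (take j L)" "a <= b"
  shows "a \<in> set (take j L)"
proof -
  obtain ib where ib: "ib < j" "ib < length L" "L ! ib = b" using assms(4) by (auto simp: in_set_conv_nth)
  obtain ia where ia: "ia < length L" "L ! ia = a" using assms(3) by (auto simp: in_set_conv_nth)
  have "ia <= ib"
  proof (rule ccontr)
    assume "\<not> ia <= ib"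
    then have "b <= a" using sorted_nth_mono[OF assms(1), of ib ia] ia ib by simp
    then have "L ! ia = L ! ib" using ia ib assms(5) by simp
    then show False using assms(2) ia(1) ib(2) \<open>\<not> ia <= ib\<close> nth_eq_iff_index_eq by force
  qed
  then show ?thesis using ia ib by (auto simp: in_set_conv_nth intro!: exI[of _ ia])
qed

lemma fill_entries:
  assumes "strict_partition m ga" "fill ga S"
  defines "es \<equiv> map (\<lambda>k. (cell_of S k, marked S (cell_of S k))) (letter_list S)"
  shows "signed_growing es" "fst ` set es = shifted_diagram ga" "map scont es = contents S" "es = entries_of (contents S)"
proof -
  note d = fill_dom[OF assms(1,2)]
  have inj: "inj_on (absval S) (dom S)" and sf: "signed_filling ga S" using assms(2) unfolding fill_def by auto
  have L: "set (letter_list S) = letters S" "sorted (letter_list S)" "distinct (letter_list S)"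
    unfolding letter_list_def using d(3) by auto
  have f: "map fst es = map (cell_of S) (letter_list S)" unfolding es_def by simp
  have im: "cell_of S ` K = {x \<in> dom S. absval S x \<in> K}" if "K \<subseteq> letters S" for K
  proof
    show "cell_of S ` K \<subseteq> {x \<in> dom S. absval S x \<in> K}"
    proof (rule image_subsetI)
      fix k assume k: "k \<in> K"
      then have "k \<in> letters S" using that by (rule subsetD[rotated])
      then show "cell_of S k \<in> {x \<in> dom S. absval S x \<in> K}" using cell_of_letter[OF inj] k by (metis (mono_tags, lifting) mem_Collect_eq)
    qed
    show "{x \<in> dom S. absval S x \<in> K} \<subseteq> cell_of S ` K" using cell_of_absval[OF inj] by force
  qed
  have "shifted_young (set (take j (map fst es)))" for j
  proof -
    let ?K = "set (take j (letter_list S))"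
    have K: "?K \<subseteq> letters S" using set_take_subset[of j "letter_list S"] L(1) by simp
    have e: "set (take j (map fst es)) = {x \<in> dom S. absval S x \<in> ?K}"
      unfolding f take_map set_map by (rule im[OF K])
    show ?thesis unfolding e
    proof (rule shifted_youngI)
      show "finite {x \<in> dom S. absval S x \<in> ?K}" by (rule finite_subset[OF _ shifted_young_finite[OF d(2)]]) blast
      show "1 <= r & r <= c" if "(r, c) \<in> {x \<in> dom S. absval S x \<in> ?K}" for r c
        using that shifted_young_pos[OF d(2)] by blast
      fix r c r' c' assume h: "(r', c') \<in> {x \<in> dom S. absval S x \<in> ?K}" "1 <= r" "r <= r'" "r <= c" "c <= c'"
      have "(r, c) \<in> dom S" by (rule shifted_youngD[OF d(2), of r' c']) (use h in auto)
      moreover from this have "absval S (r, c) \<in> ?K"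
        using sorted_take_down[OF L(2,3), of "absval S (r, c)" "absval S (r', c')" j] fill_mono[OF assms(1,2), of r c r' c'] h L(1)
        unfolding letters_def by auto
      ultimately show "(r, c) \<in> {x \<in> dom S. absval S x \<in> ?K}" by simp
    qed
  qed
  moreover have "distinct (map fst es)"
    unfolding f distinct_map using L cell_of_letter[OF inj] by (auto intro: inj_on_inverseI)
  moreover have "r ~= c" if "((r, c), True) \<in> set es" for r c
  proof -
    note mem = that
    obtain k where k: "k \<in> letters S" "(r, c) = cell_of S k" "marked S (cell_of S k)"
      using mem L(1) unfolding es_def by auto
    have "(r, c) \<in> dom S" "marked S (r, c)" using cell_of_letter[OF inj k(1)] k(2,3) by metis+
    then show ?thesis using sf unfolding signed_filling_def by auto
  qed
  ultimately show sg: "signed_growing es" unfolding signed_growing_def growing_def by blast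
  have "fst ` set es = cell_of S ` letters S" using f L(1) by (metis set_map)
  also have "\<dots> = dom S" using im[OF order.refl] unfolding letters_def by auto
  finally show "fst ` set es = shifted_diagram ga" using d(1) by simp
  show c: "map scont es = contents S" unfolding es_def contents_def by (simp add: content_scont comp_def)
  show "es = entries_of (contents S)" using signed_growing_cells[OF sg] c by simp
qed

lemma length_letter_list: "strict_partition m ga ==> fill ga S ==> length (letter_list S) = sum_list ga"
  using fill_dom unfolding letter_list_def by simp

lemma fill_contents_valid:
  assumes "strict_partition m ga" "fill ga S"
  shows "shifted.legal (contents S)"
    "shifted.shape (contents S) = cfg (doubled (shifted_diagram ga))"
    "length (contents S) = sum_list ga"
  using signed_growing_valid[OF fill_entries(1)[OF assms], unfolded fill_entries(2,3)[OF assms]] length_letter_list[OF assms]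
  by (simp_all add: contents_def)

text \<open>A filling is determined by its letters and contents, which reduces equations between fillings to equations between sequences.\<close>

lemma fill_normal_form:
  assumes "strict_partition m ga" "fill ga S"
  shows "S = filling_of (letter_list S) (contents S)"
proof -
  note e = fill_entries[OF assms]
  have inj: "inj_on (absval S) (dom S)" using assms(2) unfolding fill_def by auto
  let ?L = "letter_list S" and ?q = "contents S"
  have len: "length ?q = length ?L" unfolding contents_def by simp
  have L: "set ?L = letters S" unfolding letter_list_def using fill_dom[OF assms] by auto
  have nth: "(cell_of S (?L ! j), marked S (cell_of S (?L ! j))) = (cell_at ?q j, ?q ! j < 0)" if "j < length ?L" for j
  proof -
    note h = arg_cong[OF e(4), of "\<lambda>es. es ! j"]
    have "cell_of S (?L ! j) = cell_at ?q j" using arg_cong[OF h, of fst] that len unfolding entries_of_def by simp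
    moreover have "marked S (cell_of S (?L ! j)) = (?q ! j < 0)" using arg_cong[OF h, of snd] that len unfolding entries_of_def by simp
    ultimately show ?thesis by blast
  qed
  have c: "map (cell_at ?q) [0..<length ?q] = map (cell_of S) ?L"
    by (rule nth_equalityI) (use nth len in auto)
  have mk: "marked S (cell_of S (?L ! j)) = (?q ! j < 0)" if "j < length ?L" for j using nth[OF that] by blast
  have z: "zip ?L (map (\<lambda>e. e < 0) ?q) = map (\<lambda>k. (k, marked S (cell_of S k))) ?L"
    by (rule nth_equalityI) (use mk len in auto)
  have "filling_of ?L ?q = map_of (map (\<lambda>k. (cell_of S k, (k, marked S (cell_of S k)))) ?L)"
    unfolding filling_of_def c z by (simp add: zip_map_map zip_same_conv_map comp_def)
  also have "\<dots> = S"
  proof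
    fix x
    have k: "\<And>k. k \<in> letters S ==> S (cell_of S k) = Some (k, marked S (cell_of S k))"
    proof -
      fix k assume "k \<in> letters S"
      then have "cell_of S k \<in> dom S" "absval S (cell_of S k) = k" using cell_of_letter[OF inj] by auto
      then show "S (cell_of S k) = Some (k, marked S (cell_of S k))" unfolding absval_def marked_def by (auto simp: dom_def)
    qed
    show "map_of (map (\<lambda>k. (cell_of S k, (k, marked S (cell_of S k)))) ?L) x = S x"
    proof (cases "S x")
      case None
      then have "x ~: fst ` set (map (\<lambda>k. (cell_of S k, (k, marked S (cell_of S k)))) ?L)" using L k by force
      then show ?thesis using None by (simp add: map_of_eq_None_iff[THEN iffD2])
    next
      case (Some y)
      then have xd: "x \<in> dom S" by blast
      define k where "k = absval S x"
      have kk: "k \<in> letters S" "cell_of S k = x" using xd cell_of_absval[OF inj xd] unfolding k_def letters_def by auto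
      have d: "distinct (map fst (map (\<lambda>k. (cell_of S k, (k, marked S (cell_of S k)))) ?L))"
        using e(1) unfolding signed_growing_def growing_def by (simp add: comp_def)
      have "(x, (k, marked S x)) \<in> set (map (\<lambda>k. (cell_of S k, (k, marked S (cell_of S k)))) ?L)" using kk L by auto
      then show ?thesis using map_of_is_SomeI[OF d] k[OF kk(1)] kk(2) by simp
    qed
  qed
  finally show ?thesis by simp
qed

lemma filling_of_fill:
  assumes ga: "strict_partition m ga" and q: "shifted.legal q" "shifted.shape q = cfg (doubled (shifted_diagram ga))"
    and L: "sorted L" "distinct L" "length L = length q"
  shows "fill ga (filling_of L q)" "letter_list (filling_of L q) = L" "contents (filling_of L q) = q" "letters (filling_of L q) = set L"
proof -
  obtain es where es: "signed_growing es" "map scont es = q" using valid_signed_growing[OF q(1)] by blast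
  have ee: "es = entries_of q" using signed_growing_cells[OF es(1)] es(2) by simp
  have gr: "growing shifted_young (map fst es)" using es(1) unfolding signed_growing_def by blast
  have cells: "map fst es = map (cell_at q) [0..<length q]" unfolding ee entries_of_def by simp
  have dc: "distinct (map (cell_at q) [0..<length q])" using gr cells unfolding growing_def by simp
  have yes: "shifted_young (fst ` set es)" using growing_set[OF gr] by simp
  have D: "fst ` set es = shifted_diagram ga"
    by (rule scfg_inj[OF yes shifted_diagram_young[OF ga]]) (use signed_growing_valid(2)[OF es(1)] es(2) q(2) in simp)
  let ?S = "filling_of L q"
  have sv: "?S (cell_at q j) = Some (L ! j, q ! j < 0)" if "j < length q" for j
    unfolding filling_of_def
    by (rule map_of_is_SomeI) (use dc that L(3) in \<open>auto simp: in_set_zip intro!: exI[of _ j]\<close>)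
  have domS: "dom ?S = cell_at q ` {0..<length q}"
  proof -
    have "dom ?S = set (map fst (zip (map (cell_at q) [0..<length q]) (zip L (map (\<lambda>e. e < 0) q))))"
      unfolding filling_of_def by (simp only: dom_map_of_conv_image_fst set_map)
    also have "\<dots> = set (map (cell_at q) [0..<length q])" using L(3) by (subst map_fst_zip) auto
    finally show ?thesis by simp
  qed
  have dom2: "dom ?S = shifted_diagram ga"
    unfolding domS D[symmetric] using cells by (metis atLeastLessThan_upt set_map)
  have ci: "cell_at q i = cell_at q j \<longleftrightarrow> i = j" if "i < length q" "j < length q" for i j
    using nth_eq_iff_index_eq[OF dc, of i j] that by simp
  have av: "absval ?S (cell_at q j) = L ! j" "marked ?S (cell_at q j) = (q ! j < 0)" if "j < length q" for j
    using sv[OF that] unfolding absval_def marked_def by auto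
  have inj: "inj_on (absval ?S) (dom ?S)"
    unfolding domS
  proof (rule inj_onI)
    fix x y assume "x \<in> cell_at q ` {0..<length q}" "y \<in> cell_at q ` {0..<length q}" "absval ?S x = absval ?S y"
    then obtain i j where "x = cell_at q i" "y = cell_at q j" "i < length q" "j < length q" "absval ?S x = absval ?S y" by force
    then show "x = y" using av L(3) nth_eq_iff_index_eq[OF L(2), of i j] by simp
  qed
  have le: "absval ?S (r, c) < absval ?S (r', c')"
    if h: "(r, c) \<in> dom ?S" "(r', c') \<in> dom ?S" "r <= r'" "c <= c'" "(r, c) ~= (r', c')" for r c r' c'
  proof -
    obtain i j where ij: "i < length q" "j < length q" "(r, c) = cell_at q i" "(r', c') = cell_at q j"
      using h(1,2) unfolding domS by auto
    have "length (map fst es) = length q" using es(2) by auto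
    then have y: "shifted_young (set (take (Suc j) (map fst es)))" using gr ij(2) unfolding growing_def by auto
    have tk: "take (Suc j) [0..<length q] = [0..<Suc j]" using ij(2) by (simp add: take_upt del: upt_Suc)
    have "(r', c') \<in> set (take (Suc j) (map fst es))"
      unfolding cells ij(4) using ij(2) by (auto simp: take_map)
    then have "(r, c) \<in> set (take (Suc j) (map fst es))"
      using shifted_youngD[OF y _ _ h(3) _ h(4)] shifted_young_pos[OF shifted_diagram_young[OF ga]] h(1) dom2 by blast
    then have "(r, c) \<in> cell_at q ` {0..<Suc j}" unfolding cells take_map set_map tk atLeastLessThan_upt .
    then obtain i' where "(r, c) = cell_at q i'" "i' \<in> {0..<Suc j}" by (rule imageE)
    then have i': "i' <= j" "cell_at q i' = cell_at q i" using ij(3) by simp_all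
    then have "i <= j" using ci[of i' i] ij(1,2) by simp
    moreover have "i ~= j" using ij h(5) by auto
    ultimately have "L ! i < L ! j" using L ij sorted_nth_mono[OF L(1), of i j] nth_eq_iff_index_eq[OF L(2), of i j] by simp
    then show ?thesis using av ij by metis
  qed
  have nd: "\<not> marked ?S (r, r)" if "(r, r) \<in> dom ?S" for r
  proof -
    have "(r, r) \<in> cell_at q ` {0..<length q}" using that unfolding domS .
    then obtain j where j: "j < length q" "(r, r) = cell_at q j" by auto
    then have "((r, r), q ! j < 0) \<in> set es" unfolding ee entries_of_def by auto
    then have "\<not> q ! j < 0" using es(1) unfolding signed_growing_def by metis
    then show ?thesis using av(2)[OF j(1)] j(2) by simp
  qed
  show "fill ga ?S" unfolding fill_def signed_filling_def using dom2 inj le nd by auto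
  show lt: "letters ?S = set L" unfolding letters_def domS image_image set_conv_nth using av L(3) by (auto simp: image_iff)
  show ll: "letter_list ?S = L" unfolding letter_list_def lt using L by (simp add: sorted_list_of_set.idem_if_sorted_distinct)
  show "contents ?S = q"
  proof (rule nth_equalityI)
    show "length (contents ?S) = length q" unfolding contents_def ll using L(3) by simp
    fix j assume "j < length (contents ?S)"
    then have j: "j < length q" unfolding contents_def ll using L(3) by simp
    have "cell_of ?S (L ! j) = cell_at q j"
      using cell_of_absval[OF inj, of "cell_at q j"] av(1)[OF j] j unfolding domS by simp
    then have "contents ?S ! j = scont (cell_at q j, q ! j < 0)" unfolding contents_def ll using j L(3) av(2) content_scont by simp
    also have "\<dots> = map scont es ! j" unfolding ee entries_of_def using j by simp
    finally show "contents ?S ! j = q ! j" unfolding es(2) .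
  qed
qed


section \<open>The maps d on content sequences\<close>

lemma seq_move_valid:
  assumes "shifted.legal q" "i = 0 \<or> 2 <= i & i < length q"
  shows "shifted.legal (seq_move i q)" "shifted.shape (seq_move i q) = shifted.shape q"
    "length (seq_move i q) = length q"
proof -
  obtain u where u: "distinct u" "fst (shifted.rsk u) = q" using shifted.rsk_surj[OF assms(1)] by blast
  obtain P where P: "shifted.rsk u = (q, P)" using u(2) by (metis prod.collapse)
  have lu: "length q = length u" using shifted.rsk_valid[OF u(1) P] by blast
  have i: "i = 0 \<or> 2 <= i & i < length u" using assms(2) lu by simp
  have m: "shifted.rsk (word_move i u) = (seq_move i q, P)" using rsk_word_move[OF u(1) i] P by simp
  have d: "distinct (word_move i u)" using mset_eq_imp_distinct_iff[OF mset_word_move[OF i]] u(1) by simp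
  have l: "length (word_move i u) = length u" using mset_eq_length[OF mset_word_move[OF i]] .
  show "shifted.legal (seq_move i q)" "length (seq_move i q) = length q"
    using shifted.rsk_valid[OF d m] l lu by auto
  show "shifted.shape (seq_move i q) = shifted.shape q"
    using shifted.rsk_shape[OF d] shifted.rsk_shape[OF u(1)] m P by simp
qed

text \<open>A recursive form of \<open>cell_at\<close>, for cells that follow a given initial part.\<close>

fun cells_from :: "int list => int list => cell list" where
  "cells_from s [] = []"
| "cells_from s (e # t) =
    (let k = Suc (length (filter (\<lambda>f. \<bar>f\<bar> = \<bar>e\<bar>) s)) in (k, k + nat \<bar>e\<bar>)) # cells_from (s @ [e]) t"

lemma cell_at_filter:
  assumes "j < length q"
  shows "cell_at q j = (let k = length (filter (\<lambda>e. \<bar>e\<bar> = \<bar>q ! j\<bar>) (take (Suc j) q)) in (k, k + nat \<bar>q ! j\<bar>))"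
proof -
  have "length (filter (\<lambda>e. \<bar>e\<bar> = \<bar>q ! j\<bar>) (take (Suc j) q)) = card {i. i <= j & \<bar>q ! i\<bar> = \<bar>q ! j\<bar>}"
    unfolding length_filter_conv_card using assms by (intro arg_cong[where f = card]) (auto simp: less_Suc_eq_le)
  then show ?thesis unfolding cell_at_def by simp
qed

lemma cells_from_cell_at: "map (cell_at (s @ t)) [length s..<length (s @ t)] = cells_from s t"
proof (induction t arbitrary: s)
  case (Cons e t)
  have u: "[length s..<length (s @ e # t)] = length s # [length (s @ [e])..<length ((s @ [e]) @ t)]"
    by (simp add: upt_conv_Cons del: upt_Suc)
  have "cell_at (s @ e # t) (length s) = hd (cells_from s (e # t))"
    by (subst cell_at_filter) (auto simp: Let_def)
  then show ?case unfolding u using Cons.IH[of "s @ [e]"] by simp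
qed simp

lemma cells_from_cong:
  assumes "\<And>x. length (filter (\<lambda>f. \<bar>f\<bar> = x) s) = length (filter (\<lambda>f. \<bar>f\<bar> = x) s')"
  shows "cells_from s t = cells_from s' t"
  using assms
proof (induction t arbitrary: s s')
  case (Cons e t)
  have "cells_from (s @ [e]) t = cells_from (s' @ [e]) t" by (rule Cons.IH) (simp add: Cons.prems)
  then show ?case using Cons.prems[of "\<bar>e\<bar>"] by simp
qed simp

lemma cells_from_append: "cells_from s (t @ t') = cells_from s t @ cells_from (s @ t) t'"
  by (induction t arbitrary: s) auto

lemma cells_from_abs: "map abs t = map abs t' ==> cells_from s t = cells_from s t'"
proof (induction t arbitrary: s t')
  case (Cons e t)
  then obtain e' u where t': "t' = e' # u" "\<bar>e'\<bar> = \<bar>e\<bar>" "map abs t = map abs u" by (cases t') auto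
  have "cells_from (s @ [e]) t = cells_from (s @ [e]) u" by (rule Cons.IH[OF t'(3)])
  also have "\<dots> = cells_from (s @ [e']) u" by (rule cells_from_cong) (auto simp: t'(2))
  finally show ?case unfolding t'(1) by (simp add: t'(2) del: cells_from.simps(1))
qed simp

lemma filling_of_cells: "filling_of L q = map_of (zip (cells_from [] q) (zip L (map (\<lambda>e. e < 0) q)))"
  using cells_from_cell_at[of "[]" q] unfolding filling_of_def by simp

lemma length_cells_from [simp]: "length (cells_from s t) = length t"
  by (induction t arbitrary: s) auto

lemma map_option_filling: "(\<lambda>x. map_option f (map_of (zip cs vs) x)) = map_of (zip cs (map f vs))"
  by (simp add: zip_map2 fun_eq_iff map_of_map[symmetric, unfolded comp_def] case_prod_beta' del: map_of_zip_map)

lemma toggle_filling_of: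
  assumes "length L1 = length s" "length L2 = length r" "k ~: set L1" "k ~: set L2" "e ~= 0"
  shows "toggle k (filling_of (L1 @ k # L2) (s @ e # r)) = filling_of (L1 @ k # L2) (s @ (- e) # r)"
proof -
  let ?f = "\<lambda>(v, m). (v, if v = k then \<not> m else m)"
  have c: "cells_from [] (s @ (- e) # r) = cells_from [] (s @ e # r)" by (rule cells_from_abs) simp
  have id: "map ?f (zip L M) = zip L M" if "k ~: set L" for L M
    by (rule map_idI) (use that in \<open>auto split: if_splits dest: set_zip_leftD\<close>)
  have "map ?f (zip (L1 @ k # L2) (map (\<lambda>e. e < 0) (s @ e # r))) = zip (L1 @ k # L2) (map (\<lambda>e. e < 0) (s @ (- e) # r))"
    using assms id by auto
  then show ?thesis unfolding toggle_def filling_of_cells map_option_filling c by simp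
qed

lemma swap_abs_filling_of: "swap_abs j k (filling_of L q) = filling_of (map (transpose j k) L) q"
proof -
  have "map (\<lambda>(v, m). (transpose j k v, m)) (zip L M) = zip (map (transpose j k) L) M" for M :: "bool list"
    by (simp add: zip_map1 case_prod_beta')
  then show ?thesis unfolding swap_abs_def filling_of_cells map_option_filling by (simp only: length_map)
qed

lemma map_of_swap: "x ~= y ==> map_of (ps @ (x, u) # (y, w) # rs) = map_of (ps @ (y, w) # (x, u) # rs)"
  by (rule ext) (auto simp: map_add_def split: option.splits)

text \<open>Cells on different diagonals do not depend on each other's order.\<close>

lemma filling_of_swap:
  assumes "length L1 = length s" "\<bar>a\<bar> ~= \<bar>c\<bar>"
  shows "filling_of (L1 @ k # l # L2) (s @ a # c # r) = filling_of (L1 @ l # k # L2) (s @ c # a # r)"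
proof -
  define x where "x = (let k = Suc (length (filter (\<lambda>f. \<bar>f\<bar> = \<bar>a\<bar>) s)) in (k, k + nat \<bar>a\<bar>))"
  define y where "y = (let k = Suc (length (filter (\<lambda>f. \<bar>f\<bar> = \<bar>c\<bar>) s)) in (k, k + nat \<bar>c\<bar>))"
  have "x ~= y"
  proof
    assume "x = y"
    then have "nat \<bar>a\<bar> = nat \<bar>c\<bar>" unfolding x_def y_def by (auto simp: Let_def)
    then show False using assms(2) by simp
  qed
  have e: "cells_from (s @ [a, c]) r = cells_from (s @ [c, a]) r" by (rule cells_from_cong) simp
  have f: "cells_from [] (s @ a # c # r) = cells_from [] s @ x # y # cells_from (s @ [a, c]) r"
    "cells_from [] (s @ c # a # r) = cells_from [] s @ y # x # cells_from (s @ [a, c]) r"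
    using assms(2) e unfolding cells_from_append x_def y_def by (auto simp: Let_def)
  show ?thesis unfolding filling_of_cells f using assms(1) map_of_swap[OF \<open>x ~= y\<close>] by simp
qed

lemma toggle_toggle: "toggle j (toggle k S) = toggle k (toggle j S)"
  unfolding toggle_def by (rule ext) (auto simp: option.map_comp comp_def case_prod_beta' intro!: option.map_cong)

lemma swap_abs_sym: "swap_abs j k S = swap_abs k j S"
  unfolding swap_abs_def by (simp add: transpose_commute)

text \<open>The letter \<open>i\<close> is on the middle diagonal exactly if the contents are monotone; otherwise it is on an extreme
  one, and the other extreme letter is \<open>i - 1\<close> or \<open>i + 1\<close>.\<close>

lemma dmap_cases:
  fixes S :: filling and i :: nat
  assumes i: "2 <= i" and d: "diagonal S (i - 1) = - x" "diagonal S i = - y" "diagonal S (i + 1) = - z"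
    and v: "x ~= y" "y ~= z" "x = z --> x = 0"
  shows "(x < y \<longleftrightarrow> y < z) ==> dmap i S = S"
    and "\<not> (x < y \<longleftrightarrow> y < z) ==> x = z ==> dmap i S = toggle i S"
    and "x < z & z < y \<or> y < z & z < x ==> dmap i S = (if adjacent_abs x y then toggle (i - 1) (toggle i S) else swap_abs (i - 1) i S)"
    and "z < x & x < y \<or> y < x & x < z ==> dmap i S = (if adjacent_abs y z then toggle i (toggle (i + 1) S) else swap_abs i (i + 1) S)"
proof -
  have i0: "i ~= 0" "i - 1 ~= i" "i - 1 ~= i + 1" "i ~= i + 1" using i by auto
  have tx: "(THE k. k \<in> {i - 1, i, i + 1} & diagonal S k = - x) = i - 1" if "x ~= z"
    by (rule the_equality) (use d v that in auto)
  have ty: "(THE k. k \<in> {i - 1, i, i + 1} & diagonal S k = - y) = i"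
    by (rule the_equality) (use d v in auto)
  have tz: "(THE k. k \<in> {i - 1, i, i + 1} & diagonal S k = - z) = i + 1" if "x ~= z"
    by (rule the_equality) (use d v that in auto)
  note D = dmap_def[of i S, unfolded if_not_P[OF i0(1)] list.map d]
  have adj: "\<bar>\<bar>- x\<bar> - \<bar>- y\<bar>\<bar> = 1 \<longleftrightarrow> adjacent_abs x y" "\<bar>\<bar>- y\<bar> - \<bar>- x\<bar>\<bar> = 1 \<longleftrightarrow> adjacent_abs x y"
    "\<bar>\<bar>- y\<bar> - \<bar>- z\<bar>\<bar> = 1 \<longleftrightarrow> adjacent_abs y z" "\<bar>\<bar>- z\<bar> - \<bar>- y\<bar>\<bar> = 1 \<longleftrightarrow> adjacent_abs y z"
    unfolding adjacent_abs_def by auto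
  show "dmap i S = S" if "x < y \<longleftrightarrow> y < z"
  proof (cases "x < y")
    case True
    then have "sort [- x, - y, - z] = [- z, - y, - x]" using that by simp
    then show ?thesis unfolding D by simp
  next
    case False
    then have "sort [- x, - y, - z] = [- x, - y, - z]" using that v by simp
    then show ?thesis unfolding D by simp
  qed
  show "dmap i S = toggle i S" if "\<not> (x < y \<longleftrightarrow> y < z)" "x = z"
  proof (cases "x < y")
    case True
    then have "sort [- x, - y, - z] = [- y, - x, - x]" using that by simp
    then show ?thesis unfolding D using True ty by (simp add: Let_def)
  next
    case False
    then have "sort [- x, - y, - z] = [- x, - x, - y]" using that v by simp
    then show ?thesis unfolding D using False ty v by (simp add: Let_def)
  qed
  show "dmap i S = (if adjacent_abs x y then toggle (i - 1) (toggle i S) else swap_abs (i - 1) i S)"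
    if h: "x < z & z < y \<or> y < z & z < x"
  proof (cases "x < z & z < y")
    case True
    then have "sort [- x, - y, - z] = [- y, - z, - x]" by simp
    then show ?thesis unfolding D using True ty tx adj toggle_toggle[of i "i - 1" S] swap_abs_sym[of i "i - 1" S] by (simp add: Let_def)
  next
    case False
    then have "sort [- x, - y, - z] = [- x, - z, - y]" "y < z" "z < x" using h by auto
    then show ?thesis unfolding D using ty tx adj by (simp add: Let_def)
  qed
  show "dmap i S = (if adjacent_abs y z then toggle i (toggle (i + 1) S) else swap_abs i (i + 1) S)"
    if h: "z < x & x < y \<or> y < x & x < z"
  proof (cases "z < x & x < y")
    case True
    then have "sort [- x, - y, - z] = [- y, - x, - z]" by simp
    then show ?thesis unfolding D using True ty tz adj by (simp add: Let_def)
  next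
    case False
    then have "sort [- x, - y, - z] = [- z, - x, - y]" "y < x" "x < z" using h by auto
    then show ?thesis unfolding D using ty tz adj toggle_toggle[of "i + 1" i S] swap_abs_sym[of "i + 1" i S] by (simp add: Let_def)
  qed
qed

lemma letter_list_consecutive:
  assumes "finite (letters S)" "{i - 1, i, i + 1} \<subseteq> letters S" "2 <= i"
  obtains L1 L2 where "letter_list S = L1 @ [i - 1, i, i + 1] @ L2" "\<forall>k\<in>set L1. k < i - 1" "\<forall>k\<in>set L2. i + 1 < k"
proof -
  let ?L = "letter_list S"
  have L: "sorted ?L" "distinct ?L" "set ?L = letters S" unfolding letter_list_def using assms(1) by auto
  define L1 where "L1 = filter (\<lambda>k. k < i - 1) ?L"
  define L2 where "L2 = filter (\<lambda>k. i + 1 < k) ?L"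
  have "sorted (L1 @ [i - 1, i, i + 1] @ L2)" "distinct (L1 @ [i - 1, i, i + 1] @ L2)"
    unfolding L1_def L2_def using L assms(3) by (auto simp: sorted_append sorted_wrt_filter)
  moreover have "set (L1 @ [i - 1, i, i + 1] @ L2) = set ?L"
    unfolding L1_def L2_def using L(3) assms(2,3) by auto
  ultimately have "?L = L1 @ [i - 1, i, i + 1] @ L2" using L sorted_distinct_set_unique by metis
  then show thesis using that unfolding L1_def L2_def by auto
qed

text \<open>The hypothesis that the three letters are consecutive in the filling makes the three contents a legal triple,
  so that the exceptional coincidence of diagonals is the one in \<open>shifted_tri\<close>.\<close>

lemma fill_dmap:
  assumes ga: "strict_partition m ga" and S: "fill ga S" and i: "2 <= i" "{i - 1, i, i + 1} \<subseteq> letters S"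
    and L: "letter_list S = L1 @ [i - 1, i, i + 1] @ L2"
  shows "fill ga (dmap i S)" "letters (dmap i S) = letters S"
    "contents (dmap i S) = at3 shifted_tri (length L1 + 2) (contents S)"
proof -
  let ?q = "contents S"
  note v = fill_contents_valid[OF ga S]
  have ll: "sorted (letter_list S)" "distinct (letter_list S)" "set (letter_list S) = letters S"
    unfolding letter_list_def using fill_dom[OF ga S] by auto
  define s where "s = map (content S) L1"
  define r where "r = map (content S) L2"
  define x where "x = content S (i - 1)"
  define y where "y = content S i"
  define z where "z = content S (i + 1)"
  have q: "?q = s @ [x, y, z] @ r" unfolding contents_def L s_def r_def x_def y_def z_def by simp
  have len: "length L1 = length s" "length L2 = length r" unfolding s_def r_def by auto
  have nf: "S = filling_of (L1 @ [i - 1, i, i + 1] @ L2) (s @ [x, y, z] @ r)"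
    using fill_normal_form[OF ga S] unfolding L q .
  have va: "shifted.valid (shifted.shape s) [x, y, z]" "shifted.legal s"
    using v(1) unfolding q shifted.valid_append by auto
  define M where "M = shifted.shape s"
  have M: "mirrored M" unfolding M_def by (rule shifted.conf_sh[OF shifted.conf_start va(2)])
  have a: "addable M x" "addable (hop2 x M) y" "addable (hop2 y (hop2 x M)) z" using va(1) unfolding M_def by auto
  have far: "\<bar>x\<bar> ~= \<bar>y\<bar>" "\<bar>y\<bar> ~= \<bar>z\<bar>"
  proof -
    have "\<bar>e\<bar> ~= \<bar>f\<bar>" if "addable (hop2 e N) f" for e f N
    proof
      assume "\<bar>e\<bar> = \<bar>f\<bar>"
      then have "f \<in> hop2 e N" unfolding hop2_mem by linarith
      then show False using that unfolding addable_def by blast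
    qed
    then show "\<bar>x\<bar> ~= \<bar>y\<bar>" "\<bar>y\<bar> ~= \<bar>z\<bar>" using a by blast+
  qed
  have rep: "x = z ==> x = 0 & \<bar>y\<bar> = 1" using shifted_repeat[OF M, of x y] va(1) unfolding M_def by auto
  have dist: "distinct (L1 @ [i - 1, i, i + 1] @ L2)" using ll(2) unfolding L .
  have dg: "diagonal S (i - 1) = - x" "diagonal S i = - y" "diagonal S (i + 1) = - z"
    unfolding x_def y_def z_def content_def by auto
  note dc = dmap_cases[OF i(1) dg]
  have xy: "x ~= y" "y ~= z" "x = z --> x = 0" using far rep by auto
  note dc = dc[OF xy]
  have t1: "toggle (i - 1) (filling_of (L1 @ [i - 1, i, i + 1] @ L2) (s @ [e, f, g] @ r)) = filling_of (L1 @ [i - 1, i, i + 1] @ L2) (s @ [- e, f, g] @ r)"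
    if "e ~= 0" for e f g
    using toggle_filling_of[of L1 s "[i, i + 1] @ L2" "[f, g] @ r" "i - 1" e] len dist that by auto
  have t2: "toggle i (filling_of (L1 @ [i - 1, i, i + 1] @ L2) (s @ [e, f, g] @ r)) = filling_of (L1 @ [i - 1, i, i + 1] @ L2) (s @ [e, - f, g] @ r)"
    if "f ~= 0" for e f g
    using toggle_filling_of[of "L1 @ [i - 1]" "s @ [e]" "[i + 1] @ L2" "[g] @ r" i f] len dist that by auto
  have t3: "toggle (i + 1) (filling_of (L1 @ [i - 1, i, i + 1] @ L2) (s @ [e, f, g] @ r)) = filling_of (L1 @ [i - 1, i, i + 1] @ L2) (s @ [e, f, - g] @ r)"
    if "g ~= 0" for e f g
    using toggle_filling_of[of "L1 @ [i - 1, i]" "s @ [e, f]" L2 r "i + 1" g] len dist that by auto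
  have tid: "map (transpose j k) L = L" if "j ~: set L" "k ~: set L" for j k :: nat and L
    by (rule map_idI) (use that in \<open>auto simp: transpose_def\<close>)
  have w1: "swap_abs (i - 1) i S = filling_of (L1 @ [i - 1, i, i + 1] @ L2) (s @ [y, x, z] @ r)"
  proof -
    have "swap_abs (i - 1) i S = filling_of (L1 @ i # (i - 1) # (i + 1) # L2) (s @ x # y # z # r)"
      by (subst nf, subst swap_abs_filling_of) (use dist tid in \<open>auto simp: transpose_def\<close>)
    also have "\<dots> = filling_of (L1 @ (i - 1) # i # (i + 1) # L2) (s @ y # x # z # r)"
      by (rule filling_of_swap[OF len(1) far(1)])
    finally show ?thesis by simp
  qed
  have w2: "swap_abs i (i + 1) S = filling_of (L1 @ [i - 1, i, i + 1] @ L2) (s @ [x, z, y] @ r)"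
  proof -
    have "swap_abs i (i + 1) S = filling_of ((L1 @ [i - 1]) @ (i + 1) # i # L2) ((s @ [x]) @ y # z # r)"
      by (subst nf, subst swap_abs_filling_of) (use dist tid in \<open>auto simp: transpose_def\<close>)
    also have "\<dots> = filling_of ((L1 @ [i - 1]) @ i # (i + 1) # L2) ((s @ [x]) @ z # y # r)"
      by (rule filling_of_swap) (use len far in auto)
    finally show ?thesis by simp
  qed
  have dm: "dmap i S = filling_of (L1 @ [i - 1, i, i + 1] @ L2) (s @ list3 (shifted_tri (x, y, z)) @ r)"
  proof -
    consider "x < y \<longleftrightarrow> y < z" | "\<not> (x < y \<longleftrightarrow> y < z)" "x = z" | "x < z & z < y \<or> y < z & z < x"
      | "z < x & x < y \<or> y < x & x < z" using xy by linarith
    then show ?thesis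
    proof cases
      case 1
      then show ?thesis using dc(1) nf by simp
    next
      case 2
      have "y ~= 0" using rep 2 by auto
      then have "toggle i S = filling_of (L1 @ [i - 1, i, i + 1] @ L2) (s @ [x, - y, z] @ r)" using t2[of y x z] nf by simp
      then show ?thesis using dc(2)[OF 2] 2 by simp
    next
      case 3
      have tri: "shifted_tri (x, y, z) = (if adjacent_abs x y then (- x, - y, z) else (y, x, z))" using 3 by auto
      show ?thesis
      proof (cases "adjacent_abs x y")
        case True
        have "x ~= 0" "y ~= 0" using True 3 unfolding adjacent_abs_def by auto
        then have "toggle (i - 1) (toggle i S) = filling_of (L1 @ [i - 1, i, i + 1] @ L2) (s @ [- x, - y, z] @ r)"
          using t2[of y x z] t1[of x "- y" z] nf by simp
        then show ?thesis using dc(3)[OF 3] True unfolding tri by simp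
      next
        case False
        then show ?thesis using dc(3)[OF 3] w1 unfolding tri by simp
      qed
    next
      case 4
      have tri: "shifted_tri (x, y, z) = (if adjacent_abs y z then (x, - y, - z) else (x, z, y))" using 4 by auto
      show ?thesis
      proof (cases "adjacent_abs y z")
        case True
        have "z ~= 0" "y ~= 0" using True 4 unfolding adjacent_abs_def by auto
        then have "toggle i (toggle (i + 1) S) = filling_of (L1 @ [i - 1, i, i + 1] @ L2) (s @ [x, - y, - z] @ r)"
          using t3[of z x y] t2[of y x "- z"] nf by simp
        then show ?thesis using dc(4)[OF 4] True unfolding tri by simp
      next
        case False
        then show ?thesis using dc(4)[OF 4] w2 unfolding tri by simp
      qed
    qed
  qed
  have at: "at3 shifted_tri (length L1 + 2) ?q = s @ list3 (shifted_tri (x, y, z)) @ r"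
    using at3_append[of s "length L1 + 2" shifted_tri "(x, y, z)" r] len unfolding q by simp
  define q' where "q' = at3 shifted_tri (length L1 + 2) ?q"
  have "length L1 + 2 < length ?q" unfolding q using len by simp
  then have v': "shifted.legal q'" "shifted.shape q' = cfg (doubled (shifted_diagram ga))" "length q' = length ?q"
    using seq_move_valid[OF v(1), of "length L1 + 2"] v(2) unfolding q'_def seq_move_def by auto
  have D: "dmap i S = filling_of (letter_list S) q'" unfolding dm q'_def at L ..
  have "length (letter_list S) = length q'" using v'(3) unfolding contents_def by simp
  note F = filling_of_fill[OF ga v'(1,2) ll(1,2) this]
  show "fill ga (dmap i S)" "letters (dmap i S) = letters S" "contents (dmap i S) = at3 shifted_tri (length L1 + 2) (contents S)"
    using F ll(3) unfolding D q'_def by auto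
qed

lemma fill_toggle:
  assumes ga: "strict_partition m ga" and S: "fill ga S" and L: "letter_list S = j # k # L2"
  shows "fill ga (toggle k S)" "letters (toggle k S) = letters S" "contents (toggle k S) = negate_second (contents S)"
proof -
  let ?q = "contents S"
  note v = fill_contents_valid[OF ga S]
  have ll: "sorted (letter_list S)" "distinct (letter_list S)" "set (letter_list S) = letters S"
    unfolding letter_list_def using fill_dom[OF ga S] by auto
  define r where "r = map (content S) L2"
  have q: "?q = content S j # content S k # r" unfolding contents_def L r_def by simp
  have "content S j = 0" using v(1) unfolding q by (auto simp: addable_def)
  then have y: "content S k ~= 0" using v(1) unfolding q by (auto simp: addable_def hop2_mem)
  have dist: "distinct (j # k # L2)" using ll(2) unfolding L .
  have "toggle k (filling_of ([j] @ k # L2) ([content S j] @ content S k # r)) = filling_of ([j] @ k # L2) ([content S j] @ (- content S k) # r)"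
    by (rule toggle_filling_of) (use dist y r_def in auto)
  moreover have nf: "S = filling_of ([j] @ k # L2) ([content S j] @ content S k # r)"
    using fill_normal_form[OF ga S] unfolding L q by simp
  ultimately have D: "toggle k S = filling_of (letter_list S) (negate_second ?q)" unfolding L q by simp
  have v': "shifted.legal (negate_second ?q)" "shifted.shape (negate_second ?q) = cfg (doubled (shifted_diagram ga))"
    "length (negate_second ?q) = length ?q"
    using seq_move_valid[OF v(1), of 0] v(2) unfolding seq_move_def by auto
  have "length (letter_list S) = length (negate_second ?q)" using v'(3) unfolding contents_def by simp
  note F = filling_of_fill[OF ga v'(1,2) ll(1,2) this]
  show "fill ga (toggle k S)" "letters (toggle k S) = letters S" "contents (toggle k S) = negate_second (contents S)"
    using F ll(3) unfolding D by auto
qed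

text \<open>A transposition that respects the order of the letters renames them and leaves the contents alone.\<close>

lemma fill_relabel:
  assumes ga: "strict_partition m ga" and S: "fill ga S" and f: "strict_mono_on (letters S) (transpose j k)"
  shows "fill ga (swap_abs j k S)" "letters (swap_abs j k S) = transpose j k ` letters S" "contents (swap_abs j k S) = contents S"
proof -
  note v = fill_contents_valid[OF ga S]
  let ?L = "letter_list S"
  have ll: "sorted ?L" "distinct ?L" "set ?L = letters S"
    unfolding letter_list_def using fill_dom[OF ga S] by auto
  have D: "swap_abs j k S = filling_of (map (transpose j k) ?L) (contents S)"
    by (subst fill_normal_form[OF ga S]) (rule swap_abs_filling_of)
  have s: "sorted (map (transpose j k) ?L)"
    using ll f by (auto simp: sorted_wrt_map intro!: sorted_wrt_mono_rel[OF _ ll(1)] dest: strict_mono_on_imp_mono_on monotone_onD)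
  have d: "distinct (map (transpose j k) ?L)" using ll(2,3) f by (simp add: distinct_map strict_mono_on_imp_inj_on)
  have "length (map (transpose j k) ?L) = length (contents S)" unfolding contents_def by simp
  note F = filling_of_fill[OF ga v(1,2) s d this]
  show "fill ga (swap_abs j k S)" "letters (swap_abs j k S) = transpose j k ` letters S" "contents (swap_abs j k S) = contents S"
    using F ll(3) unfolding D by auto
qed


section \<open>The hook reading order\<close>

definition before :: "'a list => 'a => 'a => bool" where
  "before w x y \<longleftrightarrow> (\<exists>u v. w = u @ v & x \<in> set u & y \<in> set v)"

lemma before_index: "before w x y \<longleftrightarrow> (\<exists>p q. p < q & q < length w & w ! p = x & w ! q = y)"
proof
  assume "before w x y"
  then obtain u v where w: "w = u @ v" "x \<in> set u" "y \<in> set v" unfolding before_def by blast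
  obtain p where p: "p < length u" "u ! p = x" using w(2) by (auto simp: in_set_conv_nth)
  obtain q where q: "q < length v" "v ! q = y" using w(3) by (auto simp: in_set_conv_nth)
  show "\<exists>p q. p < q & q < length w & w ! p = x & w ! q = y"
    using p q unfolding w(1) by (intro exI[of _ p] exI[of _ "length u + q"]) (auto simp: nth_append)
next
  assume "\<exists>p q. p < q & q < length w & w ! p = x & w ! q = y"
  then obtain p q where pq: "p < q" "q < length w" "w ! p = x" "w ! q = y" by blast
  have "x \<in> set (take q w)" using pq by (auto simp: in_set_conv_nth intro!: exI[of _ p])
  moreover have "y \<in> set (drop q w)" using pq by (auto simp: in_set_conv_nth intro!: exI[of _ 0])
  ultimately show "before w x y" unfolding before_def by (metis append_take_drop_id)
qed

lemma Des_word_before: "i \<in> Des_word w \<longleftrightarrow> before w (i + 1) i"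
  unfolding Des_word_def before_index by blast

lemma before_in_set: "before w x y ==> x \<in> set w & y \<in> set w"
  unfolding before_def by auto

lemma before_asym:
  assumes "distinct w" "before w x y"
  shows "\<not> before w y x"
proof
  assume "before w y x"
  then obtain p q where 1: "p < q" "q < length w" "w ! p = y" "w ! q = x" unfolding before_index by blast
  obtain p' q' where 2: "p' < q'" "q' < length w" "w ! p' = x" "w ! q' = y" using assms(2) unfolding before_index by blast
  have "p = q'" "q = p'" using 1 2 assms(1) nth_eq_iff_index_eq[of w p q'] nth_eq_iff_index_eq[of w q p'] by auto
  then show False using 1 2 by simp
qed

lemma before_append_left: "before u x y ==> before (u @ v) x y"
  unfolding before_def by (metis Un_iff append_assoc set_append)

lemma before_append_right: "before v x y ==> before (u @ v) x y"
  unfolding before_def by (metis Un_iff append_assoc set_append)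

lemma before_append_both: "x \<in> set u ==> y \<in> set v ==> before (u @ v) x y"
  unfolding before_def by blast

lemma before_total:
  assumes "x \<in> set w" "y \<in> set w" "x ~= y"
  shows "before w x y \<or> before w y x"
proof -
  obtain p where p: "p < length w" "w ! p = x" using assms(1) by (auto simp: in_set_conv_nth)
  obtain q where q: "q < length w" "w ! q = y" using assms(2) by (auto simp: in_set_conv_nth)
  have "p ~= q" using p q assms(3) by auto
  then show ?thesis unfolding before_index using p q by (metis linorder_neqE_nat)
qed

lemma before_append_iff:
  assumes "distinct (u @ v)"
  shows "x \<in> set u ==> y \<in> set u ==> before (u @ v) x y \<longleftrightarrow> before u x y"
    and "x \<in> set v ==> y \<in> set v ==> before (u @ v) x y \<longleftrightarrow> before v x y"
    and "x \<in> set u ==> y \<in> set v ==> before (u @ v) x y"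
    and "x \<in> set v ==> y \<in> set u ==> \<not> before (u @ v) x y"
proof -
  have irr: "\<not> before w x x" if "distinct w" for w :: "'a list" and x using before_asym[OF that] by blast
  show "before (u @ v) x y \<longleftrightarrow> before u x y" if "x \<in> set u" "y \<in> set u"
    using before_append_left[of u _ _ v] before_total[of x u y] before_asym[OF assms, of x y] irr[OF assms] that by metis
  show "before (u @ v) x y \<longleftrightarrow> before v x y" if "x \<in> set v" "y \<in> set v"
    using before_append_right[of v _ _ u] before_total[of x v y] before_asym[OF assms, of x y] irr[OF assms] that by metis
  show "before (u @ v) x y" if "x \<in> set u" "y \<in> set v" by (rule before_append_both[OF that])
  show "\<not> before (u @ v) x y" if "x \<in> set v" "y \<in> set u"
    using before_append_both[OF that(2,1)] before_asym[OF assms] by blast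
qed

lemma before_concat:
  assumes "before ns i j" "x \<in> set (f i)" "y \<in> set (f j)"
  shows "before (concat (map f ns)) x y"
proof -
  obtain u v where "ns = u @ v" "i \<in> set u" "j \<in> set v" using assms(1) unfolding before_def by blast
  then show ?thesis using assms(2,3) by (auto intro!: before_append_both)
qed

lemma before_concat_same:
  assumes "i \<in> set ns" "before (f i) x y"
  shows "before (concat (map f ns)) x y"
proof -
  obtain u v where "ns = u @ i # v" using assms(1) by (meson split_list)
  then have "concat (map f ns) = concat (map f u) @ f i @ concat (map f v)" by simp
  then show ?thesis using before_append_right[OF before_append_left[OF assms(2)]] by simp
qed

lemma before_sorted:
  assumes "finite A" "a \<in> A" "b \<in> A" "a < b"
  shows "before (map f (sorted_list_of_set A)) (f a) (f b)"
proof -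
  let ?L = "sorted_list_of_set A"
  have L: "sorted ?L" "distinct ?L" "set ?L = A" using assms(1) by auto
  obtain p where p: "p < length ?L" "?L ! p = a" using assms(2) L(3) by (metis in_set_conv_nth)
  obtain q where q: "q < length ?L" "?L ! q = b" using assms(3) L(3) by (metis in_set_conv_nth)
  have "p < q"
  proof (rule ccontr)
    assume "\<not> p < q"
    then have "?L ! q <= ?L ! p" using sorted_nth_mono[OF L(1), of q p] p by simp
    then show False using p q assms(4) by simp
  qed
  then show ?thesis unfolding before_index using p q by (intro exI[of _ p] exI[of _ q]) auto
qed

lemma before_rev_sorted:
  assumes "finite A" "a \<in> A" "b \<in> A" "b < a"
  shows "before (rev (sorted_list_of_set A)) a b"
proof -
  have "before (sorted_list_of_set A) b a" using before_sorted[OF assms(1,3,2,4), of "\<lambda>x. x"] by simp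
  then show ?thesis unfolding before_def by (metis rev_append set_rev)
qed

lemma distinct_concat_map:
  assumes "distinct ns" "\<And>i. i \<in> set ns ==> distinct (f i)"
    "\<And>i j. i \<in> set ns ==> j \<in> set ns ==> i ~= j ==> set (f i) \<inter> set (f j) = {}"
  shows "distinct (concat (map f ns))"
  using assms
proof (induction ns)
  case (Cons n ns)
  have "set (f n) \<inter> set (f j) = {}" if "j \<in> set ns" for j using Cons.prems that by auto
  then have "set (f n) \<inter> set (concat (map f ns)) = {}" by auto
  moreover have "distinct (concat (map f ns))" by (rule Cons.IH) (use Cons.prems in auto)
  ultimately show ?case using Cons.prems(2)[of n] by simp
qed simp

text \<open>The index at which the hook reading word reads a cell.\<close>

definition stage :: "filling => cell => nat" where
  "stage S x = (if marked S x then snd x else fst x)"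

definition block :: "filling => nat => nat list" where
  "block S i = marked_in_column S i @ unmarked_in_row S i"

lemma block_rows_finite:
  assumes "finite (dom S)"
  shows "finite {r. (r, i) \<in> dom S & marked S (r, i)}" "finite {c. (i, c) \<in> dom S & \<not> marked S (i, c)}"
proof -
  show "finite {r. (r, i) \<in> dom S & marked S (r, i)}" by (rule finite_subset[of _ "fst ` dom S"]) (use assms in force)+
  show "finite {c. (i, c) \<in> dom S & \<not> marked S (i, c)}" by (rule finite_subset[of _ "snd ` dom S"]) (use assms in force)+
qed

lemma set_block:
  assumes "finite (dom S)"
  shows "set (marked_in_column S i) = absval S ` {x \<in> dom S. marked S x & stage S x = i}"
    "set (unmarked_in_row S i) = absval S ` {x \<in> dom S. \<not> marked S x & stage S x = i}"
    "set (block S i) = absval S ` {x \<in> dom S. stage S x = i}"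
proof -
  have 1: "(\<lambda>r. (r, i)) ` {r. (r, i) \<in> dom S & marked S (r, i)} = {x \<in> dom S. marked S x & stage S x = i}" (is "?A = ?B")
  proof (intro set_eqI iffI)
    fix x assume "x \<in> ?A"
    then show "x \<in> ?B" unfolding stage_def by (elim imageE) (simp only: mem_Collect_eq snd_conv if_True simp_thms)
  next
    fix x assume x: "x \<in> ?B"
    then have "stage S x = i" "marked S x" by blast+
    then have "snd x = i" unfolding stage_def by simp
    then have "x = (fst x, i)" by (metis prod.collapse)
    then show "x \<in> ?A" using x by (intro image_eqI[of _ _ "fst x"]) auto
  qed
  have 2: "(\<lambda>c. (i, c)) ` {c. (i, c) \<in> dom S & \<not> marked S (i, c)} = {x \<in> dom S. \<not> marked S x & stage S x = i}" (is "?A = ?B")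
  proof (intro set_eqI iffI)
    fix x assume "x \<in> ?A"
    then show "x \<in> ?B" unfolding stage_def by (elim imageE) (simp only: mem_Collect_eq fst_conv if_False simp_thms)
  next
    fix x assume x: "x \<in> ?B"
    then have "stage S x = i" "\<not> marked S x" by blast+
    then have "fst x = i" unfolding stage_def by simp
    then have "x = (i, snd x)" by (metis prod.collapse)
    then show "x \<in> ?A" using x by (intro image_eqI[of _ _ "snd x"]) auto
  qed
  show m: "set (marked_in_column S i) = absval S ` {x \<in> dom S. marked S x & stage S x = i}"
    unfolding marked_in_column_def 1[symmetric] image_image using block_rows_finite[OF assms] by simp
  show u: "set (unmarked_in_row S i) = absval S ` {x \<in> dom S. \<not> marked S x & stage S x = i}"
    unfolding unmarked_in_row_def 2[symmetric] image_image using block_rows_finite[OF assms] by simp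
  show "set (block S i) = absval S ` {x \<in> dom S. stage S x = i}"
    unfolding block_def set_append m u by blast
qed

lemma hook_block: "hook S = concat (map (block S) (rev (sorted_list_of_set (fst ` dom S \<union> snd ` dom S))))"
  unfolding hook_def block_def ..

lemma stage_index: "x \<in> dom S ==> stage S x \<in> fst ` dom S \<union> snd ` dom S"
  unfolding stage_def by simp

lemma hook_set:
  assumes "finite (dom S)"
  shows "set (hook S) = letters S"
proof -
  have "set (hook S) = (\<Union>i\<in>fst ` dom S \<union> snd ` dom S. absval S ` {x \<in> dom S. stage S x = i})"
    unfolding hook_block using assms set_block(3)[OF assms] by simp
  also have "\<dots> = absval S ` dom S"
  proof (intro equalityI subsetI)
    fix a assume "a \<in> absval S ` dom S"
    then obtain x where x: "a = absval S x" "x \<in> dom S" by (rule imageE)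
    show "a \<in> (\<Union>i\<in>fst ` dom S \<union> snd ` dom S. absval S ` {x \<in> dom S. stage S x = i})"
      by (rule UN_I[OF stage_index[OF x(2)]]) (use x in simp)
  qed (elim UN_E imageE, simp)
  finally show ?thesis unfolding letters_def .
qed

lemma hook_distinct:
  assumes "finite (dom S)" "inj_on (absval S) (dom S)"
  shows "distinct (hook S)"
  unfolding hook_block
proof (rule distinct_concat_map)
  have disj: "absval S ` X \<inter> absval S ` Y = {}" if "X \<subseteq> dom S" "Y \<subseteq> dom S" "X \<inter> Y = {}" for X Y
    using inj_on_image_Int[OF assms(2) that(1,2)] that(3) by simp
  show "distinct (rev (sorted_list_of_set (fst ` dom S \<union> snd ` dom S)))" by simp
  show "distinct (block S i)" for i
  proof -
    have "distinct (marked_in_column S i)" "distinct (unmarked_in_row S i)"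
      unfolding marked_in_column_def unmarked_in_row_def distinct_map using block_rows_finite[OF assms(1)] assms(2)
      by (auto intro!: inj_onI dest: inj_onD)
    moreover have "set (marked_in_column S i) \<inter> set (unmarked_in_row S i) = {}"
      unfolding set_block[OF assms(1)] by (rule disj) auto
    ultimately show ?thesis unfolding block_def by simp
  qed
  show "set (block S i) \<inter> set (block S j) = {}" if "i ~= j" for i j
    unfolding set_block[OF assms(1)] by (rule disj) (use that in auto)
qed

text \<open>The four ways in which one cell is read before another.\<close>

lemma hook_before:
  assumes fin: "finite (dom S)" and x: "x \<in> dom S" and y: "y \<in> dom S"
  shows "stage S y < stage S x ==> before (hook S) (absval S x) (absval S y)"
    and "stage S y = stage S x ==> marked S x ==> \<not> marked S y ==> before (hook S) (absval S x) (absval S y)"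
    and "snd y = snd x ==> marked S x ==> marked S y ==> fst x < fst y ==> before (hook S) (absval S x) (absval S y)"
    and "fst y = fst x ==> \<not> marked S x ==> \<not> marked S y ==> snd x < snd y ==> before (hook S) (absval S x) (absval S y)"
proof -
  let ?I = "fst ` dom S \<union> snd ` dom S"
  have fI: "finite ?I" using fin by simp
  note ix = stage_index[OF x] and iy = stage_index[OF y]
  have bx: "absval S x \<in> set (block S (stage S x))" and by': "absval S y \<in> set (block S (stage S y))"
    unfolding set_block[OF fin] using x y by auto
  show "before (hook S) (absval S x) (absval S y)" if "stage S y < stage S x"
    unfolding hook_block by (rule before_concat[OF before_rev_sorted[OF fI ix iy that]]) (rule bx, rule by')
  have same: "before (hook S) (absval S x) (absval S y)" if "before (block S (stage S x)) (absval S x) (absval S y)"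
    unfolding hook_block by (rule before_concat_same[of "stage S x"]) (use fI ix that in auto)
  show "before (hook S) (absval S x) (absval S y)" if "stage S y = stage S x" "marked S x" "\<not> marked S y"
    by (rule same, unfold block_def, rule before_append_both)
      (use set_block[OF fin, of "stage S x"] x y that in auto)
  show "before (hook S) (absval S x) (absval S y)" if "snd y = snd x" "marked S x" "marked S y" "fst x < fst y"
  proof (rule same, unfold block_def, rule before_append_left)
    define r c r' where "r = fst x" and "c = snd x" and "r' = fst y"
    have xy: "x = (r, c)" "y = (r', c)" using that(1) unfolding r_def c_def r'_def by (metis prod.collapse)+
    show "before (marked_in_column S (stage S x)) (absval S x) (absval S y)"
      unfolding marked_in_column_def stage_def using that(2) unfolding xy
      using before_sorted[OF block_rows_finite(1)[OF fin, of c], of r r' "\<lambda>r. absval S (r, c)"] x y that xy by simp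
  qed
  show "before (hook S) (absval S x) (absval S y)" if "fst y = fst x" "\<not> marked S x" "\<not> marked S y" "snd x < snd y"
  proof (rule same, unfold block_def, rule before_append_right)
    define r c c' where "r = fst x" and "c = snd x" and "c' = snd y"
    have xy: "x = (r, c)" "y = (r, c')" using that(1) unfolding r_def c_def c'_def by (metis prod.collapse)+
    show "before (unmarked_in_row S (stage S x)) (absval S x) (absval S y)"
      unfolding unmarked_in_row_def stage_def using that(2) unfolding xy
      using before_sorted[OF block_rows_finite(2)[OF fin, of r], of c c' "\<lambda>c. absval S (r, c)"] x y that xy by simp
  qed
qed

text \<open>If no letter is in between, then neither cell is strictly to the upper right of the other. So of two unmarked
  letters the one of smaller content is in a higher row or further left in the same row, of two marked ones it is in a column
  further right or lower in the same column, and contents of marked letters are negative: in each case it is read first.\<close>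

lemma hook_consecutive_aux:
  assumes ga: "strict_partition m ga" and S: "fill ga S"
    and ab: "a \<in> letters S" "b \<in> letters S" "a < b" and gap: "\<And>k. k \<in> letters S ==> \<not> (a < k & k < b)"
  shows "content S b < content S a & before (hook S) b a \<or> content S a < content S b & before (hook S) a b"
proof -
  note d = fill_dom[OF ga S]
  have inj: "inj_on (absval S) (dom S)" and sf: "signed_filling ga S" using S unfolding fill_def by auto
  have fin: "finite (dom S)" by (rule shifted_young_finite[OF d(2)])
  obtain r c where x: "cell_of S a = (r, c)" by fastforce
  obtain r' c' where y: "cell_of S b = (r', c')" by fastforce
  have xd: "(r, c) \<in> dom S" "absval S (r, c) = a" using cell_of_letter[OF inj ab(1)] unfolding x by auto
  have yd: "(r', c') \<in> dom S" "absval S (r', c') = b" using cell_of_letter[OF inj ab(2)] unfolding y by auto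
  have px: "1 <= r" "r <= c" "1 <= r'" "r' <= c'" using shifted_young_pos[OF d(2)] xd(1) yd(1) by blast+
  have n1: "\<not> (r' <= r & c' <= c)" using fill_mono[OF ga S yd(1) xd(1)] xd(2) yd(2) ab(3) by auto
  have n2: "\<not> (r < r' & c < c')"
  proof
    assume h: "r < r' & c < c'"
    have m: "(r, c + 1) \<in> dom S" by (rule shifted_youngD[OF d(2) yd(1)]) (use h px in auto)
    have "absval S (r, c) < absval S (r, c + 1)" using sf xd(1) m unfolding signed_filling_def by auto
    moreover have "absval S (r, c + 1) <= absval S (r', c')" by (rule fill_mono[OF ga S m yd(1)]) (use h in auto)
    moreover have "absval S (r, c + 1) ~= absval S (r', c')" using inj_onD[OF inj _ m yd(1)] h by auto
    moreover have "absval S (r, c + 1) \<in> letters S" unfolding letters_def using m by blast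
    ultimately show False using gap xd(2) yd(2) by fastforce
  qed
  have nx: "marked S (r, c) ==> r ~= c" and ny: "marked S (r', c') ==> r' ~= c'"
    using sf xd(1) yd(1) unfolding signed_filling_def by blast+
  have ca: "content S a = scont ((r, c), marked S (r, c))" "content S b = scont ((r', c'), marked S (r', c'))"
    unfolding content_scont x y by auto
  note hx = hook_before[OF fin xd(1) yd(1), unfolded xd(2) yd(2)] and hy = hook_before[OF fin yd(1) xd(1), unfolded xd(2) yd(2)]
  have st: "stage S (r, c) = (if marked S (r, c) then c else r)" "stage S (r', c') = (if marked S (r', c') then c' else r')"
    unfolding stage_def by auto
  consider (right) "r' <= r" "c < c'" | (up) "r < r'" "c' <= c" using n1 n2 by linarith
  then show ?thesis
  proof cases
    case right
    show ?thesis
    proof (cases "marked S (r, c)"; cases "marked S (r', c')")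
      assume m: "marked S (r, c)" "marked S (r', c')"
      then show ?thesis using right hy(1) ca st by auto
    next
      assume m: "marked S (r, c)" "\<not> marked S (r', c')"
      then have "r' < c" using right px nx by auto
      then show ?thesis using right hx(1) ca st m nx px by auto
    next
      assume m: "\<not> marked S (r, c)" "marked S (r', c')"
      then have "r < c'" using right px by auto
      then show ?thesis using right hy(1) ca st m ny px by auto
    next
      assume m: "\<not> marked S (r, c)" "\<not> marked S (r', c')"
      then show ?thesis using right hx(1,4) ca st by (cases "r' = r") auto
    qed
  next
    case up
    show ?thesis
    proof (cases "marked S (r, c)"; cases "marked S (r', c')")
      assume m: "marked S (r, c)" "marked S (r', c')"
      then show ?thesis using up hx(1,3) ca st by (cases "c' = c") auto
    next
      assume m: "marked S (r, c)" "\<not> marked S (r', c')"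
      then have "r' <= c" using up px by auto
      then show ?thesis using up hx(1,2) ca st m nx px by (cases "r' = c") auto
    next
      assume m: "\<not> marked S (r, c)" "marked S (r', c')"
      then have "r < c'" using up px by auto
      then show ?thesis using up hy(1) ca st m ny px by auto
    next
      assume m: "\<not> marked S (r, c)" "\<not> marked S (r', c')"
      then show ?thesis using up hy(1) ca st by auto
    qed
  qed
qed

text \<open>Hence, for consecutive letters of a filling, the order in the hook reading word is the order of the contents.\<close>

lemma hook_consecutive:
  assumes ga: "strict_partition m ga" and S: "fill ga S"
    and ab: "a \<in> letters S" "b \<in> letters S" "a < b" and gap: "\<And>k. k \<in> letters S ==> \<not> (a < k & k < b)"
  shows "before (hook S) a b \<longleftrightarrow> content S a < content S b" "before (hook S) b a \<longleftrightarrow> content S b < content S a"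
proof -
  have "distinct (hook S)"
    using hook_distinct shifted_young_finite[OF fill_dom(2)[OF ga S]] S unfolding fill_def by blast
  then have "\<not> (before (hook S) a b & before (hook S) b a)" using before_asym by metis
  then show "before (hook S) a b \<longleftrightarrow> content S a < content S b" "before (hook S) b a \<longleftrightarrow> content S b < content S a"
    using hook_consecutive_aux[OF assms] by auto
qed

lemma before_filter:
  assumes "before w x y" "P x" "P y"
  shows "before (filter P w) x y"
proof -
  obtain u v where "w = u @ v" "x \<in> set u" "y \<in> set v" using assms(1) unfolding before_def by blast
  then show ?thesis unfolding before_def using assms(2,3) by (intro exI[of _ "filter P u"] exI[of _ "filter P v"]) auto
qed

lemma before_three: "before [p, q, r] x y \<longleftrightarrow> x = p & y = q \<or> x = p & y = r \<or> x = q & y = r"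
proof
  assume "before [p, q, r] x y"
  then obtain i j where ij: "i < j" "j < 3" "[p, q, r] ! i = x" "[p, q, r] ! j = y" unfolding before_index by auto
  then have "i = 0 & j = 1 \<or> i = 0 & j = 2 \<or> i = 1 & j = 2" by auto
  then show "x = p & y = q \<or> x = p & y = r \<or> x = q & y = r" using ij by auto
next
  assume "x = p & y = q \<or> x = p & y = r \<or> x = q & y = r"
  then show "before [p, q, r] x y"
    unfolding before_def by (auto intro: exI[of _ "[p]"] exI[of _ "[p, q]"])
qed


section \<open>Schur functions and Schur P-functions of classes of words\<close>

lemma sum_series: "(\<Sum>x\<in>A. f x :: series) M = (\<Sum>x\<in>A. f x M)"
  by (induction A rule: infinite_finite_induct) auto

lemma unshifted_orbit_bij:
  assumes "distinct u"
  shows "bij_betw (\<lambda>w. fst (unshifted.rsk w)) (orbit (at3 knuth) {2..<length u} u)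
    {q \<in> {q. unshifted.legal q & length q = length u}.
      unshifted.shape q = unshifted.shape (fst (unshifted.rsk u))}"
proof (rule unshifted.rsk_orbit_bij[OF assms, where b = "at3 knuth"])
  fix w j assume w: "mset w = mset u" "j \<in> {2..<length u}"
  show "mset (at3 knuth j w) = mset u & unshifted.rsk (at3 knuth j w) = (at3 knuth j (fst (unshifted.rsk w)), snd (unshifted.rsk w))"
    using w unshifted.rsk_knuth[of w j] mset_at3_knuth[of j w] mset_eq_length[OF w(1)] mset_eq_imp_distinct_iff[OF w(1)] assms by simp
qed (use unshifted_connected in blast)

lemma shifted_orbit_bij:
  assumes "distinct u"
  shows "bij_betw (\<lambda>w. fst (shifted.rsk w)) (orbit word_move ({0} \<union> {2..<length u}) u)
    {q \<in> {q. shifted.legal q & length q = length u}.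
      shifted.shape q = shifted.shape (fst (shifted.rsk u))}"
proof (rule shifted.rsk_orbit_bij[OF assms, where b = seq_move])
  fix w j assume w: "mset w = mset u" "j \<in> {0} \<union> {2..<length u}"
  have "j = 0 \<or> 2 <= j & j < length w" using w(2) mset_eq_length[OF w(1)] by auto
  then show "mset (word_move j w) = mset u & shifted.rsk (word_move j w) = (seq_move j (fst (shifted.rsk w)), snd (shifted.rsk w))"
    using w(1) rsk_word_move[of w j] mset_word_move[of j w] mset_eq_imp_distinct_iff[OF w(1)] assms by simp
qed (use shifted_connected in blast)

lemma word_move_path:
  assumes "distinct u" "w \<in> orbit word_move ({0} \<union> {2..<length u}) u"
  shows "\<exists>is. set is \<subseteq> {0} \<union> {2..<length u} & count_list is (length u - 1) <= 2 & w = fold word_move is u"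
proof -
  let ?J = "{0} \<union> {2..<length u}"
  let ?f = "\<lambda>w. fst (shifted.rsk w)"
  note b = shifted_orbit_bij[OF assms(1)]
  have v: "shifted.rsk u = (?f u, snd (shifted.rsk u))" by simp
  note vu = shifted.rsk_valid[OF assms(1) v]
  have fw: "shifted.legal (?f w)" "length (?f w) = length u" "shifted.shape (?f w) = shifted.shape (?f u)"
    using bij_betwE[OF b] assms(2) by auto
  obtain "is" where i: "set is \<subseteq> ?J" "count_list is (length u - 1) <= 2" "fold seq_move is (?f u) = ?f w"
    using shifted_connected[of "?f u" "?f w" "length u"] vu fw by auto
  have d: "distinct w" "length w = length u" if "w \<in> {w. mset w = mset u}" for w
    using that mset_eq_imp_distinct_iff[of w u] assms mset_eq_length[of w u] by auto
  have "?f (fold word_move is u) = fold seq_move is (?f u)"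
  proof (rule fold_commuting[where W = "{w. mset w = mset u}" and J = ?J, THEN conjunct2])
    fix w j assume w: "w \<in> {w. mset w = mset u}" "j \<in> ?J"
    show "word_move j w \<in> {w. mset w = mset u} & ?f (word_move j w) = seq_move j (?f w)"
      using rsk_word_move[OF d(1)[OF w(1)], of j] mset_word_move[of j w] w d(2)[OF w(1)] by auto
  qed (use i(1) in auto)
  then have "?f (fold word_move is u) = ?f w" using i(3) by simp
  moreover have "fold word_move is u \<in> orbit word_move ?J u" using i(1) unfolding orbit_def by blast
  ultimately have "fold word_move is u = w" using bij_betw_imp_inj_on[OF b] assms(2) by (meson inj_onD)
  then show ?thesis using i(1,2) by blast
qed

lemma growing_order:
  assumes "growing young xs" "i < length xs" "j < length xs" "xs ! i = (r, c)" "xs ! j = (r', c')" "r <= r'" "c <= c'"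
  shows "i <= j"
proof -
  have y: "young (set (take (Suc j) xs))" using assms(1,3) unfolding growing_def by simp
  have d: "distinct xs" using assms(1) unfolding growing_def by blast
  have "(r', c') \<in> set (take (Suc j) xs)" using assms(3,5) by (auto simp: in_set_conv_nth intro!: exI[of _ j])
  moreover have "1 <= r" "1 <= c" using young_pos[OF growing_set[OF assms(1)], of r c] assms(2,4) by (metis nth_mem)+
  ultimately have "(r, c) \<in> set (take (Suc j) xs)" using youngD[OF y] assms(6,7) by blast
  then obtain k where "k <= j" "xs ! k = (r, c)" using assms(3) by (auto simp: in_set_conv_nth less_Suc_eq_le)
  then show ?thesis using d assms(2-4) nth_eq_iff_index_eq[of xs k i] by simp
qed

definition compatible :: "nat set => nat => nat multiset => nat list => bool" where
  "compatible D m M is \<longleftrightarrow> length is = m & (\<forall>i\<in>set is. 1 <= i) & sorted is & (\<forall>j\<in>D. is ! (j - 1) < is ! j) & mset is = M"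

lemma finite_compatible: "finite {is. compatible D m M is}"
proof (rule finite_subset)
  show "{is. compatible D m M is} \<subseteq> {is. set is \<subseteq> set_mset M & length is = m}" unfolding compatible_def by auto
qed (rule finite_lists_length_eq, simp)

definition tableau_of :: "cell set => cell list => nat list => cell => nat" where
  "tableau_of D xs is = restrict (\<lambda>x. the (map_of (zip xs is) x)) D"

lemma tableau_of_nth:
  assumes "distinct xs" "set xs = D" "length is = length xs" "j < length xs"
  shows "tableau_of D xs is (xs ! j) = is ! j"
proof -
  have "map_of (zip xs is) (xs ! j) = Some (is ! j)"
    by (rule map_of_is_SomeI) (use assms in \<open>auto simp: in_set_zip intro!: exI[of _ j]\<close>)
  then show ?thesis unfolding tableau_of_def using assms(2,4) by auto
qed

text \<open>For a standard tableau, an ascent of contents means that the next cell is further right.\<close>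

lemma key_increasing:
  assumes g: "growing young xs" and i: "compatible (descents (map cont xs)) (length xs) M is"
    and pq: "p < q" "q < length xs"
  shows "(is ! p, snd (xs ! p)) < (is ! q, snd (xs ! q))"
  using pq
proof (induction q)
  case (Suc q)
  have step: "(is ! q, snd (xs ! q)) < (is ! Suc q, snd (xs ! Suc q))"
  proof -
    have le: "is ! q <= is ! Suc q" using i Suc.prems unfolding compatible_def by (simp add: sorted_nth_mono)
    show ?thesis
    proof (cases "is ! q = is ! Suc q")
      case True
      then have "Suc q ~: descents (map cont xs)" using i unfolding compatible_def by fastforce
      then have ct: "cont (xs ! q) <= cont (xs ! Suc q)" unfolding descents_def using Suc.prems by auto
      obtain r c where x: "xs ! q = (r, c)" by fastforce
      obtain r' c' where y: "xs ! Suc q = (r', c')" by fastforce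
      have "\<not> (r' <= r & c' <= c)" using growing_order[OF g _ _ y x] Suc.prems by fastforce
      then have "c < c'" using ct x y by auto
      then show ?thesis using True x y by simp
    next
      case False
      then show ?thesis using le by simp
    qed
  qed
  show ?case
  proof (cases "p = q")
    case True
    then show ?thesis using step by simp
  next
    case False
    then show ?thesis using Suc step by (meson Suc_lessD less_SucE order_less_trans)
  qed
qed simp

lemma semistandard_tableau_of:
  assumes g: "growing young xs" "set xs = diagram la" and i: "compatible (descents (map cont xs)) (length xs) M is"
  shows "tableau_of (diagram la) xs is \<in> semistandard la"
    "image_mset (tableau_of (diagram la) xs is) (mset_set (diagram la)) = M"
proof -
  let ?T = "tableau_of (diagram la) xs is"
  have d: "distinct xs" using g(1) unfolding growing_def by blast
  have len: "length is = length xs" using i unfolding compatible_def by blast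
  note T = tableau_of_nth[OF d g(2) len]
  have idx: "\<exists>j < length xs. xs ! j = x" if "x \<in> diagram la" for x using that g(2) by (metis in_set_conv_nth)
  have pos: "1 <= ?T x" if "x \<in> diagram la" for x
  proof -
    note xD = that
    obtain j where j: "j < length xs" "xs ! j = x" using idx[OF xD] by blast
    then have "is ! j \<in> set is" using len by simp
    then show ?thesis using i T[OF j(1)] j(2) unfolding compatible_def by auto
  qed
  have row: "?T (r, c) <= ?T (r, c')" if h: "(r, c) \<in> diagram la" "(r, c') \<in> diagram la" "c < c'" for r c c'
  proof -
    obtain p where p: "p < length xs" "xs ! p = (r, c)" using idx[OF h(1)] by blast
    obtain q where q: "q < length xs" "xs ! q = (r, c')" using idx[OF h(2)] by blast
    have "p <= q" using growing_order[OF g(1) p(1) q(1) p(2) q(2)] h(3) by simp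
    then have "is ! p <= is ! q" using i q(1) len unfolding compatible_def by (simp add: sorted_nth_mono)
    then show ?thesis using T[OF p(1)] T[OF q(1)] p q by simp
  qed
  have col: "?T (r, c) < ?T (r', c)" if h: "(r, c) \<in> diagram la" "(r', c) \<in> diagram la" "r < r'" for r r' c
  proof -
    obtain p where p: "p < length xs" "xs ! p = (r, c)" using idx[OF h(1)] by blast
    obtain q where q: "q < length xs" "xs ! q = (r', c)" using idx[OF h(2)] by blast
    have "p <= q" using growing_order[OF g(1) p(1) q(1) p(2) q(2)] h(3) by simp
    moreover have "p ~= q" using p q h(3) by auto
    ultimately have "(is ! p, snd (xs ! p)) < (is ! q, snd (xs ! q))" using key_increasing[OF g(1) i _ q(1)] by simp
    then show ?thesis using T[OF p(1)] T[OF q(1)] p q by simp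
  qed
  have "?T \<in> diagram la \<rightarrow>\<^sub>E {1..}" using pos unfolding tableau_of_def by (auto simp: PiE_def)
  then show "?T \<in> semistandard la" unfolding semistandard_def using row col by blast
  have "mset_set (diagram la) = mset xs" using mset_set_set[OF d] g(2) by simp
  moreover have "map ?T xs = is" by (rule nth_equalityI) (use len T in auto)
  ultimately show "image_mset ?T (mset_set (diagram la)) = M" using i unfolding compatible_def by (metis mset_map)
qed

text \<open>The cells of a semistandard tableau are numbered by increasing entry, and from left to right among equal entries.\<close>

lemma standardize:
  assumes la: "young (diagram la)" and T: "T \<in> semistandard la" "image_mset T (mset_set (diagram la)) = M"
  obtains xs "is" where "growing young xs" "set xs = diagram la" "compatible (descents (map cont xs)) (length xs) M is"
    "tableau_of (diagram la) xs is = T"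
proof -
  let ?D = "diagram la"
  \<comment> \<open>ties are broken by the column, as equal entries form a horizontal strip\<close>
  define key where "key = (\<lambda>x :: cell. (T x, snd x))"
  have row: "T (r, c) <= T (r, c')" if "(r, c) \<in> ?D" "(r, c') \<in> ?D" "c <= c'" for r c c'
    using T(1) that unfolding semistandard_def by (cases "c = c'") auto
  have col: "T (r, c) < T (r', c)" if "(r, c) \<in> ?D" "(r', c) \<in> ?D" "r < r'" for r r' c
    using T(1) that unfolding semistandard_def by auto
  have ext: "T \<in> ?D \<rightarrow>\<^sub>E {1..}" using T(1) unfolding semistandard_def by auto
  have mono: "key (r, c) < key (r', c')" if h: "(r, c) \<in> ?D" "(r', c') \<in> ?D" "r <= r'" "c <= c'" "(r, c) ~= (r', c')" for r c r' c'
  proof -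
    have p: "1 <= r" "1 <= c" using young_pos[OF la h(1)] by auto
    have m: "(r, c') \<in> ?D" by (rule youngD[OF la h(2)]) (use h p in auto)
    show ?thesis
    proof (cases "r = r'")
      case True
      then show ?thesis using row[OF h(1) m h(4)] h unfolding key_def by (auto simp: less_prod_def' le_less)
    next
      case False
      then have "T (r, c) < T (r', c')" using row[OF h(1) m h(4)] col[OF m h(2)] h(3) by simp
      then show ?thesis unfolding key_def by simp
    qed
  qed
  have inj: "inj_on key ?D"
  proof (rule inj_onI)
    fix x y assume h: "x \<in> ?D" "y \<in> ?D" "key x = key y"
    obtain r c where x: "x = (r, c)" by fastforce
    obtain r' c' where y: "y = (r', c')" by fastforce
    have "c = c'" using h(3) x y unfolding key_def by simp
    then show "x = y" using mono[of r c r' c'] mono[of r' c' r c] h x y by (cases "r <= r'") auto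
  qed
  obtain ds where ds: "set ds = ?D" "distinct ds" using finite_distinct_list[OF young_finite[OF la]] by blast
  define xs where "xs = sort_key key ds"
  have xs: "set xs = ?D" "distinct xs" "sorted (map key xs)" unfolding xs_def using ds by auto
  have idx: "p < q" if "p < length xs" "q < length xs" "key (xs ! p) < key (xs ! q)" for p q
  proof (rule ccontr)
    assume "\<not> p < q"
    then have "key (xs ! q) <= key (xs ! p)" using sorted_nth_mono[OF xs(3), of q p] that by simp
    then show False using that(3) by simp
  qed
  have inc: "key (xs ! p) < key (xs ! q)" if "p < q" "q < length xs" for p q
  proof -
    have "key (xs ! p) <= key (xs ! q)" using sorted_nth_mono[OF xs(3), of p q] that by simp
    moreover have "key (xs ! p) ~= key (xs ! q)"
      using inj_onD[OF inj, of "xs ! p" "xs ! q"] xs that nth_mem[of p xs] nth_mem[of q xs] nth_eq_iff_index_eq[OF xs(2), of p q] by auto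
    ultimately show ?thesis by simp
  qed
  have g: "growing young xs" unfolding growing_def
  proof (intro conjI allI impI)
    fix k assume "k <= length xs"
    show "young (set (take k xs))"
    proof (rule youngI)
      have sub: "set (take k xs) \<subseteq> ?D" using set_take_subset[of k xs] xs(1) by simp
      show "1 <= r & 1 <= c" if "(r, c) \<in> set (take k xs)" for r c using young_pos[OF la] sub that by blast
      fix r c r' c' assume h: "(r', c') \<in> set (take k xs)" "1 <= r" "r <= r'" "1 <= c" "c <= c'"
      have m: "(r', c') \<in> ?D" using h(1) sub by blast
      then have m': "(r, c) \<in> ?D" by (rule youngD[OF la]) (use h in auto)
      show "(r, c) \<in> set (take k xs)"
      proof (cases "(r, c) = (r', c')")
        case False
        obtain q where q: "q < k" "q < length xs" "xs ! q = (r', c')" using h(1) by (auto simp: in_set_conv_nth)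
        obtain p where p: "p < length xs" "xs ! p = (r, c)" using m' xs(1) by (metis in_set_conv_nth)
        have "p < q" using idx[OF p(1) q(2)] mono[OF m' m h(3,5) False] p(2) q(3) by simp
        then show ?thesis using p q by (auto simp: in_set_conv_nth intro!: exI[of _ p])
      qed (use h in auto)
    qed simp
  qed (rule xs(2))
  define ii where "ii = map T xs"
  have "compatible (descents (map cont xs)) (length xs) M ii" unfolding compatible_def
  proof (intro conjI ballI)
    show "length ii = length xs" unfolding ii_def by simp
    show "1 <= i" if "i \<in> set ii" for i using that ext xs(1) unfolding ii_def by (auto simp: PiE_def Pi_def)
    show "sorted ii" unfolding sorted_iff_nth_mono_less ii_def
    proof (intro allI impI)
      fix p q assume h: "p < q" "q < length (map T xs)"
      then show "map T xs ! p <= map T xs ! q" using inc[of p q] unfolding key_def by (auto simp: less_prod_def')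
    qed
    show "mset ii = M" unfolding ii_def mset_map T(2)[symmetric] using mset_set_set[OF xs(2)] xs(1) by simp
    fix j assume j: "j \<in> descents (map cont xs)"
    then have jl: "1 <= j" "j < length xs" "cont (xs ! j) < cont (xs ! (j - 1))" unfolding descents_def by auto
    obtain r c where x: "xs ! (j - 1) = (r, c)" by fastforce
    obtain r' c' where y: "xs ! j = (r', c')" by fastforce
    have xm: "(r, c) \<in> ?D" "(r', c') \<in> ?D" using xs(1) x y jl nth_mem[of "j - 1" xs] nth_mem[of j xs] by auto
    have k: "key (r, c) < key (r', c')" using inc[of "j - 1" j] jl x y by simp
    show "ii ! (j - 1) < ii ! j"
    proof (rule ccontr)
      assume "\<not> ii ! (j - 1) < ii ! j"
      then have "T (r, c) = T (r', c')" "c < c'" using k jl x y unfolding ii_def key_def by (auto simp: less_prod_def')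
      moreover from this have "r < r'" using jl(3) x y by auto
      moreover have m: "(r, c') \<in> ?D" by (rule youngD[OF la xm(2)]) (use calculation young_pos[OF la xm(1)] in auto)
      ultimately show False using row[OF xm(1) m] col[OF m xm(2)] by simp
    qed
  qed
  moreover have "tableau_of ?D xs ii = T"
  proof
    fix x show "tableau_of ?D xs ii x = T x"
    proof (cases "x \<in> ?D")
      case True
      then obtain j where j: "j < length xs" "xs ! j = x" using xs(1) by (metis in_set_conv_nth)
      show ?thesis using tableau_of_nth[OF xs(2,1) _ j(1), of ii] j unfolding ii_def by simp
    next
      case False
      then show ?thesis using PiE_arb[OF ext False] unfolding tableau_of_def by simp
    qed
  qed
  ultimately show thesis using that g xs(1) by blast
qed

lemma tableau_of_inj:
  assumes "growing young xs" "set xs = diagram la" "compatible (descents (map cont xs)) (length xs) M is"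
    and "growing young xs'" "set xs' = diagram la" "compatible (descents (map cont xs')) (length xs') M is'"
    and "tableau_of (diagram la) xs is = tableau_of (diagram la) xs' is'"
  shows "xs = xs' & is = is'"
proof -
  define T where "T = tableau_of (diagram la) xs is"
  have main: "map (\<lambda>x. (T x, snd x)) ys = zip js (map snd ys) & sorted (map (\<lambda>x. (T x, snd x)) ys) & distinct (map (\<lambda>x. (T x, snd x)) ys)"
    if h: "growing young ys" "set ys = diagram la" "compatible (descents (map cont ys)) (length ys) M js" "tableau_of (diagram la) ys js = T" for ys js
  proof -
    have d: "distinct ys" using h(1) unfolding growing_def by blast
    have len: "length js = length ys" using h(3) unfolding compatible_def by blast
    note t = tableau_of_nth[OF d h(2) len, unfolded h(4)]
    have e: "map (\<lambda>x. (T x, snd x)) ys = zip js (map snd ys)" by (rule nth_equalityI) (use t len in auto)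
    have "sorted_wrt (<) (map (\<lambda>x. (T x, snd x)) ys)"
      unfolding sorted_wrt_iff_nth_less using key_increasing[OF h(1,3)] t by auto
    then show ?thesis using e strict_sorted_iff by blast
  qed
  note m1 = main[OF assms(1-3) T_def[symmetric]] and m2 = main[OF assms(4-6)]
  have T': "tableau_of (diagram la) xs' is' = T" using assms(7) T_def by simp
  have "map (\<lambda>x. (T x, snd x)) xs = map (\<lambda>x. (T x, snd x)) xs'"
  proof (rule sorted_distinct_set_unique)
    show "set (map (\<lambda>x. (T x, snd x)) xs) = set (map (\<lambda>x. (T x, snd x)) xs')" by (simp only: set_map assms(2,5))
  qed (use m1 m2[OF T'] in blast)+
  moreover have "inj_on (\<lambda>x. (T x, snd x)) (set xs \<union> set xs')"
    using m1 assms(2,5) by (simp add: distinct_map)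
  ultimately have x: "xs = xs'" using map_inj_on by blast
  have "length is = length xs" "length is' = length xs" using assms(3,6) x unfolding compatible_def by auto
  then have "is = map fst (zip is (map snd xs))" "is' = map fst (zip is' (map snd xs))" by simp_all
  then have "is = is'" using m1 m2[OF T'] x by metis
  then show ?thesis using x by blast
qed

text \<open>A semistandard tableau is the same as a standard tableau together with the weakly increasing list of its entries,
  where equal entries are allowed at ascents only.\<close>

lemma schur_fundamental:
  assumes la: "young (diagram la)"
  defines "m \<equiv> sum_list la"
  shows "schur la = (\<Sum>q\<in>{q. unshifted.legal q & length q = m & unshifted.shape q = cfg (diagram la)}.
    fundamental m (descents q))"
proof
  fix M
  define Xs where "Xs = {xs. growing young xs & set xs = diagram la}"
  define Qs where "Qs = {q. unshifted.legal q & length q = m & unshifted.shape q = cfg (diagram la)}"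
  have len: "length xs = m" if "xs \<in> Xs" for xs
    using that distinct_card[of xs] diagram_card(2)[of la] unfolding Xs_def growing_def m_def by auto
  have bij: "bij_betw (map cont) Xs Qs"
  proof (rule bij_betw_imageI)
    show "inj_on (map cont) Xs" using growing_young_inj unfolding Xs_def by (intro inj_onI) auto
    show "map cont ` Xs = Qs"
    proof (intro equalityI subsetI)
      fix q assume "q \<in> map cont ` Xs"
      then obtain xs where xs: "q = map cont xs" "xs \<in> Xs" by (rule imageE)
      then show "q \<in> Qs" using growing_young_valid[of xs] len[OF xs(2)] unfolding Xs_def Qs_def by simp
    next
      fix q assume q: "q \<in> Qs"
      then obtain xs where xs: "growing young xs" "map cont xs = q" using valid_growing_young[of q] unfolding Qs_def by blast
      have "cfg (set xs) = cfg (diagram la)" using growing_young_valid(2)[OF xs(1)] xs(2) q unfolding Qs_def by simp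
      then have "set xs = diagram la" by (rule cfg_inj[OF growing_set[OF xs(1)] la])
      then show "q \<in> map cont ` Xs" using xs unfolding Xs_def by blast
    qed
  qed
  define P where "P = Sigma Xs (\<lambda>xs. {is. compatible (descents (map cont xs)) m M is})"
  have finX: "finite Xs"
  proof (rule finite_subset)
    show "Xs \<subseteq> {xs. set xs \<subseteq> diagram la & length xs = m}" using len unfolding Xs_def by auto
  qed (rule finite_lists_length_eq[OF diagram_card(1)])
  have "bij_betw (\<lambda>(xs, is). tableau_of (diagram la) xs is) P {T \<in> semistandard la. image_mset T (mset_set (diagram la)) = M}"
  proof (rule bij_betw_imageI)
    have P: "growing young xs" "set xs = diagram la" "compatible (descents (map cont xs)) (length xs) M is" if "(xs, is) \<in> P" for xs "is"
      using that len unfolding P_def Xs_def by auto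
    show "inj_on (\<lambda>(xs, is). tableau_of (diagram la) xs is) P"
    proof (rule inj_onI, clarify)
      fix xs "is" xs' is' assume h: "(xs, is) \<in> P" "(xs', is') \<in> P" "tableau_of (diagram la) xs is = tableau_of (diagram la) xs' is'"
      show "xs = xs' & is = is'" by (rule tableau_of_inj[OF P[OF h(1)] P[OF h(2)] h(3)])
    qed
    show "(\<lambda>(xs, is). tableau_of (diagram la) xs is) ` P = {T \<in> semistandard la. image_mset T (mset_set (diagram la)) = M}"
    proof (intro equalityI subsetI)
      fix T assume "T \<in> (\<lambda>(xs, is). tableau_of (diagram la) xs is) ` P"
      then obtain xs "is" where h: "(xs, is) \<in> P" "T = tableau_of (diagram la) xs is" by auto
      show "T \<in> {T \<in> semistandard la. image_mset T (mset_set (diagram la)) = M}"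
        using semistandard_tableau_of[OF P[OF h(1)]] h(2) by blast
    next
      fix T assume "T \<in> {T \<in> semistandard la. image_mset T (mset_set (diagram la)) = M}"
      then obtain xs "is" where h: "growing young xs" "set xs = diagram la" "compatible (descents (map cont xs)) (length xs) M is"
        "tableau_of (diagram la) xs is = T" using standardize[OF la, of T M] by blast
      have "xs \<in> Xs" using h unfolding Xs_def by blast
      then have "(xs, is) \<in> P" using h(3) len unfolding P_def by auto
      then show "T \<in> (\<lambda>(xs, is). tableau_of (diagram la) xs is) ` P" using h(4) by (intro image_eqI[of _ _ "(xs, is)"]) auto
    qed
  qed
  then have "schur la M = int (card P)" unfolding schur_def by (simp add: bij_betw_same_card)
  also have "\<dots> = (\<Sum>xs\<in>Xs. int (card {is. compatible (descents (map cont xs)) m M is}))"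
    unfolding P_def using finX finite_compatible by (simp add: card_SigmaI)
  also have "\<dots> = (\<Sum>xs\<in>Xs. fundamental m (descents (map cont xs)) M)"
    unfolding fundamental_def compatible_def by simp
  also have "\<dots> = (\<Sum>q\<in>Qs. fundamental m (descents q) M)" by (rule sum.reindex_bij_betw[OF bij])
  finally show "schur la M = (\<Sum>q\<in>{q. unshifted.legal q & length q = m & unshifted.shape q = cfg (diagram la)}.
    fundamental m (descents q)) M" unfolding sum_series Qs_def .
qed

lemma knuth_class_schur:
  fixes u :: "nat list"
  assumes "distinct u"
  shows "\<exists>la. is_partition (length u) la &
    (\<Sum>w\<in>orbit (at3 knuth) {2..<length u} u. fundamental (length u) (descents w)) = schur la"
proof -
  let ?q = "fst (unshifted.rsk u)"
  have v: "unshifted.rsk u = (?q, snd (unshifted.rsk u))" by simp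
  note vu = unshifted.rsk_valid[OF assms v]
  obtain xs where xs: "growing young xs" "map cont xs = ?q" using valid_growing_young vu by blast
  have c: "card (set xs) = length u" using xs vu distinct_card[of xs] unfolding growing_def by (metis length_map)
  obtain la where la: "is_partition (length u) la" "diagram la = set xs" using young_is_diagram[OF growing_set[OF xs(1)]] c by metis
  have yl: "young (diagram la)" using la(2) growing_set[OF xs(1)] by simp
  have sl: "sum_list la = length u" using la(1) unfolding is_partition_def by simp
  have sh: "unshifted.shape ?q = cfg (diagram la)" using growing_young_valid(2)[OF xs(1)] xs(2) la(2) by simp
  note b = unshifted_orbit_bij[OF assms, unfolded sh]
  have dw: "distinct w" if "w \<in> orbit (at3 knuth) {2..<length u} u" for w
  proof -
    note w = that
    obtain "is" where i: "set is \<subseteq> {2..<length u}" "w = fold (at3 knuth) is u" using w unfolding orbit_def by blast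
    have "mset (fold (at3 knuth) is x) = mset x" if "length x = length u" for x :: "nat list"
      using i(1) that
    proof (induction "is" arbitrary: x)
      case (Cons j js)
      have "mset (at3 knuth j x) = mset x" by (rule mset_at3_knuth) (use Cons.prems in auto)
      moreover have "length (at3 knuth j x) = length u" using mset_eq_length[OF calculation] Cons.prems by simp
      ultimately show ?case using Cons.IH[of "at3 knuth j x"] Cons.prems by simp
    qed simp
    then show ?thesis using i(2) mset_eq_imp_distinct_iff assms by blast
  qed
  have "(\<Sum>w\<in>orbit (at3 knuth) {2..<length u} u. fundamental (length u) (descents w)) =
      (\<Sum>w\<in>orbit (at3 knuth) {2..<length u} u. fundamental (length u) (descents (fst (unshifted.rsk w))))"
    by (rule sum.cong) (use dw unshifted.descents_rsk in auto)
  also have "\<dots> = (\<Sum>q\<in>{q \<in> {q. unshifted.legal q & length q = length u}. unshifted.shape q = cfg (diagram la)}.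
      fundamental (length u) (descents q))"
    by (rule sum.reindex_bij_betw[OF b])
  also have "\<dots> = schur la" unfolding schur_fundamental[OF yl] sl by (simp add: conj_assoc)
  finally show ?thesis using la(1) by blast
qed

lemma SST_fill: "strict_partition m ga ==> S \<in> SST ga \<longleftrightarrow> fill ga S & letters S = {1..sum_list ga}"
  unfolding SST_def fill_def letters_def bij_betw_def by auto

lemma descents_hook:
  assumes ga: "strict_partition m ga" and S: "S \<in> SST ga"
  shows "Des_word (hook S) = descents (contents S)"
proof -
  have f: "fill ga S" "letters S = {1..sum_list ga}" using SST_fill[OF ga] S by auto
  have L: "letter_list S = [1..<Suc (sum_list ga)]" unfolding letter_list_def f(2)
    by (metis atLeastLessThanSuc_atLeastAtMost sorted_list_of_set_range)
  have set: "set (hook S) = {1..sum_list ga}" using hook_set[OF shifted_young_finite[OF fill_dom(2)[OF ga f(1)]]] f(2) by simp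
  have "i \<in> Des_word (hook S) \<longleftrightarrow> i \<in> descents (contents S)" for i
  proof (cases "1 <= i & i < sum_list ga")
    case True
    have "before (hook S) (i + 1) i \<longleftrightarrow> content S (i + 1) < content S i"
      by (rule hook_consecutive(2)[OF ga f(1)]) (use True f(2) in auto)
    moreover have "contents S ! i = content S (i + 1)" "contents S ! (i - 1) = content S i" "length (contents S) = sum_list ga"
      unfolding contents_def L using True by (auto simp del: upt_Suc)
    ultimately show ?thesis using True unfolding Des_word_before descents_def by auto
  next
    case False
    have "length (contents S) = sum_list ga" unfolding contents_def L by (simp del: upt_Suc)
    then show ?thesis using False before_in_set[of "hook S" "i + 1" i] unfolding Des_word_before descents_def set by auto
  qed
  then show ?thesis by blast
qed

lemma SST_contents_bij:
  assumes ga: "strict_partition m ga"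
  shows "bij_betw contents (SST ga) {q \<in> {q. shifted.legal q & length q = m}.
    shifted.shape q = cfg (doubled (shifted_diagram ga))}"
proof (rule bij_betw_imageI)
  have m: "sum_list ga = m" using ga unfolding strict_partition_def by blast
  let ?L = "[1..<Suc m]"
  have L: "letter_list S = ?L" if "S \<in> SST ga" for S
    using that SST_fill[OF ga] m unfolding letter_list_def by (metis atLeastLessThanSuc_atLeastAtMost sorted_list_of_set_range)
  show "inj_on contents (SST ga)"
    using fill_normal_form[OF ga] SST_fill[OF ga] L by (intro inj_onI) metis
  show "contents ` SST ga = {q \<in> {q. shifted.legal q & length q = m}.
    shifted.shape q = cfg (doubled (shifted_diagram ga))}"
  proof (intro equalityI subsetI)
    fix q assume "q \<in> contents ` SST ga"
    then obtain S where S: "q = contents S" "S \<in> SST ga" by (rule imageE)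
    then show "q \<in> {q \<in> {q. shifted.legal q & length q = m}.
      shifted.shape q = cfg (doubled (shifted_diagram ga))}"
      using fill_contents_valid[OF ga] SST_fill[OF ga] m by simp
  next
    fix q assume "q \<in> {q \<in> {q. shifted.legal q & length q = m}.
      shifted.shape q = cfg (doubled (shifted_diagram ga))}"
    then have q: "shifted.legal q" "shifted.shape q = cfg (doubled (shifted_diagram ga))" "length q = m" by auto
    have sL: "sorted ?L" "distinct ?L" "length ?L = length q" using q(3) by (simp_all del: upt_Suc)
    note F = filling_of_fill[OF ga q(1,2) sL]
    have "filling_of ?L q \<in> SST ga" unfolding SST_fill[OF ga] using F m by (simp del: upt_Suc add: atLeastLessThanSuc_atLeastAtMost)
    then show "q \<in> contents ` SST ga" using F(3) by (metis image_eqI)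
  qed
qed

lemma queer_class_schurP:
  assumes "distinct u"
  shows "\<exists>ga. strict_partition (length u) ga &
    (\<Sum>w\<in>orbit word_move ({0} \<union> {2..<length u}) u. fundamental (length u) (descents w)) = schurP ga"
proof -
  let ?q = "fst (shifted.rsk u)"
  have v: "shifted.rsk u = (?q, snd (shifted.rsk u))" by simp
  note vu = shifted.rsk_valid[OF assms v]
  obtain es where es: "signed_growing es" "map scont es = ?q" using valid_signed_growing vu by blast
  have gr: "growing shifted_young (map fst es)" using es(1) unfolding signed_growing_def by blast
  have "distinct (map fst es)" using gr unfolding growing_def by blast
  then have "card (set (map fst es)) = length es" using distinct_card[of "map fst es"] by simp
  moreover have "length es = length u" using arg_cong[OF es(2), of length] vu by simp
  ultimately have c: "card (fst ` set es) = length u" by simp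
  have yes: "shifted_young (fst ` set es)" using growing_set[OF gr] by simp
  obtain ga where ga: "strict_partition (length u) ga" "shifted_diagram ga = fst ` set es" using shifted_young_is_diagram[OF yes] c by metis
  have sl: "sum_list ga = length u" using ga(1) unfolding strict_partition_def by simp
  have sh: "shifted.shape ?q = cfg (doubled (shifted_diagram ga))" using signed_growing_valid(2)[OF es(1)] es(2) ga(2) by simp
  note b = shifted_orbit_bij[OF assms, unfolded sh]
  have dw: "distinct w" if "w \<in> orbit word_move ({0} \<union> {2..<length u}) u" for w
  proof -
    note w = that
    obtain "is" where i: "set is \<subseteq> {0} \<union> {2..<length u}" "w = fold word_move is u" using w unfolding orbit_def by blast
    have "mset (fold word_move is x) = mset x" if "length x = length u" for x
      using i(1) that
    proof (induction "is" arbitrary: x)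
      case (Cons j js)
      have "mset (word_move j x) = mset x" by (rule mset_word_move) (use Cons.prems in auto)
      moreover have "length (word_move j x) = length u" using mset_eq_length[OF calculation] Cons.prems by simp
      ultimately show ?case using Cons.IH[of "word_move j x"] Cons.prems by simp
    qed simp
    then show ?thesis using i(2) mset_eq_imp_distinct_iff assms by blast
  qed
  have "(\<Sum>w\<in>orbit word_move ({0} \<union> {2..<length u}) u. fundamental (length u) (descents w)) =
      (\<Sum>w\<in>orbit word_move ({0} \<union> {2..<length u}) u. fundamental (length u) (descents (fst (shifted.rsk w))))"
    by (rule sum.cong) (use dw shifted.descents_rsk in auto)
  also have "\<dots> = (\<Sum>q\<in>{q \<in> {q. shifted.legal q & length q = length u}.
      shifted.shape q = cfg (doubled (shifted_diagram ga))}. fundamental (length u) (descents q))"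
    by (rule sum.reindex_bij_betw[OF b])
  also have "\<dots> = (\<Sum>S\<in>SST ga. fundamental (length u) (descents (contents S)))"
    by (rule sum.reindex_bij_betw[OF SST_contents_bij[OF ga(1)], symmetric])
  also have "\<dots> = schurP ga" unfolding schurP_def sl by (rule sum.cong) (use descents_hook[OF ga(1)] in auto)
  finally show ?thesis using ga(1) by blast
qed


section \<open>Words of concatenated tableaux\<close>

lemma orbit_word_mset:
  assumes "w \<in> orbit word_move ({0} \<union> {2..<length u}) u"
  shows "mset w = mset u"
proof -
  obtain "is" where i: "set is \<subseteq> {0} \<union> {2..<length u}" "w = fold word_move is u" using assms unfolding orbit_def by blast
  have "mset (fold word_move is x) = mset x" if "length x = length u" for x
    using i(1) that
  proof (induction "is" arbitrary: x)
    case (Cons j js)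
    have "mset (word_move j x) = mset x" by (rule mset_word_move) (use Cons.prems in auto)
    moreover have "length (word_move j x) = length u" using mset_eq_length[OF calculation] Cons.prems by simp
    ultimately show ?case using Cons.IH[of "word_move j x"] Cons.prems by simp
  qed simp
  then show ?thesis using i(2) by simp
qed

text \<open>The content sequences of all fillings of one shifted shape.\<close>

definition model_contents :: "nat list => int list set" where
  "model_contents ga = {q. shifted.legal q & length q = sum_list ga &
     shifted.shape q = cfg (doubled (shifted_diagram ga))}"

text \<open>An inverse of insertion on the sequences of one shape that respects the moves. It exists as the orbit of
  one word is in bijection with the sequences.\<close>

definition word_model :: "nat list => (int list => nat list) => bool" where
  "word_model ga om \<longleftrightarrow> (\<forall>q \<in> model_contents ga. distinct (om q) & set (om q) = {1..sum_list ga} & fst (shifted.rsk (om q)) = q &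
     (\<forall>i. i = 0 \<or> 2 <= i & i < sum_list ga --> om (seq_move i q) = word_move i (om q)))"

lemma word_model_exists: "\<exists>om. word_model ga om"
proof (cases "model_contents ga = {}")
  case False
  then obtain q0 where q0: "q0 \<in> model_contents ga" by blast
  then have v0: "shifted.legal q0" "length q0 = sum_list ga"
    "shifted.shape q0 = cfg (doubled (shifted_diagram ga))" unfolding model_contents_def by auto
  obtain u where u: "distinct u" "set u = {1..length q0}" "fst (shifted.rsk u) = q0" using shifted.rsk_surj[OF v0(1)] by blast
  have lu: "length u = sum_list ga" using distinct_card[OF u(1)] u(2) v0(2) by simp
  define C where "C = orbit word_move ({0} \<union> {2..<length u}) u"
  define f where "f = (\<lambda>w. fst (shifted.rsk w))"
  have b: "bij_betw f C (model_contents ga)"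
    using shifted_orbit_bij[OF u(1)] u(3) v0(3) lu unfolding C_def f_def model_contents_def by (simp add: conj_assoc)
  define om where "om = inv_into C f"
  have om: "om q \<in> C" "f (om q) = q" if "q \<in> model_contents ga" for q
    using that b unfolding om_def bij_betw_def by (auto simp: inv_into_into f_inv_into_f)
  have C: "distinct w" "set w = {1..sum_list ga}" "length w = sum_list ga" if "w \<in> C" for w
    using orbit_word_mset[of w u] that u(1,2) v0(2) lu mset_eq_imp_distinct_iff[of w u] mset_eq_setD[of w u] mset_eq_length[of w u]
    unfolding C_def by auto
  have "om (seq_move i q) = word_move i (om q)" if q: "q \<in> model_contents ga" and i: "i = 0 \<or> 2 <= i & i < sum_list ga" for q i
  proof -
    have m: "seq_move i q \<in> model_contents ga"
      using seq_move_valid[of q i] q i unfolding model_contents_def by auto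
    have "word_move i (om q) \<in> C" using orbit_step[of "om q" word_move _ u i] om(1)[OF q] i lu unfolding C_def by auto
    moreover have "f (word_move i (om q)) = seq_move i q"
      using rsk_word_move[of "om q" i] C[OF om(1)[OF q]] i om(2)[OF q] unfolding f_def by simp
    ultimately show ?thesis using b om[OF m] unfolding bij_betw_def by (metis inj_onD)
  qed
  then have "word_model ga om" unfolding word_model_def using om C unfolding f_def by blast
  then show ?thesis by blast
qed (simp add: word_model_def)

lemma word_modelD:
  assumes "word_model ga om" "q \<in> model_contents ga"
  shows "distinct (om q)" "set (om q) = {1..sum_list ga}" "length (om q) = sum_list ga" "fst (shifted.rsk (om q)) = q"
    "i = 0 \<or> 2 <= i & i < sum_list ga ==> om (seq_move i q) = word_move i (om q)"
proof -
  show d: "distinct (om q)" "set (om q) = {1..sum_list ga}" "fst (shifted.rsk (om q)) = q"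
    "i = 0 \<or> 2 <= i & i < sum_list ga ==> om (seq_move i q) = word_move i (om q)"
    using assms(1)[unfolded word_model_def, rule_format, OF assms(2)] by auto
  show "length (om q) = sum_list ga" using distinct_card[OF d(1)] d(2) by simp
qed

definition rank :: "filling => nat => nat" where
  "rank S k = card {l \<in> letters S. l < k}"

lemma nth_card_less:
  assumes "sorted L" "distinct L" "j < length L"
  shows "card {l \<in> set L. l < L ! j} = j"
proof -
  have "{l \<in> set L. l < L ! j} = set (take j L)"
  proof (intro equalityI subsetI)
    fix l assume "l \<in> {l \<in> set L. l < L ! j}"
    then obtain p where p: "p < length L" "L ! p = l" "l < L ! j" by (auto simp: in_set_conv_nth)
    have "p < j"
    proof (rule ccontr)
      assume "\<not> p < j"
      then show False using sorted_nth_mono[OF assms(1), of j p] p by simp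
    qed
    then show "l \<in> set (take j L)" using p by (auto simp: in_set_conv_nth intro!: exI[of _ p])
  next
    fix l assume "l \<in> set (take j L)"
    then obtain p where p: "p < j" "L ! p = l" by (auto simp: in_set_conv_nth)
    have "l <= L ! j" using sorted_nth_mono[OF assms(1), of p j] p assms(3) by simp
    moreover have "l ~= L ! j" using nth_eq_iff_index_eq[OF assms(2), of p j] p assms(3) by simp
    ultimately show "l \<in> {l \<in> set L. l < L ! j}" using p assms(3) by auto
  qed
  then show ?thesis using distinct_card[of "take j L"] assms(2,3) by simp
qed

lemma rank_letter_list:
  assumes "finite (letters S)"
  shows "j < length (letter_list S) ==> rank S (letter_list S ! j) = j"
    and "k \<in> letters S ==> rank S k < length (letter_list S) & letter_list S ! rank S k = k"
proof -
  have L: "sorted (letter_list S)" "distinct (letter_list S)" "set (letter_list S) = letters S"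
    unfolding letter_list_def using assms by auto
  show r: "rank S (letter_list S ! j) = j" if "j < length (letter_list S)" for j
    using nth_card_less[OF L(1,2) that] unfolding rank_def L(3) .
  show "rank S k < length (letter_list S) & letter_list S ! rank S k = k" if "k \<in> letters S"
  proof -
    have "k \<in> set (letter_list S)" using that unfolding L(3) .
    then obtain j where "j < length (letter_list S)" "letter_list S ! j = k" unfolding in_set_conv_nth by blast
    then show ?thesis using r by auto
  qed
qed

lemma rank_inj:
  assumes "finite (letters S)" "k \<in> letters S" "l \<in> letters S" "rank S k = rank S l"
  shows "k = l"
  using rank_letter_list(2)[OF assms(1)] assms(2-4) by metis

lemma rank_Suc:
  assumes "finite (letters S)" "a \<in> letters S" "b \<in> letters S" "a < b" "\<And>k. k \<in> letters S ==> \<not> (a < k & k < b)"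
  shows "rank S b = Suc (rank S a)"
proof -
  have "{l \<in> letters S. l < b} = insert a {l \<in> letters S. l < a}"
  proof (intro equalityI subsetI)
    fix l assume "l \<in> {l \<in> letters S. l < b}"
    then show "l \<in> insert a {l \<in> letters S. l < a}" using assms(5)[of l] by auto
  next
    fix l assume "l \<in> insert a {l \<in> letters S. l < a}"
    then show "l \<in> {l \<in> letters S. l < b}" using assms(2,4) by auto
  qed
  then show ?thesis unfolding rank_def using assms(1) by simp
qed

text \<open>The moves entry by entry; entries are what the two fillings of a concatenated tableau contribute.\<close>

lemma nth_at3:
  assumes "2 <= i" "i < length xs" "j < length xs"
  shows "at3 f i xs ! j = (case f (xs ! (i - 2), xs ! (i - 1), xs ! i) of (a, b, c) =>
    if j = i - 2 then a else if j = i - 1 then b else if j = i then c else xs ! j)"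
proof -
  obtain n where n: "i = n + 2" using assms(1) by (metis le_Suc_ex add.commute)
  obtain a b c where f: "f (xs ! (i - 2), xs ! (i - 1), xs ! i) = (a, b, c)" by (metis surj_pair)
  have l: "length (take n xs) = n" using n assms(2) by simp
  have f': "f (xs ! n, xs ! Suc n, xs ! Suc (Suc n)) = (a, b, c)" using f n by simp
  have e: "at3 f i xs = take n xs @ [a, b, c] @ drop (n + 3) xs" unfolding at3_def n by (simp add: numeral_3_eq_3 f')
  consider "j < n" | "j = n" | "j = n + 1" | "j = n + 2" | "n + 3 <= j" by linarith
  then have "(take n xs @ [a, b, c] @ drop (n + 3) xs) ! j = (if j = n then a else if j = n + 1 then b else if j = n + 2 then c else xs ! j)"
  proof cases
    case 5
    then have "([a, b, c] @ drop (n + 3) xs) ! (j - n) = drop (n + 3) xs ! (j - (n + 3))"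
      by (simp add: nth_append numeral_3_eq_3)
    then show ?thesis using 5 n assms(2,3) l by (simp add: nth_append)
  qed (use n assms(2) l in \<open>simp_all add: nth_append\<close>)
  then show ?thesis unfolding e f using n by simp
qed

lemma nth_swap_front: "2 <= length xs ==> j < length xs ==>
    swap_front xs ! j = (if j = 0 then xs ! 1 else if j = 1 then xs ! 0 else xs ! j)"
  by (cases xs rule: swap_front.cases) (auto simp: nth_Cons split: nat.splits)

lemma knuth_shift: "knuth (c + x, c + y, c + (z :: nat)) = (case knuth (x, y, z) of (p, q, r) => (c + p, c + q, c + r))"
  by auto

lemma triple_order:
  assumes "distinct w" "{a, b, c} \<subseteq> set w" "a ~= b" "b ~= c" "a ~= c"
  obtains x y z where "{x, y, z} = {a, b, c}" "x ~= y" "y ~= z" "x ~= z" "before w x y" "before w y z" "before w x z"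
    "filter (\<lambda>k. k \<in> {a, b, c}) w = [x, y, z]"
proof -
  let ?u = "filter (\<lambda>k. k \<in> {a, b, c}) w"
  have s: "set ?u = {a, b, c}" using assms(2) by auto
  have d: "distinct ?u" using assms(1) by simp
  have "length ?u = card {a, b, c}" using distinct_card[OF d] unfolding s by (rule sym)
  also have "\<dots> = 3" using assms(3-5) by simp
  finally have "length ?u = 3" .
  then obtain x y z where u: "?u = [x, y, z]" by (auto simp: numeral_3_eq_3 length_Suc_conv)
  have xyz: "{x, y, z} = {a, b, c}" "x ~= y" "y ~= z" "x ~= z" using s d unfolding u by auto
  have bw: "before w p q" if "before ?u p q" for p q
  proof -
    have pq: "p \<in> {a, b, c}" "q \<in> {a, b, c}" using before_in_set[OF that] s by auto
    have "p ~= q" using before_asym[OF d that] that by blast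
    then have "before w p q \<or> before w q p" using before_total[of p w q] pq assms(2) by blast
    moreover have "\<not> before w q p"
    proof
      assume "before w q p"
      then have "before ?u q p" using before_filter[of w q p "\<lambda>k. k \<in> {a, b, c}"] pq by blast
      then show False using before_asym[OF d that] by blast
    qed
    ultimately show ?thesis by blast
  qed
  show thesis by (rule that[OF xyz bw bw bw u]) (simp_all only: u before_three simp_thms)
qed

lemma contents_determined:
  assumes ga: "strict_partition (sum_list ga) ga" and om: "word_model ga om" and S: "fill ga S" and S': "fill ga S'"
    and l: "letters S = letters S'" and e: "\<And>k. k \<in> letters S ==> om (contents S) ! rank S k = om (contents S') ! rank S k"
  shows "S = S'"
proof -
  have q: "contents S \<in> model_contents ga" "contents S' \<in> model_contents ga"
    using fill_contents_valid[OF ga S] fill_contents_valid[OF ga S'] unfolding model_contents_def by auto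
  note w = word_modelD[OF om q(1)] and w' = word_modelD[OF om q(2)]
  note fin = fill_dom(3)[OF ga S]
  have "om (contents S) = om (contents S')"
  proof (rule nth_equalityI)
    show "length (om (contents S)) = length (om (contents S'))" using w(3) w'(3) by simp
    fix j assume "j < length (om (contents S))"
    then have j: "j < length (letter_list S)" using w(3) length_letter_list[OF ga S] by simp
    then have "letter_list S ! j \<in> letters S" using nth_mem[OF j] fin unfolding letter_list_def by simp
    then show "om (contents S) ! j = om (contents S') ! j" using e[of "letter_list S ! j"] rank_letter_list(1)[OF fin j] by simp
  qed
  then have "contents S = contents S'" using w(4) w'(4) by metis
  moreover have "letter_list S = letter_list S'" using l unfolding letter_list_def by simp
  ultimately show ?thesis using fill_normal_form[OF ga S] fill_normal_form[OF ga S'] by metis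
qed

lemma inj_on_case_sum: "inj_on (case_sum f g) (A <+> B) \<longleftrightarrow> inj_on f A & inj_on g B & f ` A \<inter> g ` B = {}"
proof
  assume h: "inj_on (case_sum f g) (A <+> B)"
  have "inj_on f A" using inj_onD[OF h, of "Inl _" "Inl _"] by (intro inj_onI) auto
  moreover have "inj_on g B" using inj_onD[OF h, of "Inr _" "Inr _"] by (intro inj_onI) auto
  moreover have "f a ~= g b" if "a \<in> A" "b \<in> B" for a b using inj_onD[OF h, of "Inl a" "Inr b"] that by auto
  ultimately show "inj_on f A & inj_on g B & f ` A \<inter> g ` B = {}" by auto
next
  assume h: "inj_on f A & inj_on g B & f ` A \<inter> g ` B = {}"
  then have ne: "f a ~= g b" if "a \<in> A" "b \<in> B" for a b using that by (metis IntI emptyE imageI)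
  show "inj_on (case_sum f g) (A <+> B)"
  proof (rule inj_onI)
    fix x y assume xy: "x \<in> A <+> B" "y \<in> A <+> B" "case_sum f g x = case_sum f g y"
    show "x = y" using xy(1)
    proof (rule PlusE)
      fix a assume a: "a \<in> A" "x = Inl a"
      show ?thesis using xy(2) by (rule PlusE) (use a xy(3) h ne[OF a(1)] in \<open>auto dest: inj_onD\<close>)
    next
      fix b assume b: "b \<in> B" "x = Inr b"
      show ?thesis using xy(2) by (rule PlusE) (use b xy(3) h ne[OF _ b(1)] in \<open>auto dest: inj_onD\<close>)
    qed
  qed
qed

locale tensor =
  fixes ga de :: "nat list" and wa wd :: "int list => nat list"
  assumes ga: "strict_partition (sum_list ga) ga" and de: "strict_partition (sum_list de) de"
    and wa: "word_model ga wa" and wd: "word_model de wd"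
begin

abbreviation "m \<equiv> sum_list ga"
abbreviation "n \<equiv> sum_list ga + sum_list de"

lemma tensor_iff:
  "(S, T) \<in> SST_tensor ga de \<longleftrightarrow> fill ga S & fill de T & letters S \<inter> letters T = {} & letters S \<union> letters T = {1..n}"
proof -
  have "inj_on (case_sum (absval S) (absval T)) (dom S <+> dom T) \<longleftrightarrow>
      inj_on (absval S) (dom S) & inj_on (absval T) (dom T) & letters S \<inter> letters T = {}"
    unfolding letters_def by (rule inj_on_case_sum)
  moreover have "case_sum (absval S) (absval T) ` (dom S <+> dom T) = letters S \<union> letters T"
    unfolding letters_def Plus_def by (simp add: image_Un image_image)
  ultimately show ?thesis unfolding SST_tensor_def fill_def bij_betw_def by auto
qed

lemma tensorD:
  assumes "(S, T) \<in> SST_tensor ga de"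
  shows "fill ga S" "fill de T" "letters S \<inter> letters T = {}" "letters S \<union> letters T = {1..n}"
  using assms tensor_iff by auto

text \<open>The entries of \<open>T\<close> are raised above those of \<open>S\<close> because \<open>hook(S)\<close> precedes \<open>hook(T)\<close>.\<close>

definition entry :: "filling \<times> filling => nat => nat" where
  "entry X k = (if k \<in> letters (fst X) then wa (contents (fst X)) ! rank (fst X) k
     else m + wd (contents (snd X)) ! rank (snd X) k)"

definition word_of :: "filling \<times> filling => nat list" where
  "word_of X = map (entry X) [1..<Suc n]"

lemma length_word_of [simp]: "length (word_of X) = n"
  unfolding word_of_def by (simp del: upt_Suc)

lemma word_of_nth: "1 <= k ==> k <= n ==> word_of X ! (k - 1) = entry X k"
  unfolding word_of_def by (simp del: upt_Suc)

lemma contents_model: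
  "fill ga S ==> contents S \<in> model_contents ga" "fill de T ==> contents T \<in> model_contents de"
  using fill_contents_valid[OF ga] fill_contents_valid[OF de] unfolding model_contents_def by auto

lemma model_word:
  "fill ga S ==> distinct (wa (contents S)) & set (wa (contents S)) = {1..m} & length (wa (contents S)) = m &
     fst (shifted.rsk (wa (contents S))) = contents S"
  "fill de T ==> distinct (wd (contents T)) & set (wd (contents T)) = {1..sum_list de} & length (wd (contents T)) = sum_list de &
     fst (shifted.rsk (wd (contents T))) = contents T"
  using word_modelD[OF wa contents_model(1)] word_modelD[OF wd contents_model(2)] by simp_all

lemma rank_less:
  "fill ga S ==> k \<in> letters S ==> rank S k < m" "fill de T ==> k \<in> letters T ==> rank T k < sum_list de"
  using rank_letter_list(2) fill_dom(3)[OF ga] fill_dom(3)[OF de] length_letter_list[OF ga] length_letter_list[OF de] by metis+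

lemma entry_range:
  assumes "(S, T) \<in> SST_tensor ga de"
  shows "k \<in> letters S ==> 1 <= entry (S, T) k & entry (S, T) k <= m"
    and "k \<in> letters T ==> m < entry (S, T) k & entry (S, T) k <= n"
proof -
  note f = tensorD[OF assms]
  show "1 <= entry (S, T) k & entry (S, T) k <= m" if "k \<in> letters S"
    using that rank_less(1)[OF f(1) that] model_word(1)[OF f(1)] nth_mem[of "rank S k" "wa (contents S)"] unfolding entry_def by auto
  show "m < entry (S, T) k & entry (S, T) k <= n" if "k \<in> letters T"
  proof -
    have "k ~: letters S" using that f(3) by blast
    then show ?thesis
      using that rank_less(2)[OF f(2) that] model_word(2)[OF f(2)] nth_mem[of "rank T k" "wd (contents T)"] unfolding entry_def by auto
  qed
qed

lemma entry_inj:
  assumes X: "(S, T) \<in> SST_tensor ga de"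
  shows "inj_on (entry (S, T)) {1..n}"
proof (rule inj_onI)
  fix k l assume h: "k \<in> {1..n}" "l \<in> {1..n}" "entry (S, T) k = entry (S, T) l"
  note f = tensorD[OF X]
  note fin = fill_dom(3)[OF ga f(1)] fill_dom(3)[OF de f(2)]
  have kl: "k \<in> letters S \<or> k \<in> letters T" "l \<in> letters S \<or> l \<in> letters T" using h(1,2) f(4) by blast+
  then consider "k \<in> letters S" "l \<in> letters S" | "k \<in> letters T" "l \<in> letters T" | "k \<in> letters S" "l \<in> letters T" | "k \<in> letters T" "l \<in> letters S" by blast
  then show "k = l"
  proof cases
    case 1
    then have "wa (contents S) ! rank S k = wa (contents S) ! rank S l" using h(3) unfolding entry_def by simp
    then have "rank S k = rank S l" using model_word(1)[OF f(1)] rank_less(1)[OF f(1)] 1 nth_eq_iff_index_eq by metis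
    then show ?thesis using rank_inj[OF fin(1) 1] by simp
  next
    case 2
    then have "k ~: letters S" "l ~: letters S" using f(3) by auto
    then have "wd (contents T) ! rank T k = wd (contents T) ! rank T l" using h(3) unfolding entry_def by simp
    then have "rank T k = rank T l" using model_word(2)[OF f(2)] rank_less(2)[OF f(2)] 2 nth_eq_iff_index_eq by metis
    then show ?thesis using rank_inj[OF fin(2) 2] by simp
  next
    case 3
    then show ?thesis using entry_range(1)[OF X 3(1)] entry_range(2)[OF X 3(2)] h(3) by simp
  next
    case 4
    then show ?thesis using entry_range(1)[OF X 4(2)] entry_range(2)[OF X 4(1)] h(3) by simp
  qed
qed

lemma distinct_word_of: "X \<in> SST_tensor ga de ==> distinct (word_of X)"
  using entry_inj[of "fst X" "snd X"] unfolding word_of_def distinct_map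
  by (simp add: atLeastLessThanSuc_atLeastAtMost del: upt_Suc)

text \<open>The size of an entry tells which filling owns the letter, and the entries of each filling give
  back its contents by insertion.\<close>

lemma word_of_inj: "inj_on word_of (SST_tensor ga de)"
proof (rule inj_onI)
  fix X Y assume h: "X \<in> SST_tensor ga de" "Y \<in> SST_tensor ga de" "word_of X = word_of Y"
  obtain S T where X: "X = (S, T)" by fastforce
  obtain S' T' where Y: "Y = (S', T')" by fastforce
  note f = tensorD[OF h(1)[unfolded X]]
  note f' = tensorD[OF h(2)[unfolded Y]]
  have e: "entry (S, T) k = entry (S', T') k" if "k \<in> {1..n}" for k
    using word_of_nth[of k X] word_of_nth[of k Y] h(3) that X Y by auto
  have "k \<in> letters S \<longleftrightarrow> k \<in> letters S'" for k
  proof (cases "k \<in> {1..n}")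
    case True
    then have kk: "k \<in> letters S \<or> k \<in> letters T" "k \<in> letters S' \<or> k \<in> letters T'" using f(4) f'(4) by auto
    show ?thesis
      using entry_range[OF h(1)[unfolded X], of k] entry_range[OF h(2)[unfolded Y], of k] e[OF True] kk by fastforce
  next
    case False
    then show ?thesis using f(4) f'(4) by blast
  qed
  then have lS: "letters S = letters S'" by blast
  then have lT: "letters T = letters T'" using f(3,4) f'(3,4) by blast
  have rS: "rank S = rank S'" "rank T = rank T'" using lS lT unfolding rank_def by auto
  have "S = S'"
  proof (rule contents_determined[OF ga wa f(1) f'(1) lS])
    fix k assume k: "k \<in> letters S"
    then have "entry (S, T) k = entry (S', T') k" using e[of k] f(4) by blast
    then show "wa (contents S) ! rank S k = wa (contents S') ! rank S k" using k lS rS unfolding entry_def by simp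
  qed
  moreover have "T = T'"
  proof (rule contents_determined[OF de wd f(2) f'(2) lT])
    fix k assume k: "k \<in> letters T"
    then have "k ~: letters S" "k ~: letters S'" using f(3) lS by auto
    moreover have "entry (S, T) k = entry (S', T') k" using e[of k] f(4) k by blast
    ultimately show "wd (contents T) ! rank T k = wd (contents T') ! rank T k" using rS unfolding entry_def by simp
  qed
  ultimately show "X = Y" unfolding X Y by simp
qed

lemma hook_tensor_props:
  assumes "(S, T) \<in> SST_tensor ga de"
  shows "distinct (hook S @ hook T)" "set (hook S) = letters S" "set (hook T) = letters T"
proof -
  note f = tensorD[OF assms]
  have fin: "finite (dom S)" "finite (dom T)" using shifted_young_finite fill_dom(2)[OF ga f(1)] fill_dom(2)[OF de f(2)] by blast+
  show s: "set (hook S) = letters S" "set (hook T) = letters T" using hook_set fin by auto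
  show "distinct (hook S @ hook T)" using hook_distinct fin f s unfolding fill_def by auto
qed

lemma contents_rank:
  assumes "strict_partition k ga'" "fill ga' S" "a \<in> letters S"
  shows "contents S ! rank S a = content S a"
  using rank_letter_list(2)[OF fill_dom(3)[OF assms(1,2)] assms(3)] unfolding contents_def by simp

text \<open>Within a filling this is the comparison of contents, and a letter of \<open>S\<close> precedes a letter of \<open>T\<close> on both sides.
  The gap conditions are needed since contents compare only letters that are consecutive in their filling.\<close>

lemma before_entry:
  assumes X: "(S, T) \<in> SST_tensor ga de" and kl: "k \<in> {1..n}" "l \<in> {1..n}" "k < l"
    and gS: "k \<in> letters S ==> l \<in> letters S ==> (\<And>j. j \<in> letters S ==> \<not> (k < j & j < l))"
    and gT: "k \<in> letters T ==> l \<in> letters T ==> (\<And>j. j \<in> letters T ==> \<not> (k < j & j < l))"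
  shows "before (hook_tensor (S, T)) k l \<longleftrightarrow> entry (S, T) k < entry (S, T) l"
    "before (hook_tensor (S, T)) l k \<longleftrightarrow> entry (S, T) l < entry (S, T) k"
proof -
  note f = tensorD[OF X]
  note h = hook_tensor_props[OF X]
  note bi = before_append_iff[OF h(1), unfolded h(2,3)]
  have w: "hook_tensor (S, T) = hook S @ hook T" unfolding hook_tensor_def by simp
  have main: "before (hook S @ hook T) k l \<longleftrightarrow> entry (S, T) k < entry (S, T) l"
  proof -
    consider "k \<in> letters S" "l \<in> letters S" | "k \<in> letters T" "l \<in> letters T" | "k \<in> letters S" "l \<in> letters T" | "k \<in> letters T" "l \<in> letters S"
      using kl f(4) by blast
    then show ?thesis
    proof cases
      case 1
      note g = gS[OF 1]
      have r: "rank S l = Suc (rank S k)" by (rule rank_Suc[OF fill_dom(3)[OF ga f(1)] 1 kl(3) g])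
      have v: "shifted.rsk (wa (contents S)) = (contents S, snd (shifted.rsk (wa (contents S))))"
        using model_word(1)[OF f(1)] by (metis prod.collapse)
      have "rank S l < m" by (rule rank_less(1)[OF f(1) 1(2)])
      then have "wa (contents S) ! rank S k < wa (contents S) ! rank S l \<longleftrightarrow> content S k < content S l"
        using shifted.rsk_valid[OF _ v] model_word(1)[OF f(1)] r contents_rank[OF ga f(1) 1(1)] contents_rank[OF ga f(1) 1(2)] by auto
      then show ?thesis using bi(1)[OF 1] hook_consecutive(1)[OF ga f(1) 1 kl(3) g] 1 unfolding entry_def by simp
    next
      case 2
      note g = gT[OF 2]
      have nS: "k ~: letters S" "l ~: letters S" using 2 f(3) by auto
      have r: "rank T l = Suc (rank T k)" by (rule rank_Suc[OF fill_dom(3)[OF de f(2)] 2 kl(3) g])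
      have v: "shifted.rsk (wd (contents T)) = (contents T, snd (shifted.rsk (wd (contents T))))"
        using model_word(2)[OF f(2)] by (metis prod.collapse)
      have "rank T l < sum_list de" by (rule rank_less(2)[OF f(2) 2(2)])
      then have "wd (contents T) ! rank T k < wd (contents T) ! rank T l \<longleftrightarrow> content T k < content T l"
        using shifted.rsk_valid[OF _ v] model_word(2)[OF f(2)] r contents_rank[OF de f(2) 2(1)] contents_rank[OF de f(2) 2(2)] by auto
      then show ?thesis using bi(2)[OF 2] hook_consecutive(1)[OF de f(2) 2 kl(3) g] nS unfolding entry_def by simp
    next
      case 3
      then show ?thesis using bi(3)[OF 3] entry_range(1)[OF X 3(1)] entry_range(2)[OF X 3(2)] by simp
    next
      case 4
      then show ?thesis using bi(4)[OF 4] entry_range(1)[OF X 4(2)] entry_range(2)[OF X 4(1)] by simp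
    qed
  qed
  have ne: "entry (S, T) k ~= entry (S, T) l" using inj_onD[OF entry_inj[OF X], of k l] kl by auto
  have "k \<in> set (hook S @ hook T)" "l \<in> set (hook S @ hook T)" using kl f(4) h(2,3) by auto
  then have "before (hook S @ hook T) l k \<longleftrightarrow> \<not> before (hook S @ hook T) k l"
    using before_total[of k _ l] before_asym[OF h(1)] kl(3) by blast
  then show "before (hook_tensor (S, T)) k l \<longleftrightarrow> entry (S, T) k < entry (S, T) l"
    "before (hook_tensor (S, T)) l k \<longleftrightarrow> entry (S, T) l < entry (S, T) k" using main ne unfolding w by auto
qed

lemma Des_word_of:
  assumes "X \<in> SST_tensor ga de"
  shows "Des_tensor X = descents (word_of X)"
proof -
  obtain S T where X: "X = (S, T)" by fastforce
  note A = assms[unfolded X]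
  have set: "set (hook_tensor X) = {1..n}" using hook_tensor_props[OF A] A tensor_iff unfolding X hook_tensor_def by auto
  have "i \<in> Des_word (hook_tensor X) \<longleftrightarrow> i \<in> descents (word_of X)" for i
  proof (cases "1 <= i & i < n")
    case True
    have "before (hook_tensor X) (i + 1) i \<longleftrightarrow> entry X (i + 1) < entry X i"
      unfolding X by (rule before_entry(2)[OF A]) (use True in auto)
    moreover have "word_of X ! i = entry X (i + 1)" "word_of X ! (i - 1) = entry X i"
      using word_of_nth[of "i + 1" X] word_of_nth[of i X] True by auto
    ultimately show ?thesis using True unfolding Des_word_before descents_def by auto
  next
    case False
    then show ?thesis using before_in_set[of "hook_tensor X" "i + 1" i] set unfolding Des_word_before descents_def by auto
  qed
  then show ?thesis unfolding Des_tensor_def by blast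
qed

text \<open>If consecutive letters belong to different fillings, then exchanging them changes no relative order
  inside either filling.\<close>

lemma swap_letters:
  assumes X: "(S, T) \<in> SST_tensor ga de" and xz: "x \<in> {1..n}" "z \<in> {1..n}" "x = Suc z \<or> z = Suc x"
    and sides: "x \<in> letters S \<longleftrightarrow> z \<in> letters T"
  shows "(swap_abs x z S, swap_abs x z T) \<in> SST_tensor ga de"
    "k \<in> {1..n} ==> entry (swap_abs x z S, swap_abs x z T) k = entry (S, T) (transpose x z k)"
proof -
  note f = tensorD[OF X]
  let ?t = "transpose x z"
  have one: "\<not> (x \<in> letters S & z \<in> letters S)" "\<not> (x \<in> letters T & z \<in> letters T)" using sides f(3,4) xz by blast+
  have mono: "strict_mono_on A ?t" if "\<not> (x \<in> A & z \<in> A)" for A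
  proof (rule strict_mono_onI)
    fix a b assume "a \<in> A" "b \<in> A" "a < b"
    then show "?t a < ?t b" using that xz(3) unfolding transpose_def by auto
  qed
  note rS = fill_relabel[OF ga f(1) mono[OF one(1)]] and rT = fill_relabel[OF de f(2) mono[OF one(2)]]
  have tu: "?t ` {1..n} = {1..n}" using xz by (auto simp: transpose_def image_iff split: if_splits)
  have "?t ` (letters S \<inter> letters T) = ?t ` letters S \<inter> ?t ` letters T" by (rule image_Int[OF inj_transpose])
  then have dis: "letters (swap_abs x z S) \<inter> letters (swap_abs x z T) = {}" unfolding rS(2) rT(2) using f(3) by simp
  have "letters (swap_abs x z S) \<union> letters (swap_abs x z T) = {1..n}"
    unfolding rS(2) rT(2) image_Un[symmetric] f(4) tu ..
  then show "(swap_abs x z S, swap_abs x z T) \<in> SST_tensor ga de" using tensor_iff rS(1) rT(1) dis by blast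
  have rank: "rank (swap_abs x z U) k = rank U (?t k)" if "letters (swap_abs x z U) = ?t ` letters U" "\<not> (x \<in> letters U & z \<in> letters U)" "?t k \<in> letters U" for U k
  proof -
    have sm: "strict_mono_on (letters U) ?t" by (rule mono[OF that(2)])
    have "{l \<in> ?t ` letters U. l < k} = ?t ` {l \<in> letters U. l < ?t k}"
    proof (intro equalityI subsetI)
      fix l assume "l \<in> {l \<in> ?t ` letters U. l < k}"
      then obtain l' where l': "l' \<in> letters U" "l = ?t l'" "?t l' < k" by auto
      have "l' < ?t k"
      proof (rule ccontr)
        assume "\<not> l' < ?t k"
        then have "?t (?t k) <= ?t l'" using strict_mono_on_leD[OF sm that(3) l'(1)] by simp
        then show False using l'(3) by simp
      qed
      then show "l \<in> ?t ` {l \<in> letters U. l < ?t k}" using l' by blast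
    next
      fix l assume "l \<in> ?t ` {l \<in> letters U. l < ?t k}"
      then obtain l' where l': "l' \<in> letters U" "l = ?t l'" "l' < ?t k" by auto
      have "?t l' < ?t (?t k)" by (rule strict_mono_onD[OF sm l'(1) that(3) l'(3)])
      then show "l \<in> {l \<in> ?t ` letters U. l < k}" using l' by auto
    qed
    then show ?thesis unfolding rank_def that(1) by (simp add: card_image inj_on_subset[OF inj_transpose])
  qed
  show "entry (swap_abs x z S, swap_abs x z T) k = entry (S, T) (?t k)" if k: "k \<in> {1..n}"
  proof -
    have iff: "k \<in> letters (swap_abs x z S) \<longleftrightarrow> ?t k \<in> letters S"
      unfolding rS(2) by (metis imageE imageI transpose_involutory)
    show ?thesis
    proof (cases "?t k \<in> letters S")
      case True
      then show ?thesis using rank[OF rS(2) one(1) True] iff rS(3) unfolding entry_def by simp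
    next
      case False
      have "?t k \<in> {1..n}" using k tu by blast
      then have "?t k \<in> letters T" using False f(4) by blast
      then show ?thesis using rank[OF rT(2) one(2)] iff rT(3) False unfolding entry_def by simp
    qed
  qed
qed

end


section \<open>The maps psi as moves on words\<close>

lemma dmap_model_word:
  assumes ga: "strict_partition (sum_list ga) ga" and om: "word_model ga om" and S: "fill ga S"
    and i: "2 <= i" "{i - 1, i, i + 1} \<subseteq> letters S"
  shows "fill ga (dmap i S)" "letters (dmap i S) = letters S"
    "k \<in> letters S ==> om (contents (dmap i S)) ! rank (dmap i S) k =
      (case knuth (om (contents S) ! rank S (i - 1), om (contents S) ! rank S i, om (contents S) ! rank S (i + 1)) of (a, b, c) =>
        if k = i - 1 then a else if k = i then b else if k = i + 1 then c else om (contents S) ! rank S k)"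
proof -
  note fin = fill_dom(3)[OF ga S]
  obtain L1 L2 where L: "letter_list S = L1 @ [i - 1, i, i + 1] @ L2"
    by (rule letter_list_consecutive[OF fin i(2,1)])
  define p where "p = length L1"
  note d = fill_dmap[OF ga S i L, folded p_def]
  show "fill ga (dmap i S)" and l: "letters (dmap i S) = letters S" by (rule d(1), rule d(2))
  have len: "length (letter_list S) = sum_list ga" by (rule length_letter_list[OF ga S])
  then have pm: "p + 2 < sum_list ga" unfolding L p_def by simp
  have r: "rank S (i - 1) = p" "rank S i = p + 1" "rank S (i + 1) = p + 2"
    using rank_letter_list(1)[OF fin, of p] rank_letter_list(1)[OF fin, of "p + 1"] rank_letter_list(1)[OF fin, of "p + 2"]
    unfolding L p_def by (simp_all add: nth_append)
  have q: "contents S \<in> model_contents ga" using fill_contents_valid[OF ga S] unfolding model_contents_def by auto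
  let ?w = "om (contents S)"
  have w: "length ?w = sum_list ga" by (rule word_modelD(3)[OF om q])
  have c: "om (contents (dmap i S)) = at3 knuth (p + 2) ?w"
    using word_modelD(5)[OF om q, of "p + 2"] pm d(3) unfolding seq_move_def word_move_def by simp
  have rk: "rank (dmap i S) = rank S" unfolding rank_def l ..
  assume k: "k \<in> letters S"
  have kl: "rank S k < length ?w" using rank_letter_list(2)[OF fin k] len w by simp
  have eq: "rank S k = p \<longleftrightarrow> k = i - 1" "rank S k = p + 1 \<longleftrightarrow> k = i" "rank S k = p + 2 \<longleftrightarrow> k = i + 1"
    using rank_inj[OF fin k] i(2) r by auto
  have "at3 knuth (p + 2) ?w ! rank S k = (case knuth (?w ! p, ?w ! (p + 1), ?w ! (p + 2)) of (a, b, c) =>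
      if rank S k = p then a else if rank S k = p + 1 then b else if rank S k = p + 2 then c else ?w ! rank S k)"
    using nth_at3[of "p + 2" ?w "rank S k" knuth] kl pm w by simp
  then show "om (contents (dmap i S)) ! rank (dmap i S) k =
      (case knuth (?w ! rank S (i - 1), ?w ! rank S i, ?w ! rank S (i + 1)) of (a, b, c) =>
        if k = i - 1 then a else if k = i then b else if k = i + 1 then c else ?w ! rank S k)"
    unfolding c rk r eq .
qed

lemma toggle_model_word:
  assumes ga: "strict_partition (sum_list ga) ga" and om: "word_model ga om" and S: "fill ga S"
    and l: "{1, 2} \<subseteq> letters S" "0 ~: letters S"
  shows "fill ga (toggle 2 S)" "letters (toggle 2 S) = letters S"
    "k \<in> letters S ==> om (contents (toggle 2 S)) ! rank (toggle 2 S) k = om (contents S) ! rank S (transpose 1 2 k)"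
proof -
  note fin = fill_dom(3)[OF ga S]
  have LL: "sorted (letter_list S)" "distinct (letter_list S)" "set (letter_list S) = letters S"
    unfolding letter_list_def using fin by auto
  define L2 where "L2 = filter (\<lambda>k. 2 < k) (letter_list S)"
  have "sorted (1 # 2 # L2)" "distinct (1 # 2 # L2)" unfolding L2_def using LL by (auto simp: sorted_wrt_filter)
  moreover have "set (1 # 2 # L2) = set (letter_list S)"
  proof (intro equalityI subsetI)
    fix k assume "k \<in> set (letter_list S)"
    moreover from this have "k ~= 0" using l(2) LL(3) by metis
    ultimately show "k \<in> set (1 # 2 # L2)" unfolding L2_def by auto
  qed (use l(1) LL(3) in \<open>auto simp: L2_def\<close>)
  ultimately have L: "letter_list S = 1 # 2 # L2" using LL sorted_distinct_set_unique by metis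
  note d = fill_toggle[OF ga S L]
  show "fill ga (toggle 2 S)" and lt: "letters (toggle 2 S) = letters S" by (rule d(1), rule d(2))
  have len: "length (letter_list S) = sum_list ga" by (rule length_letter_list[OF ga S])
  have r: "rank S 1 = 0" "rank S 2 = 1"
    using rank_letter_list(1)[OF fin, of 0] rank_letter_list(1)[OF fin, of 1] unfolding L by simp_all
  have q: "contents S \<in> model_contents ga" using fill_contents_valid[OF ga S] unfolding model_contents_def by auto
  let ?w = "om (contents S)"
  have w: "length ?w = sum_list ga" by (rule word_modelD(3)[OF om q])
  have c: "om (contents (toggle 2 S)) = swap_front ?w"
    using word_modelD(5)[OF om q, of 0] d(3) unfolding seq_move_def word_move_def by simp
  have rk: "rank (toggle 2 S) = rank S" unfolding rank_def lt ..
  assume k: "k \<in> letters S"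
  have kl: "rank S k < length ?w" using rank_letter_list(2)[OF fin k] len w by simp
  have eq: "rank S k = 0 \<longleftrightarrow> k = 1" "rank S k = 1 \<longleftrightarrow> k = 2"
    using rank_inj[OF fin k] l(1) r by auto
  have l2: "2 <= length ?w" using len w L by simp
  show "om (contents (toggle 2 S)) ! rank (toggle 2 S) k = ?w ! rank S (transpose 1 2 k)"
    unfolding c rk nth_swap_front[OF l2 kl] eq using r by (auto simp: transpose_def)
qed

context tensor begin

text \<open>The entrywise form of a Knuth move, as it is verified for each case of \<open>\<psi>\<^sub>i\<close>.\<close>

lemma word_move_entries:
  assumes i: "2 <= i" "i < n"
    and e: "\<And>k. k \<in> {1..n} ==> entry Y k = (case knuth (entry X (i - 1), entry X i, entry X (i + 1)) of (a, b, c) =>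
        if k = i - 1 then a else if k = i then b else if k = i + 1 then c else entry X k)"
  shows "word_of Y = word_move i (word_of X)"
proof (rule nth_equalityI)
  have W: "word_move i (word_of X) = at3 knuth i (word_of X)" unfolding word_move_def using i by simp
  show "length (word_of Y) = length (word_move i (word_of X))" unfolding W using i by (simp add: length_at3)
  fix j assume "j < length (word_of Y)"
  then have j: "j < n" by simp
  have t: "word_of X ! (i - 2) = entry X (i - 1)" "word_of X ! (i - 1) = entry X i" "word_of X ! i = entry X (i + 1)"
    "word_of X ! j = entry X (Suc j)" "word_of Y ! j = entry Y (Suc j)"
    using word_of_nth[of "i - 1" X] word_of_nth[of i X] word_of_nth[of "i + 1" X] word_of_nth[of "Suc j" X] word_of_nth[of "Suc j" Y] i j
    by (simp_all add: numeral_2_eq_2)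
  have eq: "j = i - 2 \<longleftrightarrow> Suc j = i - 1" "j = i - 1 \<longleftrightarrow> Suc j = i" "j = i \<longleftrightarrow> Suc j = i + 1" using i by auto
  have n: "at3 knuth i (word_of X) ! j = (case knuth (entry X (i - 1), entry X i, entry X (i + 1)) of (a, b, c) =>
        if Suc j = i - 1 then a else if Suc j = i then b else if Suc j = i + 1 then c else entry X (Suc j))"
    using nth_at3[of i "word_of X" j knuth] i j unfolding t eq by simp
  show "word_of Y ! j = word_move i (word_of X) ! j" unfolding W n t by (rule e) (use j in simp)
qed

lemma before_entry_iff:
  assumes X: "(S, T) \<in> SST_tensor ga de" and kl: "k \<in> {1..n}" "l \<in> {1..n}" "k ~= l"
    and gap: "\<And>j. k < j & j < l \<or> l < j & j < k ==> \<not> {k, j, l} \<subseteq> letters S & \<not> {k, j, l} \<subseteq> letters T"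
  shows "before (hook_tensor (S, T)) k l \<longleftrightarrow> entry (S, T) k < entry (S, T) l"
proof (cases "k < l")
  case True
  show ?thesis by (rule before_entry(1)[OF X kl(1,2) True]) (use gap in auto)
next
  case False
  then have "l < k" using kl(3) by simp
  show ?thesis by (rule before_entry(2)[OF X kl(2,1) \<open>l < k\<close>]) (use gap in auto)
qed

text \<open>If \<open>i\<close> is between \<open>i - 1\<close> and \<open>i + 1\<close> in the reading word, then the three entries are monotone and both sides
  do nothing. If the three letters are in one filling, then \<open>d\<^sub>i\<close> is a Knuth move of its word. If both fillings own
  some of them, then all three compare as their entries, and \<open>\<psi>\<^sub>i\<close> exchanges the smallest entry with
  the largest one.\<close>

lemma psi_word_ge2:
  assumes A: "(S, T) \<in> SST_tensor ga de" and i: "2 <= i" "i < n"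
  shows "psi i (S, T) \<in> SST_tensor ga de & word_of (psi i (S, T)) = word_move i (word_of (S, T))"
proof -
  let ?e = "entry (S, T)" and ?h = "hook_tensor (S, T)" and ?K = "{i - 1, i, i + 1}"
  note f = tensorD[OF A]
  have K: "?K \<subseteq> {1..n}" using i by auto
  have setw: "set ?h = {1..n}" "distinct ?h" using hook_tensor_props[OF A] f(4) unfolding hook_tensor_def by auto
  have ne: "i - 1 ~= i" "i ~= i + 1" "i - 1 ~= i + 1" using i by auto
  obtain x y z where xyz: "{x, y, z} = ?K" "x ~= y" "y ~= z" "x ~= z" "before ?h x y" "before ?h y z" "before ?h x z"
    and u: "filter (\<lambda>k. k \<in> ?K) ?h = [x, y, z]"
    by (rule triple_order[OF setw(2) _ ne]) (use K setw(1) in auto)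
  have xK: "x \<in> ?K" "y \<in> ?K" "z \<in> ?K" using xyz(1) by auto
  then have xn: "x \<in> {1..n}" "y \<in> {1..n}" "z \<in> {1..n}" using K by auto
  have psi: "psi i (S, T) = (if y = i then (S, T)
          else if ?K \<subseteq> letters S then (dmap i S, T)
          else if ?K \<subseteq> letters T then (S, dmap i T)
          else (swap_abs x z S, swap_abs x z T))"
    using i unfolding psi_def u Let_def by simp
  consider "y = i" | "y ~= i" "?K \<subseteq> letters S" | "y ~= i" "\<not> ?K \<subseteq> letters S" "?K \<subseteq> letters T"
    | "y ~= i" "\<not> ?K \<subseteq> letters S" "\<not> ?K \<subseteq> letters T" by blast
  then show ?thesis
  proof cases
    case 1
    then have xz: "x = i - 1 & z = i + 1 \<or> x = i + 1 & z = i - 1" using xyz by auto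
    have "?e x < ?e y" by (rule iffD1[OF before_entry_iff[OF A xn(1,2) xyz(2)] xyz(5)]) (use xz 1 in auto)
    moreover have "?e y < ?e z" by (rule iffD1[OF before_entry_iff[OF A xn(2,3) xyz(3)] xyz(6)]) (use xz 1 in auto)
    ultimately have "knuth (?e (i - 1), ?e i, ?e (i + 1)) = (?e (i - 1), ?e i, ?e (i + 1))" using xz 1 by auto
    then have "word_of (S, T) = word_move i (word_of (S, T))" by (intro word_move_entries i) auto
    then show ?thesis using A 1 unfolding psi by simp
  next
    case 2
    note d = dmap_model_word[OF ga wa f(1) i(1) 2(2)]
    have "(dmap i S, T) \<in> SST_tensor ga de" using f d(1,2) tensor_iff by simp
    moreover have "word_of (dmap i S, T) = word_move i (word_of (S, T))"
    proof (rule word_move_entries[OF i])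
      fix k
      show "entry (dmap i S, T) k = (case knuth (?e (i - 1), ?e i, ?e (i + 1)) of (a, b, c) =>
        if k = i - 1 then a else if k = i then b else if k = i + 1 then c else ?e k)"
      proof (cases "k \<in> letters S")
        case True
        then have "entry (dmap i S, T) k = wa (contents (dmap i S)) ! rank (dmap i S) k" "?e k = wa (contents S) ! rank S k"
          unfolding entry_def using d(2) by simp_all
        moreover have "?e (i - 1) = wa (contents S) ! rank S (i - 1)" "?e i = wa (contents S) ! rank S i" "?e (i + 1) = wa (contents S) ! rank S (i + 1)"
          unfolding entry_def using 2(2) by simp_all
        ultimately show ?thesis using d(3)[OF True] by (simp only:)
      next
        case False
        moreover have "k ~= i - 1" "k ~= i" "k ~= i + 1" using False 2(2) by auto
        ultimately show ?thesis unfolding entry_def using d(2) by (simp split: prod.split)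
      qed
    qed
    ultimately show ?thesis using 2 unfolding psi by simp
  next
    case 3
    note d = dmap_model_word[OF de wd f(2) i(1) 3(3)]
    have nS: "i - 1 ~: letters S" "i ~: letters S" "i + 1 ~: letters S" using 3(3) f(3) by auto
    have "(S, dmap i T) \<in> SST_tensor ga de" using f d(1,2) tensor_iff by simp
    moreover have "word_of (S, dmap i T) = word_move i (word_of (S, T))"
    proof (rule word_move_entries[OF i])
      fix k assume k: "k \<in> {1..n}"
      let ?w = "wd (contents T)"
      have e3: "?e (i - 1) = m + ?w ! rank T (i - 1)" "?e i = m + ?w ! rank T i" "?e (i + 1) = m + ?w ! rank T (i + 1)"
        unfolding entry_def using nS by simp_all
      show "entry (S, dmap i T) k = (case knuth (?e (i - 1), ?e i, ?e (i + 1)) of (a, b, c) =>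
        if k = i - 1 then a else if k = i then b else if k = i + 1 then c else ?e k)"
      proof (cases "k \<in> letters S")
        case True
        moreover have "k ~= i - 1" "k ~= i" "k ~= i + 1" using True nS by auto
        ultimately show ?thesis unfolding entry_def by (simp split: prod.split)
      next
        case False
        then have kT: "k \<in> letters T" using k f(4) by blast
        have 1: "entry (S, dmap i T) k = m + wd (contents (dmap i T)) ! rank (dmap i T) k" "?e k = m + ?w ! rank T k"
          unfolding entry_def using False by simp_all
        show ?thesis unfolding e3 1 knuth_shift d(3)[OF kT] by (simp split: prod.split)
      qed
    qed
    moreover have "psi i (S, T) = (S, dmap i T)" unfolding psi using 3 by (simp only: if_False if_True)
    ultimately show ?thesis by simp
  next
    case 4
    have lt: "?e a < ?e b" if "before ?h a b" "a \<in> ?K" "b \<in> ?K" "a ~= b" for a b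
    proof (rule iffD1[OF before_entry_iff[OF A] that(1)])
      show "a \<in> {1..n}" "b \<in> {1..n}" "a ~= b" using that K by auto
      fix j assume "a < j & j < b \<or> b < j & j < a"
      then have "{a, j, b} = ?K" using that(2-4) by auto
      then show "\<not> {a, j, b} \<subseteq> letters S & \<not> {a, j, b} \<subseteq> letters T" using 4 by simp
    qed
    have exy: "?e x < ?e y" "?e y < ?e z" using lt xyz xK by auto
    have side: "a \<in> letters S \<longleftrightarrow> ?e a <= m" if "a \<in> {1..n}" for a
    proof (cases "a \<in> letters S")
      case True
      then show ?thesis using entry_range(1)[OF A True] by simp
    next
      case False
      then have "a \<in> letters T" using that f(4) by blast
      then show ?thesis using entry_range(2)[OF A, of a] False by simp
    qed
    have inT: "a \<in> letters T \<longleftrightarrow> a ~: letters S" if "a \<in> {1..n}" for a using that f(3,4) by blast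
    have "x \<in> letters S"
    proof (rule ccontr)
      assume "x ~: letters S"
      then have "x ~: letters S" "y ~: letters S" "z ~: letters S" using side xn exy by auto
      then have "{x, y, z} \<subseteq> letters T" using inT xn by simp
      then show False using 4(3) unfolding xyz(1) by blast
    qed
    moreover have "z \<in> letters T"
    proof (rule ccontr)
      assume "z ~: letters T"
      then have "z \<in> letters S" using inT xn by simp
      then have "x \<in> letters S" "y \<in> letters S" "z \<in> letters S" using side xn exy by auto
      then have "{x, y, z} \<subseteq> letters S" by simp
      then show False using 4(2) unfolding xyz(1) by blast
    qed
    ultimately have sides: "x \<in> letters S \<longleftrightarrow> z \<in> letters T" by blast
    have cases: "y = i - 1 & x = i & z = i + 1 \<or> y = i - 1 & x = i + 1 & z = i
        \<or> y = i + 1 & x = i & z = i - 1 \<or> y = i + 1 & x = i - 1 & z = i" using 4(1) xyz(2-4) xK by auto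
    then have adj: "x = Suc z \<or> z = Suc x" using i by auto
    note s = swap_letters[OF A xn(1,3) adj sides]
    have "word_of (swap_abs x z S, swap_abs x z T) = word_move i (word_of (S, T))"
    proof (rule word_move_entries[OF i])
      fix k assume k: "k \<in> {1..n}"
      show "entry (swap_abs x z S, swap_abs x z T) k = (case knuth (?e (i - 1), ?e i, ?e (i + 1)) of (a, b, c) =>
        if k = i - 1 then a else if k = i then b else if k = i + 1 then c else ?e k)"
        unfolding s(2)[OF k]
        using cases by (elim disjE conjE) (use exy i in \<open>auto simp: transpose_def\<close>)
    qed
    moreover have "psi i (S, T) = (swap_abs x z S, swap_abs x z T)" unfolding psi using 4 by (simp only: if_False)
    ultimately show ?thesis using s(1) by simp
  qed
qed

lemma psi_word_0:
  assumes A: "(S, T) \<in> SST_tensor ga de"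
  shows "psi 0 (S, T) \<in> SST_tensor ga de & word_of (psi 0 (S, T)) = word_move 0 (word_of (S, T))"
proof (cases "2 <= n")
  case False
  have "letters S \<union> letters T = {1..n}" using A tensor_iff by auto
  then have l: "2 ~: letters S" "2 ~: letters T" using False by auto
  have "swap_front w = w" if "length w < 2" for w :: "nat list" using that by (cases w rule: swap_front.cases) auto
  then have "word_move 0 (word_of (S, T)) = word_of (S, T)" using False unfolding word_move_def by simp
  then show ?thesis using A l unfolding psi_def by simp
next
  case True
  let ?e = "entry (S, T)"
  note f = tensorD[OF A]
  have n0: "0 ~: letters S" "0 ~: letters T" using f(4) by (metis UnI1 atLeastAtMost_iff not_one_le_zero, metis UnI2 atLeastAtMost_iff not_one_le_zero)
  have n12: "1 \<in> {1..n}" "2 \<in> {1..n}" using True by auto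
  have word: "word_of Y = word_move 0 (word_of (S, T))" if "\<And>k. k \<in> {1..n} ==> entry Y k = ?e (transpose 1 2 k)" for Y
  proof (rule nth_equalityI)
    have l: "length (swap_front w) = length w" for w :: "nat list" by (cases w rule: swap_front.cases) auto
    show "length (word_of Y) = length (word_move 0 (word_of (S, T)))" unfolding word_move_def by (simp add: l)
    fix j assume "j < length (word_of Y)"
    then have j: "j < n" by simp
    have t: "word_of X ! j = entry X (Suc j)" "word_of X ! 0 = entry X 1" "word_of X ! 1 = entry X 2" for X
      using word_of_nth[of "Suc j" X] word_of_nth[of 1 X] word_of_nth[of 2 X] True j by simp_all
    have n: "swap_front (word_of (S, T)) ! j = (if j = 0 then ?e 2 else if j = 1 then ?e 1 else ?e (Suc j))"
      using nth_swap_front[of "word_of (S, T)" j] True j unfolding t by simp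
    have "entry Y (Suc j) = ?e (transpose 1 2 (Suc j))" by (rule that) (use j in simp)
    then show "word_of Y ! j = word_move 0 (word_of (S, T)) ! j"
      unfolding word_move_def t by (simp add: n transpose_def numeral_2_eq_2)
  qed
  consider "{1, 2} \<subseteq> letters S" | "{1, 2} \<subseteq> letters T" | "1 \<in> letters S" "2 \<in> letters T" | "1 \<in> letters T" "2 \<in> letters S"
    using n12 f(4) by blast
  then show ?thesis
  proof cases
    case 1
    note d = toggle_model_word[OF ga wa f(1) 1 n0(1)]
    have psi: "psi 0 (S, T) = (toggle 2 S, T)" using 1 unfolding psi_def dmap_def by simp
    have "(toggle 2 S, T) \<in> SST_tensor ga de" using f d(1,2) tensor_iff by simp
    moreover have "word_of (toggle 2 S, T) = word_move 0 (word_of (S, T))"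
    proof (rule word)
      fix k
      show "entry (toggle 2 S, T) k = ?e (transpose 1 2 k)"
      proof (cases "k \<in> letters S")
        case True
        moreover have "transpose 1 2 k \<in> letters S" using True 1 by (auto simp: transpose_def)
        ultimately show ?thesis using d(2) d(3)[OF True] unfolding entry_def by simp
      next
        case False
        then have "transpose 1 2 k = k" using 1 by (auto simp: transpose_def)
        then show ?thesis using False d(2) unfolding entry_def by simp
      qed
    qed
    ultimately show ?thesis unfolding psi by simp
  next
    case 2
    note d = toggle_model_word[OF de wd f(2) 2 n0(2)]
    have nS: "1 ~: letters S" "2 ~: letters S" using 2 f(3) by auto
    have psi: "psi 0 (S, T) = (S, toggle 2 T)" using 2 nS unfolding psi_def dmap_def by simp
    have "(S, toggle 2 T) \<in> SST_tensor ga de" using f d(1,2) tensor_iff by simp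
    moreover have "word_of (S, toggle 2 T) = word_move 0 (word_of (S, T))"
    proof (rule word)
      fix k assume k: "k \<in> {1..n}"
      show "entry (S, toggle 2 T) k = ?e (transpose 1 2 k)"
      proof (cases "k \<in> letters S")
        case True
        then have "transpose 1 2 k = k" using nS by (auto simp: transpose_def)
        then show ?thesis using True unfolding entry_def by simp
      next
        case False
        moreover have "transpose 1 2 k ~: letters S" using False nS by (auto simp: transpose_def)
        moreover have "k \<in> letters T" using k f(4) False by blast
        ultimately show ?thesis using d(3) unfolding entry_def by simp
      qed
    qed
    ultimately show ?thesis unfolding psi by simp
  next
    case 3
    then have l: "1 ~: letters T" "2 ~: letters S" using f(3) by auto
    have psi: "psi 0 (S, T) = (swap_abs 1 2 S, swap_abs 1 2 T)" using 3 l unfolding psi_def by simp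
    show ?thesis unfolding psi using swap_letters[OF A n12] 3 word by simp
  next
    case 4
    then have l: "1 ~: letters S" "2 ~: letters T" using f(3) by auto
    have psi: "psi 0 (S, T) = (swap_abs 1 2 S, swap_abs 1 2 T)" using 4 l unfolding psi_def by simp
    show ?thesis unfolding psi using swap_letters[OF A n12] l word by simp
  qed
qed

lemma psi_word:
  assumes "X \<in> SST_tensor ga de" "i = 0 \<or> 2 <= i & i < n"
  shows "psi i X \<in> SST_tensor ga de" "word_of (psi i X) = word_move i (word_of X)"
  using psi_word_0[of "fst X" "snd X"] psi_word_ge2[of "fst X" "snd X" i] assms by auto

end


section \<open>The queer dual equivalence\<close>

lemma nth_at3_other:
  assumes "2 <= i" "i < length xs" "j < length xs" "j + 2 < i \<or> i < j"
  shows "at3 f i xs ! j = xs ! j"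
proof -
  have "j ~= i - 2" "j ~= i - 1" "j ~= i" using assms(1,4) by auto
  then show ?thesis using nth_at3[OF assms(1-3), of f] by (simp split: prod.splits)
qed

text \<open>The two moves act on disjoint sets of positions.\<close>

lemma at3_commute:
  assumes i: "2 <= i" "i + 3 <= j" "j < length xs"
  shows "at3 f j (at3 f i xs) = at3 f i (at3 f j xs)"
proof -
  have i': "i < length xs" "2 <= j" using i by auto
  note l = length_at3[OF i(1) i'(1)] length_at3[OF i'(2) i(3)]
  have a: "at3 f i xs ! (j - 2) = xs ! (j - 2)" "at3 f i xs ! (j - 1) = xs ! (j - 1)" "at3 f i xs ! j = xs ! j"
    by (rule nth_at3_other; use i in arith)+
  have b: "at3 f j xs ! (i - 2) = xs ! (i - 2)" "at3 f j xs ! (i - 1) = xs ! (i - 1)" "at3 f j xs ! i = xs ! i"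
    by (rule nth_at3_other; use i in arith)+
  show ?thesis
  proof (rule nth_equalityI)
    show "length (at3 f j (at3 f i xs)) = length (at3 f i (at3 f j xs))" using l i i' by (simp add: length_at3)
    fix k assume "k < length (at3 f j (at3 f i xs))"
    then have k: "k < length xs" using length_at3[of j "at3 f i xs" f] l i i' by simp
    have 1: "at3 f j (at3 f i xs) ! k = (case f (xs ! (j - 2), xs ! (j - 1), xs ! j) of (a, b, c) =>
        if k = j - 2 then a else if k = j - 1 then b else if k = j then c else at3 f i xs ! k)"
      using nth_at3[of j "at3 f i xs" k f] k l i i' unfolding a by simp
    have 2: "at3 f i (at3 f j xs) ! k = (case f (xs ! (i - 2), xs ! (i - 1), xs ! i) of (a, b, c) =>
        if k = i - 2 then a else if k = i - 1 then b else if k = i then c else at3 f j xs ! k)"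
      using nth_at3[of i "at3 f j xs" k f] k l i i' unfolding b by simp
    have ij: "i ~= j - 2" "i ~= j - 1" "i ~= j" "i - 1 ~= j - 2" "i - 1 ~= j - 1" "i - 1 ~= j" "i - 2 ~= j - 2" "i - 2 ~= j - 1" "i - 2 ~= j"
      using i by auto
    show "at3 f j (at3 f i xs) ! k = at3 f i (at3 f j xs) ! k"
      unfolding 1 2 nth_at3[OF i(1) i'(1) k] nth_at3[OF i'(2) i(3) k] using ij by (auto split: prod.splits)
  qed
qed

lemma swap_front_at3_commute:
  assumes "4 <= i" "i < length xs"
  shows "swap_front (at3 f i xs) = at3 f i (swap_front xs)"
proof -
  obtain x y r where xs: "xs = x # y # r" using assms by (cases xs rule: swap_front.cases) auto
  have "at3 f i (x # y # r) = x # y # at3 f (i - 2) r" for x y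
  proof -
    obtain j where "i = j + 4" using assms(1) by (metis le_Suc_ex add.commute)
    then show ?thesis unfolding at3_def by (simp add: numeral_2_eq_2 eval_nat_numeral)
  qed
  then show ?thesis unfolding xs by simp
qed

lemma word_move_commute:
  assumes "i = 0 \<or> 2 <= i" "2 <= j" "i < length u" "j < length u" "if i = 0 then 4 <= j else i + 3 <= j"
  shows "word_move j (word_move i u) = word_move i (word_move j u)"
  using assms at3_commute[of i j u knuth] swap_front_at3_commute[of j u knuth] unfolding word_move_def by (auto split: if_splits)

lemma at3_infix:
  assumes "2 <= j" "j < length v"
  shows "at3 f (j + length a) (a @ v @ c) = a @ at3 f j v @ c"
proof -
  obtain s x y z r where v: "v = s @ [x, y, z] @ r" "length s = j - 2" using at3_split[OF assms] by metis
  show ?thesis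
    using at3_append[OF v(2) assms(1), of f "(x, y, z)" r] at3_append[of "a @ s" "j + length a" f "(x, y, z)" "r @ c"] v assms(1)
    by simp
qed

lemma word_move_prefix:
  assumes "i = 0 & 2 <= length v \<or> 2 <= i & i < length v"
  shows "word_move i (v @ c) = word_move i v @ c"
proof (cases "i = 0")
  case True
  then show ?thesis using assms unfolding word_move_def by (cases v rule: swap_front.cases) auto
next
  case False
  then show ?thesis using assms at3_prefix[of i v knuth c] unfolding word_move_def by simp
qed

lemma orbit_image:
  assumes step: "\<And>x j. x \<in> W ==> j \<in> J ==> b j x \<in> W & a (s j) (F x) = F (b j x)" and x: "x \<in> W"
  shows "set is \<subseteq> J ==> fold a (map s is) (F x) = F (fold b is x)"
    and "orbit a (s ` J) (F x) = F ` orbit b J x"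
proof -
  have main: "fold a (map s is) (F x) = F (fold b is x)" if "set is \<subseteq> J" "x \<in> W" for "is" x
    using that
  proof (induction "is" arbitrary: x)
    case (Cons j js)
    then show ?case using step[of x j] by simp
  qed simp
  then show "set is \<subseteq> J ==> fold a (map s is) (F x) = F (fold b is x)" using x by blast
  show "orbit a (s ` J) (F x) = F ` orbit b J x"
  proof (intro equalityI subsetI)
    fix y assume "y \<in> orbit a (s ` J) (F x)"
    then obtain js where js: "js \<in> lists (s ` J)" "y = fold a js (F x)" unfolding orbit_def by auto
    then obtain "is" where "is \<in> lists J" "js = map s is" unfolding lists_image by blast
    then have "set is \<subseteq> J" "y = F (fold b is x)" using main x js(2) by auto
    then show "y \<in> F ` orbit b J x" unfolding orbit_def by blast
  next
    fix y assume "y \<in> F ` orbit b J x"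
    then obtain "is" where i: "set is \<subseteq> J" "y = F (fold b is x)" unfolding orbit_def by blast
    then have "y = fold a (map s is) (F x)" using main x by simp
    moreover have "set (map s is) \<subseteq> s ` J" using i(1) by auto
    ultimately show "y \<in> orbit a (s ` J) (F x)" unfolding orbit_def by blast
  qed
qed

text \<open>Moves with indices between \<open>h\<close> and \<open>i\<close> touch only a factor of length \<open>i - h + 3\<close>.\<close>

lemma orbit_knuth_infix:
  fixes a b c :: "nat list"
  assumes "2 <= h" "h <= i" "length a = h - 2" "length b = i - h + 3"
  shows "orbit word_move {h..i} (a @ b @ c) = (\<lambda>v. a @ v @ c) ` orbit (at3 knuth) {2..<length b} b"
proof -
  have J: "(\<lambda>j. j + length a) ` {2..<length b} = {h..i}"
  proof (intro equalityI subsetI)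
    fix k assume "k \<in> {h..i}"
    then have "k - length a \<in> {2..<length b}" "k = k - length a + length a" using assms by auto
    then show "k \<in> (\<lambda>j. j + length a) ` {2..<length b}" by blast
  qed (use assms in auto)
  have "orbit word_move ((\<lambda>j. j + length a) ` {2..<length b}) (a @ b @ c) = (\<lambda>v. a @ v @ c) ` orbit (at3 knuth) {2..<length b} b"
  proof (rule orbit_image(2)[where W = "{v. length v = length b}" and F = "\<lambda>v. a @ v @ c"])
    fix x :: "nat list" and j assume x: "x \<in> {v. length v = length b}" "j \<in> {2..<length b}"
    then show "at3 knuth j x \<in> {v. length v = length b} & word_move (j + length a) (a @ x @ c) = a @ at3 knuth j x @ c"
      using length_at3[of j x knuth] at3_infix[of j x knuth a c] unfolding word_move_def by simp
  qed simp
  then show ?thesis unfolding J .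
qed

lemma
  assumes "2 <= length b"
  shows orbit_word_move_prefix: "orbit word_move ({0} \<union> {2..<length b}) (b @ c) = (\<lambda>v. v @ c) ` orbit word_move ({0} \<union> {2..<length b}) b"
    and fold_word_move_prefix: "set is \<subseteq> {0} \<union> {2..<length b} ==> fold word_move is (b @ c) = fold word_move is b @ c"
proof -
  have step: "word_move j x \<in> {v. length v = length b} & word_move (id j) (x @ c) = word_move j x @ c"
    if "x \<in> {v. length v = length b}" "j \<in> {0} \<union> {2..<length b}" for x j
    using word_move_prefix[of j x c] mset_eq_length[OF mset_word_move, of j x] that assms by auto
  note o = orbit_image[where a = word_move and b = word_move and W = "{v. length v = length b}" and F = "\<lambda>v. v @ c" and s = id and J = "{0} \<union> {2..<length b}" and x = b, OF step]
  show "orbit word_move ({0} \<union> {2..<length b}) (b @ c) = (\<lambda>v. v @ c) ` orbit word_move ({0} \<union> {2..<length b}) b"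
    using o(2) by simp
  show "set is \<subseteq> {0} \<union> {2..<length b} ==> fold word_move is (b @ c) = fold word_move is b @ c"
    using o(1)[of "is"] by simp
qed

lemma restrict_descents:
  "restrict_Des (length a + 1) (length a + length v) (descents (a @ v @ c)) = descents v"
proof (intro equalityI subsetI)
  fix k assume "k \<in> restrict_Des (length a + 1) (length a + length v) (descents (a @ v @ c))"
  then obtain x where x: "x \<in> descents (a @ v @ c)" "length a + 1 <= x" "x < length a + length v" "k = x - length a"
    unfolding restrict_Des_def by auto
  define y where "y = x - length a - 1"
  have y: "x = length a + Suc y" using x(2) unfolding y_def by simp
  show "k \<in> descents v" using x(1,3,4) unfolding y descents_def by (simp add: nth_append)
next
  fix k assume "k \<in> descents v"
  then have "k + length a \<in> descents (a @ v @ c)" "1 <= k" "k < length v" unfolding descents_def by (auto simp: nth_append)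
  then show "k \<in> restrict_Des (length a + 1) (length a + length v) (descents (a @ v @ c))"
    unfolding restrict_Des_def by (auto intro!: image_eqI[of _ _ "k + length a"])
qed

lemma descents_prefix: "descents (b @ c) \<inter> {1..<length b} = descents b"
  unfolding descents_def by (auto simp: nth_append)

context tensor begin

abbreviation "A \<equiv> SST_tensor ga de"

lemma psi_involution: "i = 0 \<or> 2 <= i & i < n ==> involution_on A (psi i)"
  unfolding involution_on_def
proof (intro ballI conjI)
  fix X assume i: "i = 0 \<or> 2 <= i & i < n" and X: "X \<in> A"
  note p = psi_word[OF X i]
  note pp = psi_word[OF p(1) i]
  show "psi i X \<in> A" by (rule p(1))
  have "word_of (psi i (psi i X)) = word_of X" unfolding pp(2) p(2) by (rule word_move_word_move) (use i in simp)
  then show "psi i (psi i X) = X" by (rule inj_onD[OF word_of_inj _ pp(1) X])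
qed

lemma psi_commute:
  assumes X: "X \<in> A" and ij: "i = 0 \<or> 2 <= i & i < n" "j = 0 \<or> 2 <= j & j < n"
    and c: "word_move j (word_move i (word_of X)) = word_move i (word_move j (word_of X))"
  shows "psi j (psi i X) = psi i (psi j X)"
proof -
  note p = psi_word[OF X ij(1)] psi_word[OF X ij(2)]
  note pp = psi_word[OF p(1) ij(2)] psi_word[OF p(3) ij(1)]
  have "word_of (psi j (psi i X)) = word_of (psi i (psi j X))" unfolding pp p by (rule c)
  then show ?thesis using word_of_inj pp(1,3) by (auto dest: inj_onD)
qed

lemma fold_psi:
  assumes "X \<in> A" "set is \<subseteq> {0} \<union> {2..<n}"
  shows "fold psi is X \<in> A & word_of (fold psi is X) = fold word_move is (word_of X)"
  by (rule fold_commuting[where J = "{0} \<union> {2..<n}"]) (use psi_word assms in auto)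

text \<open>Classes, and sums over them that depend on descents only, can be computed on words.\<close>

lemma class_word_of:
  assumes X: "X \<in> A" and J: "J \<subseteq> {0} \<union> {2..<n}"
  shows "gen_class A psi J X \<subseteq> A" "word_of ` gen_class A psi J X = orbit word_move J (word_of X)"
    "(\<Sum>U\<in>gen_class A psi J X. g (Des_tensor U)) = (\<Sum>w\<in>orbit word_move J (word_of X). (g (descents w) :: series))"
proof -
  have o: "gen_class A psi J X = orbit psi J X" by (rule gen_class_eq_orbit[OF _ X]) (use J psi_involution in auto)
  have f: "fold psi is X \<in> A & word_of (fold psi is X) = fold word_move is (word_of X)" if "set is \<subseteq> J" for "is"
    using fold_psi[OF X] that J by blast
  show sub: "gen_class A psi J X \<subseteq> A" unfolding o orbit_def using f by blast
  show im: "word_of ` gen_class A psi J X = orbit word_move J (word_of X)"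
  proof (intro equalityI subsetI)
    fix w assume "w \<in> word_of ` gen_class A psi J X"
    then obtain "is" where "set is \<subseteq> J" "w = word_of (fold psi is X)" unfolding o orbit_def by blast
    then show "w \<in> orbit word_move J (word_of X)" unfolding orbit_def using f by auto
  next
    fix w assume "w \<in> orbit word_move J (word_of X)"
    then obtain "is" where i: "set is \<subseteq> J" "w = fold word_move is (word_of X)" unfolding orbit_def by blast
    then have "w = word_of (fold psi is X)" using f by simp
    then show "w \<in> word_of ` gen_class A psi J X" unfolding o orbit_def using i(1) by blast
  qed
  have "(\<Sum>w\<in>orbit word_move J (word_of X). g (descents w)) = (\<Sum>U\<in>gen_class A psi J X. g (descents (word_of U)))"
    unfolding im[symmetric] by (simp add: sum.reindex inj_on_subset[OF word_of_inj sub])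
  also have "\<dots> = (\<Sum>U\<in>gen_class A psi J X. g (Des_tensor U))"
    by (rule sum.cong) (use sub Des_word_of in auto)
  finally show "(\<Sum>U\<in>gen_class A psi J X. g (Des_tensor U)) = (\<Sum>w\<in>orbit word_move J (word_of X). g (descents w))" by simp
qed

lemma finite_SST_tensor: "finite A"
proof (rule inj_on_finite[OF word_of_inj])
  show "word_of ` A \<subseteq> {w. set w \<subseteq> {1..n} & length w = n}"
  proof (intro subsetI CollectI conjI)
    fix w k assume w: "w \<in> word_of ` A" "k \<in> set w"
    then obtain S T l where A: "(S, T) \<in> A" and l: "l \<in> {1..n}" "k = entry (S, T) l" unfolding word_of_def by force
    have "l \<in> letters S \<or> l \<in> letters T" using A l(1) tensor_iff by blast
    then show "k \<in> {1..n}" using entry_range[OF A, of l] l(2) by auto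
  qed auto
  show "finite {w. set w \<subseteq> {1..n} & length w = n}" by (rule finite_lists_length_eq) simp
qed

lemma schur_class:
  assumes X: "X \<in> A" and h: "1 < h" "h <= i" "i < n"
  shows "\<exists>la. is_partition (i - h + 3) la &
    (\<Sum>U\<in>gen_class A psi {h..i} X. fundamental (i - h + 3) (restrict_Des (h - 1) (i + 1) (Des_tensor U))) = schur la"
proof -
  define a where "a = take (h - 2) (word_of X)"
  define b where "b = take (i - h + 3) (drop (h - 2) (word_of X))"
  define c where "c = drop (i - h + 3) (drop (h - 2) (word_of X))"
  have w: "word_of X = a @ b @ c" unfolding a_def b_def c_def by (simp only: append_take_drop_id)
  have len: "length a = h - 2" "length b = i - h + 3" unfolding a_def b_def using h by auto
  have d: "distinct b" using distinct_word_of[OF X] unfolding w by simp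
  have p: "h - 1 = length a + 1" "i + 1 = length a + length b" using h len by auto
  let ?O = "orbit (at3 knuth) {2..<length b} b"
  have h2: "2 <= h" using h(1) by simp
  have J: "{h..i} \<subseteq> {0} \<union> {2..<n}" using h by auto
  have lv: "length v = length b" if v: "v \<in> ?O" for v
  proof -
    obtain "is" where i: "set is \<subseteq> {2..<length b}" "v = fold (at3 knuth) is b" using v unfolding orbit_def by blast
    have "length (fold (at3 knuth) is x) = length b" if "length x = length b" for x :: "nat list"
      using i(1) that
    proof (induction "is" arbitrary: x)
      case (Cons j js)
      then have "length (at3 knuth j x) = length b" using length_at3[of j x knuth] by simp
      then show ?case using Cons by simp
    qed simp
    then show ?thesis using i(2) by simp
  qed
  have "(\<Sum>U\<in>gen_class A psi {h..i} X. fundamental (i - h + 3) (restrict_Des (h - 1) (i + 1) (Des_tensor U)))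
      = (\<Sum>w\<in>orbit word_move {h..i} (a @ b @ c). fundamental (i - h + 3) (restrict_Des (h - 1) (i + 1) (descents w)))"
    unfolding w[symmetric] by (rule class_word_of(3)[OF X J])
  also have "\<dots> = (\<Sum>v\<in>?O. fundamental (i - h + 3) (restrict_Des (h - 1) (i + 1) (descents (a @ v @ c))))"
    unfolding orbit_knuth_infix[OF h2 h(2) len]
    by (subst sum.reindex) (auto simp: inj_on_def)
  also have "\<dots> = (\<Sum>v\<in>?O. fundamental (length b) (descents v))"
  proof (rule sum.cong)
    fix v assume "v \<in> ?O"
    then have "length v = length b" by (rule lv)
    then have "restrict_Des (h - 1) (i + 1) (descents (a @ v @ c)) = descents v"
      using restrict_descents[of a v c] unfolding p by (simp only:)
    then show "fundamental (i - h + 3) (restrict_Des (h - 1) (i + 1) (descents (a @ v @ c))) = fundamental (length b) (descents v)"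
      unfolding len(2) by simp
  qed simp
  finally show ?thesis using knuth_class_schur[OF d] unfolding len(2) by simp
qed

text \<open>The moves with indices up to \<open>k\<close> act on the first \<open>k + 1\<close> entries.\<close>

lemma split_front:
  assumes X: "X \<in> A" and k: "1 <= k" "k < n"
  obtains b c where "word_of X = b @ c" "length b = k + 1" "distinct b"
    "orbit word_move ({0} \<union> {2..k}) (word_of X) = (\<lambda>v. v @ c) ` orbit word_move ({0} \<union> {2..<length b}) b"
    "\<forall>is. set is \<subseteq> {0} \<union> {2..k} --> fold word_move is (word_of X) = fold word_move is b @ c"
proof -
  define b where "b = take (k + 1) (word_of X)"
  define c where "c = drop (k + 1) (word_of X)"
  have w: "word_of X = b @ c" unfolding b_def c_def by simp
  have len: "length b = k + 1" unfolding b_def using k by simp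
  have d: "distinct b" using distinct_word_of[OF X] unfolding w by simp
  have J: "{2..<length b} = {2..k}" using len by auto
  have l2: "2 <= length b" using len k by simp
  note o = orbit_word_move_prefix[OF l2, of c, unfolded J, folded w] fold_word_move_prefix[OF l2, unfolded J, of _ c, folded w]
  show thesis by (rule that[OF w len d]) (unfold J, rule o(1), use o(2) in blast)
qed

lemma schurP_class:
  assumes X: "X \<in> A" and i: "1 <= i" "i < n"
  shows "\<exists>ga'. strict_partition (i + 1) ga' &
    (\<Sum>U\<in>gen_class A psi ({0} \<union> {2..i}) X. fundamental (i + 1) (Des_tensor U \<inter> {1..i})) = schurP ga'"
proof -
  obtain b c where b: "word_of X = b @ c" "length b = i + 1" "distinct b"
    "orbit word_move ({0} \<union> {2..i}) (word_of X) = (\<lambda>v. v @ c) ` orbit word_move ({0} \<union> {2..<length b}) b"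
    "\<forall>is. set is \<subseteq> {0} \<union> {2..i} --> fold word_move is (word_of X) = fold word_move is b @ c"
    by (rule split_front[OF X i])
  let ?O = "orbit word_move ({0} \<union> {2..<length b}) b"
  have J: "{0} \<union> {2..i} \<subseteq> {0} \<union> {2..<n}" using i by auto
  have "(\<Sum>U\<in>gen_class A psi ({0} \<union> {2..i}) X. fundamental (i + 1) (Des_tensor U \<inter> {1..i}))
      = (\<Sum>w\<in>(\<lambda>v. v @ c) ` ?O. fundamental (i + 1) (descents w \<inter> {1..i}))"
    using class_word_of(3)[OF X J, of "\<lambda>D. fundamental (i + 1) (D \<inter> {1..i})"] unfolding b(4) by simp
  also have "\<dots> = (\<Sum>v\<in>?O. fundamental (i + 1) (descents (v @ c) \<inter> {1..i}))"
    by (auto simp: sum.reindex inj_on_def)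
  also have "\<dots> = (\<Sum>v\<in>?O. fundamental (length b) (descents v))"
  proof (rule sum.cong)
    fix v assume "v \<in> ?O"
    then have "length v = length b" by (rule mset_eq_length[OF orbit_word_mset])
    then have "{1..i} = {1..<length v}" using b(2) by auto
    then show "fundamental (i + 1) (descents (v @ c) \<inter> {1..i}) = fundamental (length b) (descents v)"
      using descents_prefix[of v c] b(2) by simp
  qed simp
  finally show ?thesis using queer_class_schurP[OF b(3)] unfolding b(2) by simp
qed

lemma short_path:
  assumes X: "X \<in> A" and k: "1 <= k" "k < n" and Y: "Y \<in> gen_class A psi ({0} \<union> {2..k}) X"
  shows "\<exists>is. set is \<subseteq> {0} \<union> {2..k} & count_list is k <= 2 & Y = fold psi is X"
proof -
  obtain b c where b: "word_of X = b @ c" "length b = k + 1" "distinct b"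
    "orbit word_move ({0} \<union> {2..k}) (word_of X) = (\<lambda>v. v @ c) ` orbit word_move ({0} \<union> {2..<length b}) b"
    "\<forall>is. set is \<subseteq> {0} \<union> {2..k} --> fold word_move is (word_of X) = fold word_move is b @ c"
    by (rule split_front[OF X k])
  have J: "{0} \<union> {2..k} \<subseteq> {0} \<union> {2..<n}" using k by auto
  have "word_of Y \<in> orbit word_move ({0} \<union> {2..k}) (word_of X)" using class_word_of(2)[OF X J] Y by blast
  then obtain v where v: "word_of Y = v @ c" "v \<in> orbit word_move ({0} \<union> {2..<length b}) b" unfolding b(4) by blast
  obtain "is" where i: "set is \<subseteq> {0} \<union> {2..<length b}" "count_list is (length b - 1) <= 2" "v = fold word_move is b"
    using word_move_path[OF b(3) v(2)] by blast
  have i': "set is \<subseteq> {0} \<union> {2..k}" using i(1) b(2) by auto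
  then have f: "fold psi is X \<in> A" "word_of (fold psi is X) = word_of Y"
    using fold_psi[OF X, of "is"] J b(5)[rule_format, OF i'] v(1) i(3) by auto
  have "Y \<in> A" using class_word_of(1)[OF X J] Y by blast
  then have "Y = fold psi is X" using inj_onD[OF word_of_inj f(2) f(1)] by simp
  then show ?thesis using i' i(2) b(2) by auto
qed

lemma queer_dual_equivalence_psi:
  "queer_dual_equivalence n A Des_tensor psi"
proof -
  have J: "{h \<in> queer_indices n. h <= k} = {0} \<union> {2..k}" if "k < n" for k
    using that unfolding queer_indices_def by auto
  have Des: "Des_tensor X \<subseteq> {1..<n}" if "X \<in> A" for X unfolding Des_word_of[OF that] descents_def by auto
  have c: "psi j (psi i X) = psi i (psi j X)"
    if "X \<in> A" "i = 0 \<or> 2 <= i" "2 <= j" "j < n" "if i = 0 then 4 <= j else i + 3 <= j" for X i j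
  proof (rule psi_commute[OF that(1)])
    show "i = 0 \<or> 2 <= i & i < n" "j = 0 \<or> 2 <= j & j < n" using that by (auto split: if_splits)
    have "i < length (word_of X)" using that by (auto split: if_splits)
    then show "word_move j (word_move i (word_of X)) = word_move i (word_move j (word_of X))"
      using that by (intro word_move_commute) auto
  qed
  have far: "psi j (psi i X) = psi i (psi j X)"
    if "1 < i" "i < n" "1 < j" "j < n" "\<bar>int i - int j\<bar> \<ge> 3" "X \<in> A" for i j X
  proof (cases "i + 3 <= j")
    case True
    show ?thesis by (rule c) (use that True in auto)
  next
    case False
    show ?thesis by (rule c[symmetric]) (use that False in auto)
  qed
  have "dual_equivalence n A Des_tensor psi"
    unfolding dual_equivalence_def using finite_SST_tensor Des psi_involution schur_class far by auto
  moreover have "\<forall>i. 3 < i & i < n --> (\<forall>S\<in>A. psi 0 (psi i S) = psi i (psi 0 S))"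
    using c[of _ 0] by (auto intro: sym)
  moreover have "\<exists>la. strict_partition (i + 1) la &
      (\<Sum>U\<in>gen_class A psi {h \<in> queer_indices n. h <= i} X. fundamental (i + 1) (Des_tensor U \<inter> {1..i})) = schurP la"
    if "i \<in> {1, 2, 3}" "i < n" "X \<in> A" for i X
    unfolding J[OF that(2)] by (rule schurP_class[OF that(3) _ that(2)]) (use that(1) in auto)
  moreover have "\<exists>is. set is \<subseteq> {0} \<union> {2..k} & count_list is k <= 2 & Y = fold psi is X"
    if "1 <= k & k < n" "X \<in> A" "Y \<in> gen_class A psi {h \<in> queer_indices n. h <= k} X" for k X Y
    using short_path[of X k Y] that J[of k] by simp
  ultimately show ?thesis unfolding queer_dual_equivalence_def using psi_involution[of 0] by simp
qed

end

theorem theorem7p7: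
  fixes \<gamma> \<delta> :: "nat list" and n :: nat
  assumes "strict_partition (sum_list \<gamma>) \<gamma>"
    and "strict_partition (sum_list \<delta>) \<delta>"
    and "n = sum_list \<gamma> + sum_list \<delta>"
  shows "(\<forall>i \<in> queer_indices n. \<forall>X \<in> SST_tensor \<gamma> \<delta>. psi i X \<in> SST_tensor \<gamma> \<delta>) \<and>
         queer_dual_equivalence n (SST_tensor \<gamma> \<delta>) Des_tensor psi"
proof -
  obtain wa wd where "word_model \<gamma> wa" "word_model \<delta> wd" using word_model_exists by meson
  then interpret tensor \<gamma> \<delta> wa wd using assms by unfold_locales
  show ?thesis unfolding assms(3) using queer_dual_equivalence_psi psi_word(1) unfolding queer_indices_def by auto
qed

end
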